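(* For each $\gamma>0$ and $\Delta\in\mathbb{N}$ there exist $\beta>0$ and $C$ such that if $p\ge C\big(\tfrac{\log n}{n}\big)^{1/\Delta}$, the following holds. If $H$ is an $n$-vertex graph with maximum degree $\Delta(H)\le\Delta$, chromatic number $\chi(H)$ and bandwidth $\mathrm{bw}(H)\le\beta n$, and $G$ is an $n$-vertex graph with minimum degree $\delta(G)\ge\big(\tfrac{\chi(H)-1}{\chi(H)}+\gamma\big)n$, then asymptotically almost surely $H$ is a subgraph of $G_p$.
   Context: For a graph $G$, $G_p$ denotes the random spanning subgraph of $G$ obtained by keeping each edge of $G$ independently with probability $p=p(n)$. Asymptotically almost surely means with probability tending to $1$ as $n\to\infty$. Logarithms are to base $2$. The bandwidth $\mathrm{bw}(H)$ is the least $b$ such that there is a labelling of $V(H)$ by $1,\dots,v(H)$ with $|i-j|\le b$ for every edge $ij$. *)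

theory Defs
  imports "HOL-Probability.Probability"
begin

record 'a ugraph =
  verts :: "'a set"
  edges :: "'a set set"

definition simple_graph :: "'a ugraph \<Rightarrow> bool" where
  "simple_graph G \<longleftrightarrow>
     finite (verts G) \<and> (\<forall>e\<in>edges G. e \<subseteq> verts G \<and> card e = 2)"

definition n_vertex_graph :: "nat \<Rightarrow> 'a ugraph \<Rightarrow> bool" where
  "n_vertex_graph n G \<longleftrightarrow> simple_graph G \<and> card (verts G) = n"

definition degree :: "'a ugraph \<Rightarrow> 'a \<Rightarrow> nat" where
  "degree G v = card {e \<in> edges G. v \<in> e}"

text \<open>The maximum and minimum degree are meaningful for nonempty graphs only,
  since \<open>Max\<close> and \<open>Min\<close> are unspecified on the empty set.\<close>

definition max_degree :: "'a ugraph \<Rightarrow> nat" where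
  "max_degree G = Max (degree G ` verts G)"

definition min_degree :: "'a ugraph \<Rightarrow> nat" where
  "min_degree G = Min (degree G ` verts G)"

definition proper_colouring :: "'a ugraph \<Rightarrow> nat \<Rightarrow> ('a \<Rightarrow> nat) \<Rightarrow> bool" where
  "proper_colouring G k c \<longleftrightarrow>
     c ` verts G \<subseteq> {..<k} \<and> (\<forall>u v. {u, v} \<in> edges G \<longrightarrow> c u \<noteq> c v)"

definition chromatic_number :: "'a ugraph \<Rightarrow> nat" where
  "chromatic_number G = (LEAST k. \<exists>c. proper_colouring G k c)"

definition bandwidth :: "'a ugraph \<Rightarrow> nat" where
  "bandwidth G = (LEAST b. \<exists>l. bij_betw l (verts G) {1..card (verts G)} \<and>
     (\<forall>u v. {u, v} \<in> edges G \<longrightarrow> \<bar>int (l u) - int (l v)\<bar> \<le> int b))"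

text \<open>\<open>H\<close> is a subgraph of \<open>G\<close> in the unlabelled sense: \<open>G\<close> contains a
  (not necessarily induced) copy of \<open>H\<close>.\<close>

definition subgraph_of :: "'a ugraph \<Rightarrow> 'b ugraph \<Rightarrow> bool" where
  "subgraph_of H G \<longleftrightarrow>
     (\<exists>f. inj_on f (verts H) \<and> f ` verts H \<subseteq> verts G \<and> (\<forall>e\<in>edges H. f ` e \<in> edges G))"

text \<open>The coin flips \<open>\<omega> e\<close> for \<open>e \<in> edges G\<close> are independent Bernoulli variables with
  parameter \<open>p\<close>; the value \<open>False\<close> outside \<open>edges G\<close> is only the default of \<open>Pi_pmf\<close>.
  Note that \<open>bernoulli_pmf\<close> silently truncates parameters outside \<open>{0..1}\<close>.\<close>

definition random_subgraph :: "'a ugraph \<Rightarrow> real \<Rightarrow> 'a ugraph pmf" where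
  "random_subgraph G p =
     map_pmf (\<lambda>\<omega>. \<lparr>verts = verts G, edges = {e \<in> edges G. \<omega> e}\<rparr>)
       (Pi_pmf (edges G) False (\<lambda>_. bernoulli_pmf p))"

end

(*
The regularity lemma gives a cluster structure of G into which H is embedded greedily: the vertices
of H are placed one after the other, each at a uniformly random admissible vertex of its cluster. A
small set of reserved vertices of H takes up the vertices of G left over at the end, by swapping them
into places with a compatible neighbourhood. Every step has linearly many choices, so that a
prescribed set of s placements has probability at most (K/n)^s. If a set F of edges on v vertices with
c components embeds into a graph of maximum degree D, then 2|F| <= (D+1)(v-c), and there are at most
n^c D^(v-c) embeddings; hence F lies in the random copy of H with probability at most q^|F|, where q
is of order n^(-2/(D+1)). Therefore every family of edge sets covering all copies of H has q-weight
1-o(1), and the fragment argument of Park and Pham yields a copy of H in the random subgraph of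
density of order q log n, which is O((log n/n)^(1/D)).
*)

theory Submission
  imports Defs
begin

section \<open>The Park-Pham theorem\<close>

text \<open>Clusters have unequal sizes and miss a few vertices, and all that is known of a leftover
  vertex v is that it has many neighbours in all clusters except some of weight at most \<nu>. So
  the swaps must work for every pair of a cluster and a vertex v. To this end an initial part of H
  runs through all r-cliques of the cluster graph, each as often as the product of its weights
  demands; then for every such pair linearly many vertices of H lie in the cluster and have all
  their neighbours in clusters suited to v. The rest of H is spread over the clusters by
  multiplicative weights. Holding back a reserve also leaves a fixed proportion of each cluster
  free, which is what keeps the greedy process alive to its end without a blow-up lemma. Random
  processes are nested averages, treated as positive linear functionals; a probability space appears
  only when the result is translated to \<open>random_subgraph\<close>. The logarithm is absorbed
  since 2/(\<Delta>+1) > 1/\<Delta> for \<Delta> > 1; for \<Delta> = 1 the two densities agree. The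
  degree condition forces the chromatic number to be at most 1/\<gamma>, so constants may depend on
  it.\<close>

definition bern :: "real => 'e set => ('e set => real) => real" where
 "bern p E F = (\<Sum>W\<in>Pow E. p ^ card W * (1 - p) ^ card (E - W) * F W)"

lemma bern_empty [simp]: "bern p {} F = F {}"
 by (simp add: bern_def)

text \<open>Conditioning on whether \<open>e\<close> is drawn; \<open>bern_const\<close> and
  \<open>bern_union\<close> are inductions through this recursion.\<close>

lemma bern_insert:
 assumes "finite E" "e \<notin> E"
 shows "bern p (insert e E) F = p * bern p E (\<lambda>W. F (insert e W)) + (1 - p) * bern p E F"
proof -
 have disj: "Pow E \<inter> insert e ` Pow E = {}" using assms by auto
 have inj: "inj_on (insert e) (Pow E)" using assms(2)
  by (auto simp: inj_on_def insert_eq_iff)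
 let ?g = "\<lambda>W. p ^ card W * (1 - p) ^ card (insert e E - W) * F W"
 have "bern p (insert e E) F = sum ?g (Pow E) + sum ?g (insert e ` Pow E)"
  unfolding bern_def Pow_insert using assms disj by (subst sum.union_disjoint) auto
 also have "sum ?g (Pow E) = (1 - p) * bern p E F"
  unfolding bern_def sum_distrib_left
 proof (rule sum.cong, simp)
  fix W assume W: "W \<in> Pow E"
  have "insert e E - W = insert e (E - W)" using W assms by auto
  hence "card (insert e E - W) = Suc (card (E - W))" using assms by simp
  thus "?g W = (1 - p) * (p ^ card W * (1 - p) ^ card (E - W) * F W)" by simp
 qed
 also have "sum ?g (insert e ` Pow E) = p * bern p E (\<lambda>W. F (insert e W))"
  unfolding bern_def sum_distrib_left sum.reindex[OF inj]
 proof (rule sum.cong, simp)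
  fix W assume W: "W \<in> Pow E"
  have "insert e E - insert e W = E - W" using W assms by auto
  moreover have "card (insert e W) = Suc (card W)"
   using W assms finite_subset by (subst card_insert_disjoint) auto
  ultimately show "(?g \<circ> insert e) W =
   p * (p ^ card W * (1 - p) ^ card (E - W) * F (insert e W))" by simp
 qed
 finally show ?thesis by simp
qed

lemma bern_lin: "bern p E (\<lambda>W. a * F W + b * G W) = a * bern p E F + b * bern p E G"
 by (simp add: bern_def sum_distrib_left sum.distrib [symmetric] algebra_simps)

lemma bern_const:
 assumes "finite E" shows "bern p E (\<lambda>_. c) = c"
 using assms by (induction E) (auto simp: bern_insert algebra_simps)

lemma bern_mono:
 assumes "0 \<le> p" "p \<le> 1" "\<And>W. W \<subseteq> E ==> F W \<le> G W"
 shows "bern p E F \<le> bern p E G"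
 unfolding bern_def using assms by (intro sum_mono mult_left_mono) auto

text \<open>An element is missed by both of two independent samples with probability (1-p)(1-q), so
  their union is again a binomial sample. This splits a sample into rounds and also couples samples
  of different densities.\<close>

lemma bern_union:
 assumes "finite E"
 shows "bern p E (\<lambda>W. bern q E (\<lambda>W'. F (W \<union> W'))) = bern (p + q - p * q) E F"
 using assms
proof (induction E arbitrary: F)
 case (insert e E)
 have A: "bern p E (\<lambda>W. bern q (insert e E) (\<lambda>W'. F (insert e W \<union> W')))
   = bern (p + q - p * q) E (\<lambda>W. F (insert e W))"
 proof -
  have "bern p E (\<lambda>W. bern q (insert e E) (\<lambda>W'. F (insert e W \<union> W')))
    = bern p E (\<lambda>W. q * bern q E (\<lambda>W'. F (insert e (W \<union> W'))) + (1 - q) * bern q E (\<lambda>W'. F (insert e (W \<union> W'))))"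
   by (simp add: bern_insert insert)
  also have "... = bern p E (\<lambda>W. bern q E (\<lambda>W'. F (insert e (W \<union> W'))))"
   by (simp add: algebra_simps)
  finally show ?thesis using insert.IH[of "\<lambda>W. F (insert e W)"] by simp
 qed
 have B: "bern p E (\<lambda>W. bern q (insert e E) (\<lambda>W'. F (W \<union> W')))
   = q * bern (p + q - p * q) E (\<lambda>W. F (insert e W)) + (1 - q) * bern (p + q - p * q) E F"
 proof -
  have "bern p E (\<lambda>W. bern q (insert e E) (\<lambda>W'. F (W \<union> W')))
    = bern p E (\<lambda>W. q * bern q E (\<lambda>W'. F (insert e (W \<union> W'))) + (1 - q) * bern q E (\<lambda>W'. F (W \<union> W')))"
   by (simp add: bern_insert insert)
  also have "... = q * bern p E (\<lambda>W. bern q E (\<lambda>W'. F (insert e (W \<union> W'))))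
    + (1 - q) * bern p E (\<lambda>W. bern q E (\<lambda>W'. F (W \<union> W')))" by (rule bern_lin)
  finally show ?thesis using insert.IH[of "\<lambda>W. F (insert e W)"] insert.IH[of F] by simp
 qed
 show ?case
  unfolding bern_insert[OF insert.hyps, of p] bern_insert[OF insert.hyps, of "p + q - p * q"] A B
  by (simp add: algebra_simps)
qed simp

lemma bern_upset_mono:
 assumes "finite E" "0 \<le> p" "p \<le> p'" "p' \<le> 1"
  and up: "\<And>W W'. W \<subseteq> W' ==> W' \<subseteq> E ==> F W \<le> F W'"
 shows "bern p E F \<le> bern p' E F"
proof (cases "p = 1")
 case False
 hence p1: "p < 1" using assms by auto
 \<comment> \<open>The density of the second sample that lifts p to p'.\<close>
 define q where "q = (p' - p) / (1 - p)"
 have q: "0 \<le> q" "q \<le> 1" using assms p1 by (auto simp: q_def field_simps)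
 have "q * (1 - p) = p' - p" using p1 by (simp add: q_def)
 hence e: "p + q - p * q = p'" by (simp add: algebra_simps)
 have "bern p E F = bern p E (\<lambda>W. bern q E (\<lambda>_. F W))" using assms by (simp add: bern_const)
 also have "... \<le> bern p E (\<lambda>W. bern q E (\<lambda>W'. F (W \<union> W')))"
  using assms q p1 by (intro bern_mono up) auto
 finally show ?thesis using bern_union[OF assms(1), of p q F] e by simp
qed (use assms in auto)

section \<open>Minimum fragments and the iteration over their sizes\<close>

definition fragment :: "'e set set => 'e set => 'e set => 'e set" where
 "fragment H W S = arg_min card (\<lambda>T. \<exists>S'\<in>H. S' \<subseteq> W \<union> S \<and> T = S' - W)"

lemma fragment:
 assumes "S \<in> H"
 shows "\<exists>S'\<in>H. S' \<subseteq> W \<union> S \<and> fragment H W S = S' - W"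
  and "\<And>S'. S' \<in> H ==> S' \<subseteq> W \<union> S ==> card (fragment H W S) \<le> card (S' - W)"
proof -
 have ex: "\<exists>S'\<in>H. S' \<subseteq> W \<union> S \<and> S - W = S' - W" using assms by auto
 note * = arg_min_nat_lemma[of "\<lambda>T. \<exists>S'\<in>H. S' \<subseteq> W \<union> S \<and> T = S' - W" "S - W" card, OF ex]
 show "\<exists>S'\<in>H. S' \<subseteq> W \<union> S \<and> fragment H W S = S' - W"
  using * by (simp add: fragment_def)
 show "\<And>S'. S' \<in> H ==> S' \<subseteq> W \<union> S ==> card (fragment H W S) \<le> card (S' - W)"
  using * unfolding fragment_def by blast
qed

definition large_fragments :: "nat => 'e set set => 'e set => 'e set set" where
 "large_fragments m H W = {T \<in> fragment H W ` H. m \<le> card T}"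

text \<open>A large fragment \<open>T\<close> of \<open>W\<close> is contained in every member of \<open>H\<close> inside \<open>W \<union> T\<close>,
 so given \<open>W \<union> T\<close> there are few choices for \<open>T\<close>.\<close>

lemma fragment_cost:
 assumes fin: "finite E" and H: "H \<subseteq> Pow E" and sz: "\<And>S. S \<in> H ==> card S < 2 ^ Suc k"
  and q: "0 < q" "q \<le> p" "p \<le> 1"
 shows "bern p E (\<lambda>W. \<Sum>T\<in>large_fragments (2^k) H W. q ^ card T) \<le> (4 * q / p) ^ (2 ^ k)"
proof -
 define pr where "pr W = p ^ card W * (1 - p) ^ card (E - W)" for W
 have p0: "0 < p" using q by auto
 have pr0: "pr W \<ge> 0" for W using q p0 by (simp add: pr_def)
 \<comment> \<open>\<open>pick\<close> depends on \<open>Z\<close> alone. A large fragment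
   \<open>T\<close> of \<open>W\<close> will lie inside \<open>pick (W \<union> T)\<close>, so
   \<open>W \<union> T\<close> determines \<open>T\<close> up to the choice of a subset of a set
   with fewer than 2^(k+1) elements; \<open>Q\<close> lists these subsets.\<close>
 define pick where "pick Z = (SOME S. S \<in> H \<and> S \<subseteq> Z)" for Z
 define Q where "Q Z = (if \<exists>S\<in>H. S \<subseteq> Z then {T \<in> Pow (pick Z). 2^k \<le> card T} else {})" for Z
 have pick: "pick Z \<in> H" "pick Z \<subseteq> Z" if "\<exists>S\<in>H. S \<subseteq> Z" for Z
  using someI_ex[of "\<lambda>S. S \<in> H \<and> S \<subseteq> Z"] that by (auto simp: pick_def)
 let ?U = "large_fragments (2^k) H"
 have Uprop: "T \<inter> W = {} \<and> T \<subseteq> E \<and> T \<in> Q (W \<union> T)" if TU: "T \<in> ?U W" for W T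
 proof -
  obtain S where S: "S \<in> H" "T = fragment H W S" "2^k \<le> card T"
   using TU unfolding large_fragments_def by blast
  obtain S' where S': "S' \<in> H" "S' \<subseteq> W \<union> S" "T = S' - W" using fragment(1)[OF S(1)] S(2) by metis
  have ex: "\<exists>S\<in>H. S \<subseteq> W \<union> T" using S' by auto
  have TE: "T \<subseteq> E" using S' H by auto
  hence finT: "finite T" using fin by (rule finite_subset)
  have TS: "T \<subseteq> S" using S' by auto
  \<comment> \<open>\<open>pick (W \<union> T)\<close> lies in \<open>W \<union> S\<close>, hence
    competes in the minimisation that defines \<open>T\<close>. Outside \<open>W\<close> it is
    contained in \<open>T\<close> and no smaller, so it equals \<open>T\<close> there.\<close>
  have "card T \<le> card (pick (W \<union> T) - W)"
   using fragment(2)[OF S(1), of "pick (W \<union> T)" W] pick[OF ex] S(2) TS by auto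
  moreover have "pick (W \<union> T) - W \<subseteq> T" using pick[OF ex] by auto
  ultimately have "pick (W \<union> T) - W = T" using finT card_seteq by blast
  thus ?thesis using S' TE ex S(3) by (auto simp: Q_def)
 qed
 have finU: "finite (?U W)" for W
 proof -
  have "finite H" using H fin by (meson finite_Pow_iff finite_subset)
  thus ?thesis by (simp add: large_fragments_def)
 qed
 have finQ: "finite (Q Z)" if "Z \<subseteq> E" for Z
 proof (cases "\<exists>S\<in>H. S \<subseteq> Z")
  case True
  have "pick Z \<subseteq> E" using pick(2)[OF True] that by (rule subset_trans)
  hence "finite (pick Z)" using fin by (rule finite_subset)
  thus ?thesis by (simp add: Q_def)
 next
  case False thus ?thesis unfolding Q_def by auto
 qed
 \<comment> \<open>\<open>pr W\<close> has a factor (1-p)^|T| that is bounded by 1, where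
   \<open>pr (W \<union> T)\<close> has p^|T|. So weight q^|T| at \<open>W\<close> is traded for
   (q/p)^|T| at \<open>W \<union> T\<close>.\<close>
 have bound1: "pr W * q ^ card T \<le> pr (W \<union> T) * (q / p) ^ card T" if "W \<subseteq> E" "T \<in> ?U W" for W T
 proof -
  have T: "T \<inter> W = {}" "T \<subseteq> E" using Uprop that by auto
  have f: "finite T" "finite W" using that T fin by (auto intro: finite_subset)
  have c1: "card (W \<union> T) = card W + card T" using f T by (subst card_Un_disjoint) auto
  have "E - W = (E - (W \<union> T)) \<union> T" using T that by auto
  hence c2: "card (E - W) = card (E - (W \<union> T)) + card T"
   using f fin by (subst card_Un_disjoint[symmetric]) auto
  have "pr W * q ^ card T \<le> p ^ card W * (1 - p) ^ card (E - (W \<union> T)) * q ^ card T"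
   unfolding pr_def c2 using q p0
   by (intro mult_right_mono mult_left_mono power_decreasing) auto
  also have "... = pr (W \<union> T) * (q / p) ^ card T"
   unfolding pr_def c1 using p0 by (simp add: power_add power_divide)
  finally show ?thesis .
 qed
 have "bern p E (\<lambda>W. \<Sum>T\<in>?U W. q ^ card T) = (\<Sum>W\<in>Pow E. \<Sum>T\<in>?U W. pr W * q ^ card T)"
  by (simp add: bern_def pr_def sum_distrib_left)
 also have "... = (\<Sum>(W,T)\<in>Sigma (Pow E) ?U. pr W * q ^ card T)"
  using fin finU by (subst sum.Sigma) auto
 also have "... \<le> (\<Sum>(W,T)\<in>Sigma (Pow E) ?U. pr (W \<union> T) * (q / p) ^ card T)"
  using bound1 by (intro sum_mono) auto
 also have "... = (\<Sum>(Z,T)\<in>(\<lambda>(W,T). (W \<union> T, T)) ` Sigma (Pow E) ?U. pr Z * (q / p) ^ card T)"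
 proof (subst sum.reindex)
  show "inj_on (\<lambda>(W,T). (W \<union> T, T)) (Sigma (Pow E) ?U)"
  proof (rule inj_onI)
   fix x y assume xy: "x \<in> Sigma (Pow E) ?U" "y \<in> Sigma (Pow E) ?U"
    "(\<lambda>(W,T). (W \<union> T, T)) x = (\<lambda>(W,T). (W \<union> T, T)) y"
   obtain W T where x: "x = (W, T)" by (cases x)
   obtain W' T' where y: "y = (W', T')" by (cases y)
   have "T' = T" "W \<union> T = W' \<union> T" "T \<inter> W = {}" "T \<inter> W' = {}"
    using xy x y Uprop[of T W] Uprop[of T W'] by auto
   thus "x = y" using x y by blast
  qed
 qed (auto intro!: sum.cong)
 also have "... \<le> (\<Sum>(Z,T)\<in>Sigma (Pow E) Q. pr Z * (q / p) ^ card T)"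
 proof (rule sum_mono2)
  show "finite (Sigma (Pow E) Q)" using fin finQ by auto
  show "(\<lambda>(W,T). (W \<union> T, T)) ` Sigma (Pow E) ?U \<subseteq> Sigma (Pow E) Q"
   using Uprop by fastforce
 qed (use pr0 q p0 in auto)
 also have "... = (\<Sum>Z\<in>Pow E. \<Sum>T\<in>Q Z. pr Z * (q / p) ^ card T)"
  using fin finQ by (subst sum.Sigma) auto
 also have "... \<le> (\<Sum>Z\<in>Pow E. pr Z * (4 * q / p) ^ (2 ^ k))"
 proof (rule sum_mono)
  fix Z assume Z: "Z \<in> Pow E"
  have "(\<Sum>T\<in>Q Z. (q / p) ^ card T) \<le> (4 * q / p) ^ (2 ^ k)"
  proof (cases "\<exists>S\<in>H. S \<subseteq> Z")
   case True
   note P = pick[OF True]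
   have "pick Z \<subseteq> E" using P(2) Z by simp
   hence fp: "finite (pick Z)" using fin by (rule finite_subset)
   have "(\<Sum>T\<in>Q Z. (q / p) ^ card T) \<le> (\<Sum>T\<in>Q Z. (q / p) ^ (2 ^ k))"
    using True q p0 by (intro sum_mono power_decreasing) (auto simp: Q_def)
   also have "... = card (Q Z) * (q / p) ^ (2 ^ k)" by simp
   also have "... \<le> 2 ^ (2 ^ Suc k) * (q / p) ^ (2 ^ k)"
   proof (rule mult_right_mono)
    have "card (Q Z) \<le> card (Pow (pick Z))"
     using fp True by (intro card_mono) (auto simp: Q_def)
    also have "... = 2 ^ card (pick Z)" using fp by (simp add: card_Pow)
    also have "... \<le> 2 ^ (2 ^ Suc k)" using sz[OF P(1)]
     by (intro power_increasing) auto
    finally have "card (Q Z) \<le> (2::nat) ^ (2 ^ Suc k)" .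
    thus "real (card (Q Z)) \<le> 2 ^ (2 ^ Suc k)"
     by (metis of_nat_le_iff of_nat_numeral of_nat_power)
   qed (use q p0 in auto)
   \<comment> \<open>The number of possible \<open>T\<close> is at most 4^(2^k), the source of the
     factor 4 in the bound.\<close>
   also have "(2::real) ^ (2 ^ Suc k) = 4 ^ (2 ^ k)"
   proof -
    have "(2::real) ^ (2 ^ Suc k) = (2 ^ 2) ^ (2 ^ k)" by (simp only: power_mult[symmetric] power_Suc)
    thus ?thesis by simp
   qed
   finally show ?thesis by (simp add: power_mult_distrib[symmetric])
  next
   case False
   hence "Q Z = {}" unfolding Q_def by auto
   thus ?thesis using q p0 by simp
  qed
  thus "(\<Sum>T\<in>Q Z. pr Z * (q / p) ^ card T) \<le> pr Z * (4 * q / p) ^ (2 ^ k)"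
   unfolding sum_distrib_left[symmetric] by (intro mult_left_mono pr0)
 qed
 also have "... = bern p E (\<lambda>_. (4 * q / p) ^ (2 ^ k))"
  by (simp add: bern_def pr_def)
 finally show ?thesis using bern_const[OF fin] by simp
qed

text \<open>\<open>\<kappa>\<close> is a lower bound for the q-cost of all covers of
  \<open>H\<close> and stays free in the induction. A round of density \<open>ps k\<close> replaces
  \<open>H\<close> by its fragments with fewer than 2^k elements; a cover of these together with the
  large fragments covers \<open>H\<close>. So the new lower bound is \<open>\<kappa>\<close> minus
  the cost of the large fragments, and as the claim is linear in \<open>\<kappa>\<close>, only the
  expectation of that cost enters.\<close>

theorem park_pham:
 fixes ps :: "nat => real"
 assumes "finite E" "0 < q" "\<And>i. i < k ==> q \<le> ps i" "(\<Sum>i<k. ps i) \<le> p" "p \<le> 1"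
  and "H \<subseteq> Pow E" "\<And>S. S \<in> H ==> card S < 2 ^ k"
  and "\<And>G. G \<subseteq> Pow E ==> (\<forall>S\<in>H. \<exists>T\<in>G. T \<subseteq> S) ==> \<kappa> \<le> (\<Sum>T\<in>G. q ^ card T)"
 shows "\<kappa> - (\<Sum>i<k. (4 * q / ps i) ^ (2 ^ i)) \<le> bern p E (\<lambda>W. of_bool (\<exists>S\<in>H. S \<subseteq> W))"
 using assms(3-)
proof (induction k arbitrary: H \<kappa> p)
 case 0
 \<comment> \<open>Members have fewer than 2^0 elements. If there is one, it is empty and the
   probability is 1, while the cover {{}} gives \<open>\<kappa> \<le> 1\<close>; otherwise the empty
   cover gives \<open>\<kappa> \<le> 0\<close>.\<close>
 show ?case
 proof (cases "H = {}")
  case True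
  hence "\<kappa> \<le> 0" using "0.prems"(6)[of "{}"] by simp
  moreover have "bern p E (\<lambda>W. 0) = 0" by (simp add: bern_def)
  ultimately show ?thesis using True by simp
 next
  case False
  then obtain S where S: "S \<in> H" by auto
  have "S \<subseteq> E" using "0.prems"(4) S by auto
  hence "finite S" using assms(1) by (rule finite_subset)
  hence "S = {}" using "0.prems"(5)[OF S] by simp
  hence E: "{} \<in> H" using S by simp
  hence "(\<lambda>W. of_bool (\<exists>S\<in>H. S \<subseteq> W)) = (\<lambda>W::'a set. 1::real)" by (auto simp: fun_eq_iff)
  moreover have "\<kappa> \<le> 1" using "0.prems"(6)[of "{{}}"] by simp
  ultimately show ?thesis using bern_const[OF assms(1), of p 1] by simp
 qed
next
 case (Suc k)
 define P where "P = (\<Sum>i<k. ps i)"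
 define s where "s = ps k"
 define err where "err = (\<Sum>i<k. (4 * q / ps i) ^ (2 ^ i))"
 have qs: "q \<le> s" using Suc.prems(1) by (simp add: s_def)
 have P0: "0 \<le> P" unfolding P_def using Suc.prems(1) assms(2) by (intro sum_nonneg) (meson lessThan_iff less_SucI less_imp_le order.trans)
 have sP: "s + P \<le> p" using Suc.prems(2) by (simp add: P_def s_def)
 hence s1: "s \<le> 1" "P \<le> 1" using P0 Suc.prems(3) qs assms(2) by auto
 let ?F = "\<lambda>W. of_bool (\<exists>S\<in>H. S \<subseteq> W) :: real"
 define H' where "H' W = {T \<in> fragment H W ` H. card T < 2 ^ k}" for W
 define cost where "cost W = (\<Sum>T\<in>large_fragments (2^k) H W. q ^ card T)" for W
 have finH: "finite H" using Suc.prems(4) assms(1) by (meson finite_Pow_iff finite_subset)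
 have frE: "fragment H W S \<subseteq> E" "fragment H W S \<subseteq> S" if "S \<in> H" for W S
  using fragment(1)[OF that, of W] Suc.prems(4) that by (blast+)
 \<comment> \<open>With the first sample \<open>W\<close> fixed, the other rounds work on the small
   fragments; a fragment inside \<open>W'\<close> completes to a member of \<open>H\<close> inside
   \<open>W \<union> W'\<close>.\<close>
 have main: "\<kappa> - cost W - err \<le> bern P E (\<lambda>W'. ?F (W \<union> W'))" if W: "W \<subseteq> E" for W
 proof -
  have "\<kappa> - cost W - err \<le> bern P E (\<lambda>W'. of_bool (\<exists>S\<in>H' W. S \<subseteq> W'))"
   unfolding err_def
  proof (rule Suc.IH)
   show "\<And>i. i < k ==> q \<le> ps i" using Suc.prems(1) by simp
   show "sum ps {..<k} \<le> P" by (simp add: P_def)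
   show "P \<le> 1" using s1 by simp
   show "H' W \<subseteq> Pow E" using frE by (auto simp: H'_def)
   show "\<And>S. S \<in> H' W ==> card S < 2 ^ k" by (simp add: H'_def)
   fix G assume G: "G \<subseteq> Pow E" "\<forall>S\<in>H' W. \<exists>T\<in>G. T \<subseteq> S"
   have finG: "finite G" using G(1) assms(1) by (meson finite_Pow_iff finite_subset)
   let ?L = "large_fragments (2^k) H W"
   have finL: "finite ?L" using finH by (simp add: large_fragments_def)
   have "\<kappa> \<le> (\<Sum>T\<in>G \<union> ?L. q ^ card T)"
   proof (rule Suc.prems(6))
    show "G \<union> ?L \<subseteq> Pow E" using G(1) frE by (auto simp: large_fragments_def)
    show "\<forall>S\<in>H. \<exists>T\<in>G \<union> ?L. T \<subseteq> S"
    proof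
     fix S assume S: "S \<in> H"
     show "\<exists>T\<in>G \<union> ?L. T \<subseteq> S"
     proof (cases "card (fragment H W S) < 2 ^ k")
      case True
      hence "fragment H W S \<in> H' W" using S by (auto simp: H'_def)
      then obtain T where "T \<in> G" "T \<subseteq> fragment H W S" using G(2) by auto
      thus ?thesis using frE(2)[OF S] by blast
     next
      case False
      hence "fragment H W S \<in> ?L" using S by (auto simp: large_fragments_def)
      thus ?thesis using frE(2)[OF S] by blast
     qed
    qed
   qed
   also have "... \<le> (\<Sum>T\<in>G. q ^ card T) + (\<Sum>T\<in>?L. q ^ card T)"
   proof -
    have "sum (\<lambda>T. q ^ card T) (G \<union> ?L) + sum (\<lambda>T. q ^ card T) (G \<inter> ?L)
     = (\<Sum>T\<in>G. q ^ card T) + (\<Sum>T\<in>?L. q ^ card T)"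
     using finG finL by (rule sum.union_inter)
    moreover have "0 \<le> sum (\<lambda>T. q ^ card T) (G \<inter> ?L)" using assms(2) by (intro sum_nonneg) auto
    ultimately show ?thesis by linarith
   qed
   finally show "\<kappa> - cost W \<le> (\<Sum>T\<in>G. q ^ card T)" by (simp add: cost_def)
  qed
  also have "... \<le> bern P E (\<lambda>W'. ?F (W \<union> W'))"
  proof (rule bern_mono[OF P0 s1(2)])
   fix W' assume "W' \<subseteq> E"
   have "\<exists>S\<in>H. S \<subseteq> W \<union> W'" if h: "\<exists>S\<in>H' W. S \<subseteq> W'"
   proof -
    obtain S where S: "S \<in> H" "fragment H W S \<subseteq> W'" using h by (auto simp: H'_def)
    thus ?thesis using fragment(1)[OF S(1), of W] by blast
   qed
   thus "of_bool (\<exists>S\<in>H' W. S \<subseteq> W') \<le> ?F (W \<union> W')" by auto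
  qed
  finally show ?thesis .
 qed
 have s0: "0 \<le> s" using qs assms(2) by simp
 have "bern s E (\<lambda>W. \<kappa> - cost W - err) \<le> bern s E (\<lambda>W. bern P E (\<lambda>W'. ?F (W \<union> W')))"
  using main s0 s1 by (intro bern_mono) auto
 also have "... = bern (s + P - s * P) E ?F" by (rule bern_union[OF assms(1)])
 also have "... \<le> bern p E ?F"
 proof (rule bern_upset_mono[OF assms(1)])
  have "s * P \<le> s" using s0 P0 s1 by (simp add: mult_left_le)
  thus "0 \<le> s + P - s * P" using P0 by simp
  show "s + P - s * P \<le> p" using sP s0 P0 by (smt (verit) mult_nonneg_nonneg)
 qed (use Suc.prems(3) in auto)
 finally have 1: "bern s E (\<lambda>W. \<kappa> - cost W - err) \<le> bern p E ?F" .
 have "bern s E (\<lambda>W. \<kappa> - cost W - err) = bern s E (\<lambda>W. 1 * (\<kappa> - err) + (-1) * cost W)"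
  by (simp add: algebra_simps)
 also have "... = (\<kappa> - err) - bern s E cost" unfolding bern_lin using bern_const[OF assms(1)] by simp
 finally have 2: "bern s E (\<lambda>W. \<kappa> - cost W - err) = (\<kappa> - err) - bern s E cost" .
 have "bern s E cost \<le> (4 * q / s) ^ (2 ^ k)"
  unfolding cost_def using fragment_cost[OF assms(1) Suc.prems(4,5) assms(2) qs s1(1)] by simp
 thus ?case using 1 2 by (simp add: err_def s_def)
qed

section \<open>The regularity lemma\<close>

definition edge_count :: "('b => 'b => bool) => 'b set => 'b set => real" where
 "edge_count g X Y = (\<Sum>x\<in>X. \<Sum>y\<in>Y. of_bool (g x y))"

definition edge_density :: "('b => 'b => bool) => 'b set => 'b set => real" where
 "edge_density g X Y = edge_count g X Y / (real (card X) * real (card Y))"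

text \<open>Only a lack of edges counts as irregular: the embedding uses nothing but lower bounds on
  degrees into large sets, and the energy argument works with one sign.\<close>

definition lower_irregular :: "real => ('b => 'b => bool) => 'b set => 'b set => bool" where
 "lower_irregular \<epsilon> g A B \<longleftrightarrow> (\<exists>X\<subseteq>A. \<exists>Y\<subseteq>B. \<epsilon> * card A \<le> card X \<and> \<epsilon> * card B \<le> card Y \<and>
   edge_count g X Y < (edge_density g A B - \<epsilon>) * card X * card Y)"

text \<open>A partition is encoded by a family \<open>\<D>\<close> that generates it, its parts
  being the classes of points with equal memberships. Refining the partition is then enlarging the
  family.\<close>

definition atom :: "'b set => 'b set set => 'b => 'b set" where
 "atom V \<D> x = {y\<in>V. \<forall>D\<in>\<D>. x \<in> D \<longleftrightarrow> y \<in> D}"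

definition cell_avg :: "'b set => 'b set set => ('b => real) => 'b => real" where
 "cell_avg V \<D> F x = (\<Sum>x'\<in>atom V \<D> x. F x') / card (atom V \<D> x)"

text \<open>The conditional expectation of the adjacency function given the product partition;
  \<open>energy\<close> is its squared L2 norm.\<close>

definition step_density :: "'b set => ('b => 'b => bool) => 'b set set => 'b => 'b => real" where
 "step_density V g \<D> x y = edge_density g (atom V \<D> x) (atom V \<D> y)"

definition energy :: "'b set => ('b => 'b => bool) => 'b set set => real" where
 "energy V g \<D> = (\<Sum>x\<in>V. \<Sum>y\<in>V. (step_density V g \<D> x y)\<^sup>2)"

lemma atom_self: "x \<in> V ==> x \<in> atom V \<D> x"
 by (simp add: atom_def)

lemma atom_subset: "atom V \<D> x \<subseteq> V"
 by (auto simp: atom_def)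

lemma atom_eq: "y \<in> atom V \<D> x ==> atom V \<D> y = atom V \<D> x"
 by (auto simp: atom_def)

lemma atom_eq_iff:
 "x \<in> V ==> y \<in> V ==> atom V \<D> x = atom V \<D> y \<longleftrightarrow> y \<in> atom V \<D> x"
 using atom_eq[of y V \<D> x] atom_self[of y V \<D>] by auto

lemma atom_refine:
 assumes "\<D> \<subseteq> \<D>'" "x \<in> V" "y \<in> V" "atom V \<D>' x = atom V \<D>' y"
 shows "atom V \<D> x = atom V \<D> y"
proof -
 have "y \<in> atom V \<D>' x" using assms(4) atom_self[OF assms(3)] by simp
 hence "y \<in> atom V \<D> x" using assms(1) unfolding atom_def by blast
 thus ?thesis using atom_eq by metis
qed

lemma atom_mem_iff:
 assumes "D \<in> \<D>" "x \<in> V" "y \<in> V" "atom V \<D> x = atom V \<D> y"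
 shows "x \<in> D \<longleftrightarrow> y \<in> D"
proof -
 have "y \<in> atom V \<D> x" using assms(4) atom_self[OF assms(3)] by simp
 thus ?thesis using assms(1) by (auto simp: atom_def)
qed

text \<open>Averaging over cells is self-adjoint: after the sums are exchanged, the weights 1/|cell|
  over one cell add up to 1, because \<open>h\<close> is constant on it.\<close>

lemma sum_cell_avg:
 fixes h F :: "'a => real"
 assumes fin: "finite V"
  and h: "\<And>x y. x \<in> V ==> y \<in> V ==> atom V \<D> x = atom V \<D> y ==> h x = h y"
 shows "(\<Sum>x\<in>V. cell_avg V \<D> F x * h x) = (\<Sum>x\<in>V. F x * h x)"
proof -
 have sub: "(\<Sum>y\<in>atom V \<D> x. G y) = (\<Sum>y\<in>V. if y \<in> atom V \<D> x then G y else 0)"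
  for G :: "'a => real" and x
  using sum.inter_restrict[OF fin, of G "atom V \<D> x"] atom_subset[of V \<D> x] by (simp add: Int_absorb1)
 have "(\<Sum>x\<in>V. cell_avg V \<D> F x * h x)
   = (\<Sum>x\<in>V. \<Sum>y\<in>V. if y \<in> atom V \<D> x then F y * h x / card (atom V \<D> x) else 0)"
  unfolding sub[symmetric] cell_avg_def
  by (simp add: sum_divide_distrib sum_distrib_right)
 also have "... = (\<Sum>y\<in>V. \<Sum>x\<in>V. if y \<in> atom V \<D> x then F y * h x / card (atom V \<D> x) else 0)"
  by (rule sum.swap)
 also have "... = (\<Sum>y\<in>V. F y * h y)"
 proof (rule sum.cong, simp)
  fix y assume y: "y \<in> V"
  have "(\<Sum>x\<in>V. if y \<in> atom V \<D> x then F y * h x / card (atom V \<D> x) else 0)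
    = (\<Sum>x\<in>V. if x \<in> atom V \<D> y then F y * h y / card (atom V \<D> y) else 0)"
  proof (rule sum.cong, simp)
   fix x assume x: "x \<in> V"
   have iff: "y \<in> atom V \<D> x \<longleftrightarrow> x \<in> atom V \<D> y" using x y atom_eq_iff by metis
   have "h x = h y" "atom V \<D> x = atom V \<D> y" if "y \<in> atom V \<D> x"
    using h[OF x y] atom_eq[OF that] by auto
   thus "(if y \<in> atom V \<D> x then F y * h x / card (atom V \<D> x) else 0) =
     (if x \<in> atom V \<D> y then F y * h y / card (atom V \<D> y) else 0)" using iff by auto
  qed
  also have "... = (\<Sum>x\<in>atom V \<D> y. F y * h y / card (atom V \<D> y))"
   by (rule sub[symmetric])
  also have "... = F y * h y"
  proof -
   have "finite (atom V \<D> y)" using fin atom_subset by (rule finite_subset[rotated])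
   hence "card (atom V \<D> y) \<noteq> 0" using atom_self[OF y] by auto
   thus ?thesis by simp
  qed
  finally show "(\<Sum>x\<in>V. if y \<in> atom V \<D> x then F y * h x / card (atom V \<D> x) else 0) = F y * h y" .
 qed
 finally show ?thesis .
qed

lemma step_density_avg:
 "step_density V g \<D> x y = cell_avg V \<D> (\<lambda>x'. cell_avg V \<D> (\<lambda>y'. of_bool (g x' y')) y) x"
 by (simp add: step_density_def edge_density_def edge_count_def cell_avg_def
   sum_divide_distrib[symmetric] field_simps)

lemma sum_step_density:
 assumes fin: "finite V"
  and h: "\<And>x y x' y'. x \<in> V ==> y \<in> V ==> x' \<in> V ==> y' \<in> V ==>
    atom V \<D> x = atom V \<D> x' ==> atom V \<D> y = atom V \<D> y' ==> h x y = h x' y'"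
 shows "(\<Sum>x\<in>V. \<Sum>y\<in>V. step_density V g \<D> x y * h x y) = (\<Sum>x\<in>V. \<Sum>y\<in>V. of_bool (g x y) * h x y)"
proof -
 have "(\<Sum>x\<in>V. \<Sum>y\<in>V. step_density V g \<D> x y * h x y)
   = (\<Sum>y\<in>V. \<Sum>x\<in>V. cell_avg V \<D> (\<lambda>x'. cell_avg V \<D> (\<lambda>y'. of_bool (g x' y')) y) x * h x y)"
  by (subst sum.swap) (simp add: step_density_avg)
 also have "... = (\<Sum>y\<in>V. \<Sum>x\<in>V. cell_avg V \<D> (\<lambda>y'. of_bool (g x y')) y * h x y)"
  by (intro sum.cong refl sum_cell_avg[OF fin]) (auto intro: h)
 also have "... = (\<Sum>x\<in>V. \<Sum>y\<in>V. cell_avg V \<D> (\<lambda>y'. of_bool (g x y')) y * h x y)"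
  by (rule sum.swap)
 also have "... = (\<Sum>x\<in>V. \<Sum>y\<in>V. of_bool (g x y) * h x y)"
  by (intro sum.cong refl sum_cell_avg[OF fin]) (auto intro: h)
 finally show ?thesis .
qed

lemma edge_count_nonneg: "0 \<le> edge_count g X Y"
 by (simp add: edge_count_def sum_nonneg)

lemma edge_count_le: "edge_count g X Y \<le> card X * card Y"
proof -
 have "edge_count g X Y \<le> (\<Sum>x\<in>X. \<Sum>y\<in>Y. 1)"
  unfolding edge_count_def by (intro sum_mono) auto
 thus ?thesis by simp
qed

lemma edge_density_bounds: "0 \<le> edge_density g X Y" "edge_density g X Y \<le> 1"
proof -
 show "0 \<le> edge_density g X Y"
  unfolding edge_density_def by (intro divide_nonneg_nonneg edge_count_nonneg) auto
 show "edge_density g X Y \<le> 1"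
 proof (cases "real (card X) * real (card Y) = 0")
  case False
  hence "0 < real (card X) * real (card Y)" by (metis mult_nonneg_nonneg of_nat_0_le_iff order_le_less)
  thus ?thesis using edge_count_le[of g X Y] unfolding edge_density_def by (subst divide_le_eq_1_pos) auto
 qed (auto simp: edge_density_def)
qed

lemma energy_le:
 assumes "finite V" shows "energy V g \<D> \<le> (real (card V))\<^sup>2"
proof -
 have "energy V g \<D> \<le> (\<Sum>x\<in>V. \<Sum>y\<in>V. 1)"
  unfolding energy_def step_density_def
  by (intro sum_mono power_le_one edge_density_bounds)
 thus ?thesis by (simp add: power2_eq_square)
qed

text \<open>Pythagoras: the coarse density is a projection of the fine one. Against a function
  constant on coarse cells both integrate like \<open>g\<close>, so the cross term is the coarse
  energy.\<close>

lemma energy_diff: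
 assumes fin: "finite V" and sub: "\<D> \<subseteq> \<D>'"
 shows "(\<Sum>x\<in>V. \<Sum>y\<in>V. (step_density V g \<D> x y - step_density V g \<D>' x y)\<^sup>2)
   = energy V g \<D>' - energy V g \<D>"
proof -
 let ?f = "step_density V g \<D>" and ?f' = "step_density V g \<D>'"
 have "(\<Sum>x\<in>V. \<Sum>y\<in>V. ?f' x y * ?f x y) = (\<Sum>x\<in>V. \<Sum>y\<in>V. of_bool (g x y) * ?f x y)"
 proof (rule sum_step_density[OF fin])
  fix x y x' y' assume a: "x \<in> V" "y \<in> V" "x' \<in> V" "y' \<in> V"
   "atom V \<D>' x = atom V \<D>' x'" "atom V \<D>' y = atom V \<D>' y'"
  show "?f x y = ?f x' y'"
   using atom_refine[OF sub a(1,3,5)] atom_refine[OF sub a(2,4,6)] by (simp add: step_density_def)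
 qed
 also have "... = (\<Sum>x\<in>V. \<Sum>y\<in>V. ?f x y * ?f x y)"
  by (intro sum_step_density[OF fin, symmetric]) (simp add: step_density_def)
 finally have cross: "(\<Sum>x\<in>V. \<Sum>y\<in>V. ?f' x y * ?f x y) = energy V g \<D>"
  by (simp add: energy_def power2_eq_square)
 have "(\<Sum>x\<in>V. \<Sum>y\<in>V. (?f x y - ?f' x y)\<^sup>2)
   = (\<Sum>x\<in>V. \<Sum>y\<in>V. (?f x y)\<^sup>2 + (?f' x y)\<^sup>2 - 2 * (?f' x y * ?f x y))"
  by (intro sum.cong refl) (simp add: power2_diff)
 also have "... = energy V g \<D> + energy V g \<D>' - 2 * energy V g \<D>"
  by (simp add: sum.distrib sum_subtractf energy_def sum_distrib_left[symmetric] cross[unfolded energy_def])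
 finally show ?thesis by simp
qed

lemma partition_atoms:
 assumes "finite V" shows "partition_on V (atom V \<D> ` V)"
 unfolding partition_on_def disjoint_def
proof (intro conjI ballI impI)
 show "\<Union> (atom V \<D> ` V) = V" using atom_self atom_subset by fast
 show "{} \<notin> atom V \<D> ` V" using atom_self by fastforce
 fix a b assume ab: "a \<in> atom V \<D> ` V" "b \<in> atom V \<D> ` V" "a \<noteq> b"
 show "a \<inter> b = {}"
 proof (rule ccontr)
  assume "a \<inter> b \<noteq> {}"
  then obtain z where z: "z \<in> a" "z \<in> b" by auto
  obtain x y where "a = atom V \<D> x" "b = atom V \<D> y" using ab by auto
  hence "a = atom V \<D> z" "b = atom V \<D> z" using atom_eq z by metis+
  thus False using ab by simp
 qed
qed

lemma card_atoms:
 assumes "finite V" "finite \<D>" shows "card (atom V \<D> ` V) \<le> 2 ^ card \<D>"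
proof -
 have "atom V \<D> ` V \<subseteq> (\<lambda>S. {y\<in>V. {D\<in>\<D>. y \<in> D} = S}) ` Pow \<D>"
 proof
  fix A assume "A \<in> atom V \<D> ` V"
  then obtain x where "A = atom V \<D> x" by auto
  hence "A = {y\<in>V. {D\<in>\<D>. y \<in> D} = {D\<in>\<D>. x \<in> D}}" by (auto simp: atom_def)
  thus "A \<in> (\<lambda>S. {y\<in>V. {D\<in>\<D>. y \<in> D} = S}) ` Pow \<D>" by auto
 qed
 hence "card (atom V \<D> ` V) \<le> card ((\<lambda>S. {y\<in>V. {D\<in>\<D>. y \<in> D} = S}) ` Pow \<D>)"
  using assms by (intro card_mono) auto
 also have "... \<le> card (Pow \<D>)" using assms by (intro card_image_le) auto
 finally show ?thesis using assms by (simp add: card_Pow)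
qed

definition irregular_weight :: "real => ('b => 'b => bool) => 'b set set => real" where
 "irregular_weight \<epsilon> g P =
   (\<Sum>(A,B)\<in>{(A,B)\<in>P \<times> P. lower_irregular \<epsilon> g A B}. real (card A) * real (card B))"

text \<open>The witnesses of all irregular pairs join the generating family. On a witness rectangle
  the old density is constant and the new one is on average more than \<epsilon> smaller, so the
  squared distance over A \<times> B is at least \<epsilon>^4 |A||B|. The rectangles A \<times> B
  are disjoint, and the irregular ones weigh more than \<epsilon> n^2.\<close>

lemma energy_increment:
 fixes g :: "'b => 'b => bool"
 assumes fin: "finite V" "finite \<D>" and D: "\<D> \<subseteq> Pow V" and eps: "0 < \<epsilon>"
  and irr: "irregular_weight \<epsilon> g (atom V \<D> ` V) > \<epsilon> * (card V)\<^sup>2"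
 shows "\<exists>\<D>'. finite \<D>' \<and> \<D>' \<subseteq> Pow V \<and> card \<D>' \<le> card \<D> + 2 * (2 ^ card \<D> * 2 ^ card \<D>) \<and>
   energy V g \<D>' \<ge> energy V g \<D> + \<epsilon>^5 * (card V)\<^sup>2"
proof -
 define P where "P = atom V \<D> ` V"
 define I where "I = {(A,B)\<in>P \<times> P. lower_irregular \<epsilon> g A B}"
 have finP: "finite P" using fin by (simp add: P_def)
 have finI: "finite I"
 proof (rule finite_subset)
  show "I \<subseteq> P \<times> P" by (auto simp: I_def)
  show "finite (P \<times> P)" using finP by simp
 qed
 have PV: "A \<subseteq> V" if "A \<in> P" for A using that atom_subset[of V \<D>] unfolding P_def by blast
 define Q where "Q i XY \<longleftrightarrow> fst XY \<subseteq> fst i \<and> snd XY \<subseteq> snd i \<and> \<epsilon> * card (fst i) \<le> card (fst XY) \<and>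
   \<epsilon> * card (snd i) \<le> card (snd XY) \<and>
   edge_count g (fst XY) (snd XY) < (edge_density g (fst i) (snd i) - \<epsilon>) * card (fst XY) * card (snd XY)"
  for i XY :: "'b set \<times> 'b set"
 define w where "w i = (SOME XY. Q i XY)" for i
 have w: "Q i (w i)" if i: "i \<in> I" for i
 proof -
  obtain A B where AB: "i = (A, B)" by (cases i)
  have "lower_irregular \<epsilon> g A B" using i AB by (simp add: I_def)
  then obtain X Y where "X \<subseteq> A" "Y \<subseteq> B" "\<epsilon> * card A \<le> card X" "\<epsilon> * card B \<le> card Y"
   "edge_count g X Y < (edge_density g A B - \<epsilon>) * card X * card Y" unfolding lower_irregular_def by blast
  hence "Q i (X, Y)" by (simp add: Q_def AB)
  hence "\<exists>XY. Q i XY" by blast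
  thus ?thesis unfolding w_def by (metis someI_ex)
 qed
 have wV: "fst (w i) \<subseteq> V" "snd (w i) \<subseteq> V" if "i \<in> I" for i
 proof -
  have "fst i \<in> P" "snd i \<in> P" using that by (auto simp: I_def)
  hence "fst i \<subseteq> V" "snd i \<subseteq> V" using PV by blast+
  moreover have "fst (w i) \<subseteq> fst i" "snd (w i) \<subseteq> snd i" using w[OF that] by (simp_all add: Q_def)
  ultimately show "fst (w i) \<subseteq> V" "snd (w i) \<subseteq> V" by simp_all
 qed
 define \<D>' where "\<D>' = \<D> \<union> ((fst \<circ> w) ` I \<union> (snd \<circ> w) ` I)"
 have finD': "finite \<D>'" using fin finI by (simp add: \<D>'_def)
 have cI: "card I \<le> 2 ^ card \<D> * 2 ^ card \<D>"
 proof -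
  have "card I \<le> card (P \<times> P)" using finP by (intro card_mono) (auto simp: I_def)
  also have "... \<le> 2 ^ card \<D> * 2 ^ card \<D>"
   unfolding card_cartesian_product P_def by (intro mult_mono card_atoms fin) auto
  finally show ?thesis .
 qed
 have cD': "card \<D>' \<le> card \<D> + 2 * (2 ^ card \<D> * 2 ^ card \<D>)"
 proof -
  have "card \<D>' \<le> card \<D> + (card ((fst \<circ> w) ` I) + card ((snd \<circ> w) ` I))"
   unfolding \<D>'_def by (meson card_Un_le add_left_mono order.trans)
  also have "... \<le> card \<D> + (card I + card I)" by (intro add_mono card_image_le finI order_refl)
  finally show ?thesis using cI by simp
 qed
 let ?f = "step_density V g \<D>" and ?f' = "step_density V g \<D>'"
 let ?s = "\<lambda>x y. (?f x y - ?f' x y)\<^sup>2"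
 have cell: "(\<Sum>x\<in>fst i. \<Sum>y\<in>snd i. ?s x y) \<ge> \<epsilon>^4 * (card (fst i) * card (snd i))" if i: "i \<in> I" for i
 proof -
  obtain A B where AB: "i = (A, B)" by (cases i)
  obtain X Y where XY: "w i = (X, Y)" by (cases "w i")
  have AP: "A \<in> P" "B \<in> P" using i AB by (auto simp: I_def)
  have XA: "X \<subseteq> A" "Y \<subseteq> B" and cX: "\<epsilon> * card A \<le> card X" "\<epsilon> * card B \<le> card Y"
   and ed: "edge_count g X Y < (edge_density g A B - \<epsilon>) * card X * card Y"
   using w[OF i] AB XY by (auto simp: Q_def)
  have XV: "X \<subseteq> V" "Y \<subseteq> V" using XA PV AP by auto
  have mem: "X \<in> \<D>'" "Y \<in> \<D>'"
   using i XY imageI[OF i, of "fst \<circ> w"] imageI[OF i, of "snd \<circ> w"] unfolding \<D>'_def by auto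
  have finAB: "finite A" "finite B" using PV[OF AP(1)] PV[OF AP(2)] fin(1) by (auto dest: finite_subset)
  have fAB: "?f x y = edge_density g A B" if "x \<in> A" "y \<in> B" for x y
  proof -
   obtain a b where ab: "A = atom V \<D> a" "B = atom V \<D> b" using AP unfolding P_def by blast
   have "A = atom V \<D> x" "B = atom V \<D> y" using that atom_eq[of x V \<D> a] atom_eq[of y V \<D> b] ab by auto
   thus ?thesis by (simp add: step_density_def)
  qed
  have restrict: "(\<Sum>x\<in>X. \<Sum>y\<in>Y. F x y) = (\<Sum>x\<in>V. \<Sum>y\<in>V. F x y * (of_bool (x \<in> X) * of_bool (y \<in> Y)))"
   for F :: "'b => 'b => real"
  proof -
   have "(\<Sum>x\<in>V. \<Sum>y\<in>V. F x y * (of_bool (x \<in> X) * of_bool (y \<in> Y)))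
     = (\<Sum>x\<in>V. if x \<in> X then (\<Sum>y\<in>V. if y \<in> Y then F x y else 0) else 0)"
    by (intro sum.cong refl) (auto simp: of_bool_def if_distrib cong: if_cong)
   also have "... = (\<Sum>x\<in>X. \<Sum>y\<in>Y. F x y)"
    using XV fin(1) by (simp add: sum.inter_restrict[symmetric] Int_absorb1)
   finally show ?thesis by simp
  qed
  have "(\<Sum>x\<in>X. \<Sum>y\<in>Y. ?f' x y) = (\<Sum>x\<in>V. \<Sum>y\<in>V. of_bool (g x y) * (of_bool (x \<in> X) * of_bool (y \<in> Y)))"
   unfolding restrict
  proof (rule sum_step_density[OF fin(1)])
   fix x y x' y' assume a: "x \<in> V" "y \<in> V" "x' \<in> V" "y' \<in> V"
    "atom V \<D>' x = atom V \<D>' x'" "atom V \<D>' y = atom V \<D>' y'"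
   show "of_bool (x \<in> X) * of_bool (y \<in> Y) = (of_bool (x' \<in> X) * of_bool (y' \<in> Y) :: real)"
    using atom_mem_iff[OF mem(1) a(1,3,5)] atom_mem_iff[OF mem(2) a(2,4,6)] by simp
  qed
  also have "... = edge_count g X Y" unfolding edge_count_def restrict ..
  finally have sf': "(\<Sum>x\<in>X. \<Sum>y\<in>Y. ?f' x y) = edge_count g X Y" .
  have sf: "(\<Sum>x\<in>X. \<Sum>y\<in>Y. ?f x y) = edge_density g A B * card X * card Y"
  proof -
   have "(\<Sum>x\<in>X. \<Sum>y\<in>Y. ?f x y) = (\<Sum>x\<in>X. \<Sum>y\<in>Y. edge_density g A B)"
    using XA by (intro sum.cong refl fAB) auto
   thus ?thesis by simp
  qed
  have "\<epsilon>^4 * (card A * card B) = \<epsilon>\<^sup>2 * ((\<epsilon> * card A) * (\<epsilon> * card B))"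
   by (simp add: power2_eq_square power4_eq_xxxx)
  also have "... \<le> \<epsilon>\<^sup>2 * (real (card X) * real (card Y))"
   by (intro mult_left_mono mult_mono cX) (use eps in auto)
  also have "... = \<epsilon>\<^sup>2 * (card X * card Y)" by simp
  also have "... \<le> 2 * \<epsilon> * (edge_density g A B * card X * card Y - edge_count g X Y) - \<epsilon>\<^sup>2 * (card X * card Y)"
  proof -
   have "\<epsilon> * (card X * card Y) \<le> edge_density g A B * card X * card Y - edge_count g X Y"
    using ed by (simp add: algebra_simps)
   hence "(2 * \<epsilon>) * (\<epsilon> * (card X * card Y)) \<le> (2 * \<epsilon>) * (edge_density g A B * card X * card Y - edge_count g X Y)"
    using eps by (intro mult_left_mono) auto
   thus ?thesis by (simp add: power2_eq_square algebra_simps)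
  qed
  also have "... = (\<Sum>x\<in>X. \<Sum>y\<in>Y. 2 * \<epsilon> * (?f x y - ?f' x y) - \<epsilon>\<^sup>2)"
   by (simp add: sum_subtractf sum_distrib_left[symmetric] sf sf')
  \<comment> \<open>The tangent bound z^2 \<ge> 2\<epsilon>z - \<epsilon>^2 takes the place of the
    Cauchy-Schwarz inequality; it is sharp when the deficiency z is constantly \<epsilon>.\<close>
  also have "... \<le> (\<Sum>x\<in>X. \<Sum>y\<in>Y. ?s x y)"
  proof (intro sum_mono)
   fix x y
   have "0 \<le> (?f x y - ?f' x y - \<epsilon>)\<^sup>2" by simp
   thus "2 * \<epsilon> * (?f x y - ?f' x y) - \<epsilon>\<^sup>2 \<le> ?s x y" by (simp add: power2_eq_square algebra_simps)
  qed
  also have "... \<le> (\<Sum>x\<in>A. \<Sum>y\<in>B. ?s x y)"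
  proof -
   have "(\<Sum>x\<in>X. \<Sum>y\<in>Y. ?s x y) \<le> (\<Sum>x\<in>X. \<Sum>y\<in>B. ?s x y)"
    using XA finAB by (intro sum_mono sum_mono2) auto
   also have "... \<le> (\<Sum>x\<in>A. \<Sum>y\<in>B. ?s x y)"
    using XA finAB by (intro sum_mono2 sum_nonneg) auto
   finally show ?thesis .
  qed
  finally show ?thesis by (simp add: AB)
 qed
 have disj: "(fst i \<times> snd i) \<inter> (fst j \<times> snd j) = {}" if "i \<in> I" "j \<in> I" "i \<noteq> j" for i j
 proof -
  have *: "\<And>A B. A \<in> P ==> B \<in> P ==> A \<noteq> B ==> A \<inter> B = {}"
   using partition_atoms[OF fin(1), of \<D>] unfolding partition_on_def disjoint_def P_def by blast
  have "fst i \<in> P" "snd i \<in> P" "fst j \<in> P" "snd j \<in> P" using that by (auto simp: I_def)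
  moreover have "fst i \<noteq> fst j \<or> snd i \<noteq> snd j" using that(3) by (simp add: prod_eq_iff)
  ultimately show ?thesis using * by blast
 qed
 have "\<epsilon>^5 * (card V)\<^sup>2 \<le> \<epsilon>^4 * irregular_weight \<epsilon> g P"
 proof -
  have "\<epsilon>^4 * (\<epsilon> * (card V)\<^sup>2) \<le> \<epsilon>^4 * irregular_weight \<epsilon> g P"
   using irr eps by (intro mult_left_mono) (auto simp: P_def)
  thus ?thesis by (simp add: power_Suc[symmetric] mult.assoc[symmetric] power_Suc2[symmetric] del: power_Suc)
 qed
 also have "... = (\<Sum>i\<in>I. \<epsilon>^4 * (card (fst i) * card (snd i)))"
  unfolding irregular_weight_def I_def[symmetric] sum_distrib_left by (simp add: case_prod_beta)
 also have "... \<le> (\<Sum>i\<in>I. \<Sum>x\<in>fst i. \<Sum>y\<in>snd i. ?s x y)" by (intro sum_mono cell)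
 also have "... = (\<Sum>i\<in>I. \<Sum>(x,y)\<in>fst i \<times> snd i. ?s x y)"
  by (simp add: sum.cartesian_product)
 also have "... = (\<Sum>(x,y)\<in>(\<Union>i\<in>I. fst i \<times> snd i). ?s x y)"
 proof (rule sum.UNION_disjoint[symmetric, OF finI])
  show "\<forall>i\<in>I. finite (fst i \<times> snd i)"
  proof
   fix i assume "i \<in> I"
   hence "fst i \<in> P" "snd i \<in> P" by (auto simp: I_def)
   hence "fst i \<subseteq> V" "snd i \<subseteq> V" using PV by blast+
   thus "finite (fst i \<times> snd i)" using fin(1) by (auto dest: finite_subset)
  qed
  show "\<forall>i\<in>I. \<forall>j\<in>I. i \<noteq> j --> fst i \<times> snd i \<inter> fst j \<times> snd j = {}" using disj by blast
 qed
 also have "... \<le> (\<Sum>(x,y)\<in>V \<times> V. ?s x y)"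
 proof (rule sum_mono2)
  have "fst i \<in> P \<and> snd i \<in> P" if "i \<in> I" for i using that by (auto simp: I_def)
  thus "(\<Union>i\<in>I. fst i \<times> snd i) \<subseteq> V \<times> V" using PV by blast
 qed (use fin in auto)
 also have "... = energy V g \<D>' - energy V g \<D>"
  unfolding energy_diff[OF fin(1), of \<D> \<D>' g, symmetric, OF Un_upper1[of \<D> "(fst \<circ> w) ` I \<union> (snd \<circ> w) ` I", folded \<D>'_def]]
  by (simp add: sum.cartesian_product)
 finally have "energy V g \<D>' \<ge> energy V g \<D> + \<epsilon>^5 * (card V)\<^sup>2" by simp
 moreover have "\<D>' \<subseteq> Pow V" unfolding \<D>'_def using D wV by (simp add: image_subset_iff)
 ultimately show ?thesis using finD' cD' by blast
qed

text \<open>The bound on the size of the family depends on \<epsilon> and \<open>k\<close> only.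
  Either regularity has been reached or each of \<open>k\<close> refinements has raised the energy
  by \<epsilon>^5 n^2.\<close>

lemma energy_iterate:
 assumes eps: "0 < \<epsilon>"
 shows "\<exists>N. \<forall>V (g :: 'b => 'b => bool). finite V --> (\<exists>\<D>. finite \<D> \<and> \<D> \<subseteq> Pow V \<and> card \<D> \<le> N \<and>
   (irregular_weight \<epsilon> g (atom V \<D> ` V) \<le> \<epsilon> * (card V)\<^sup>2 \<or> energy V g \<D> \<ge> real k * \<epsilon>^5 * (card V)\<^sup>2))"
proof (induction k)
 case 0
 have "energy V g {} \<ge> 0" for V and g :: "'b => 'b => bool" by (simp add: energy_def sum_nonneg)
 thus ?case by (intro exI[of _ 0] allI impI exI[of _ "{}"]) auto
next
 case (Suc k)
 then obtain N where N: "\<And>V (g :: 'b => 'b => bool). finite V ==> \<exists>\<D>. finite \<D> \<and> \<D> \<subseteq> Pow V \<and> card \<D> \<le> N \<and>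
   (irregular_weight \<epsilon> g (atom V \<D> ` V) \<le> \<epsilon> * (card V)\<^sup>2 \<or> energy V g \<D> \<ge> real k * \<epsilon>^5 * (card V)\<^sup>2)"
  by blast
 show ?case
 proof (intro exI[of _ "N + 2 * (2 ^ N * 2 ^ N)"] allI impI)
  fix V :: "'b set" and g :: "'b => 'b => bool" assume V: "finite V"
  obtain \<D> where D: "finite \<D>" "\<D> \<subseteq> Pow V" "card \<D> \<le> N" and
   or: "irregular_weight \<epsilon> g (atom V \<D> ` V) \<le> \<epsilon> * (card V)\<^sup>2 \<or> energy V g \<D> \<ge> real k * \<epsilon>^5 * (card V)\<^sup>2"
   using N[OF V] by blast
  show "\<exists>\<D>. finite \<D> \<and> \<D> \<subseteq> Pow V \<and> card \<D> \<le> N + 2 * (2 ^ N * 2 ^ N) \<and>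
   (irregular_weight \<epsilon> g (atom V \<D> ` V) \<le> \<epsilon> * (card V)\<^sup>2 \<or> energy V g \<D> \<ge> real (Suc k) * \<epsilon>^5 * (card V)\<^sup>2)"
  proof (cases "irregular_weight \<epsilon> g (atom V \<D> ` V) \<le> \<epsilon> * (card V)\<^sup>2")
   case True
   thus ?thesis using D by (intro exI[of _ \<D>]) auto
  next
   case False
   then obtain \<D>' where D': "finite \<D>'" "\<D>' \<subseteq> Pow V" "card \<D>' \<le> card \<D> + 2 * (2 ^ card \<D> * 2 ^ card \<D>)"
    "energy V g \<D>' \<ge> energy V g \<D> + \<epsilon>^5 * (card V)\<^sup>2"
    using energy_increment[OF V D(1,2) eps, of g] by auto
   have "card \<D> + 2 * (2 ^ card \<D> * 2 ^ card \<D>) \<le> N + 2 * (2 ^ N * 2 ^ N)"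
    using D(3) by (intro add_mono mult_mono power_increasing) auto
   moreover have "energy V g \<D>' \<ge> real (Suc k) * \<epsilon>^5 * (card V)\<^sup>2"
    using D'(4) or False by (simp add: algebra_simps)
   ultimately show ?thesis using D' by (intro exI[of _ \<D>']) auto
  qed
 qed
qed

theorem regularity_lemma:
 assumes eps: "0 < \<epsilon>"
 shows "\<exists>N. \<forall>V (g :: 'b => 'b => bool). finite V -->
   (\<exists>P. partition_on V P \<and> card P \<le> N \<and> irregular_weight \<epsilon> g P \<le> \<epsilon> * (card V)\<^sup>2)"
proof -
 \<comment> \<open>Energy never exceeds n^2, so for this \<open>k\<close> the second alternative is
   impossible.\<close>
 obtain k :: nat where k: "1 < real k * \<epsilon>^5" using eps reals_Archimedean3[of "\<epsilon>^5"] by auto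
 obtain N where N: "\<And>V (g :: 'b => 'b => bool). finite V ==> \<exists>\<D>. finite \<D> \<and> \<D> \<subseteq> Pow V \<and> card \<D> \<le> N \<and>
   (irregular_weight \<epsilon> g (atom V \<D> ` V) \<le> \<epsilon> * (card V)\<^sup>2 \<or> energy V g \<D> \<ge> real k * \<epsilon>^5 * (card V)\<^sup>2)"
  using energy_iterate[OF eps, of k] by blast
 show ?thesis
 proof (intro exI[of _ "2^N"] allI impI)
  fix V :: "'b set" and g :: "'b => 'b => bool" assume V: "finite V"
  obtain \<D> where D: "finite \<D>" "\<D> \<subseteq> Pow V" "card \<D> \<le> N" and
   or: "irregular_weight \<epsilon> g (atom V \<D> ` V) \<le> \<epsilon> * (card V)\<^sup>2 \<or> energy V g \<D> \<ge> real k * \<epsilon>^5 * (card V)\<^sup>2"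
   using N[OF V] by blast
  have irr: "irregular_weight \<epsilon> g (atom V \<D> ` V) \<le> \<epsilon> * (card V)\<^sup>2"
  proof (cases "V = {}")
   case True
   thus ?thesis by (simp add: irregular_weight_def)
  next
   case False
   hence "0 < (real (card V))\<^sup>2" using V by (simp add: card_gt_0_iff)
   hence "1 * (real (card V))\<^sup>2 < real k * \<epsilon>^5 * (real (card V))\<^sup>2" using k by (intro mult_strict_right_mono) auto
   thus ?thesis using or energy_le[OF V, of g \<D>] by auto
  qed
  have "card (atom V \<D> ` V) \<le> 2 ^ N"
   using card_atoms[OF V D(1)] D(3) by (meson le_trans one_le_numeral power_increasing)
  thus "\<exists>P. partition_on V P \<and> card P \<le> 2 ^ N \<and> irregular_weight \<epsilon> g P \<le> \<epsilon> * (card V)\<^sup>2"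
   using partition_atoms[OF V] irr by (intro exI[of _ "atom V \<D> ` V"]) auto
 qed
qed

section \<open>Typical pairs and clusters\<close>

text \<open>Regularity in the form used by the embedding: whatever large candidate set Y a neighbour
  still has in \<open>B\<close>, most choices in \<open>A\<close> keep a proportion \<open>d\<close>
  of it. The notion is not symmetric, so adjacent clusters must be typical in both orders.\<close>

definition typical_pair :: "('b => 'b => bool) => real => real => 'b set => 'b set => bool" where
 "typical_pair g d \<delta> A B \<longleftrightarrow> (\<forall>Y\<subseteq>B. \<delta> * real (card B) \<le> real (card Y) -->
   real (card {a\<in>A. real (card {y\<in>Y. g a y}) < d * real (card Y)}) \<le> \<delta> * real (card A))"

lemma edge_count_card:
 assumes "finite Y" shows "edge_count g X Y = (\<Sum>x\<in>X. real (card {y\<in>Y. g x y}))"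
 unfolding edge_count_def using assms by (intro sum.cong refl) (simp add: Int_def)

text \<open>Too many exceptional vertices X would contradict lower regularity: they send fewer than
  d|X||Y| edges to Y, whereas density at least 2d minus \<epsilon> \<le> d guarantees
  d|X||Y|.\<close>

lemma typical_pair_of_regular:
 fixes d \<delta> \<epsilon> :: real
 assumes fin: "finite A" "finite B" and reg: "\<not> lower_irregular \<epsilon> g A B"
  and dens: "2 * d \<le> edge_density g A B" and eps: "\<epsilon> \<le> d" "\<epsilon> \<le> \<delta>" and d0: "0 \<le> \<delta>"
 shows "typical_pair g d \<delta> A B"
 unfolding typical_pair_def
proof (intro allI impI)
 fix Y assume Y: "Y \<subseteq> B" "\<delta> * card B \<le> card Y"
 define X where "X = {a\<in>A. real (card {y\<in>Y. g a y}) < d * card Y}"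
 have finY: "finite Y" using Y(1) fin(2) by (rule finite_subset)
 have XA: "X \<subseteq> A" by (auto simp: X_def)
 hence finX: "finite X" using fin(1) by (rule finite_subset)
 have "card X \<le> \<delta> * card A"
 proof (rule ccontr)
  assume "\<not> ?thesis"
  hence cX: "\<delta> * card A < card X" by simp
  have "0 \<le> \<delta> * card A" using d0 by simp
  hence "0 < card X" using cX by linarith
  hence X0: "X \<noteq> {}" by auto
  have 1: "\<epsilon> * card A \<le> card X" using cX eps(2) mult_right_mono[of \<epsilon> \<delta> "real (card A)"] by simp
  have 2: "\<epsilon> * card B \<le> card Y" using Y(2) eps(2) mult_right_mono[of \<epsilon> \<delta> "real (card B)"] by simp
  have "(edge_density g A B - \<epsilon>) * card X * card Y \<le> edge_count g X Y"
   using reg XA Y(1) 1 2 unfolding lower_irregular_def by (meson not_le)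
  moreover have "edge_count g X Y < (\<Sum>x\<in>X. d * card Y)"
   unfolding edge_count_card[OF finY] using X0 finX by (intro sum_strict_mono) (auto simp: X_def)
  moreover have "d * (card X * card Y) \<le> (edge_density g A B - \<epsilon>) * (card X * card Y)"
   using dens eps(1) by (intro mult_right_mono) auto
  ultimately show False by (simp add: algebra_simps)
 qed
 thus "card {a\<in>A. real (card {y\<in>Y. g a y}) < d * card Y} \<le> \<delta> * card A" by (simp add: X_def)
qed

lemma edge_count_commute:
 assumes "\<And>x y. x \<in> X ==> y \<in> Y ==> g x y = g y x"
 shows "edge_count g X Y = edge_count g Y X"
 unfolding edge_count_def using assms by (subst sum.swap) (intro sum.cong refl, auto)

lemma irregular_weight_alt:
 assumes "finite P"
 shows "irregular_weight \<epsilon> g P = (\<Sum>A\<in>P. \<Sum>B\<in>P. real (card A) * real (card B) * of_bool (lower_irregular \<epsilon> g A B))"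
proof -
 have "(\<Sum>A\<in>P. \<Sum>B\<in>P. real (card A) * real (card B) * of_bool (lower_irregular \<epsilon> g A B))
  = (\<Sum>i\<in>P\<times>P. real (card (fst i)) * real (card (snd i)) * of_bool (lower_irregular \<epsilon> g (fst i) (snd i)))"
  by (simp add: sum.cartesian_product case_prod_beta)
 also have "... = (\<Sum>i\<in>P\<times>P. if lower_irregular \<epsilon> g (fst i) (snd i) then real (card (fst i)) * real (card (snd i)) else 0)"
  by (intro sum.cong) auto
 also have "... = (\<Sum>i\<in>{i\<in>P\<times>P. lower_irregular \<epsilon> g (fst i) (snd i)}. real (card (fst i)) * real (card (snd i)))"
  using assms by (subst sum.inter_filter) auto
 also have "{i\<in>P\<times>P. lower_irregular \<epsilon> g (fst i) (snd i)} = {(A,B)\<in>P \<times> P. lower_irregular \<epsilon> g A B}" by auto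
 finally show ?thesis by (simp add: irregular_weight_def case_prod_beta)
qed

text \<open>Clusters may differ in size; equal sizes are replaced by the lower bound
  \<open>c\<close> on relative sizes, and everything later is measured by weight. Tiny parts and
  parts with much weight in irregular pairs are discarded. \<open>c\<close> is chosen before
  \<alpha> and the graph.\<close>

theorem cluster_lemma:
 fixes d \<tau> \<delta> :: real
 assumes "0 < d" "0 < \<tau>" "0 < \<delta>"
 shows "\<exists>c::real. 0 < c \<and> (\<forall>V (g :: 'b => 'b => bool) (\<alpha>::real). finite V \<and> V \<noteq> {} \<and> (\<forall>u\<in>V. \<forall>v\<in>V. g u v = g v u) \<and>
   (\<forall>v\<in>V. \<alpha> * card V \<le> card {u\<in>V. g v u}) -->
   (\<exists>\<A>. finite \<A> \<and> disjoint \<A> \<and> \<Union>\<A> \<subseteq> V \<and> (\<forall>A\<in>\<A>. c * card V \<le> card A) \<and>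
    (1 - \<tau>) * card V \<le> (\<Sum>A\<in>\<A>. real (card A)) \<and>
    (\<forall>A\<in>\<A>. (\<alpha> - 2 * d - \<tau>) * card V \<le>
      (\<Sum>B\<in>{B\<in>\<A>. typical_pair g d \<delta> A B \<and> typical_pair g d \<delta> B A}. real (card B)))))"
proof -
 define \<sigma> where "\<sigma> = \<tau> / 4"
 have s0: "0 < \<sigma>" using assms by (simp add: \<sigma>_def)
 define \<epsilon> where "\<epsilon> = min (min d \<delta>) (min (\<tau> / 8) (\<sigma> * \<tau> / 16))"
 have e0: "0 < \<epsilon>" "\<epsilon> \<le> d" "\<epsilon> \<le> \<delta>" "\<epsilon> \<le> \<tau> / 8" "\<epsilon> \<le> \<sigma> * \<tau> / 16" using assms s0 by (auto simp: \<epsilon>_def)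
 obtain N where N: "\<And>V (g :: 'b => 'b => bool). finite V ==>
   (\<exists>P. partition_on V P \<and> card P \<le> N \<and> irregular_weight \<epsilon> g P \<le> \<epsilon> * (card V)\<^sup>2)"
  using regularity_lemma[OF e0(1)] by blast
 define c where "c = \<epsilon> / (real N + 1)"
 have c0: "0 < c" using e0 by (simp add: c_def)
 have main: "\<exists>\<A>. finite \<A> \<and> disjoint \<A> \<and> \<Union>\<A> \<subseteq> V \<and> (\<forall>A\<in>\<A>. c * card V \<le> card A) \<and>
    (1 - \<tau>) * card V \<le> (\<Sum>A\<in>\<A>. real (card A)) \<and>
    (\<forall>A\<in>\<A>. (\<alpha> - 2 * d - \<tau>) * card V \<le>
      (\<Sum>B\<in>{B\<in>\<A>. typical_pair g d \<delta> A B \<and> typical_pair g d \<delta> B A}. real (card B)))"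
  if V: "finite V" "V \<noteq> {}" and sym: "\<forall>u\<in>V. \<forall>v\<in>V. g u v = g v u"
   and deg: "\<forall>v\<in>V. \<alpha> * card V \<le> card {u\<in>V. g v u}" for V and g :: "'b => 'b => bool" and \<alpha> :: real
 proof -
  define n where "n = real (card V)"
  have n0: "0 < n" using V by (simp add: n_def card_gt_0_iff)
  obtain P where P: "partition_on V P" "card P \<le> N" "irregular_weight \<epsilon> g P \<le> \<epsilon> * n\<^sup>2"
   using N[OF V(1), of g] by (auto simp: n_def)
  have finP: "finite P" using P(1) V(1) by (rule finite_elements[rotated])
  have UP: "\<Union>P = V" and disP: "disjoint P" using P(1) by (auto simp: partition_on_def)
  have PV: "A \<subseteq> V" if "A \<in> P" for A using that UP by blast
  have finA: "finite A" if "A \<in> P" for A using PV[OF that] V(1) by (rule finite_subset)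
  have sumP: "(\<Sum>x\<in>V. F x) = (\<Sum>B\<in>P. \<Sum>x\<in>B. F x)" for F :: "'b => real"
   using sum.Union_disjoint[of P F] finA disP unfolding UP disjoint_def by (simp add: comp_def)
  have totP: "(\<Sum>B\<in>P. real (card B)) = n" using sumP[of "\<lambda>_. 1"] by (simp add: n_def)
  define irr where "irr A B \<longleftrightarrow> lower_irregular \<epsilon> g A B \<or> lower_irregular \<epsilon> g B A" for A B
  define bad where "bad A = (\<Sum>B\<in>P. real (card B) * of_bool (irr A B))" for A
  have bad_tot: "(\<Sum>A\<in>P. card A * bad A) \<le> 2 * \<epsilon> * n\<^sup>2"
  proof -
   have "(\<Sum>A\<in>P. card A * bad A) \<le> (\<Sum>A\<in>P. \<Sum>B\<in>P. real (card A) * real (card B) * of_bool (lower_irregular \<epsilon> g A B)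
     + real (card B) * real (card A) * of_bool (lower_irregular \<epsilon> g B A))"
    unfolding bad_def sum_distrib_left irr_def by (intro sum_mono) (auto simp: of_bool_def)
   also have "... = irregular_weight \<epsilon> g P + irregular_weight \<epsilon> g P"
    unfolding irregular_weight_alt[OF finP] sum.distrib
    by (subst (4) sum.swap) simp
   finally show ?thesis using P(3) by simp
  qed
  define \<A> where "\<A> = {A\<in>P. c * n \<le> card A \<and> bad A \<le> \<sigma> * n}"
  have AP: "\<A> \<subseteq> P" by (auto simp: \<A>_def)
  have dropped: "(\<Sum>B\<in>P - \<A>. real (card B)) \<le> \<tau> / 2 * n"
  proof -
   \<comment> \<open>At most N parts are too small, losing \<epsilon>n in total; by Markov's
     inequality with threshold \<sigma>n, the parts with many irregular partners weigh at most
     2\<epsilon>n/\<sigma>.\<close>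
   have "(\<Sum>B\<in>P - \<A>. real (card B)) \<le> (\<Sum>B\<in>P - \<A>. c * n + real (card B) * bad B / (\<sigma> * n))"
   proof (rule sum_mono)
    fix B assume "B \<in> P - \<A>"
    hence "card B < c * n \<or> \<sigma> * n < bad B" by (auto simp: \<A>_def)
    moreover have b0: "0 \<le> bad B" by (simp add: bad_def sum_nonneg)
    hence "0 \<le> real (card B) * bad B / (\<sigma> * n)" using s0 n0 by simp
    moreover have "real (card B) \<le> real (card B) * bad B / (\<sigma> * n)" if "\<sigma> * n < bad B"
    proof -
     have "real (card B) * (\<sigma> * n) \<le> real (card B) * bad B" using that by (intro mult_left_mono) auto
     thus ?thesis using s0 n0 by (simp add: pos_le_divide_eq)
    qed
    moreover have "0 \<le> c * n" using c0 n0 by simp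
    ultimately show "real (card B) \<le> c * n + real (card B) * bad B / (\<sigma> * n)" by auto
   qed
   also have "... \<le> (\<Sum>B\<in>P. c * n + real (card B) * bad B / (\<sigma> * n))"
    using c0 n0 s0 finP by (intro sum_mono2) (auto simp: bad_def intro!: add_nonneg_nonneg divide_nonneg_pos mult_nonneg_nonneg sum_nonneg)
   also have "... = card P * (c * n) + (\<Sum>A\<in>P. card A * bad A) / (\<sigma> * n)"
    by (simp add: sum.distrib sum_divide_distrib)
   also have "... \<le> real N * (c * n) + 2 * \<epsilon> * n\<^sup>2 / (\<sigma> * n)"
    using P(2) c0 n0 s0 bad_tot by (intro add_mono mult_right_mono divide_right_mono) auto
   also have "... \<le> \<epsilon> * n + 2 * \<epsilon> / \<sigma> * n"
   proof -
    have "real N * c \<le> \<epsilon>" using e0 by (simp add: c_def field_simps)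
    hence "real N * (c * n) \<le> \<epsilon> * n" using n0 by (simp add: mult.assoc[symmetric])
    moreover have "2 * \<epsilon> * n\<^sup>2 / (\<sigma> * n) = 2 * \<epsilon> / \<sigma> * n" using n0 by (simp add: power2_eq_square)
    ultimately show ?thesis by simp
   qed
   also have "... \<le> \<tau> / 8 * n + \<tau> / 8 * n"
   proof -
    have "2 * \<epsilon> / \<sigma> \<le> \<tau> / 8" using e0(5) s0 by (simp add: divide_le_eq algebra_simps)
    thus ?thesis using e0(4) n0 by (intro add_mono mult_right_mono) auto
   qed
   also have "... \<le> \<tau> / 2 * n" using assms n0 by simp
   finally show ?thesis .
  qed
  have split: "(\<Sum>B\<in>P. real (card B)) = (\<Sum>B\<in>\<A>. real (card B)) + (\<Sum>B\<in>P - \<A>. real (card B))"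
   using sum.subset_diff[OF AP finP, of "\<lambda>B. real (card B)"] by simp
  have big: "(1 - \<tau>) * n \<le> (\<Sum>A\<in>\<A>. real (card A))"
  proof -
   have "0 \<le> \<tau> * n" using assms n0 by simp
   thus ?thesis using split dropped totP by (simp add: algebra_simps)
  qed
  have degA: "(\<alpha> - 2 * d - \<tau>) * n \<le>
      (\<Sum>B\<in>{B\<in>\<A>. typical_pair g d \<delta> A B \<and> typical_pair g d \<delta> B A}. real (card B))" if A: "A \<in> \<A>" for A
  proof -
   let ?R = "\<lambda>B. B \<in> \<A> \<and> typical_pair g d \<delta> A B \<and> typical_pair g d \<delta> B A"
   have AP': "A \<in> P" using A AP by auto
   have fA: "finite A" using finA AP' .
   have cA: "0 < real (card A)"
   proof -
    have "0 < c * n" using c0 n0 by simp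
    thus ?thesis using A by (auto simp: \<A>_def)
   qed
   \<comment> \<open>Edges from \<open>A\<close> to \<open>B\<close> are charged to one of four
     causes: \<open>B\<close> is adjacent to \<open>A\<close>, the density is below 2d, the pair is
     irregular, or \<open>B\<close> was dropped. Over all \<open>B\<close> the last three cost at
     most (2d + \<tau>)n per vertex of \<open>A\<close>.\<close>
   have pt: "edge_count g A B \<le> card A * (real (card B) * of_bool (?R B) + 2 * d * card B
     + real (card B) * of_bool (irr A B) + real (card B) * of_bool (B \<notin> \<A>))" if B: "B \<in> P" for B
   proof -
    have fB: "finite B" using finA B .
    have triv: "edge_count g A B \<le> card A * real (card B)" using edge_count_le[of g A B] by simp
    have nn: "0 \<le> 2 * d * card B" using assms by simp
    show ?thesis
    proof (cases "?R B \<or> irr A B \<or> B \<notin> \<A>")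
     case True
     hence "real (card B) \<le> real (card B) * of_bool (?R B) + 2 * d * card B
     + real (card B) * of_bool (irr A B) + real (card B) * of_bool (B \<notin> \<A>)" using nn by auto
     hence "card A * real (card B) \<le> card A * (real (card B) * of_bool (?R B) + 2 * d * card B
     + real (card B) * of_bool (irr A B) + real (card B) * of_bool (B \<notin> \<A>))" using cA by (intro mult_left_mono) auto
     thus ?thesis using triv by linarith
    next
     case False
     have com: "edge_count g A B = edge_count g B A"
     proof (rule edge_count_commute)
      fix x y assume "x \<in> A" "y \<in> B"
      thus "g x y = g y x" using sym PV[OF AP'] PV[OF B] by blast
     qed
     hence dcom: "edge_density g A B = edge_density g B A" by (simp add: edge_density_def mult.commute)
     have "edge_density g A B < 2 * d"
     proof (rule ccontr)
      assume "\<not> ?thesis"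
      hence "2 * d \<le> edge_density g A B" "2 * d \<le> edge_density g B A" using dcom by auto
      hence "typical_pair g d \<delta> A B" "typical_pair g d \<delta> B A"
       using typical_pair_of_regular[OF fA fB, of \<epsilon> g d \<delta>] typical_pair_of_regular[OF fB fA, of \<epsilon> g d \<delta>] False e0 assms
       by (auto simp: irr_def)
      thus False using False by blast
     qed
     hence "edge_count g A B \<le> 2 * d * (real (card A) * real (card B))"
     proof (cases "real (card A) * real (card B) = 0")
      case True
      show ?thesis unfolding True using triv[unfolded True] by simp
     next
      case F: False
      hence "0 < real (card A) * real (card B)" using cA by (metis mult_nonneg_nonneg of_nat_0_le_iff order_le_less)
      thus ?thesis using \<open>edge_density g A B < 2 * d\<close> unfolding edge_density_def by (simp add: pos_divide_less_eq mult.commute)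
     qed
     moreover have "\<not> ?R B" "\<not> irr A B" "B \<in> \<A>" using False by auto
     hence "of_bool (?R B) = (0::real)" "of_bool (irr A B) = (0::real)" "of_bool (B \<notin> \<A>) = (0::real)" by auto
     ultimately show ?thesis by (simp only: mult_zero_right add_0_left add_0_right) (simp add: algebra_simps)
    qed
   qed
   have "card A * (\<alpha> * n) \<le> edge_count g A V"
   proof -
    have "card A * (\<alpha> * n) = (\<Sum>a\<in>A. \<alpha> * n)" by simp
    also have "... \<le> (\<Sum>a\<in>A. real (card {u\<in>V. g a u}))" using deg PV[OF AP'] unfolding n_def by (intro sum_mono) blast
    also have "... = edge_count g A V" using edge_count_card[OF V(1)] by simp
    finally show ?thesis .
   qed
   also have "edge_count g A V = (\<Sum>B\<in>P. edge_count g A B)"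
    unfolding edge_count_def sumP by (rule sum.swap)
   also have "... \<le> (\<Sum>B\<in>P. card A * (real (card B) * of_bool (?R B) + 2 * d * card B
     + real (card B) * of_bool (irr A B) + real (card B) * of_bool (B \<notin> \<A>)))" by (intro sum_mono pt)
   also have "... = card A * ((\<Sum>B\<in>P. real (card B) * of_bool (?R B)) + 2 * d * n + bad A + (\<Sum>B\<in>P. real (card B) * of_bool (B \<notin> \<A>)))"
    unfolding sum_distrib_left[symmetric] by (simp add: sum.distrib bad_def sum_distrib_left[symmetric] totP)
   finally have "\<alpha> * n \<le> (\<Sum>B\<in>P. real (card B) * of_bool (?R B)) + 2 * d * n + bad A + (\<Sum>B\<in>P. real (card B) * of_bool (B \<notin> \<A>))"
    using cA by simp
   moreover have "(\<Sum>B\<in>P. real (card B) * of_bool (?R B)) = (\<Sum>B\<in>{B\<in>\<A>. typical_pair g d \<delta> A B \<and> typical_pair g d \<delta> B A}. real (card B))"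
   proof -
    have "{B\<in>P. ?R B} = {B\<in>\<A>. typical_pair g d \<delta> A B \<and> typical_pair g d \<delta> B A}" using AP by auto
    thus ?thesis using sum.inter_filter[OF finP, of "\<lambda>B. real (card B)" ?R]
     by (simp add: of_bool_def if_distrib cong: if_cong)
   qed
   moreover have "(\<Sum>B\<in>P. real (card B) * of_bool (B \<notin> \<A>)) = (\<Sum>B\<in>P - \<A>. real (card B))"
   proof -
    have "{B\<in>P. B \<notin> \<A>} = P - \<A>" by auto
    thus ?thesis using sum.inter_filter[OF finP, of "\<lambda>B. real (card B)" "\<lambda>B. B \<notin> \<A>"]
     by (simp add: of_bool_def if_distrib cong: if_cong)
   qed
   moreover have "bad A \<le> \<sigma> * n" using A by (simp add: \<A>_def)
   moreover have "\<sigma> * n \<le> \<tau> / 2 * n" using n0 assms by (simp add: \<sigma>_def)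
   ultimately show ?thesis using dropped by (simp add: algebra_simps)
  qed
  show ?thesis
  proof (intro exI[of _ \<A>] conjI ballI)
   show "finite \<A>" using AP finP by (rule finite_subset)
   show "disjoint \<A>" using disP AP unfolding disjoint_def by blast
   show "\<Union>\<A> \<subseteq> V" using AP UP by blast
   show "c * card V \<le> card A" if "A \<in> \<A>" for A using that by (simp add: \<A>_def n_def)
   show "(1 - \<tau>) * card V \<le> (\<Sum>A\<in>\<A>. real (card A))" using big by (simp add: n_def)
   show "(\<alpha> - 2 * d - \<tau>) * card V \<le>
      (\<Sum>B\<in>{B\<in>\<A>. typical_pair g d \<delta> A B \<and> typical_pair g d \<delta> B A}. real (card B))" if "A \<in> \<A>" for A
    using degA[OF that] by (simp add: n_def)
  qed
 qed
 show ?thesis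
 proof (intro exI[of _ c] conjI c0 allI impI)
  fix V :: "'b set" and g and \<alpha> :: real
  assume "finite V \<and> V \<noteq> {} \<and> (\<forall>u\<in>V. \<forall>v\<in>V. g u v = g v u) \<and> (\<forall>v\<in>V. \<alpha> * card V \<le> card {u\<in>V. g v u})"
  thus "\<exists>\<A>. finite \<A> \<and> disjoint \<A> \<and> \<Union>\<A> \<subseteq> V \<and> (\<forall>A\<in>\<A>. c * card V \<le> card A) \<and>
    (1 - \<tau>) * card V \<le> (\<Sum>A\<in>\<A>. real (card A)) \<and>
    (\<forall>A\<in>\<A>. (\<alpha> - 2 * d - \<tau>) * card V \<le>
      (\<Sum>B\<in>{B\<in>\<A>. typical_pair g d \<delta> A B \<and> typical_pair g d \<delta> B A}. real (card B)))"
   by (intro main) auto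
 qed
qed

section \<open>Cliques in weighted graphs\<close>

text \<open>The cluster graph. \<open>R\<close> may hold between a cluster and itself, so cliques,
  which are lists, may repeat a cluster; two colour classes of H may share a cluster that is typical
  with itself.\<close>

locale weighted_graph =
 fixes \<A> :: "'a set" and R :: "'a => 'a => bool" and w :: "'a => real" and \<nu> :: real
 assumes finA: "finite \<A>" and w_nonneg: "\<And>A. A \<in> \<A> ==> 0 \<le> w A"
  and R_sym: "\<And>A B. R A B ==> R B A"
  and deficiency: "\<And>A. A \<in> \<A> ==> sum w {B\<in>\<A>. \<not> R A B} \<le> \<nu>"
  and nu_nonneg: "0 \<le> \<nu>"
begin

definition clique :: "'a list => bool" where
 "clique t \<longleftrightarrow> set t \<subseteq> \<A> \<and> sorted_wrt R t"

text \<open>The condition under which H can pass from clique \<open>t\<close> to clique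
  \<open>t'\<close> at a block boundary. Equal positions are exempt because vertices of the same
  colour are never adjacent.\<close>

definition compat :: "'a list => 'a list => bool" where
 "compat t t' \<longleftrightarrow> length t = length t' \<and> (\<forall>i<length t. \<forall>j<length t. i \<noteq> j --> R (t ! i) (t' ! j))"

lemma clique_Cons: "clique (a # t) \<longleftrightarrow> a \<in> \<A> \<and> (\<forall>b\<in>set t. R a b) \<and> clique t"
 by (auto simp: clique_def)

lemma clique_Nil: "clique []" by (simp add: clique_def)

lemma clique_nth: "clique t ==> i < length t ==> j < length t ==> i \<noteq> j ==> R (t ! i) (t ! j)"
 unfolding clique_def using R_sym sorted_wrt_nth_less[of R t] by (metis nat_neq_iff)

lemma cliqueI:
 assumes "\<And>i. i < length t ==> t ! i \<in> \<A>"
  "\<And>i j. i < length t ==> j < length t ==> i \<noteq> j ==> R (t ! i) (t ! j)"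
 shows "clique t"
 unfolding clique_def using assms by (auto simp: set_conv_nth sorted_wrt_iff_nth_less)

lemma compat_refl: "clique t ==> compat t t"
 by (auto simp: compat_def clique_nth)

lemma nbhd_weight:
 assumes "S \<subseteq> \<A>" "A \<in> \<A>"
 shows "sum w S - \<nu> \<le> sum w {B\<in>S. R A B}"
proof -
 have finS: "finite S" using assms(1) finA by (rule finite_subset)
 have "sum w S = sum w {B\<in>S. R A B} + sum w {B\<in>S. \<not> R A B}"
  by (subst sum.union_disjoint[symmetric]) (auto simp: finS intro: arg_cong[where f="sum w"])
 moreover have "sum w {B\<in>S. \<not> R A B} \<le> sum w {B\<in>\<A>. \<not> R A B}"
  using assms finA w_nonneg by (intro sum_mono2) auto
 ultimately show ?thesis using deficiency[OF assms(2)] by linarith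
qed

lemma clique_exists:
 assumes "S \<subseteq> \<A>" "(real k - 1) * \<nu> < sum w S"
 shows "\<exists>t. length t = k \<and> set t \<subseteq> S \<and> clique t"
 using assms
proof (induction k arbitrary: S)
 case 0 thus ?case by (intro exI[of _ "[]"]) (simp add: clique_Nil)
next
 case (Suc k)
 have "0 \<le> (real (Suc k) - 1) * \<nu>" using nu_nonneg by simp
 hence "0 < sum w S" using Suc.prems(2) by linarith
 then obtain A where A: "A \<in> S" by (metis ex_in_conv order_less_irrefl sum.empty)
 hence AA: "A \<in> \<A>" using Suc.prems(1) by auto
 have "(real k - 1) * \<nu> < sum w {B\<in>S. R A B}"
  using nbhd_weight[OF Suc.prems(1) AA] Suc.prems(2) by (simp add: algebra_simps)
 then obtain t where "length t = k" "set t \<subseteq> {B\<in>S. R A B}" "clique t"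
  using Suc.IH[of "{B\<in>S. R A B}"] Suc.prems(1) by blast
 thus ?case using A AA by (intro exI[of _ "A # t"]) (auto simp: clique_Cons)
qed

definition cliques_in :: "'a set => nat => 'a list set" where
 "cliques_in S k = {t. length t = k \<and> set t \<subseteq> S \<and> clique t}"

lemma finite_cliques_in: "S \<subseteq> \<A> ==> finite (cliques_in S k)"
 unfolding cliques_in_def using finA
 by (auto intro!: finite_subset[OF _ finite_lists_length_eq[of S k]] dest: finite_subset)

lemma cliques_in_Suc:
 assumes "S \<subseteq> \<A>"
 shows "cliques_in S (Suc k) = (\<lambda>(A, t). A # t) ` Sigma S (\<lambda>A. cliques_in {B\<in>S. R A B} k)"
proof (intro set_eqI iffI)
 fix t assume "t \<in> cliques_in S (Suc k)"
 hence t: "length t = Suc k" "set t \<subseteq> S" "clique t" by (auto simp: cliques_in_def)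
 then obtain A t' where "t = A # t'" by (cases t) auto
 thus "t \<in> (\<lambda>(A, t). A # t) ` Sigma S (\<lambda>A. cliques_in {B\<in>S. R A B} k)"
  using t by (auto simp: cliques_in_def clique_Cons image_iff)
next
 fix t assume "t \<in> (\<lambda>(A, t). A # t) ` Sigma S (\<lambda>A. cliques_in {B\<in>S. R A B} k)"
 thus "t \<in> cliques_in S (Suc k)" using assms by (auto simp: cliques_in_def clique_Cons)
qed

lemma prod_list_w_nonneg: "set t \<subseteq> \<A> ==> 0 \<le> prod_list (map w t)"
 using w_nonneg by (induction t) auto

text \<open>When the entries are chosen one by one, each earlier choice excludes weight at most
  \<nu>, so clusters of weight at least \<open>h\<close> remain for every entry.\<close>

lemma clique_weight:
 assumes "S \<subseteq> \<A>" "(real k - 1) * \<nu> + h \<le> sum w S" "0 \<le> h"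
 shows "h ^ k \<le> (\<Sum>t\<in>cliques_in S k. prod_list (map w t))"
 using assms(1,2)
proof (induction k arbitrary: S)
 case 0
 have "cliques_in S 0 = {[]}" by (auto simp: cliques_in_def clique_Nil)
 thus ?case by simp
next
 case (Suc k)
 have finS: "finite S" using Suc.prems(1) finA by (rule finite_subset)
 have "0 \<le> real k * \<nu>" using nu_nonneg by simp
 hence hS: "h \<le> sum w S" using Suc.prems(2) by simp
 have IH: "h ^ k \<le> (\<Sum>t\<in>cliques_in {B\<in>S. R A B} k. prod_list (map w t))" if A: "A \<in> S" for A
 proof (rule Suc.IH)
  show "{B\<in>S. R A B} \<subseteq> \<A>" using Suc.prems(1) by auto
  have "A \<in> \<A>" using A Suc.prems(1) by auto
  thus "(real k - 1) * \<nu> + h \<le> sum w {B\<in>S. R A B}"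
   using nbhd_weight[OF Suc.prems(1)] Suc.prems(2) by (fastforce simp: algebra_simps)
 qed
 have "h ^ Suc k \<le> sum w S * h ^ k" using hS assms(3) by (simp add: mult_right_mono)
 also have "... = (\<Sum>A\<in>S. w A * h ^ k)" by (simp add: sum_distrib_right)
 also have "... \<le> (\<Sum>A\<in>S. w A * (\<Sum>t\<in>cliques_in {B\<in>S. R A B} k. prod_list (map w t)))"
  using Suc.prems(1) w_nonneg by (intro sum_mono mult_left_mono IH) auto
 also have "... = (\<Sum>A\<in>S. \<Sum>t\<in>cliques_in {B\<in>S. R A B} k. prod_list (map w (A # t)))"
  by (simp add: sum_distrib_left)
 also have "... = (\<Sum>(A,t)\<in>Sigma S (\<lambda>A. cliques_in {B\<in>S. R A B} k). prod_list (map w (A # t)))"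
 proof (rule sum.Sigma)
  show "\<forall>A\<in>S. finite (cliques_in {B\<in>S. R A B} k)" using Suc.prems(1) by (intro ballI finite_cliques_in) auto
 qed (rule finS)
 also have "... = (\<Sum>t\<in>cliques_in S (Suc k). prod_list (map w t))"
  unfolding cliques_in_Suc[OF Suc.prems(1)]
  by (subst sum.reindex) (auto simp: inj_on_def case_prod_beta)
 finally show ?case .
qed

section \<open>Walks between ordered cliques\<close>

definition walk_step :: "'a set => nat => 'a list => 'a list => bool" where
 "walk_step Q r t t' \<longleftrightarrow> t \<in> cliques_in Q r \<and> t' \<in> cliques_in Q r \<and> compat t t'"

lemma relpowp_map:
 assumes "\<And>x y. P x y ==> P' (f x) (f y)"
 shows "(P ^^ k) x y ==> (P' ^^ k) (f x) (f y)"
proof (induction k arbitrary: y)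
 case (Suc k)
 then obtain z where "(P ^^ k) x z" "P z y" by (auto elim: relpowp_Suc_E)
 thus ?case using Suc.IH assms by (auto intro: relpowp_Suc_I)
qed simp

lemma compat_Cons:
 assumes "compat t t'" "\<And>c. c \<in> set t' ==> R a c" "\<And>c. c \<in> set t ==> R b c"
 shows "compat (a # t) (b # t')"
 unfolding compat_def
proof (intro conjI allI impI)
 show "length (a # t) = length (b # t')" using assms by (simp add: compat_def)
 fix i j assume "i < length (a # t)" "j < length (a # t)" "i \<noteq> j"
 thus "R ((a # t) ! i) ((b # t') ! j)"
  using assms R_sym by (cases i; cases j) (auto simp: compat_def)
qed

lemma walk_step_Cons:
 assumes "walk_step {B\<in>Q. R a B} m t t'" "a \<in> Q" "Q \<subseteq> \<A>"
 shows "walk_step Q (Suc m) (a # t) (a # t')"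
proof -
 have "t \<in> cliques_in {B\<in>Q. R a B} m" "t' \<in> cliques_in {B\<in>Q. R a B} m" "compat t t'"
  using assms by (auto simp: walk_step_def)
 moreover have "compat (a # t) (a # t')"
  using calculation by (intro compat_Cons) (auto simp: cliques_in_def)
 ultimately show ?thesis using assms(2,3)
  by (auto simp: walk_step_def cliques_in_def clique_Cons)
qed

text \<open>Two cliques with heads \<open>a\<close> and \<open>b\<close> are joined through a clique in the common
 neighbourhood of \<open>a\<close> and \<open>b\<close>.\<close>

lemma clique_walk:
 assumes "Q \<subseteq> \<A>" "real r * \<nu> < sum w Q" "t \<in> cliques_in Q r" "t' \<in> cliques_in Q r"
 shows "(walk_step Q r ^^ (2 ^ r - 1)) t t'"
 using assms
proof (induction r arbitrary: Q t t')
 case 0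
 hence "t = []" "t' = []" by (auto simp: cliques_in_def)
 thus ?case by simp
next
 case (Suc m)
 obtain a T where t: "t = a # T" using Suc.prems(3) by (cases t) (auto simp: cliques_in_def)
 obtain b T' where t': "t' = b # T'" using Suc.prems(4) by (cases t') (auto simp: cliques_in_def)
 have ab: "a \<in> Q" "b \<in> Q" "a \<in> \<A>" "b \<in> \<A>" using Suc.prems t t' by (auto simp: cliques_in_def)
 let ?Qa = "{B\<in>Q. R a B}" and ?Qb = "{B\<in>Q. R b B}"
 have TT: "T \<in> cliques_in ?Qa m" "T' \<in> cliques_in ?Qb m"
  using Suc.prems t t' by (auto simp: cliques_in_def clique_Cons)
 have wa: "real m * \<nu> < sum w ?Qa"
  using nbhd_weight[OF Suc.prems(1) ab(3)] Suc.prems(2) by (simp add: algebra_simps)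
 have wb: "real m * \<nu> < sum w ?Qb"
  using nbhd_weight[OF Suc.prems(1) ab(4)] Suc.prems(2) by (simp add: algebra_simps)
 have sub: "?Qa \<subseteq> \<A>" "?Qb \<subseteq> \<A>" using Suc.prems(1) by auto
 \<comment> \<open>The common neighbourhood of the heads has lost 2\<nu>, which still suffices for a
   clique of size m that can follow either head.\<close>
 have "(real m - 1) * \<nu> < sum w {B\<in>?Qa. R b B}"
  using nbhd_weight[OF sub(1) ab(4)] wa by (simp add: algebra_simps)
 then obtain U where U: "length U = m" "set U \<subseteq> {B\<in>?Qa. R b B}" "clique U"
  using clique_exists[of "{B\<in>?Qa. R b B}" m] sub by blast
 have Ua: "U \<in> cliques_in ?Qa m" "U \<in> cliques_in ?Qb m" using U by (auto simp: cliques_in_def)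
 have 1: "(walk_step Q (Suc m) ^^ (2 ^ m - 1)) (a # T) (a # U)"
  using relpowp_map[of "walk_step ?Qa m" "walk_step Q (Suc m)" "(#) a"]
   walk_step_Cons[OF _ ab(1) Suc.prems(1)] Suc.IH[OF sub(1) wa TT(1) Ua(1)] by blast
 have 3: "(walk_step Q (Suc m) ^^ (2 ^ m - 1)) (b # U) (b # T')"
  using relpowp_map[of "walk_step ?Qb m" "walk_step Q (Suc m)" "(#) b"]
   walk_step_Cons[OF _ ab(2) Suc.prems(1)] Suc.IH[OF sub(2) wb Ua(2) TT(2)] by blast
 have 2: "walk_step Q (Suc m) (a # U) (b # U)"
  unfolding walk_step_def using U ab compat_refl[OF U(3)]
  by (auto simp: cliques_in_def clique_Cons intro!: compat_Cons)
 have "(walk_step Q (Suc m) ^^ (Suc (2 ^ m - 1))) t (b # U)"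
  unfolding t using 1 2 by (rule relpowp_Suc_I)
 hence "(walk_step Q (Suc m) ^^ (Suc (2 ^ m - 1) + (2 ^ m - 1))) t t'"
  unfolding relpowp_add using 3 t' by blast
 \<comment> \<open>Two recursive walks and one exchange of heads: 2(2^m - 1) + 1 = 2^(m+1) -
   1.\<close>
 moreover have "Suc (2 ^ m - 1) + (2 ^ m - 1) = 2 ^ Suc m - (1::nat)"
 proof -
  have "(1::nat) \<le> 2 ^ m" by simp
  thus ?thesis by (simp only: power_Suc)
 qed
 ultimately show ?case by simp
qed

text \<open>Greedily choosing the lightest cluster in the common neighbourhood of the earlier
 choices gives a clique whose weight is at most the average, also when larger
 coefficients \<open>b\<close> are given to lighter clusters.\<close>

lemma light_clique_sorted:
 assumes "S \<subseteq> \<A>" "real (length b) * \<mu> \<le> sum w S" "\<nu> \<le> \<mu>" "0 < \<mu>"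
  "sorted_wrt (\<ge>) b" "\<And>z. z \<in> set b ==> 0 \<le> z" "\<And>A. A \<in> S ==> y \<le> x A"
 shows "\<exists>t. t \<in> cliques_in S (length b) \<and>
   real (length b) * \<mu> * (\<Sum>i<length b. b ! i * (x (t ! i) - y)) \<le> sum_list b * (\<Sum>A\<in>S. w A * (x A - y))"
 using assms
proof (induction b arbitrary: S y)
 case Nil
 thus ?case by (intro exI[of _ "[]"]) (simp add: cliques_in_def clique_Nil)
next
 case (Cons b0 b)
 define k where "k = real (length b)"
 have k0: "0 \<le> k" by (simp add: k_def)
 have finS: "finite S" using Cons.prems(1) finA by (rule finite_subset)
 have wS: "(k + 1) * \<mu> \<le> sum w S" using Cons.prems(2) by (simp add: k_def algebra_simps)
 have "0 < (k + 1) * \<mu>" using k0 Cons.prems(4) by simp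
 hence "S \<noteq> {}" using wS by auto
 \<comment> \<open>The minimal value x A becomes the new baseline \<open>y\<close> for the recursion
   into the neighbourhood of \<open>A\<close>.\<close>
 then obtain A where A: "A \<in> S" "\<And>B. B \<in> S ==> x A \<le> x B"
  using ex_is_arg_min_if_finite[OF finS, of x] by (metis is_arg_min_linorder)
 have AA: "A \<in> \<A>" using A Cons.prems(1) by auto
 let ?S' = "{B\<in>S. R A B}"
 have wS': "k * \<mu> \<le> sum w ?S'"
  using nbhd_weight[OF Cons.prems(1) AA] wS Cons.prems(3) by (simp add: algebra_simps)
 obtain t where t: "t \<in> cliques_in ?S' (length b)"
  "k * \<mu> * (\<Sum>i<length b. b ! i * (x (t ! i) - x A)) \<le> sum_list b * (\<Sum>B\<in>?S'. w B * (x B - x A))"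
  using Cons.IH[of ?S' "x A"] Cons.prems A wS' unfolding k_def by fastforce
 define P where "P = (\<Sum>i<length b. b ! i * (x (t ! i) - x A))"
 define W' where "W' = (\<Sum>B\<in>S. w B * (x B - x A))"
 define s where "s = sum_list b"
 have s0: "0 \<le> s" unfolding s_def using Cons.prems(6) by (intro sum_list_nonneg) auto
 have W'0: "0 \<le> W'" unfolding W'_def using A w_nonneg Cons.prems(1) by (intro sum_nonneg mult_nonneg_nonneg) auto
 have subW: "(\<Sum>B\<in>?S'. w B * (x B - x A)) \<le> W'"
  unfolding W'_def using finS A w_nonneg Cons.prems(1) by (intro sum_mono2) auto
 have sk: "s \<le> k * b0"
 proof -
  have "sum_list b \<le> (\<Sum>z\<leftarrow>b. b0)" using Cons.prems(5) by (intro sum_list_mono2) (auto simp: list_all2_conv_all_nth)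
  thus ?thesis by (simp add: s_def k_def sum_list_triv)
 qed
 have kP: "k * \<mu> * P \<le> s * W'"
  using t(2) mult_left_mono[OF subW s0] by (simp add: P_def s_def)
 \<comment> \<open>The recursion yields P \<le> (s/k) W'/\<mu>. As coefficients decrease, s \<le> k
   b0, that is, s/k \<le> (b0+s)/(k+1).\<close>
 have main: "(k + 1) * \<mu> * P \<le> (b0 + s) * W'"
 proof (cases "length b = 0")
  case True
  hence "P = 0" by (simp add: P_def)
  moreover have "0 \<le> b0" using Cons.prems(6) by simp
  ultimately show ?thesis using s0 W'0 by simp
 next
  case False
  hence kp: "0 < k" by (simp add: k_def)
  have "k * ((k + 1) * \<mu> * P) = (k + 1) * (k * \<mu> * P)" by (simp add: algebra_simps)
  also have "... \<le> (k + 1) * (s * W')" using kP k0 by (intro mult_left_mono) auto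
  also have "... = (k * s + s) * W'" by (simp add: algebra_simps)
  also have "... \<le> (k * s + k * b0) * W'" using sk W'0 by (intro mult_right_mono) auto
  also have "... = k * ((b0 + s) * W')" by (simp add: algebra_simps)
  finally show ?thesis using kp by simp
 qed
 have yA: "0 \<le> x A - y" using Cons.prems(7)[OF A(1)] by simp
 have b0: "0 \<le> b0" using Cons.prems(6) by simp
 have sumb: "(\<Sum>i<length b. b ! i) = s"
  unfolding s_def by (metis atLeast0LessThan sum_list_sum_nth)
 have "(\<Sum>i<length (b0 # b). (b0 # b) ! i * (x ((A # t) ! i) - y))
   = b0 * (x A - y) + (\<Sum>i<length b. b ! i * (x (t ! i) - y))"
  by (simp add: sum.lessThan_Suc_shift del: sum.lessThan_Suc)
 also have "(\<Sum>i<length b. b ! i * (x (t ! i) - y)) = P + s * (x A - y)"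
  unfolding P_def sumb[symmetric] sum_distrib_right sum.distrib[symmetric] by (intro sum.cong) (auto simp: algebra_simps)
 finally have lhs: "(\<Sum>i<length (b0 # b). (b0 # b) ! i * (x ((A # t) ! i) - y)) = (b0 + s) * (x A - y) + P"
  by (simp add: algebra_simps)
 have rhs: "(\<Sum>B\<in>S. w B * (x B - y)) = W' + sum w S * (x A - y)"
  unfolding W'_def sum_distrib_right sum.distrib[symmetric] by (intro sum.cong) (auto simp: algebra_simps)
 have "(k + 1) * \<mu> * ((b0 + s) * (x A - y)) \<le> (b0 + s) * (sum w S * (x A - y))"
 proof -
  have "(k + 1) * \<mu> * ((b0 + s) * (x A - y)) \<le> sum w S * ((b0 + s) * (x A - y))"
   using wS yA b0 s0 by (intro mult_right_mono) auto
  thus ?thesis by (simp add: algebra_simps)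
 qed
 hence "(k + 1) * \<mu> * ((b0 + s) * (x A - y) + P) \<le> (b0 + s) * (W' + sum w S * (x A - y))"
  using main by (simp add: distrib_left)
 hence "real (length (b0 # b)) * \<mu> * (\<Sum>i<length (b0 # b). (b0 # b) ! i * (x ((A # t) ! i) - y))
   \<le> sum_list (b0 # b) * (\<Sum>B\<in>S. w B * (x B - y))"
  unfolding lhs rhs by (simp add: k_def s_def add.commute)
 moreover have "A # t \<in> cliques_in S (length (b0 # b))"
  using t(1) A AA by (auto simp: cliques_in_def clique_Cons)
 ultimately show ?case by blast
qed

text \<open>Coefficients are sorted decreasingly, the sorted case is applied with \<mu> = sum w \<A>
  / r, and the entries of the clique are permuted back.\<close>

lemma light_clique:
 fixes a :: "nat => real"
 assumes "0 < sum w \<A>" "real r * \<nu> \<le> sum w \<A>" "0 < r" "\<And>c. c < r ==> 0 \<le> a c" "\<And>A. A \<in> \<A> ==> 0 \<le> x A"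
 shows "\<exists>t\<in>cliques_in \<A> r. sum w \<A> * (\<Sum>c<r. a c * x (t ! c)) \<le> (\<Sum>c<r. a c) * (\<Sum>A\<in>\<A>. w A * x A)"
proof -
 define cs where "cs = rev (sort_key a [0..<r])"
 have cs: "length cs = r" "distinct cs" "set cs = {..<r}" by (auto simp: cs_def)
 define b where "b = map a cs"
 have lb: "length b = r" by (simp add: b_def cs)
 have "sorted (map a (sort_key a [0..<r]))" by simp
 hence sb: "sorted_wrt (\<ge>) b" by (simp add: b_def cs_def rev_map[symmetric] sorted_wrt_rev)
 have "\<exists>t. t \<in> cliques_in \<A> (length b) \<and>
   real (length b) * (sum w \<A> / r) * (\<Sum>i<length b. b ! i * (x (t ! i) - 0)) \<le> sum_list b * (\<Sum>A\<in>\<A>. w A * (x A - 0))"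
 proof (rule light_clique_sorted)
  show "real (length b) * (sum w \<A> / r) \<le> sum w \<A>" using assms by (simp add: lb)
  show "\<nu> \<le> sum w \<A> / r" using assms by (simp add: field_simps)
  show "\<And>z. z \<in> set b ==> 0 \<le> z" using assms cs by (auto simp: b_def)
 qed (use assms sb in auto)
 then obtain s where s: "s \<in> cliques_in \<A> r"
  "sum w \<A> * (\<Sum>i<r. b ! i * x (s ! i)) \<le> sum_list b * (\<Sum>A\<in>\<A>. w A * x A)"
  using assms(3) by (auto simp: lb)
 have bij: "bij_betw ((!) cs) {..<r} {..<r}"
  using cs by (intro bij_betw_nth) auto
 define g where "g = inv_into {..<r} ((!) cs)"
 have gbij: "bij_betw g {..<r} {..<r}" unfolding g_def by (rule bij_betw_inv_into[OF bij])
 have g1: "g c < r" "cs ! (g c) = c" if "c < r" for c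
  using that gbij bij_betw_inv_into_right[OF bij, of c] by (auto simp: g_def bij_betw_def)
 define t where "t = map (\<lambda>c. s ! (g c)) [0..<r]"
 have tn: "t ! c = s ! (g c)" if "c < r" for c using that by (simp add: t_def)
 have ls: "length s = r" "clique s" "set s \<subseteq> \<A>" using s by (auto simp: cliques_in_def)
 have ct: "clique t"
 proof (rule cliqueI)
  fix i assume "i < length t"
  thus "t ! i \<in> \<A>" using tn[of i] g1[of i] ls by (auto simp: t_def)
 next
  fix i j assume ij: "i < length t" "j < length t" "i \<noteq> j"
  hence "g i \<noteq> g j" using g1(2)[of i] g1(2)[of j] by (metis diff_zero length_map length_upt t_def)
  thus "R (t ! i) (t ! j)" using ij tn g1 clique_nth[OF ls(2)] ls(1) by (simp add: t_def)
 qed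
 have "(\<Sum>i<r. b ! i * x (s ! i)) = (\<Sum>c<r. b ! (g c) * x (s ! (g c)))"
  by (rule sum.reindex_bij_betw[OF gbij, symmetric])
 also have "... = (\<Sum>c<r. a c * x (t ! c))" using g1 tn cs by (intro sum.cong) (auto simp: b_def)
 finally have e1: "(\<Sum>i<r. b ! i * x (s ! i)) = (\<Sum>c<r. a c * x (t ! c))" .
 have e2: "sum_list b = (\<Sum>c<r. a c)" unfolding b_def using cs by (simp add: sum_list_distinct_conv_sum_set)
 have "t \<in> cliques_in \<A> r" using ct by (auto simp: cliques_in_def clique_def t_def)
 thus ?thesis using s(2) unfolding e1 e2 by blast
qed

text \<open>Row j stands for a segment of H, \<open>a j c\<close> for its number of vertices of
  colour c, and \<open>t j\<close> for the clique that receives them.\<close>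

definition load :: "nat => (nat => nat => real) => (nat => 'a list) => nat => 'a => real" where
 "load r a t m A = (\<Sum>j<m. \<Sum>c<r. if t j ! c = A then a j c else 0)"

text \<open>The potential sums the exponentials of scaled relative loads. Each clique is chosen
  light for the current exponentials, so its demand S meets at most their average and the potential
  grows by at most exp((1+\<theta>)\<kappa>S/W). The bound on \<open>\<kappa> * L\<close> keeps
  every increment z of an exponent below \<theta> \<le> 1, where exp z \<le> 1 +
  (1+\<theta>)z.\<close>

lemma multiplicative_weights:
 assumes W: "0 < sum w \<A>" and "real r * \<nu> \<le> sum w \<A>" "0 < r" and wpos: "\<And>A. A \<in> \<A> ==> 0 < w A"
  and a0: "\<And>j c. j < m ==> c < r ==> 0 \<le> a j c" and aL: "\<And>j. j < m ==> (\<Sum>c<r. a j c) \<le> L"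
  and lam: "0 \<le> \<kappa>" and th: "\<theta> \<le> 1" "\<And>A. A \<in> \<A> ==> \<kappa> * L \<le> \<theta> * w A"
 shows "\<exists>t. (\<forall>j<m. t j \<in> cliques_in \<A> r) \<and>
   (\<Sum>A\<in>\<A>. w A * exp (\<kappa> * load r a t m A / w A)) \<le> sum w \<A> * exp ((1 + \<theta>) * \<kappa> * (\<Sum>j<m. \<Sum>c<r. a j c) / sum w \<A>)"
 using a0 aL
proof (induction m)
 case 0 thus ?case by (auto simp: load_def)
next
 case (Suc m)
 have "\<exists>t. (\<forall>j<m. t j \<in> cliques_in \<A> r) \<and>
   (\<Sum>A\<in>\<A>. w A * exp (\<kappa> * load r a t m A / w A)) \<le> sum w \<A> * exp ((1 + \<theta>) * \<kappa> * (\<Sum>j<m. \<Sum>c<r. a j c) / sum w \<A>)"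
  by (rule Suc.IH) (use Suc.prems in auto)
 then obtain t where t: "\<And>j. j < m ==> t j \<in> cliques_in \<A> r" and
  Phi: "(\<Sum>A\<in>\<A>. w A * exp (\<kappa> * load r a t m A / w A)) \<le> sum w \<A> * exp ((1 + \<theta>) * \<kappa> * (\<Sum>j<m. \<Sum>c<r. a j c) / sum w \<A>)"
  by blast
 define W where "W = sum w \<A>"
 have W0: "0 < W" using assms(1) by (simp add: W_def)
 define x where "x A = exp (\<kappa> * load r a t m A / w A)" for A
 define S where "S = (\<Sum>c<r. a m c)"
 have am: "\<And>c. c < r ==> 0 \<le> a m c" using Suc.prems by simp
 have S0: "0 \<le> S" unfolding S_def using am by (intro sum_nonneg) auto
 have SL: "S \<le> L" using Suc.prems by (simp add: S_def)
 obtain s where s: "s \<in> cliques_in \<A> r" "W * (\<Sum>c<r. a m c * x (s ! c)) \<le> S * (\<Sum>A\<in>\<A>. w A * x A)"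
  using light_clique[OF assms(1-3), of "a m" x] am by (auto simp: x_def W_def S_def)
 define t' where "t' = t(m := s)"
 have t'c: "\<forall>j<Suc m. t' j \<in> cliques_in \<A> r" using t s by (auto simp: t'_def less_Suc_eq)
 define inc where "inc A = (\<Sum>c<r. if s ! c = A then a m c else 0)" for A
 have load': "load r a t' (Suc m) A = load r a t m A + inc A" for A
  unfolding load_def inc_def t'_def by (simp cong: sum.cong_simp)
 have inc0: "0 \<le> inc A" for A unfolding inc_def using am by (intro sum_nonneg) auto
 have incS: "inc A \<le> S" for A unfolding inc_def S_def using am by (intro sum_mono) auto
 have th0: "0 \<le> \<theta>"
 proof -
  have "\<A> \<noteq> {}" using W by auto
  then obtain A where A: "A \<in> \<A>" by auto
  have "0 \<le> \<kappa> * L" using lam S0 SL by simp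
  hence "0 \<le> \<theta> * w A" using th(2)[OF A] by linarith
  thus ?thesis using wpos[OF A] by (simp add: zero_le_mult_iff)
 qed
 define Phi where "Phi = (\<Sum>A\<in>\<A>. w A * x A)"
 have Phi0: "0 \<le> Phi" unfolding Phi_def x_def using w_nonneg by (intro sum_nonneg) auto
 have "(\<Sum>A\<in>\<A>. w A * exp (\<kappa> * load r a t' (Suc m) A / w A)) \<le> (\<Sum>A\<in>\<A>. w A * x A + (1 + \<theta>) * \<kappa> * (x A * inc A))"
 proof (rule sum_mono)
  fix A assume A: "A \<in> \<A>"
  define z where "z = \<kappa> * inc A / w A"
  have wA: "0 < w A" using wpos A .
  have z0: "0 \<le> z" using lam inc0 wA by (simp add: z_def)
  have "\<kappa> * inc A \<le> \<theta> * w A"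
   using mult_left_mono[OF order_trans[OF incS SL] lam, of A] th(2)[OF A] by linarith
  hence zth: "z \<le> \<theta>" using wA by (simp add: z_def divide_le_eq)
  have "exp z \<le> 1 + z + z\<^sup>2" using z0 zth th by (intro exp_bound) auto
  also have "... \<le> 1 + z + \<theta> * z" using z0 zth by (simp add: power2_eq_square mult_right_mono)
  finally have ez: "exp z \<le> 1 + (1 + \<theta>) * z" by (simp add: algebra_simps)
  have "exp (\<kappa> * load r a t' (Suc m) A / w A) = x A * exp z"
   unfolding load' x_def z_def exp_add[symmetric] by (simp add: add_divide_distrib distrib_left)
  also have "... \<le> x A * (1 + (1 + \<theta>) * z)" using ez by (intro mult_left_mono) (auto simp: x_def)
  finally have "w A * exp (\<kappa> * load r a t' (Suc m) A / w A) \<le> w A * (x A * (1 + (1 + \<theta>) * z))"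
   using wA by (intro mult_left_mono) auto
  also have "... = w A * x A + (1 + \<theta>) * \<kappa> * (x A * inc A)"
   using wA by (simp add: z_def field_simps)
  finally show "w A * exp (\<kappa> * load r a t' (Suc m) A / w A) \<le> w A * x A + (1 + \<theta>) * \<kappa> * (x A * inc A)" .
 qed
 also have "... = Phi + (1 + \<theta>) * \<kappa> * (\<Sum>A\<in>\<A>. x A * inc A)"
  by (simp add: sum.distrib sum_distrib_left Phi_def)
 also have "(\<Sum>A\<in>\<A>. x A * inc A) = (\<Sum>c<r. a m c * x (s ! c))"
 proof -
  have "(\<Sum>A\<in>\<A>. x A * inc A) = (\<Sum>A\<in>\<A>. \<Sum>c<r. if s ! c = A then a m c * x A else 0)"
   unfolding inc_def sum_distrib_left by (intro sum.cong refl) auto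
  also have "... = (\<Sum>c<r. \<Sum>A\<in>\<A>. if s ! c = A then a m c * x A else 0)" by (rule sum.swap)
  also have "... = (\<Sum>c<r. a m c * x (s ! c))"
  proof (rule sum.cong, simp)
   fix c assume "c \<in> {..<r}"
   hence "s ! c \<in> \<A>" using s(1) by (auto simp: cliques_in_def)
   thus "(\<Sum>A\<in>\<A>. if s ! c = A then a m c * x A else 0) = a m c * x (s ! c)" using finA by (simp add: sum.delta')
  qed
  finally show ?thesis .
 qed
 also have "Phi + (1 + \<theta>) * \<kappa> * (\<Sum>c<r. a m c * x (s ! c)) \<le> Phi + (1 + \<theta>) * \<kappa> * (S * Phi / W)"
  using s(2) W0 th0 lam by (intro add_left_mono mult_left_mono) (auto simp: Phi_def pos_le_divide_eq mult.commute)
 also have "... = Phi * (1 + (1 + \<theta>) * \<kappa> * S / W)" by (simp add: algebra_simps)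
 also have "... \<le> Phi * exp ((1 + \<theta>) * \<kappa> * S / W)"
  using Phi0 by (intro mult_left_mono) auto
 also have "... \<le> W * exp ((1 + \<theta>) * \<kappa> * (\<Sum>j<m. \<Sum>c<r. a j c) / W) * exp ((1 + \<theta>) * \<kappa> * S / W)"
  using Phi by (intro mult_right_mono) (auto simp: Phi_def x_def W_def)
 also have "... = W * exp ((1 + \<theta>) * \<kappa> * (\<Sum>j<Suc m. \<Sum>c<r. a j c) / W)"
  by (simp add: mult.assoc exp_add[symmetric] S_def add_divide_distrib[symmetric] distrib_left[symmetric])
 finally show ?case using t'c unfolding W_def by blast
qed

text \<open>Each cluster receives its fair share up to a relative error 2\<eta>: one \<eta> for
  isolating a single term of the potential, one for the factor 1+\<theta> with \<theta> =
  \<eta>.\<close>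

lemma balanced_cliques:
 assumes W: "0 < sum w \<A>" and "real r * \<nu> \<le> sum w \<A>" "0 < r"
  and c0: "0 < c0" "c0 < 1" "\<And>A. A \<in> \<A> ==> c0 * sum w \<A> \<le> w A"
  and a0: "\<And>j c. j < m ==> c < r ==> 0 \<le> a j c" and aL: "\<And>j. j < m ==> (\<Sum>c<r. a j c) \<le> L"
  and eta: "0 < \<eta>" "\<eta> \<le> 1" and L: "ln (1 / c0) * L \<le> \<eta>\<^sup>2 * c0 * sum w \<A>"
  and N: "(\<Sum>j<m. \<Sum>c<r. a j c) \<le> sum w \<A>"
 shows "\<exists>t. (\<forall>j<m. t j \<in> cliques_in \<A> r) \<and>
   (\<forall>A\<in>\<A>. load r a t m A \<le> w A * ((\<Sum>j<m. \<Sum>c<r. a j c) / sum w \<A> + 2 * \<eta>))"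
proof -
 define W where "W = sum w \<A>"
 define n where "n = (\<Sum>j<m. \<Sum>c<r. a j c)"
 have W0: "0 < W" using W by (simp add: W_def)
 have wpos: "0 < w A" if "A \<in> \<A>" for A
 proof -
  have "0 < c0 * sum w \<A>" using c0(1) W by simp
  thus ?thesis using c0(3)[OF that] by linarith
 qed
 \<comment> \<open>Isolating one cluster loses a factor 1/c0; at this rate the loss is an additive
   \<eta> in the relative load.\<close>
 define \<kappa> where "\<kappa> = ln (1 / c0) / \<eta>"
 have lnp: "0 < ln (1 / c0)" using c0 by simp
 have l0: "0 < \<kappa>" using lnp eta by (simp add: \<kappa>_def)
 have "\<kappa> * L \<le> \<eta> * (c0 * W)"
  using L eta by (simp add: \<kappa>_def W_def divide_le_eq power2_eq_square algebra_simps)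
 hence "\<kappa> * L \<le> \<eta> * w A" if "A \<in> \<A>" for A
  using mult_left_mono[OF c0(3)[OF that], of \<eta>] eta unfolding W_def by linarith
 hence "\<exists>t. (\<forall>j<m. t j \<in> cliques_in \<A> r) \<and>
   (\<Sum>A\<in>\<A>. w A * exp (\<kappa> * load r a t m A / w A)) \<le> sum w \<A> * exp ((1 + \<eta>) * \<kappa> * (\<Sum>j<m. \<Sum>c<r. a j c) / sum w \<A>)"
  using l0 eta wpos by (intro multiplicative_weights[where L = L] assms) auto
 then obtain t where t: "\<forall>j<m. t j \<in> cliques_in \<A> r"
  "(\<Sum>A\<in>\<A>. w A * exp (\<kappa> * load r a t m A / w A)) \<le> W * exp ((1 + \<eta>) * \<kappa> * n / W)"
  unfolding W_def n_def by blast
 have "load r a t m A \<le> w A * (n / W + 2 * \<eta>)" if A: "A \<in> \<A>" for A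
 proof -
  have "c0 * W * exp (\<kappa> * load r a t m A / w A) \<le> w A * exp (\<kappa> * load r a t m A / w A)"
   using c0(3)[OF A] by (simp add: W_def)
  also have "... \<le> (\<Sum>A\<in>\<A>. w A * exp (\<kappa> * load r a t m A / w A))"
   using A finA w_nonneg by (intro member_le_sum) auto
  also have "... \<le> W * exp ((1 + \<eta>) * \<kappa> * n / W)" by (rule t(2))
  finally have "exp (\<kappa> * load r a t m A / w A) \<le> (1 / c0) * exp ((1 + \<eta>) * \<kappa> * n / W)"
   using W0 c0 by (simp add: field_simps)
  also have "... = exp (ln (1 / c0) + (1 + \<eta>) * \<kappa> * n / W)" using c0 by (simp add: exp_add)
  finally have "\<kappa> * load r a t m A / w A \<le> ln (1 / c0) + (1 + \<eta>) * \<kappa> * n / W" by simp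
  also have "ln (1 / c0) = \<kappa> * \<eta>" using eta by (simp add: \<kappa>_def)
  finally have "\<kappa> * (load r a t m A / w A) \<le> \<kappa> * (\<eta> + (1 + \<eta>) * n / W)" by (simp add: algebra_simps)
  hence "load r a t m A / w A \<le> \<eta> + (1 + \<eta>) * n / W" using l0 by (simp only: mult_le_cancel_left_pos)
  also have "(1 + \<eta>) * n / W = n / W + \<eta> * (n / W)" by (simp add: add_divide_distrib distrib_right)
  also have "\<eta> * (n / W) \<le> \<eta> * 1" using N W0 eta by (intro mult_left_mono) (auto simp: n_def W_def)
  finally have "load r a t m A / w A \<le> n / W + 2 * \<eta>" by simp
  thus ?thesis using wpos[OF A] by (simp add: divide_le_eq mult.commute)
 qed
 thus ?thesis using t(1) unfolding n_def W_def by blast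
qed

end

section \<open>Banded graphs\<close>

lemma sum_lists_Suc:
 fixes F :: "'a list => real"
 assumes "finite S"
 shows "(\<Sum>t\<in>{t. length t = Suc k \<and> set t \<subseteq> S}. F t) = (\<Sum>A\<in>S. \<Sum>t\<in>{t. length t = k \<and> set t \<subseteq> S}. F (A # t))"
proof -
 have e: "{t. length t = Suc k \<and> set t \<subseteq> S} = (\<lambda>(A, t). A # t) ` (S \<times> {t. length t = k \<and> set t \<subseteq> S})"
  by (auto simp: image_iff length_Suc_conv)
 have fin: "finite {t. length t = k \<and> set t \<subseteq> S}"
  using finite_lists_length_eq[OF assms, of k] by (simp add: conj_commute)
 show ?thesis unfolding e
  by (subst sum.reindex) (auto simp: inj_on_def sum.cartesian_product case_prod_beta)
qed

lemma sum_prod_lists: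
 fixes w :: "'a => real"
 assumes "finite S"
 shows "(\<Sum>t\<in>{t. length t = k \<and> set t \<subseteq> S}. prod_list (map w t)) = sum w S ^ k"
proof (induction k)
 case 0
 have "{t. length t = 0 \<and> set t \<subseteq> S} = {[]}" by auto
 thus ?case by simp
next
 case (Suc k)
 thus ?case unfolding sum_lists_Suc[OF assms]
  by (simp add: sum_distrib_left[symmetric] sum_distrib_right[symmetric])
qed

text \<open>Union bound over the positions of \<open>A\<close>; the other k entries contribute at
  most W^k.\<close>

lemma sum_prod_lists_member:
 fixes w :: "'a => real"
 assumes fin: "finite S" and w: "\<And>A. A \<in> S ==> 0 \<le> w A" and A: "A \<in> S" and W: "sum w S \<le> W"
 shows "(\<Sum>t\<in>{t. length t = Suc k \<and> set t \<subseteq> S}. of_bool (A \<in> set t) * prod_list (map w t)) \<le> real (Suc k) * w A * W ^ k"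
proof -
 have "(\<Sum>B\<in>S. of_bool (A = B) * w B) = (\<Sum>B\<in>S. if B = A then w B else 0)"
  by (intro sum.cong) auto
 hence pick: "(\<Sum>B\<in>S. of_bool (A = B) * w B) = w A" using fin A by simp
 show ?thesis
proof (induction k)
 case 0
 have "(\<Sum>t\<in>{t. length t = Suc 0 \<and> set t \<subseteq> S}. of_bool (A \<in> set t) * prod_list (map w t))
   = (\<Sum>B\<in>S. of_bool (A = B) * w B)"
 proof -
  have "{t. length t = 0 \<and> set t \<subseteq> S} = {[]}" by auto
  thus ?thesis unfolding sum_lists_Suc[OF fin] by simp
 qed
 also have "... = w A" by (rule pick)
 finally show ?case by simp
next
 case (Suc k)
 let ?L = "{t. length t = Suc k \<and> set t \<subseteq> S}"
 have pn: "0 \<le> prod_list (map w t)" if "t \<in> ?L" for t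
 proof -
  have "set t \<subseteq> S" using that by auto
  thus ?thesis using w by (induction t) auto
 qed
 have s0: "0 \<le> sum w S" using w by (rule sum_nonneg)
 hence W0: "0 \<le> W" using W by simp
 have "(\<Sum>t\<in>{t. length t = Suc (Suc k) \<and> set t \<subseteq> S}. of_bool (A \<in> set t) * prod_list (map w t))
   = (\<Sum>B\<in>S. \<Sum>t\<in>?L. of_bool (A \<in> set (B # t)) * prod_list (map w (B # t)))"
  by (rule sum_lists_Suc[OF fin])
 also have "... \<le> (\<Sum>B\<in>S. \<Sum>t\<in>?L. of_bool (A = B) * w B * prod_list (map w t) + w B * (of_bool (A \<in> set t) * prod_list (map w t)))"
 proof (intro sum_mono)
  fix B t assume B: "B \<in> S" and t: "t \<in> ?L"
  have "0 \<le> w B * prod_list (map w t)" using pn[OF t] w[OF B] by simp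
  thus "of_bool (A \<in> set (B # t)) * prod_list (map w (B # t))
   \<le> of_bool (A = B) * w B * prod_list (map w t) + w B * (of_bool (A \<in> set t) * prod_list (map w t))"
   by (auto simp: of_bool_def)
 qed
 also have "... = (\<Sum>B\<in>S. of_bool (A = B) * w B) * (\<Sum>t\<in>?L. prod_list (map w t))
   + sum w S * (\<Sum>t\<in>?L. of_bool (A \<in> set t) * prod_list (map w t))"
  by (simp add: sum.distrib sum_distrib_left[symmetric] sum_distrib_right[symmetric])
 also note pick
 also have "w A * (\<Sum>t\<in>?L. prod_list (map w t)) + sum w S * (\<Sum>t\<in>?L. of_bool (A \<in> set t) * prod_list (map w t))
   \<le> w A * W ^ Suc k + W * (real (Suc k) * w A * W ^ k)"
  unfolding sum_prod_lists[OF fin] using Suc.IH w W s0 W0 A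
  by (intro add_mono mult_left_mono mult_mono power_mono sum_nonneg mult_nonneg_nonneg pn) auto
 also have "... = real (Suc (Suc k)) * w A * W ^ Suc k" by (simp add: algebra_simps)
 finally show ?case .
qed
qed

text \<open>Supplies the sequence in which the initial segments of H run through the cliques with
  prescribed multiplicities.\<close>

lemma multiplicity_sequence:
 assumes "finite K"
 shows "\<exists>f :: nat => 'a. (\<forall>j<sum m K. f j \<in> K) \<and> (\<forall>t\<in>K. card {j. j < sum m K \<and> f j = t} = m t)"
 using assms
proof (induction K)
 case (insert x K)
 then obtain f where f: "\<forall>j<sum m K. f j \<in> K" "\<forall>t\<in>K. card {j. j < sum m K \<and> f j = t} = m t" by blast
 define f' where "f' j = (if j < sum m K then f j else x)" for j
 have s: "sum m (insert x K) = sum m K + m x" using insert by simp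
 have "card {j. j < sum m (insert x K) \<and> f' j = t} = m t" if "t \<in> insert x K" for t
 proof (cases "t = x")
  case True
  have "{j. j < sum m (insert x K) \<and> f' j = t} = {sum m K..<sum m K + m x}"
   unfolding s using f(1) insert(2) True by (auto simp: f'_def not_less[symmetric] split: if_splits)
  thus ?thesis using True by simp
 next
  case False
  have "{j. j < sum m (insert x K) \<and> f' j = t} = {j. j < sum m K \<and> f j = t}"
   unfolding s using False by (auto simp: f'_def)
  thus ?thesis using f(2) that False by simp
 qed
 moreover have "\<forall>j<sum m (insert x K). f' j \<in> insert x K" using f(1) by (auto simp: f'_def)
 ultimately show ?case by blast
qed simp

text \<open>H relabelled by 0, ..., n-1 along an ordering of bandwidth at most b, with a proper
  colouring. One-sided bounds suffice because \<open>HE\<close> is symmetric.\<close>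

locale banded_graph =
 fixes n b \<Delta> r :: nat and HE :: "nat => nat => bool" and col :: "nat => nat"
 assumes HE_sym: "HE u v ==> HE v u"
  and HE_less: "HE u v ==> u < n"
  and HE_band: "HE u v ==> v \<le> u + b"
  and col_less: "u < n ==> col u < r"
  and col_proper: "HE u v ==> col u \<noteq> col v"
  and degree_le: "card {v. HE u v} \<le> \<Delta>"
begin

lemma HE_irrefl: "\<not> HE u u" using col_proper by blast

lemma finite_nbhd: "finite {v. HE u v}"
 by (rule finite_subset[of _ "{..<n}"]) (auto dest: HE_sym HE_less)

definition nb :: "nat => nat set" where "nb u = insert u {v. HE u v}"

lemma nb_sym: "v \<in> nb u \<longleftrightarrow> u \<in> nb v"
 using HE_sym by (auto simp: nb_def)

lemma nb_band: "v \<in> nb u ==> v \<le> u + b"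
 using HE_band by (auto simp: nb_def)

lemma card_nb: "card (nb u) \<le> \<Delta> + 1" "finite (nb u)"
 using degree_le[of u] finite_nbhd[of u] by (auto simp: nb_def card_insert_if)

text \<open>The ball of radius 3. If neither of two centres is near the other, their closed
  neighbourhoods are disjoint and no edge joins them, so that swaps at different centres do not
  interfere.\<close>

definition near :: "nat => nat set" where "near x = (\<Union>p\<in>nb x. \<Union>q\<in>nb p. nb q)"

lemma nearI: "p \<in> nb x ==> q \<in> nb p ==> y \<in> nb q ==> y \<in> near x"
 by (auto simp: near_def)

lemma near_sym: "y \<in> near x \<longleftrightarrow> x \<in> near y"
 unfolding near_def using nb_sym by blast

lemma near_self: "x \<in> near x"
 by (auto simp: near_def nb_def)

lemma near_band: "y \<in> near x ==> y \<le> x + 3 * b"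
 unfolding near_def by (auto dest!: nb_band)

lemma card_near: "card (near x) \<le> (\<Delta> + 1) ^ 3" "finite (near x)"
proof -
 have 1: "card (\<Union>q\<in>nb p. nb q) \<le> (\<Delta> + 1) * (\<Delta> + 1)" for p
 proof -
  have "card (\<Union>q\<in>nb p. nb q) \<le> (\<Sum>q\<in>nb p. card (nb q))" by (rule card_UN_le[OF card_nb(2)])
  also have "... \<le> (\<Sum>q\<in>nb p. \<Delta> + 1)" by (intro sum_mono card_nb)
  also have "... = card (nb p) * (\<Delta> + 1)" by simp
  also have "... \<le> (\<Delta> + 1) * (\<Delta> + 1)" by (intro mult_right_mono card_nb) auto
  finally show ?thesis .
 qed
 have "card (near x) \<le> (\<Sum>p\<in>nb x. card (\<Union>q\<in>nb p. nb q))" unfolding near_def by (rule card_UN_le[OF card_nb(2)])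
 also have "... \<le> (\<Sum>p\<in>nb x. (\<Delta> + 1) * (\<Delta> + 1))" by (intro sum_mono 1)
 also have "... = card (nb x) * ((\<Delta> + 1) * (\<Delta> + 1))" by simp
 also have "... \<le> (\<Delta> + 1) * ((\<Delta> + 1) * (\<Delta> + 1))" by (intro mult_right_mono card_nb) auto
 finally show "card (near x) \<le> (\<Delta> + 1) ^ 3" by (simp only: power3_eq_cube mult.assoc)
 show "finite (near x)" unfolding near_def using card_nb(2) by blast
qed

definition separated :: "nat set => bool" where
 "separated X \<longleftrightarrow> (\<forall>x\<in>X. \<forall>y\<in>X. x \<noteq> y --> y \<notin> near x)"

lemma separated_subset: "separated X ==> X' \<subseteq> X ==> separated X'"
 unfolding separated_def by blast

text \<open>Greedy choice, each chosen vertex excluding a ball of at most (\<Delta>+1)^3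
  vertices.\<close>

lemma separated_exists:
 assumes "finite W"
 shows "\<exists>X\<subseteq>W. separated X \<and> card W \<le> card X * (\<Delta> + 1) ^ 3"
 using assms
proof (induction W rule: finite_psubset_induct)
 case (psubset W)
 show ?case
 proof (cases "W = {}")
  case True thus ?thesis by (intro exI[of _ "{}"]) (auto simp: separated_def)
 next
  case False
  then obtain x where x: "x \<in> W" by auto
  let ?W = "W - near x"
  have "?W \<subset> W" using x near_self by blast
  then obtain X where X: "X \<subseteq> ?W" "separated X" "card ?W \<le> card X * (\<Delta> + 1) ^ 3" using psubset.IH by blast
  have finX: "finite X" using X(1) psubset.hyps by (meson finite_Diff finite_subset)
  have xX: "x \<notin> X" using X(1) near_self by blast
  have "separated (insert x X)"
   unfolding separated_def
  proof (intro ballI impI)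
   fix u v assume uv: "u \<in> insert x X" "v \<in> insert x X" "u \<noteq> v"
   show "v \<notin> near u"
    using uv X(1,2) near_sym unfolding separated_def by blast
  qed
  moreover have "card W \<le> card (insert x X) * (\<Delta> + 1) ^ 3"
  proof -
   have "card W \<le> card (near x) + card ?W"
    using card_Un_le[of "near x" ?W] card_mono[of "near x \<union> ?W" W] card_near(2)[of x] psubset.hyps by force
   also have "... \<le> (\<Delta> + 1) ^ 3 + card X * (\<Delta> + 1) ^ 3" using X(3) card_near(1) by (intro add_mono) auto
   also have "... = card (insert x X) * (\<Delta> + 1) ^ 3" using finX xX by simp
   finally show ?thesis .
  qed
  moreover have "insert x X \<subseteq> W" using X(1) x by blast
  ultimately show ?thesis by blast
 qed
qed

lemma monochromatic_separated_exists:
 assumes "W \<subseteq> {..<n}" "W \<noteq> {}"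
 shows "\<exists>X\<subseteq>W. \<exists>c<r. separated X \<and> (\<forall>x\<in>X. col x = c) \<and> card W \<le> card X * (r * (\<Delta> + 1) ^ 3)"
proof -
 have finW: "finite W" using assms(1) finite_subset by blast
 have "\<exists>c<r. card W \<le> r * card {x\<in>W. col x = c}"
 proof (rule ccontr)
  assume neg: "\<not> ?thesis"
  obtain x where "x \<in> W" using assms(2) by auto
  hence r0: "0 < r" using col_less[of x] assms(1) by auto
  have "W = (\<Union>c<r. {x\<in>W. col x = c})" using col_less assms(1) by auto
  hence "card W \<le> (\<Sum>c<r. card {x\<in>W. col x = c})" using card_UN_le[of "{..<r}" "\<lambda>c. {x\<in>W. col x = c}"] by simp
  hence "r * card W \<le> (\<Sum>c<r. r * card {x\<in>W. col x = c})" by (simp add: sum_distrib_left[symmetric])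
  also have "... < (\<Sum>c<r. card W)" using neg r0 by (intro sum_strict_mono) auto
  finally show False by simp
 qed
 then obtain c where c: "c < r" "card W \<le> r * card {x\<in>W. col x = c}" by blast
 have "finite {x\<in>W. col x = c}" using finW by simp
 from separated_exists[OF this] obtain X where X: "X \<subseteq> {x\<in>W. col x = c}" "separated X"
  "card {x\<in>W. col x = c} \<le> card X * (\<Delta> + 1) ^ 3" by blast
 have "card W \<le> r * (card X * (\<Delta> + 1) ^ 3)" using c(2) X(3) by (meson le_trans mult_le_mono2)
 hence "card W \<le> card X * (r * (\<Delta> + 1) ^ 3)" by (simp add: algebra_simps)
 thus ?thesis using X c(1) by blast
qed

end

context weighted_graph
begin

lemma cliques_in_clique: "t \<in> cliques_in S r ==> clique t" by (simp add: cliques_in_def)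

text \<open>Segment j consists of \<open>s\<close> blocks: the first 2^r - 1 walk from \<tau> (j-1)
  to \<tau> j, the others stay at \<tau> j. The walk starts at its origin, so the clique of a
  segment still governs the first block of the next one.\<close>

lemma walk_sequence:
 assumes conn: "real r * \<nu> < sum w \<A>" and \<tau>: "\<And>j. \<tau> j \<in> cliques_in \<A> r" and s: "2 ^ r - 1 < s"
 shows "\<exists>T. (\<forall>k. T k \<in> cliques_in \<A> r) \<and> (\<forall>k. compat (T k) (T (Suc k))) \<and>
   (\<forall>k. 2 ^ r - 1 \<le> k mod s --> T k = \<tau> (k div s)) \<and> (\<forall>j. T (Suc j * s) = \<tau> j)"
proof -
 define D :: nat where "D = 2 ^ r - 1"
 \<comment> \<open>For j = 0 truncated subtraction makes j - 1 equal to 0, and the first walk leads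
   from \<tau> 0 to itself.\<close>
 have "\<exists>f. f 0 = \<tau> (j - 1) \<and> f D = \<tau> j \<and> (\<forall>i<D. walk_step \<A> r (f i) (f (Suc i)))" for j
  using clique_walk[OF order_refl conn \<tau> \<tau>, of "j - 1" j] unfolding D_def relpowp_fun_conv by blast
 then obtain P where P: "\<And>j. P j 0 = \<tau> (j - 1)" "\<And>j. P j D = \<tau> j"
   "\<And>j i. i < D ==> walk_step \<A> r (P j i) (P j (Suc i))" by metis
 define T where "T k = P (k div s) (min (k mod s) D)" for k
 have Pc: "P j i \<in> cliques_in \<A> r" if "i \<le> D" for i j
 proof (cases "i = D")
  case False
  hence "walk_step \<A> r (P j i) (P j (Suc i))" using P(3) that by simp
  thus ?thesis by (simp add: walk_step_def)
 qed (use P(2) \<tau> in simp)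
 have s0: "0 < s" using s by simp
 have Ds: "D < s" using s by (simp add: D_def)
 have Tc: "T k \<in> cliques_in \<A> r" for k by (simp add: T_def Pc)
 have Tcompat: "compat (T k) (T (Suc k))" for k
 proof (cases "Suc (k mod s) = s")
  case True
  hence "Suc k div s = Suc (k div s)" "Suc k mod s = 0" by (simp_all add: div_Suc mod_Suc)
  hence "T (Suc k) = \<tau> (k div s)" by (simp add: T_def P)
  moreover have "min (k mod s) D = D" using True Ds by simp
  hence "T k = \<tau> (k div s)" by (simp add: T_def P)
  ultimately show ?thesis using compat_refl cliques_in_clique[OF \<tau>] by simp
 next
  case False
  have "Suc k mod s = Suc (k mod s)" using False by (simp add: mod_Suc)
  moreover have "Suc k div s = k div s" using False calculation by (simp add: div_Suc)
  ultimately have TS: "T (Suc k) = P (k div s) (min (Suc (k mod s)) D)" by (simp add: T_def)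
  show ?thesis
  proof (cases "k mod s < D")
   case True
   thus ?thesis using P(3)[OF True, of "k div s"] TS by (simp add: T_def walk_step_def min_def)
  next
   case False
   hence "T (Suc k) = T k" using TS by (simp add: T_def min_def)
   thus ?thesis using compat_refl cliques_in_clique[OF Tc] by simp
  qed
 qed
 have "T k = \<tau> (k div s)" if "D \<le> k mod s" for k using that by (simp add: T_def min_def P)
 moreover have "T (Suc j * s) = \<tau> j" for j
 proof -
  have "Suc j * s div s = Suc j" "Suc j * s mod s = 0" using s0 by (simp_all del: mult_Suc)
  thus ?thesis by (simp add: T_def P)
 qed
 ultimately show ?thesis using Tc Tcompat unfolding D_def by blast
qed

end

section \<open>Assigning vertices to clusters\<close>

text \<open>A block has b+1 vertices, so an edge of H stays in a block or joins consecutive ones.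
  \<open>l\<close> is the length of a segment and \<open>D\<close> the number of its blocks spent on
  the walk.\<close>

locale assignment = weighted_graph \<A> R w \<nu> + banded_graph n b \<Delta> r HE col
 for \<A> :: "'a set" and R w \<nu> n b \<Delta> r HE col +
 fixes s :: nat and T \<tau> :: "nat => 'a list" and B D l :: nat
 assumes B_def: "B = b + 1" and D_def: "D = 2 ^ r - 1" and l_def: "l = B * s" and Ds: "D < s"
  and T_clique: "T k \<in> cliques_in \<A> r" and T_compat: "compat (T k) (T (Suc k))"
  and T_main: "D \<le> k mod s ==> T k = \<tau> (k div s)" and T_start: "T (Suc j * s) = \<tau> j"
begin

definition hom :: "nat => 'a" where "hom u = T (u div B) ! col u"

definition blk :: "nat => nat" where "blk u = u div B mod s"

definition seg :: "nat => nat" where "seg u = u div l"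

lemma B0: "0 < B" and s0: "0 < s" and l0: "0 < l"
 using Ds by (auto simp: B_def l_def)

lemma seg_alt: "seg u = u div B div s"
 unfolding seg_def unfolding l_def by (rule div_mult2_eq)

lemma decomp: "u = seg u * l + (blk u * B + u mod B)"
proof -
 have "u = u div l * l + u mod l" by simp
 also have "u mod l = B * (u div B mod s) + u mod B" by (simp add: l_def mod_mult2_eq)
 finally show ?thesis by (simp add: seg_def blk_def mult.commute)
qed

lemma segI:
 assumes "j * l + k * B \<le> u" "u < Suc j * l"
 shows "seg u = j" "k \<le> blk u"
proof -
 show sj: "seg u = j" unfolding seg_def using assms by (intro div_nat_eqI) (auto simp: mult.commute)
 have "k * B \<le> blk u * B + u mod B" using decomp[of u] assms(1) unfolding sj by linarith
 also have "... < (blk u + 1) * B" using B0 by simp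
 finally have "k < blk u + 1" by (metis mult_less_cancel2)
 thus "k \<le> blk u" by simp
qed

lemma hom_mem: "u < n ==> hom u \<in> \<A>"
 using T_clique[of "u div B"] col_less[of u] by (auto simp: hom_def cliques_in_def)

text \<open>Inside a block the clique property applies, across a block boundary
  \<open>compat\<close>; both need different positions, which proper colouring provides.\<close>

lemma hom_hom:
 assumes "HE u v" shows "R (hom u) (hom v)"
proof -
 have c: "col u < r" "col v < r" "col u \<noteq> col v"
  using assms HE_sym HE_less col_less col_proper by blast+
 have lT: "length (T k) = r" for k using T_clique by (auto simp: cliques_in_def)
 have up: "v' div B = u' div B \<or> v' div B = Suc (u' div B)" if "u' \<le> v'" "v' \<le> u' + b" for u' v'
 proof -
  have "v' div B \<le> (u' + B) div B" using that B_def by (intro div_le_mono) simp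
  also have "... = Suc (u' div B)" using B0 by simp
  finally have "v' div B \<le> Suc (u' div B)" .
  moreover have "u' div B \<le> v' div B" using that by (intro div_le_mono)
  ultimately show ?thesis by linarith
 qed
 have band: "v \<le> u + b" "u \<le> v + b" using HE_band assms HE_sym by blast+
 consider "v div B = u div B" | "v div B = Suc (u div B)" | "u div B = Suc (v div B)"
  using up[of u v] up[of v u] band by linarith
 thus ?thesis
 proof cases
  case 1
  thus ?thesis using clique_nth[OF cliques_in_clique[OF T_clique]] c lT by (simp add: hom_def)
 next
  case 2
  thus ?thesis using T_compat[of "u div B"] c lT by (simp add: hom_def compat_def)
 next
  case 3
  thus ?thesis using T_compat[of "v div B"] c lT R_sym by (simp add: hom_def compat_def)
 qed
qed

lemma hom_main: "D \<le> blk u ==> hom u = \<tau> (seg u) ! col u"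
 using T_main[of "u div B"] by (simp add: hom_def blk_def seg_alt)

text \<open>Serves vertices near the end of segment j whose neighbours lie in the next segment:
  these are at most one block ahead, where \<tau> j is still in force.\<close>

lemma hom_start:
 assumes "Suc j * l \<le> u" "u < Suc j * l + B"
 shows "hom u = \<tau> j ! col u"
proof -
 have e: "Suc j * s * B = Suc j * l" unfolding l_def by (metis mult.assoc mult.commute)
 have "u div B = Suc j * s"
 proof (rule div_nat_eqI)
  show "B * (Suc j * s) \<le> u" using assms(1) e by (simp add: mult.commute)
  show "u < B * Suc (Suc j * s)" using assms(2) e by (simp add: mult.commute)
 qed
 thus ?thesis using T_start[of j] by (simp only: hom_def)
qed

definition transit :: "nat => nat set" where "transit N = {u. u < N \<and> blk u < D}"

lemma card_transit: "card (transit N) \<le> (N div l + 1) * (D * B)" "finite (transit N)"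
proof -
 let ?I = "(\<lambda>(j,i). j * l + i) ` ({..N div l} \<times> {..<D * B})"
 have sub: "transit N \<subseteq> ?I"
 proof
  fix u assume u: "u \<in> transit N"
  have "seg u \<le> N div l" using u unfolding seg_def transit_def by (intro div_le_mono) auto
  moreover have "blk u * B + u mod B < D * B"
  proof -
   have "blk u * B + u mod B < (blk u + 1) * B" using B0 by simp
   also have "... \<le> D * B" using u by (intro mult_right_mono) (auto simp: transit_def)
   finally show ?thesis .
  qed
  ultimately show "u \<in> ?I" using decomp[of u] by (force simp: image_iff)
 qed
 have "card (transit N) \<le> card ?I" using sub by (intro card_mono) auto
 also have "... \<le> card ({..N div l} \<times> {..<D * B})" by (intro card_image_le) auto
 finally show "card (transit N) \<le> (N div l + 1) * (D * B)" by (simp add: card_cartesian_product)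
 show "finite (transit N)" by (auto simp: transit_def)
qed

lemma card_seg: "card {u. seg u = j} = l" "finite {u. seg u = j}"
proof -
 have "{u. seg u = j} = {j * l..<Suc j * l}"
 proof (intro set_eqI iffI)
  fix u assume "u \<in> {u. seg u = j}"
  hence "u = j * l + u mod l" using div_mult_mod_eq[of u l] by (simp add: seg_def)
  moreover have "u mod l < l" using l0 by simp
  ultimately show "u \<in> {j * l..<Suc j * l}" by auto
 next
  fix u assume "u \<in> {j * l..<Suc j * l}"
  thus "u \<in> {u. seg u = j}" unfolding seg_def by (auto intro!: div_nat_eqI simp: mult.commute)
 qed
 thus "card {u. seg u = j} = l" "finite {u. seg u = j}" by simp_all
qed

end

text \<open>The first \<open>J\<close> segments prepare the swaps. Segment j follows the clique
  \<open>t1 j\<close>, permuted so that its head falls to the colour \<open>c j\<close> of the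
  separated set \<open>X j\<close>. \<open>Y j\<close> is the reserve, kept out of the greedy
  embedding; the vertices of \<open>X j - Y j\<close> may later give up their places.\<close>

locale phased_assignment = assignment \<A> R w \<nu> n b \<Delta> r HE col s T \<tau> B D l
 for \<A> :: "'a set" and R w \<nu> n b \<Delta> r HE col s T \<tau> B D l +
 fixes J xx yy :: nat and t1 :: "nat => 'a list" and X Y :: "nat => nat set" and c :: "nat => nat"
  and mt :: "'a list => nat" and \<mu> W :: real
 assumes t1: "j < J ==> t1 j \<in> cliques_in \<A> r"
  and mt: "t \<in> cliques_in \<A> r ==> card {j. j < J \<and> t1 j = t} = mt t"
  and mt_lo: "t \<in> cliques_in \<A> r ==> \<mu> * prod_list (map w t) \<le> mt t"
  and mt_hi: "t \<in> cliques_in \<A> r ==> mt t \<le> \<mu> * prod_list (map w t) + 1"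
  and J: "J * l \<le> n" and mu0: "0 \<le> \<mu>" and W: "sum w \<A> \<le> W"
  and X: "j < J ==> X j \<subseteq> {j * l + (D + 4) * B..<Suc j * l}"
  and X_sep: "j < J ==> separated (X j)" and X_col: "j < J ==> x \<in> X j ==> col x = c j"
  and c: "j < J ==> c j < r" and card_X: "j < J ==> card (X j) = xx"
  and Y: "j < J ==> Y j \<subseteq> X j" and card_Y: "j < J ==> card (Y j) = yy"
  and tau_hd: "j < J ==> \<tau> j ! c j = hd (t1 j)"
  and tau_tl: "j < J ==> k < r ==> k \<noteq> c j ==> \<tau> j ! k \<in> set (tl (t1 j))"
  and r0: "0 < r"
begin

definition XX :: "nat set" where "XX = (\<Union>j<J. X j)"
definition YY :: "nat set" where "YY = (\<Union>j<J. Y j)"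
definition X0 :: "nat set" where "X0 = (\<Union>j<J. X j - Y j)"

lemma X_seg:
 assumes "j < J" "x \<in> X j" shows "seg x = j" "D + 4 \<le> blk x"
proof -
 have "j * l + (D + 4) * B \<le> x" "x < Suc j * l" using X[of j] assms by auto
 thus "seg x = j" "D + 4 \<le> blk x" using segI by blast+
qed

lemma X_disj: "i < J ==> j < J ==> i \<noteq> j ==> X i \<inter> X j = {}"
 using X_seg(1) by blast

lemma finX: "j < J ==> finite (X j)" using X finite_subset by blast

lemma XX_less: "x \<in> XX ==> x < J * l"
proof -
 assume "x \<in> XX"
 then obtain j where j: "j < J" "x \<in> X j" by (auto simp: XX_def)
 have "x < Suc j * l" using X[OF j(1)] j(2) by auto
 also have "... \<le> J * l" using j(1) by (intro mult_right_mono) auto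
 finally show ?thesis .
qed

lemma YY_XX: "YY \<subseteq> XX" "X0 \<subseteq> XX" "X0 \<inter> YY = {}"
 using Y X_disj unfolding YY_def XX_def X0_def by blast+

lemma finXX: "finite XX" unfolding XX_def using finX by blast

text \<open>Within a segment this is assumed. Between segments, the margin of four blocks beyond the
  walk exceeds 3b.\<close>

lemma separated_XX: "separated XX"
 unfolding separated_def
proof (intro ballI impI)
 fix x y assume x: "x \<in> XX" and y: "y \<in> XX" and ne: "x \<noteq> y"
 obtain i where i: "i < J" "x \<in> X i" using x by (auto simp: XX_def)
 obtain j where j: "j < J" "y \<in> X j" using y by (auto simp: XX_def)
 have *: "y' \<notin> near x'" if "i' < j'" "j' < J" "x' \<in> X i'" "y' \<in> X j'" for x' y' i' j'
 proof
  assume "y' \<in> near x'"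
  hence "y' \<le> x' + 3 * b" by (rule near_band)
  moreover have "x' < Suc i' * l" using X[of i'] that by auto
  moreover have "Suc i' * l \<le> j' * l" using that by (intro mult_right_mono) auto
  moreover have "j' * l + (D + 4) * B \<le> y'" using X[of j'] that by auto
  moreover have "4 * B \<le> (D + 4) * B" by simp
  ultimately show False using B_def by linarith
 qed
 consider "i = j" | "i < j" | "j < i" by linarith
 thus "y \<notin> near x"
 proof cases
  case 1 thus ?thesis using X_sep[OF i(1)] i j ne unfolding separated_def by blast
 next
  case 2 thus ?thesis using * i j by blast
 next
  case 3 thus ?thesis using *[OF 3 i(1) j(2) i(2)] near_sym by blast
 qed
qed

lemma hom_X: "j < J ==> x \<in> X j ==> hom x = hd (t1 j)"
 using X_seg[of j x] hom_main[of x] X_col tau_hd by simp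

text \<open>Colour \<open>c j\<close> occupies the head of the clique, so neighbours of
  \<open>X j\<close> fall on its tail. The margin after the walk protects the neighbours to the left
  and \<open>hom_start\<close> those beyond the end of the segment.\<close>

lemma hom_nbhd:
 assumes "j < J" "x \<in> X j" "HE x z"
 shows "hom z \<in> set (tl (t1 j))"
proof -
 have z: "z \<le> x + b" "x \<le> z + b" using HE_band HE_sym assms(3) by blast+
 have x: "j * l + (D + 4) * B \<le> x" "x < Suc j * l" using X[OF assms(1)] assms(2) by auto
 have "(D + 4) * B = D * B + 4 * B" by (simp add: algebra_simps)
 hence lo: "j * l + D * B \<le> z" using x(1) z(2) B_def by linarith
 have "hom z = \<tau> j ! col z"
 proof (cases "z < Suc j * l")
  case True
  thus ?thesis using hom_main segI[OF lo True] by simp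
 next
  case False
  moreover have "z < Suc j * l + B" using z(1) x(2) B_def by linarith
  ultimately show ?thesis using hom_start by simp
 qed
 moreover have "col z \<noteq> c j" using X_col[OF assms(1,2)] col_proper[OF assms(3)] by metis
 moreover have "col z < r" using assms(3) HE_sym HE_less col_less by blast
 ultimately show ?thesis using tau_tl[OF assms(1)] by simp
qed

lemma finC: "finite (cliques_in \<A> r)" by (rule finite_cliques_in) simp

lemma card_segments:
 assumes "P \<subseteq> cliques_in \<A> r"
 shows "card {j. j < J \<and> t1 j \<in> P} = (\<Sum>t\<in>P. mt t)"
proof -
 have finP: "finite P" using assms finC by (rule finite_subset)
 have "{j. j < J \<and> t1 j \<in> P} = (\<Union>t\<in>P. {j. j < J \<and> t1 j = t})" by auto
 hence "card {j. j < J \<and> t1 j \<in> P} = (\<Sum>t\<in>P. card {j. j < J \<and> t1 j = t})"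
  using finP by (subst card_UN_disjoint[symmetric]) auto
 also have "... = (\<Sum>t\<in>P. mt t)" using assms mt by (intro sum.cong) auto
 finally show ?thesis .
qed

definition occ :: "'a => nat" where "occ A = card {j. j < J \<and> A \<in> set (t1 j)}"

text \<open>A cluster takes part in roughly its proportional share of the segments; the additive
  term is the rounding of \<open>mt\<close>, one per clique.\<close>

lemma occ_le:
 assumes A: "A \<in> \<A>"
 shows "occ A \<le> \<mu> * (real r * w A * W ^ (r - 1)) + card (cliques_in \<A> r)"
proof -
 let ?P = "{t \<in> cliques_in \<A> r. A \<in> set t}"
 have "{j. j < J \<and> A \<in> set (t1 j)} = {j. j < J \<and> t1 j \<in> ?P}" using t1 by auto
 hence "real (occ A) = (\<Sum>t\<in>?P. real (mt t))" unfolding occ_def using card_segments[of ?P] by simp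
 also have "... \<le> (\<Sum>t\<in>?P. \<mu> * prod_list (map w t) + 1)" using mt_hi by (intro sum_mono) auto
 also have "... = \<mu> * (\<Sum>t\<in>?P. prod_list (map w t)) + card ?P" by (simp add: sum.distrib sum_distrib_left)
 also have "... \<le> \<mu> * (real r * w A * W ^ (r - 1)) + card (cliques_in \<A> r)"
 proof (intro add_mono mult_left_mono mu0)
  obtain k where k: "r = Suc k" using r0 by (cases r) auto
  let ?L = "{t. length t = Suc k \<and> set t \<subseteq> \<A>}"
  have finL: "finite ?L" using finite_lists_length_eq[OF finA, of "Suc k"] by (simp add: conj_commute)
  have "(\<Sum>t\<in>?P. prod_list (map w t)) = (\<Sum>t\<in>?P. of_bool (A \<in> set t) * prod_list (map w t))" by (intro sum.cong) auto
  also have "... \<le> (\<Sum>t\<in>?L. of_bool (A \<in> set t) * prod_list (map w t))"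
   using finL prod_list_w_nonneg by (intro sum_mono2) (auto simp: cliques_in_def k)
  also have "... \<le> real (Suc k) * w A * W ^ k" using finA w_nonneg A W by (intro sum_prod_lists_member)
  finally show "(\<Sum>t\<in>?P. prod_list (map w t)) \<le> real r * w A * W ^ (r - 1)" by (simp add: k)
  show "real (card ?P) \<le> real (card (cliques_in \<A> r))" using finC by (intro of_nat_mono card_mono) auto
 qed
 finally show ?thesis .
qed

lemma tau_mem: "j < J ==> k < r ==> \<tau> j ! k \<in> set (t1 j)"
 using tau_hd[of j] tau_tl[of j k] t1[of j] r0 by (cases "t1 j") (auto simp: cliques_in_def)

lemma early_le: "card {u. u < J * l + b \<and> u < n \<and> hom u = A} \<le> occ A * l + ((J + 1) * (D * B) + b)"
proof -
 have "{u. u < J * l + b \<and> u < n \<and> hom u = A} \<subseteq>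
   (\<Union>j\<in>{j. j < J \<and> A \<in> set (t1 j)}. {u. seg u = j}) \<union> (transit (J * l) \<union> {J * l..<J * l + b})"
 proof
  fix u assume u: "u \<in> {u. u < J * l + b \<and> u < n \<and> hom u = A}"
  show "u \<in> (\<Union>j\<in>{j. j < J \<and> A \<in> set (t1 j)}. {u. seg u = j}) \<union> (transit (J * l) \<union> {J * l..<J * l + b})"
  proof (cases "u < J * l \<and> D \<le> blk u")
   case True
   hence "seg u < J" unfolding seg_def by (simp add: less_mult_imp_div_less)
   moreover have "hom u \<in> set (t1 (seg u))"
    using hom_main True tau_mem[OF \<open>seg u < J\<close>] col_less u by auto
   ultimately show ?thesis using u by auto
  qed (use u in \<open>auto simp: transit_def\<close>)
 qed
 hence "card {u. u < J * l + b \<and> u < n \<and> hom u = A} \<le>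
   card ((\<Union>j\<in>{j. j < J \<and> A \<in> set (t1 j)}. {u. seg u = j}) \<union> (transit (J * l) \<union> {J * l..<J * l + b}))"
  by (intro card_mono) (auto simp: card_seg card_transit)
 also have "... \<le> card (\<Union>j\<in>{j. j < J \<and> A \<in> set (t1 j)}. {u. seg u = j}) + (card (transit (J * l)) + card {J * l..<J * l + b})"
  by (meson card_Un_le add_left_mono order.trans)
 also have "... \<le> occ A * l + ((J + 1) * (D * B) + b)"
 proof (intro add_mono)
  have "card (\<Union>j\<in>{j. j < J \<and> A \<in> set (t1 j)}. {u. seg u = j}) \<le> (\<Sum>j\<in>{j. j < J \<and> A \<in> set (t1 j)}. card {u. seg u = j})"
   by (rule card_UN_le) simp
  thus "card (\<Union>j\<in>{j. j < J \<and> A \<in> set (t1 j)}. {u. seg u = j}) \<le> occ A * l" by (simp add: card_seg occ_def)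
  show "card (transit (J * l)) \<le> (J + 1) * (D * B)" using card_transit(1)[of "J * l"] l0 by simp
 qed simp
 finally show ?thesis .
qed

lemma Y_load_le: "card {u\<in>YY. hom u = A} \<le> occ A * yy"
proof -
 have "{u\<in>YY. hom u = A} \<subseteq> (\<Union>j\<in>{j. j < J \<and> A \<in> set (t1 j)}. Y j)"
 proof
  fix u assume u: "u \<in> {u\<in>YY. hom u = A}"
  then obtain j where j: "j < J" "u \<in> Y j" by (auto simp: YY_def)
  have "hd (t1 j) \<in> set (t1 j)" using t1[OF j(1)] r0 by (cases "t1 j") (auto simp: cliques_in_def)
  moreover have "hom u = hd (t1 j)" using hom_X Y j by blast
  ultimately show "u \<in> (\<Union>j\<in>{j. j < J \<and> A \<in> set (t1 j)}. Y j)" using u j by auto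
 qed
 moreover have "finite (\<Union>j\<in>{j. j < J \<and> A \<in> set (t1 j)}. Y j)" using Y finX by (auto intro: finite_subset)
 ultimately have "card {u\<in>YY. hom u = A} \<le> card (\<Union>j\<in>{j. j < J \<and> A \<in> set (t1 j)}. Y j)" by (rule card_mono[rotated])
 also have "... \<le> (\<Sum>j\<in>{j. j < J \<and> A \<in> set (t1 j)}. card (Y j))" by (rule card_UN_le) simp
 also have "... = occ A * yy" using card_Y by (simp add: occ_def)
 finally show ?thesis .
qed

lemma card_YY: "card YY = J * yy"
proof -
 have "card YY = (\<Sum>j<J. card (Y j))" unfolding YY_def
 proof (rule card_UN_disjoint)
  show "\<forall>i\<in>{..<J}. finite (Y i)" using Y finX by (auto intro: finite_subset)
  show "\<forall>i\<in>{..<J}. \<forall>j\<in>{..<J}. i \<noteq> j --> Y i \<inter> Y j = {}" using Y X_disj by blast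
 qed simp
 thus ?thesis using card_Y by simp
qed

lemma J_eq: "J = (\<Sum>t\<in>cliques_in \<A> r. mt t)"
proof -
 have "{j. j < J \<and> t1 j \<in> cliques_in \<A> r} = {..<J}" using t1 by auto
 thus ?thesis using card_segments[OF order_refl] by simp
qed

lemma J_ge:
 assumes "(real r - 1) * \<nu> + h \<le> sum w \<A>" "0 \<le> h"
 shows "\<mu> * h ^ r \<le> J"
proof -
 have "\<mu> * h ^ r \<le> \<mu> * (\<Sum>t\<in>cliques_in \<A> r. prod_list (map w t))"
  using clique_weight[OF order_refl assms] mu0 by (intro mult_left_mono)
 also have "... \<le> (\<Sum>t\<in>cliques_in \<A> r. real (mt t))" unfolding sum_distrib_left by (intro sum_mono mt_lo)
 also have "... = J" by (subst J_eq) simp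
 finally show ?thesis .
qed

text \<open>\<open>J'\<close> stands for the clusters in which a given vertex v has many neighbours.
  Cliques with head \<open>A\<close> and tail in \<open>J'\<close> have total weight at least w A
  h^(r-1), since only 2\<nu> is lost. Each is used in proportion to its weight, and each use
  contributes xx - yy vertices when that is positive.\<close>

lemma swap_count:
 assumes A: "A \<in> \<A>" and J': "J' \<subseteq> \<A>" "sum w (\<A> - J') \<le> \<nu>" and h: "0 \<le> h" "real r * \<nu> + h \<le> sum w \<A>"
 shows "\<mu> * (w A * h ^ (r - 1)) * (real xx - real yy) \<le> card {x\<in>X0. hom x = A \<and> (\<forall>z. HE x z --> hom z \<in> J')}"
proof (cases "yy \<le> xx")
 case False
 have "\<mu> * (w A * h ^ (r - 1)) * (real xx - real yy) \<le> 0"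
  using False mu0 w_nonneg[OF A] h by (intro mult_nonneg_nonpos) auto
 thus ?thesis by (rule order_trans) simp
next
 case True
 obtain k where k: "r = Suc k" using r0 by (cases r) auto
 define S where "S = {B\<in>J'. R A B}"
 define P where "P = (#) A ` cliques_in S k"
 have SA: "S \<subseteq> \<A>" using J' by (auto simp: S_def)
 have P: "P \<subseteq> cliques_in \<A> r" using A SA by (auto simp: P_def cliques_in_def k clique_Cons S_def)
 have wS: "(real k - 1) * \<nu> + h \<le> sum w S"
 proof -
  have "sum w \<A> = sum w J' + sum w (\<A> - J')" using J'(1) finA by (metis add.commute sum.subset_diff)
  moreover have "sum w J' - \<nu> \<le> sum w S" unfolding S_def by (rule nbhd_weight[OF J'(1) A])
  ultimately show ?thesis using J'(2) h(2) by (simp add: k algebra_simps)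
 qed
 let ?Z = "{j. j < J \<and> t1 j \<in> P}"
 have "\<mu> * (w A * h ^ k) \<le> \<mu> * (w A * (\<Sum>t\<in>cliques_in S k. prod_list (map w t)))"
  using clique_weight[OF SA wS h(1)] mu0 w_nonneg[OF A] by (intro mult_left_mono) auto
 also have "... = (\<Sum>t\<in>P. \<mu> * prod_list (map w t))"
  unfolding P_def by (subst sum.reindex) (auto simp: sum_distrib_left)
 also have "... \<le> (\<Sum>t\<in>P. real (mt t))" using P mt_lo by (intro sum_mono) auto
 also have "... = card ?Z" using card_segments[OF P] by simp
 finally have Z: "\<mu> * (w A * h ^ (r - 1)) \<le> card ?Z" by (simp add: k)
 have sub: "(\<Union>j\<in>?Z. X j - Y j) \<subseteq> {x\<in>X0. hom x = A \<and> (\<forall>z. HE x z --> hom z \<in> J')}"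
 proof
  fix x assume "x \<in> (\<Union>j\<in>?Z. X j - Y j)"
  then obtain j where j: "j < J" "t1 j \<in> P" "x \<in> X j" "x \<notin> Y j" by auto
  have "hom x = A" using hom_X[OF j(1,3)] j(2) by (auto simp: P_def)
  moreover have "hom z \<in> J'" if "HE x z" for z
   using hom_nbhd[OF j(1,3) that] j(2) by (auto simp: P_def cliques_in_def S_def)
  ultimately show "x \<in> {x\<in>X0. hom x = A \<and> (\<forall>z. HE x z --> hom z \<in> J')}" using j by (auto simp: X0_def)
 qed
 have "card (\<Union>j\<in>?Z. X j - Y j) = (\<Sum>j\<in>?Z. card (X j - Y j))"
 proof (rule card_UN_disjoint)
  show "\<forall>i\<in>?Z. finite (X i - Y i)" using finX by auto
  show "\<forall>i\<in>?Z. \<forall>j\<in>?Z. i \<noteq> j --> (X i - Y i) \<inter> (X j - Y j) = {}" using X_disj by blast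
 qed simp
 also have "... = (\<Sum>j\<in>?Z. xx - yy)"
 proof (intro sum.cong refl)
  fix j assume "j \<in> ?Z"
  hence j: "j < J" by simp
  have "finite (Y j)" using Y[OF j] finX[OF j] by (rule finite_subset)
  thus "card (X j - Y j) = xx - yy" using Y[OF j] card_X[OF j] card_Y[OF j] by (simp add: card_Diff_subset)
 qed
 finally have c: "card (\<Union>j\<in>?Z. X j - Y j) = card ?Z * (xx - yy)" by simp
 have "\<mu> * (w A * h ^ (r - 1)) * (real xx - real yy) \<le> card ?Z * (real xx - real yy)"
  using Z True by (intro mult_right_mono) auto
 also have "... = card (\<Union>j\<in>?Z. X j - Y j)" unfolding c using True by (simp add: of_nat_diff)
 also have "... \<le> card {x\<in>X0. hom x = A \<and> (\<forall>z. HE x z --> hom z \<in> J')}"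
  using sub finXX YY_XX(2) by (intro of_nat_mono card_mono) (auto intro: finite_subset)
 finally show ?thesis .
qed

text \<open>The load of the initial part with the walks ignored; vertices in transit are counted
  separately. It depends on \<tau> only below \<open>J\<close>, so it is known before the later
  cliques are chosen.\<close>

definition base_load :: "'a => nat" where
 "base_load A = card {u. u < J * l \<and> u \<notin> YY \<and> \<tau> (seg u) ! col u = A}"

text \<open>A vertex that is not in transit lies in the initial part or in a later segment J+j,
  where colour k goes to entry k of the clique.\<close>

lemma load_le:
 assumes m: "n \<le> (J + m) * l"
  and a: "\<And>j k. a j k = real (card {u. u < n \<and> seg u = J + j \<and> col u = k})"
 shows "card {u. u < n \<and> u \<notin> YY \<and> hom u = A} \<le>
   base_load A + load r a (\<lambda>j. \<tau> (J + j)) m A + (n div l + 1) * (D * B)"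
proof -
 let ?M = "{u. u < n \<and> J * l \<le> u \<and> \<tau> (seg u) ! col u = A}"
 let ?P = "{u. u < J * l \<and> u \<notin> YY \<and> \<tau> (seg u) ! col u = A}"
 have "{u. u < n \<and> u \<notin> YY \<and> hom u = A} \<subseteq> ?P \<union> ?M \<union> transit n"
  using hom_main by (auto simp: transit_def not_less)
 hence "card {u. u < n \<and> u \<notin> YY \<and> hom u = A} \<le> card (?P \<union> ?M \<union> transit n)"
  by (intro card_mono) (auto simp: card_transit)
 also have "... \<le> card ?P + card ?M + card (transit n)"
  by (meson card_Un_le add_mono order.trans order_refl)
 finally have 1: "card {u. u < n \<and> u \<notin> YY \<and> hom u = A} \<le> base_load A + card ?M + (n div l + 1) * (D * B)"
  using card_transit(1)[of n] by (simp add: base_load_def)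
 have "?M \<subseteq> (\<Union>j<m. \<Union>k\<in>{k. k < r \<and> \<tau> (J + j) ! k = A}. {u. u < n \<and> seg u = J + j \<and> col u = k})"
 proof
  fix u assume u: "u \<in> ?M"
  have "J \<le> seg u" unfolding seg_def using u l0 by (simp add: less_eq_div_iff_mult_less_eq)
  moreover have "seg u < J + m" unfolding seg_def using u m by (intro less_mult_imp_div_less) auto
  ultimately show "u \<in> (\<Union>j<m. \<Union>k\<in>{k. k < r \<and> \<tau> (J + j) ! k = A}. {u. u < n \<and> seg u = J + j \<and> col u = k})"
   using u col_less by (auto intro!: bexI[of _ "seg u - J"])
 qed
 hence "card ?M \<le> card (\<Union>j<m. \<Union>k\<in>{k. k < r \<and> \<tau> (J + j) ! k = A}. {u. u < n \<and> seg u = J + j \<and> col u = k})"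
  by (intro card_mono) auto
 also have "... \<le> (\<Sum>j<m. \<Sum>k\<in>{k. k < r \<and> \<tau> (J + j) ! k = A}. card {u. u < n \<and> seg u = J + j \<and> col u = k})"
  by (intro order_trans[OF card_UN_le] sum_mono card_UN_le) auto
 finally have "real (card ?M) \<le> (\<Sum>j<m. \<Sum>k\<in>{k. k < r \<and> \<tau> (J + j) ! k = A}. a j k)"
  by (simp only: a of_nat_sum[symmetric] of_nat_le_iff)
 also have "... = load r a (\<lambda>j. \<tau> (J + j)) m A"
  unfolding load_def
 proof (rule sum.cong, simp)
  fix j
  have "{k. k < r \<and> \<tau> (J + j) ! k = A} = {k\<in>{..<r}. \<tau> (J + j) ! k = A}" by auto
  thus "(\<Sum>k\<in>{k. k < r \<and> \<tau> (J + j) ! k = A}. a j k) = (\<Sum>k<r. if \<tau> (J + j) ! k = A then a j k else 0)"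
   by (simp only:) (rule sum.inter_filter, simp)
 qed
 finally show ?thesis using 1 by linarith
qed

lemma base_load_le: "base_load A \<le> occ A * l"
proof -
 have "{u. u < J * l \<and> u \<notin> YY \<and> \<tau> (seg u) ! col u = A} \<subseteq> (\<Union>j\<in>{j. j < J \<and> A \<in> set (t1 j)}. {u. seg u = j})"
 proof
  fix u assume u: "u \<in> {u. u < J * l \<and> u \<notin> YY \<and> \<tau> (seg u) ! col u = A}"
  hence "seg u < J" unfolding seg_def by (simp add: less_mult_imp_div_less)
  moreover have "u < n" using u J by simp
  ultimately show "u \<in> (\<Union>j\<in>{j. j < J \<and> A \<in> set (t1 j)}. {u. seg u = j})"
   using tau_mem[OF \<open>seg u < J\<close>, of "col u"] col_less u by auto
 qed
 hence "base_load A \<le> card (\<Union>j\<in>{j. j < J \<and> A \<in> set (t1 j)}. {u. seg u = j})"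
  unfolding base_load_def by (intro card_mono) (auto simp: card_seg)
 also have "... \<le> (\<Sum>j\<in>{j. j < J \<and> A \<in> set (t1 j)}. card {u. seg u = j})" by (rule card_UN_le) simp
 also have "... = occ A * l" by (simp add: card_seg occ_def)
 finally show ?thesis .
qed

end

lemma sum_card_fibres:
 assumes "finite S" "finite K" "\<And>u. u \<in> S ==> g u \<in> K"
 shows "(\<Sum>k\<in>K. card {u\<in>S. g u = k}) = card S"
proof -
 have "S = (\<Union>k\<in>K. {u\<in>S. g u = k})" using assms(3) by auto
 hence "card S = card (\<Union>k\<in>K. {u\<in>S. g u = k})" by simp
 also have "... = (\<Sum>k\<in>K. card {u\<in>S. g u = k})"
  using assms(1,2) by (intro card_UN_disjoint) auto
 finally show ?thesis by simp
qed

context weighted_graph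
begin

definition swap_head :: "'a list => nat => 'a list" where
 "swap_head t c = map (\<lambda>i. t ! (if i = c then 0 else if i = 0 then c else i)) [0..<length t]"

lemma swap_head:
 assumes "t \<in> cliques_in \<A> r" "c < r"
 shows "swap_head t c \<in> cliques_in \<A> r" "swap_head t c ! c = hd t"
  "k < r ==> k \<noteq> c ==> swap_head t c ! k \<in> set (tl t)"
proof -
 have t: "length t = r" "set t \<subseteq> \<A>" "clique t" using assms(1) by (auto simp: cliques_in_def)
 define \<sigma> where "\<sigma> i = (if i = c then 0 else if i = 0 then c else i)" for i
 have \<sigma>: "\<sigma> i < r" if "i < r" for i using that assms(2) by (auto simp: \<sigma>_def)
 have \<sigma>i: "\<sigma> i \<noteq> \<sigma> j" if "i \<noteq> j" for i j using that by (auto simp: \<sigma>_def)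
 have n: "swap_head t c ! i = t ! \<sigma> i" if "i < r" for i using that t by (simp add: swap_head_def \<sigma>_def)
 have len: "length (swap_head t c) = r" using t by (simp add: swap_head_def)
 have "clique (swap_head t c)"
 proof (rule cliqueI)
  fix i assume "i < length (swap_head t c)"
  thus "swap_head t c ! i \<in> \<A>" using n \<sigma> t len by auto
 next
  fix i j assume "i < length (swap_head t c)" "j < length (swap_head t c)" "i \<noteq> j"
  thus "R (swap_head t c ! i) (swap_head t c ! j)" using n \<sigma> \<sigma>i t len clique_nth[OF t(3)] by simp
 qed
 thus "swap_head t c \<in> cliques_in \<A> r" using len by (simp add: cliques_in_def clique_def)
 have "t \<noteq> []" using assms(2) t(1) by auto
 thus "swap_head t c ! c = hd t" using n[OF assms(2)] by (simp add: \<sigma>_def hd_conv_nth)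
 show "swap_head t c ! k \<in> set (tl t)" if k: "k < r" "k \<noteq> c"
 proof -
  have p: "0 < \<sigma> k" using k by (auto simp: \<sigma>_def)
  have "t ! \<sigma> k = tl t ! (\<sigma> k - 1)" using p \<sigma>[OF k(1)] t(1) by (subst nth_tl) auto
  moreover have "\<sigma> k - 1 < length (tl t)" using p \<sigma>[OF k(1)] t(1) by auto
  ultimately show ?thesis using n[OF k(1)] by simp
 qed
qed

lemma card_cliques_le:
 assumes "\<And>A. A \<in> \<A> ==> c0 * N \<le> w A" "0 < c0" "0 < N" "sum w \<A> \<le> N"
 shows "real (card (cliques_in \<A> r)) \<le> (1 / c0) ^ r"
proof -
 have "card \<A> * (c0 * N) = (\<Sum>A\<in>\<A>. c0 * N)" by simp
 also have "... \<le> sum w \<A>" by (intro sum_mono assms)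
 finally have "real (card \<A>) * (c0 * N) \<le> 1 * N" using assms(4) by simp
 hence "(real (card \<A>) * c0) * N \<le> 1 * N" by (simp add: mult.assoc)
 hence "real (card \<A>) * c0 \<le> 1" using assms(3) by (simp only: mult_le_cancel_right_pos)
 hence k: "real (card \<A>) \<le> 1 / c0" using assms(2) by (simp add: pos_le_divide_eq)
 have "card (cliques_in \<A> r) \<le> card {t. set t \<subseteq> \<A> \<and> length t = r}"
  by (intro card_mono finite_lists_length_eq finA) (auto simp: cliques_in_def)
 also have "... = card \<A> ^ r" by (rule card_lists_length_eq[OF finA])
 finally have "real (card (cliques_in \<A> r)) \<le> real (card \<A>) ^ r" by (metis of_nat_le_iff of_nat_power)
 also have "... \<le> (1 / c0) ^ r" using k by (intro power_mono) auto
 finally show ?thesis .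
qed

end

text \<open>The reserve \<open>Y\<close> creates the room: it has at least y1 n \<ge> 2 \<tau>0 n
  vertices, twice what the clusters can miss. So the other vertices of H can be balanced with the
  proportion y1/16 of each cluster left free, while every cluster keeps a linear supply of movable
  vertices in \<open>X0\<close> for every admissible \<open>J'\<close>.\<close>

lemma structure_lemma:
 fixes \<A> :: "'a set" and w :: "'a => real" and \<nu> \<xi> h0 c0 y \<kappa> \<tau>0 y1 :: real and n b \<Delta> r s B D l :: nat
 assumes wg: "weighted_graph \<A> R w \<nu>" and bg: "banded_graph n b \<Delta> r HE col"
  and r0: "0 < r" and n0: "0 < n"
  and tot: "sum w \<A> \<le> n" "(1 - \<tau>0) * n \<le> sum w \<A>"
  and gap: "real r * \<nu> + h0 * n \<le> sum w \<A>" "0 < h0" "h0 \<le> 1"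
  and cs: "\<And>A. A \<in> \<A> ==> c0 * n \<le> w A" "0 < c0" "c0 < 1"
  and B: "B = b + 1" and D: "D = 2 ^ r - 1" and l: "l = B * s" and s: "2 * (D + 4) \<le> s"
  and xi: "0 < \<xi>" "2 * \<xi> \<le> h0" "4 * real r * \<xi> \<le> 1" "8 * \<xi> \<le> 1"
  and kap: "\<kappa> * (4 * real r * (real \<Delta> + 1) ^ 3) = 1" and y: "0 < y" "4 * y \<le> \<kappa>" and yl: "1 \<le> y * l"
  and small: "(1 / c0) ^ r * l \<le> \<xi> * c0 * n"
  and y1: "y1 = y * \<xi> * h0 ^ r" and tau: "2 * \<tau>0 \<le> y1" "4 * \<tau>0 \<le> 1" "0 \<le> \<tau>0"
  and mw: "ln (2 / c0) * l \<le> (y1 / 8)\<^sup>2 * (c0 / 4) * n"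
  and tr: "real ((n div l + 1) * (D * B) + b) \<le> y1 / 16 * c0 * n"
 shows "\<exists>f X0 Y n1. (\<forall>u<n. f u \<in> \<A>) \<and> (\<forall>u v. HE u v --> R (f u) (f v)) \<and>
   X0 \<union> Y \<subseteq> {..<n1} \<and> X0 \<inter> Y = {} \<and> banded_graph.separated HE (X0 \<union> Y) \<and> n1 \<le> n \<and>
   (\<forall>A\<in>\<A>. card {u. u < n1 + b \<and> u < n \<and> f u = A} \<le> 4 * real r * \<xi> * w A) \<and>
   (\<forall>A\<in>\<A>. card {u\<in>Y. f u = A} \<le> 4 * real r * y * \<xi> * w A) \<and>
   (\<forall>A\<in>\<A>. \<forall>J'\<subseteq>\<A>. sum w (\<A> - J') \<le> \<nu> -->
    \<kappa> / 2 * \<xi> * h0 ^ (r - 1) * w A \<le> card {x\<in>X0. f x = A \<and> (\<forall>z. HE x z --> f z \<in> J')}) \<and>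
   (\<forall>A\<in>\<A>. card {u. u < n \<and> u \<notin> Y \<and> f u = A} \<le> (1 - y1 / 16) * w A)"
proof -
 interpret weighted_graph \<A> R w \<nu> by fact
 interpret banded_graph n b \<Delta> r HE col by fact
 define N where "N = real n"
 have N0: "0 < N" using n0 by (simp add: N_def)
 have wA: "c0 * N \<le> w A" if "A \<in> \<A>" for A using cs(1)[OF that] by (simp add: N_def)
 have wpos: "0 < w A" if "A \<in> \<A>" for A
 proof -
  have "0 < c0 * N" using cs(2) N0 by simp
  thus ?thesis using wA[OF that] by linarith
 qed
 have B0: "0 < B" using B by simp
 have s0: "0 < s" using s by simp
 have l0: "0 < l" using B0 s0 l by simp
 have y1pos: "0 < y1" using y1 y xi gap by simp
 have kap0: "0 < \<kappa>" using y by linarith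
 have y_le: "y \<le> 1"
 proof -
  have "1 \<le> real r * (real \<Delta> + 1) ^ 3" using r0 by (intro mult_ge1_I) (auto intro: one_le_power)
  hence "\<kappa> * 1 \<le> \<kappa> * (4 * real r * (real \<Delta> + 1) ^ 3)" using kap0 by (intro mult_left_mono) auto
  thus ?thesis using kap y by simp
 qed
 have y1_xi: "y1 \<le> \<xi>"
 proof -
  have "y * h0 ^ r \<le> 1" using y y_le gap by (intro mult_le_one power_le_one) auto
  hence "\<xi> * (y * h0 ^ r) \<le> \<xi> * 1" using xi by (intro mult_left_mono) auto
  thus ?thesis unfolding y1 by (simp add: mult.commute mult.left_commute)
 qed
 define \<K> where "\<K> = cliques_in \<A> r"
 have finK: "finite \<K>" unfolding \<K>_def by (rule finite_cliques_in) simp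
 have cardK: "real (card \<K>) * l \<le> \<xi> * c0 * N"
 proof -
  have "real (card \<K>) \<le> (1 / c0) ^ r" unfolding \<K>_def using card_cliques_le[of c0 N r] wA cs N0 tot(1) by (simp add: N_def)
  hence "real (card \<K>) * l \<le> (1 / c0) ^ r * l" by (intro mult_right_mono) auto
  thus ?thesis using small by (simp add: N_def)
 qed
 \<comment> \<open>Normalised so that \<mu>N^r segments have \<xi>N vertices. Products of weights
   sum to at most N^r and rounding adds a segment per clique, so the initial part has at most
   2\<xi>N vertices.\<close>
 define \<mu> where "\<mu> = \<xi> * N / (N ^ r * l)"
 have mu0: "0 \<le> \<mu>" using xi N0 by (simp add: \<mu>_def)
 have mul: "\<mu> * l * N ^ r = \<xi> * N" using N0 l0 by (simp add: \<mu>_def)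
 define mt where "mt t = nat \<lceil>\<mu> * prod_list (map w t)\<rceil>" for t
 have mtb: "\<mu> * prod_list (map w t) \<le> mt t" "mt t \<le> \<mu> * prod_list (map w t) + 1" if "t \<in> cliques_in \<A> r" for t
 proof -
  have "0 \<le> prod_list (map w t)" using that by (intro prod_list_w_nonneg) (auto simp: cliques_in_def)
  hence p: "0 \<le> \<mu> * prod_list (map w t)" using mu0 by simp
  show "\<mu> * prod_list (map w t) \<le> mt t" unfolding mt_def by linarith
  show "mt t \<le> \<mu> * prod_list (map w t) + 1" unfolding mt_def using p by linarith
 qed
 define J where "J = sum mt \<K>"
 obtain t1 where t1: "\<And>j. j < J ==> t1 j \<in> \<K>" "\<And>t. t \<in> \<K> ==> card {j. j < J \<and> t1 j = t} = mt t"
  using multiplicity_sequence[OF finK, of mt] unfolding J_def by blast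
 have Jl: "real J * l \<le> 2 * \<xi> * N"
 proof -
  have "real J \<le> (\<Sum>t\<in>\<K>. \<mu> * prod_list (map w t) + 1)" unfolding J_def of_nat_sum using mtb by (intro sum_mono) (auto simp: \<K>_def)
  also have "... = \<mu> * (\<Sum>t\<in>\<K>. prod_list (map w t)) + card \<K>" by (simp add: sum.distrib sum_distrib_left)
  also have "... \<le> \<mu> * N ^ r + card \<K>"
  proof (intro add_right_mono mult_left_mono mu0)
   have "(\<Sum>t\<in>\<K>. prod_list (map w t)) \<le> (\<Sum>t\<in>{t. length t = r \<and> set t \<subseteq> \<A>}. prod_list (map w t))"
   proof (rule sum_mono2)
    show "finite {t. length t = r \<and> set t \<subseteq> \<A>}" using finite_lists_length_eq[OF finA, of r] by (simp add: conj_commute)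
   qed (use prod_list_w_nonneg in \<open>auto simp: \<K>_def cliques_in_def\<close>)
   also have "... = sum w \<A> ^ r" by (rule sum_prod_lists[OF finA])
   also have "... \<le> N ^ r" using tot(1) w_nonneg by (intro power_mono sum_nonneg) (auto simp: N_def)
   finally show "(\<Sum>t\<in>\<K>. prod_list (map w t)) \<le> N ^ r" .
  qed
  finally have "real J * l \<le> (\<mu> * N ^ r + card \<K>) * l" by (intro mult_right_mono) auto
  also have "... = \<mu> * l * N ^ r + real (card \<K>) * l" by (simp add: algebra_simps)
  also have "... \<le> \<xi> * N + \<xi> * c0 * N" unfolding mul using cardK by simp
  also have "\<xi> * c0 * N \<le> \<xi> * 1 * N" using cs xi N0 by (intro mult_right_mono mult_left_mono) auto
  finally show ?thesis by (simp add: algebra_simps)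
 qed
 have Jn: "J * l \<le> n"
 proof -
  have "2 * \<xi> * N \<le> 1 * N" using xi gap N0 by (intro mult_right_mono) auto
  hence "real (J * l) \<le> real n" using Jl by (simp add: N_def)
  thus ?thesis by (simp only: of_nat_le_iff)
 qed
 \<comment> \<open>By the choice of \<kappa> each segment contains a monochromatic separated set of
   at least 2\<kappa>l vertices past the walk, enough for xx after rounding up.\<close>
 define xx yy :: nat where "xx = nat \<lceil>\<kappa> * l\<rceil>" and "yy = nat \<lceil>y * l\<rceil>"
 have kl: "4 * (y * l) \<le> \<kappa> * l" using mult_right_mono[OF y(2), of "real l"] by simp
 have xxb: "\<kappa> * l \<le> xx" "xx \<le> 2 * \<kappa> * l" using kl yl unfolding xx_def by linarith+
 have yyb: "y * l \<le> yy" "yy \<le> 2 * y * l" using yl unfolding yy_def by linarith+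
 have xy: "\<kappa> / 2 * l \<le> real xx - real yy" "yy \<le> xx" using xxb yyb kl yl by linarith+
 define Q where "Q j X c Y \<longleftrightarrow> X \<subseteq> {j * l + (D + 4) * B..<Suc j * l} \<and> separated X \<and> (\<forall>x\<in>X. col x = c) \<and> c < r \<and>
   card X = xx \<and> Y \<subseteq> X \<and> card Y = yy" for j X c and Y :: "nat set"
 have "\<exists>X c Y. Q j X c Y" if j: "j < J" for j
 proof -
  define Wj where "Wj = {j * l + (D + 4) * B..<Suc j * l}"
  have "Suc j * l \<le> J * l" using j by (intro mult_right_mono) auto
  hence Wn: "Wj \<subseteq> {..<n}" using Jn by (auto simp: Wj_def)
  have DB: "2 * ((D + 4) * B) \<le> l" using mult_right_mono[OF s, of B] l by (simp add: mult.commute mult.left_commute)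
  have "card Wj = l - (D + 4) * B" by (simp add: Wj_def)
  hence cW: "l \<le> 2 * card Wj" using DB by linarith
  hence "0 < card Wj" using l0 by linarith
  hence "Wj \<noteq> {}" by auto
  then obtain X0 c where X0: "X0 \<subseteq> Wj" "c < r" "separated X0" "\<forall>x\<in>X0. col x = c" "card Wj \<le> card X0 * (r * (\<Delta> + 1) ^ 3)"
   using monochromatic_separated_exists[OF Wn] by blast
  have "real l \<le> 2 * real (card Wj)" using cW by linarith
  also have "real (card Wj) \<le> real (card X0) * (real r * (real \<Delta> + 1) ^ 3)"
   using X0(5) by (metis (no_types, lifting) of_nat_1 of_nat_add of_nat_le_iff of_nat_mult of_nat_power)
  finally have "2 * \<kappa> * l \<le> 2 * \<kappa> * (2 * (real (card X0) * (real r * (real \<Delta> + 1) ^ 3)))"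
   using kap0 by (intro mult_left_mono) auto
  also have "... = card X0 * (\<kappa> * (4 * real r * (real \<Delta> + 1) ^ 3))" by (simp add: algebra_simps)
  finally have "2 * \<kappa> * l \<le> card X0" by (simp only: kap mult_1_right)
  hence "xx \<le> card X0" using xxb(2) by linarith
  then obtain X where X: "X \<subseteq> X0" "card X = xx" by (meson obtain_subset_with_card_n)
  obtain Y where Y: "Y \<subseteq> X" "card Y = yy" using xy(2) X(2) by (metis obtain_subset_with_card_n)
  have "Q j X c Y" using X Y X0 separated_subset[OF X0(3) X(1)] unfolding Q_def Wj_def by blast
  thus ?thesis by blast
 qed
 hence "\<forall>j. \<exists>X c Y. j < J --> Q j X c Y" by blast
 then obtain X c Y where XcY: "\<And>j. j < J ==> Q j (X j) (c j) (Y j)" by metis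
 define \<tau>1 where "\<tau>1 j = swap_head (t1 j) (c j)" for j
 have cr: "c j < r" if "j < J" for j using XcY[OF that] by (simp add: Q_def)
 have \<tau>1: "\<tau>1 j \<in> cliques_in \<A> r" "\<tau>1 j ! c j = hd (t1 j)" "k < r ==> k \<noteq> c j ==> \<tau>1 j ! k \<in> set (tl (t1 j))"
  if "j < J" for j k
  using swap_head[of "t1 j" r "c j"] t1(1)[OF that] cr[OF that] unfolding \<tau>1_def \<K>_def by blast+
 have conn: "real r * \<nu> < sum w \<A>"
 proof -
  have "0 < h0 * n" using gap n0 by simp
  thus ?thesis using gap by linarith
 qed
 have Ds: "2 ^ r - 1 < s" using s D by simp
 have phased: "\<exists>T. phased_assignment \<A> R w \<nu> n b \<Delta> r HE col s T \<tau> B D l J xx yy t1 X Y c mt \<mu> N"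
  if t: "\<And>j. \<tau> j \<in> cliques_in \<A> r" "\<And>j. j < J ==> \<tau> j = \<tau>1 j" for \<tau>
 proof -
  obtain T where T: "\<And>k. T k \<in> cliques_in \<A> r" "\<And>k. compat (T k) (T (Suc k))"
   "\<And>k. 2 ^ r - 1 \<le> k mod s ==> T k = \<tau> (k div s)" "\<And>j. T (Suc j * s) = \<tau> j"
   using walk_sequence[of r \<tau> s, OF conn t(1) Ds] by blast
  have "phased_assignment \<A> R w \<nu> n b \<Delta> r HE col s T \<tau> B D l J xx yy t1 X Y c mt \<mu> N"
  proof (unfold_locales, goal_cases)
   case 4 show ?case using Ds D by simp
  next
   case (7 k) thus ?case using T(3) D by simp
  next
   case (9 j) thus ?case using t1(1) by (simp add: \<K>_def)
  next
   case (10 t) thus ?case using t1(2) by (simp add: \<K>_def)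
  next
   case 15 show ?case using tot by (simp add: N_def)
  next
   case (16 j) thus ?case using XcY by (simp add: Q_def)
  next
   case (17 j) thus ?case using XcY by (simp add: Q_def)
  next
   case (18 j x) thus ?case using XcY by (simp add: Q_def)
  next
   case (20 j) thus ?case using XcY by (simp add: Q_def)
  next
   case (21 j) thus ?case using XcY by (simp add: Q_def)
  next
   case (22 j) thus ?case using XcY by (simp add: Q_def)
  next
   case (23 j) thus ?case using t(2) \<tau>1(2) by simp
  next
   case (24 j k) thus ?case using t(2) \<tau>1(3) by simp
  qed (use B D l T mtb Jn mu0 cr r0 in auto)
  thus ?thesis by blast
 qed
 obtain d where d: "d \<in> cliques_in \<A> r"
 proof -
  have "(real r - 1) * \<nu> < sum w \<A>" using conn nu_nonneg by (simp add: algebra_simps)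
  then obtain t where "length t = r" "set t \<subseteq> \<A>" "clique t" using clique_exists[of \<A> r] by blast
  thus ?thesis using that by (simp add: cliques_in_def)
 qed
 \<comment> \<open>A provisional assignment with a fixed clique \<open>d\<close> after the initial
   part. It determines the base loads; the later cliques are then chosen against the remaining
   capacities, and the assignment is built anew.\<close>
 define \<tau>' where "\<tau>' j = (if j < J then \<tau>1 j else d)" for j
 obtain T' where P': "phased_assignment \<A> R w \<nu> n b \<Delta> r HE col s T' \<tau>' B D l J xx yy t1 X Y c mt \<mu> N"
 proof -
  have "\<tau>' j \<in> cliques_in \<A> r" for j using \<tau>1(1)[of j] d by (simp add: \<tau>'_def)
  moreover have "j < J ==> \<tau>' j = \<tau>1 j" for j by (simp add: \<tau>'_def)
  ultimately show ?thesis using phased[of \<tau>'] that by blast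
 qed
 interpret P: phased_assignment \<A> R w \<nu> n b \<Delta> r HE col s T' \<tau>' B D l J xx yy t1 X Y c mt \<mu> N by (rule P')
 have occl: "real (P.occ A) * l \<le> 2 * real r * \<xi> * w A" if A: "A \<in> \<A>" for A
 proof -
  have "real (P.occ A) * l \<le> (\<mu> * (real r * w A * N ^ (r - 1)) + card \<K>) * l"
   unfolding \<K>_def by (intro mult_right_mono P.occ_le A) auto
  also have "... = real r * w A * (\<mu> * l * N ^ (r - 1)) + real (card \<K>) * l" by (simp add: algebra_simps)
  also have "\<mu> * l * N ^ (r - 1) = \<xi>"
  proof -
   have "N ^ r = N * N ^ (r - 1)" using r0 by (cases r) auto
   hence "N * (\<mu> * l * N ^ (r - 1)) = N * \<xi>" using mul by (simp add: algebra_simps)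
   thus ?thesis using N0 by simp
  qed
  also have "real (card \<K>) * l \<le> 1 * (\<xi> * w A)"
  proof -
   have "\<xi> * c0 * N \<le> \<xi> * w A" using mult_left_mono[OF wA[OF A], of \<xi>] xi by (simp add: mult.assoc)
   thus ?thesis using cardK by linarith
  qed
  also have "1 * (\<xi> * w A) \<le> real r * (\<xi> * w A)" using r0 xi wpos[OF A] by (intro mult_right_mono) auto
  finally show ?thesis by (simp add: algebra_simps)
 qed
 define base where "base A = P.base_load A" for A
 have base_le: "real (base A) \<le> w A / 2" if A: "A \<in> \<A>" for A
 proof -
  have "real (base A) \<le> real (P.occ A * l)" unfolding base_def by (intro of_nat_mono P.base_load_le)
  also have "... \<le> 2 * real r * \<xi> * w A" using occl[OF A] by simp
  also have "... \<le> 1 / 2 * w A" using xi wpos[OF A] by (intro mult_right_mono) auto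
  finally show ?thesis by simp
 qed
 define YY where "YY = P.YY"
 have cYY: "card YY = J * yy" unfolding YY_def by (rule P.card_YY)
 have YYl: "YY \<subseteq> {..<J * l}" using P.YY_XX(1) P.XX_less unfolding YY_def by blast
 have base_sum: "(\<Sum>A\<in>\<A>. real (base A)) = real J * l - real J * yy"
 proof -
  let ?S = "{u. u < J * l \<and> u \<notin> YY}"
  have "(\<Sum>A\<in>\<A>. card {u\<in>?S. \<tau>' (P.seg u) ! col u = A}) = card ?S"
  proof (rule sum_card_fibres)
   fix u assume u: "u \<in> ?S"
   have "\<tau>' (P.seg u) \<in> cliques_in \<A> r" using \<tau>1 d by (auto simp: \<tau>'_def)
   moreover have "col u < r" using u Jn col_less by auto
   ultimately show "\<tau>' (P.seg u) ! col u \<in> \<A>" by (auto simp: cliques_in_def)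
  qed (auto simp: finA)
  moreover have "{u\<in>?S. \<tau>' (P.seg u) ! col u = A} = {u. u < J * l \<and> u \<notin> P.YY \<and> \<tau>' (P.seg u) ! col u = A}" for A
   by (auto simp: YY_def)
  ultimately have e: "(\<Sum>A\<in>\<A>. base A) = card ?S" by (simp add: base_def P.base_load_def)
  have "?S = {..<J * l} - YY" by auto
  hence "card ?S = J * l - J * yy" using YYl cYY by (simp add: card_Diff_subset finite_subset)
  moreover have "J * yy \<le> J * l" using card_mono[OF _ YYl] cYY by simp
  ultimately have "real (card ?S) = real J * l - real J * yy" by (simp add: of_nat_diff)
  thus ?thesis using e by (metis of_nat_sum)
 qed
 define cap where "cap A = w A - base A" for A
 have cap_half: "w A / 2 \<le> cap A" "cap A \<le> w A" if "A \<in> \<A>" for A using base_le[OF that] by (auto simp: cap_def)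
 define capt where "capt = sum cap \<A>"
 have capt_eq: "capt = sum w \<A> - real J * l + real J * yy"
  using base_sum by (simp add: capt_def cap_def sum_subtractf)
 have Jyy: "y1 * N \<le> real J * yy"
 proof -
  have "\<mu> * (h0 * N) ^ r \<le> J"
  proof (rule P.J_ge)
   show "(real r - 1) * \<nu> + h0 * N \<le> sum w \<A>" using gap nu_nonneg by (simp add: N_def algebra_simps)
  qed (use gap N0 in simp)
  hence "\<mu> * (h0 * N) ^ r * (y * l) \<le> real J * yy" using yyb y mu0 gap N0 by (intro mult_mono) auto
  moreover have "\<mu> * (h0 * N) ^ r * (y * l) = y * h0 ^ r * (\<mu> * l * N ^ r)" by (simp add: power_mult_distrib algebra_simps)
  moreover have "y1 * N = y * h0 ^ r * (\<mu> * l * N ^ r)" unfolding mul y1 by simp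
  ultimately show ?thesis by linarith
 qed
 have capt_le: "capt \<le> N"
 proof -
  have "capt \<le> sum w \<A>" unfolding capt_def using cap_half by (intro sum_mono) auto
  thus ?thesis using tot by (simp add: N_def)
 qed
 have y1N: "0 < y1 * N" using y1pos N0 by simp
 have tauN: "\<tau>0 * N \<le> y1 / 2 * N" "\<tau>0 * N \<le> 1 / 4 * N" using tau N0 by (auto intro!: mult_right_mono)
 have totN: "N - \<tau>0 * N \<le> sum w \<A>" using tot(2) by (simp add: N_def algebra_simps)
 \<comment> \<open>The reserve frees y1 N places and the clusters miss at most y1/2 N, so capacity
   exceeds the N - J l remaining vertices by y1/2 N.\<close>
 have capt_ge: "N - real J * l + y1 / 2 * N \<le> capt"
  unfolding capt_eq using totN Jyy tauN(1) by simp
 have xiN: "2 * \<xi> * N \<le> 1 / 4 * N" using xi N0 by (intro mult_right_mono) auto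
 have capt_half: "N / 2 \<le> capt"
  using capt_ge Jl xiN y1N N0 by linarith
 \<comment> \<open>Capacities do not exceed weights, hence the same \<nu> bounds the missing
   capacity.\<close>
 interpret C: weighted_graph \<A> R cap \<nu>
 proof
  show "finite \<A>" by (rule finA)
  show "0 \<le> cap A" if "A \<in> \<A>" for A using cap_half[OF that] wpos[OF that] by linarith
  show "R A B ==> R B A" for A B by (rule R_sym)
  show "sum cap {B\<in>\<A>. \<not> R A B} \<le> \<nu>" if "A \<in> \<A>" for A
  proof -
   have "sum cap {B\<in>\<A>. \<not> R A B} \<le> sum w {B\<in>\<A>. \<not> R A B}" using cap_half by (intro sum_mono) auto
   thus ?thesis using deficiency[OF that] by linarith
  qed
  show "0 \<le> \<nu>" by (rule nu_nonneg)
 qed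
 define a where "a j k = real (card {u. u < n \<and> P.seg u = J + j \<and> col u = k})" for j k
 have a_row: "(\<Sum>k<r. a j k) = card {u. u < n \<and> P.seg u = J + j}" for j
 proof -
  have "(\<Sum>k<r. card {u\<in>{u. u < n \<and> P.seg u = J + j}. col u = k}) = card {u. u < n \<and> P.seg u = J + j}"
   by (rule sum_card_fibres) (auto simp: col_less)
  moreover have "{u\<in>{u. u < n \<and> P.seg u = J + j}. col u = k} = {u. u < n \<and> P.seg u = J + j \<and> col u = k}" for k by auto
  ultimately show ?thesis unfolding a_def by (metis (no_types, lifting) of_nat_sum sum.cong)
 qed
 have a_L: "(\<Sum>k<r. a j k) \<le> l" for j
 proof -
  have "card {u. u < n \<and> P.seg u = J + j} \<le> card {u. P.seg u = J + j}" using P.card_seg by (intro card_mono) auto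
  thus ?thesis unfolding a_row using P.card_seg by simp
 qed
 have nm: "n \<le> (J + n) * l"
 proof -
  have "n * 1 \<le> (J + n) * l" by (rule mult_le_mono) (use l0 in auto)
  thus ?thesis by simp
 qed
 have a_tot: "(\<Sum>j<n. \<Sum>k<r. a j k) = N - real J * l"
 proof -
  let ?S = "{u. J * l \<le> u \<and> u < n}"
  have sg: "J \<le> P.seg u \<longleftrightarrow> J * l \<le> u" for u unfolding P.seg_def using l0 by (simp add: less_eq_div_iff_mult_less_eq)
  have "(\<Sum>j<n. card {u\<in>?S. P.seg u - J = j}) = card ?S"
  proof (rule sum_card_fibres)
   fix u assume u: "u \<in> ?S"
   have "P.seg u < J + n" unfolding P.seg_def using u nm by (intro less_mult_imp_div_less) auto
   thus "P.seg u - J \<in> {..<n}" using n0 by auto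
  qed auto
  moreover have "{u\<in>?S. P.seg u - J = j} = {u. u < n \<and> P.seg u = J + j}" for j using sg by force
  ultimately have "(\<Sum>j<n. card {u. u < n \<and> P.seg u = J + j}) = card ?S" by simp
  moreover have "?S = {J * l..<n}" by auto
  ultimately have "(\<Sum>j<n. card {u. u < n \<and> P.seg u = J + j}) = n - J * l" by simp
  hence "(\<Sum>j<n. real (card {u. u < n \<and> P.seg u = J + j})) = real (n - J * l)" unfolding of_nat_sum[symmetric] by simp
  thus ?thesis unfolding a_row using Jn by (simp add: N_def of_nat_diff)
 qed
 have "\<exists>t. (\<forall>j<n. t j \<in> C.cliques_in \<A> r) \<and>
   (\<forall>A\<in>\<A>. C.load r a t n A \<le> cap A * ((\<Sum>j<n. \<Sum>k<r. a j k) / sum cap \<A> + 2 * (y1 / 8)))"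
 proof (rule C.balanced_cliques[where L = "real l" and ?c0.0 = "c0 / 2"])
  show "0 < sum cap \<A>" using capt_half N0 by (simp add: capt_def)
  have "h0 * N \<le> sum w \<A> - real r * \<nu>" using gap by (simp add: N_def)
  moreover have "2 * \<xi> * N \<le> h0 * N" using xi N0 by (intro mult_right_mono) auto
  moreover have "0 \<le> real J * yy" by simp
  ultimately show "real r * \<nu> \<le> sum cap \<A>" using capt_eq Jl unfolding capt_def by linarith
  show "c0 / 2 * sum cap \<A> \<le> cap A" if "A \<in> \<A>" for A
  proof -
   have "c0 / 2 * sum cap \<A> \<le> c0 / 2 * N" using capt_le cs by (intro mult_left_mono) (auto simp: capt_def)
   thus ?thesis using cap_half(1)[OF that] wA[OF that] by linarith
  qed
  have "y1 \<le> 1" using y1_xi xi by linarith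
  thus "y1 / 8 \<le> 1" by simp
  have "ln (2 / c0) * l \<le> (y1 / 8)\<^sup>2 * (c0 / 4) * N" using mw by (simp add: N_def)
  also have "... = (y1 / 8)\<^sup>2 * (c0 / 2) * (N / 2)" by simp
  also have "... \<le> (y1 / 8)\<^sup>2 * (c0 / 2) * capt" using capt_half cs by (intro mult_left_mono) auto
  finally show "ln (1 / (c0 / 2)) * l \<le> (y1 / 8)\<^sup>2 * (c0 / 2) * sum cap \<A>" by (simp add: capt_def)
  show "(\<Sum>j<n. \<Sum>k<r. a j k) \<le> sum cap \<A>" unfolding a_tot using capt_ge y1N by (simp add: capt_def)
 qed (use r0 cs y1pos a_L in \<open>auto simp: a_def\<close>)
 then obtain t2 where t2: "\<And>j. j < n ==> t2 j \<in> C.cliques_in \<A> r" and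
  load2: "\<And>A. A \<in> \<A> ==> C.load r a t2 n A \<le> cap A * ((N - real J * l) / capt + 2 * (y1 / 8))"
  unfolding a_tot capt_def by blast
 define \<tau> where "\<tau> j = (if j < J then \<tau>1 j else if j < J + n then t2 (j - J) else d)" for j
 have "\<tau> j \<in> cliques_in \<A> r" for j
 proof (cases "j < J")
  case True thus ?thesis using \<tau>1(1) by (simp add: \<tau>_def)
 next
  case F: False
  show ?thesis
  proof (cases "j < J + n")
   case True
   hence "j - J < n" using F by linarith
   hence "t2 (j - J) \<in> cliques_in \<A> r" by (rule t2)
   thus ?thesis using F True by (simp add: \<tau>_def)
  qed (use F d in \<open>simp add: \<tau>_def\<close>)
 qed
 moreover have "j < J ==> \<tau> j = \<tau>1 j" for j by (simp add: \<tau>_def)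
 ultimately obtain T where P2: "phased_assignment \<A> R w \<nu> n b \<Delta> r HE col s T \<tau> B D l J xx yy t1 X Y c mt \<mu> N"
  using phased[of \<tau>] by blast
 interpret F: phased_assignment \<A> R w \<nu> n b \<Delta> r HE col s T \<tau> B D l J xx yy t1 X Y c mt \<mu> N by (rule P2)
 have YY_eq: "F.YY = YY" by (simp add: YY_def F.YY_def P.YY_def)
 have base_eq: "F.base_load A = base A" for A
 proof -
  have "\<tau> (P.seg u) = \<tau>' (P.seg u)" if "u < J * l" for u
  proof -
   have "P.seg u < J" unfolding P.seg_def using that by (simp add: less_mult_imp_div_less)
   thus ?thesis by (simp add: \<tau>_def \<tau>'_def)
  qed
  hence "{u. u < J * l \<and> u \<notin> YY \<and> \<tau> (P.seg u) ! col u = A} = {u. u < J * l \<and> u \<notin> YY \<and> \<tau>' (P.seg u) ! col u = A}" by auto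
  thus ?thesis unfolding base_def F.base_load_def P.base_load_def YY_def by simp
 qed
 have trb: "real ((n div l + 1) * (D * B) + b) \<le> y1 / 16 * w A" if "A \<in> \<A>" for A
 proof -
  have "y1 / 16 * (c0 * N) \<le> y1 / 16 * w A" by (intro mult_left_mono wA that) (use y1pos in simp)
  moreover have "y1 / 16 * c0 * real n = y1 / 16 * (c0 * N)" by (simp add: N_def)
  ultimately show ?thesis using tr by linarith
 qed
 \<comment> \<open>Balancing leaves cap A y1/4 \<ge> w A y1/8 free in cluster A; the vertices in
   transit take at most half of that.\<close>
 have final_load: "card {u. u < n \<and> u \<notin> YY \<and> F.hom u = A} \<le> (1 - y1 / 16) * w A" if A: "A \<in> \<A>" for A
 proof -
  have 1: "real (card {u. u < n \<and> u \<notin> YY \<and> F.hom u = A}) \<le> base A + load r a (\<lambda>j. \<tau> (J + j)) n A + (n div l + 1) * (D * B)"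
   using F.load_le[OF nm, of a A] unfolding YY_eq base_eq by (simp add: a_def)
  have 2: "load r a (\<lambda>j. \<tau> (J + j)) n A = load r a t2 n A"
   unfolding load_def by (intro sum.cong refl) (simp add: \<tau>_def)
  have 3: "load r a t2 n A \<le> cap A * (1 - y1 / 4)"
  proof -
   have "(N - real J * l) / capt \<le> 1 - y1 / 2"
   proof -
    have c0': "0 < capt" using capt_half N0 by linarith
    have "y1 / 2 * capt \<le> y1 / 2 * N" using capt_le y1pos by (intro mult_left_mono) auto
    hence "N - real J * l \<le> (1 - y1 / 2) * capt" using capt_ge by (simp add: algebra_simps)
    thus ?thesis using c0' by (simp add: pos_divide_le_eq)
   qed
   hence "cap A * ((N - real J * l) / capt + 2 * (y1 / 8)) \<le> cap A * (1 - y1 / 4)"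
    using cap_half(1)[OF A] wpos[OF A] by (intro mult_left_mono) auto
   thus ?thesis using load2[OF A] by linarith
  qed
  have 4: "real (base A) + cap A * (1 - y1 / 4) = w A - cap A * (y1 / 4)"
   by (simp add: cap_def algebra_simps)
  have 5: "w A / 2 * (y1 / 4) \<le> cap A * (y1 / 4)" using cap_half(1)[OF A] y1pos by (intro mult_right_mono) auto
  have 6: "real ((n div l + 1) * (D * B)) \<le> y1 / 16 * w A" using trb[OF A] by simp
  have "real (card {u. u < n \<and> u \<notin> YY \<and> F.hom u = A}) \<le> w A - w A / 2 * (y1 / 4) + y1 / 16 * w A"
   using 1 2 3 4 5 6 by linarith
  also have "... = (1 - y1 / 16) * w A" by (simp add: algebra_simps)
  finally show ?thesis .
 qed
 show ?thesis
 proof (rule exI[of _ F.hom], rule exI[of _ F.X0], rule exI[of _ YY], rule exI[of _ "J * l"], intro conjI ballI allI impI)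
  show "u < n ==> F.hom u \<in> \<A>" for u by (rule F.hom_mem)
  show "HE u v ==> R (F.hom u) (F.hom v)" for u v by (rule F.hom_hom)
  have "F.X0 \<union> YY \<subseteq> F.XX" using F.YY_XX unfolding YY_eq by simp
  moreover have "F.XX \<subseteq> {..<J * l}" using F.XX_less by auto
  ultimately show "F.X0 \<union> YY \<subseteq> {..<J * l}" by (rule subset_trans)
  show "F.X0 \<inter> YY = {}" using F.YY_XX(3) unfolding YY_eq .
  show "separated (F.X0 \<union> YY)" 
  proof (rule separated_subset[OF F.separated_XX])
   show "F.X0 \<union> YY \<subseteq> F.XX" using F.YY_XX unfolding YY_eq by simp
  qed
  show "J * l \<le> n" by (rule Jn)
  fix A assume A: "A \<in> \<A>"
  show "card {u. u < J * l + b \<and> u < n \<and> F.hom u = A} \<le> 4 * real r * \<xi> * w A"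
  proof -
   have "J \<le> n div l" using Jn l0 by (simp add: less_eq_div_iff_mult_less_eq)
   hence "(J + 1) * (D * B) + b \<le> (n div l + 1) * (D * B) + b" by (intro add_mono mult_right_mono) auto
   hence "real ((J + 1) * (D * B) + b) \<le> y1 / 16 * w A" using trb[OF A] by linarith
   also have "... \<le> 2 * real r * \<xi> * w A"
   proof (rule mult_right_mono)
    have "1 * \<xi> \<le> real r * \<xi>" using r0 xi by (intro mult_right_mono) auto
    thus "y1 / 16 \<le> 2 * real r * \<xi>" using y1_xi xi by linarith
   qed (use wpos[OF A] in simp)
   finally have 1: "real ((J + 1) * (D * B) + b) \<le> 2 * real r * \<xi> * w A" .
   have "real (card {u. u < J * l + b \<and> u < n \<and> F.hom u = A}) \<le> real (P.occ A * l + ((J + 1) * (D * B) + b))"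
    using F.early_le[of A] by (intro of_nat_mono)
   also have "... = real (P.occ A) * l + real ((J + 1) * (D * B) + b)" by simp
   finally show ?thesis using 1 occl[OF A] by simp
  qed
  show "card {u\<in>YY. F.hom u = A} \<le> 4 * real r * y * \<xi> * w A"
  proof -
   have "real (card {u\<in>YY. F.hom u = A}) \<le> real (P.occ A) * yy"
    using F.Y_load_le[of A] unfolding YY_eq by (metis of_nat_le_iff of_nat_mult)
   also have "... \<le> real (P.occ A) * (2 * y * l)" using yyb by (intro mult_left_mono) auto
   also have "... = 2 * y * (real (P.occ A) * l)" by simp
   also have "... \<le> 2 * y * (2 * real r * \<xi> * w A)" using occl[OF A] y by (intro mult_left_mono) auto
   finally show ?thesis by (simp add: algebra_simps)
  qed
  show "card {u. u < n \<and> u \<notin> YY \<and> F.hom u = A} \<le> (1 - y1 / 16) * w A" by (rule final_load[OF A])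
  fix J' assume J': "J' \<subseteq> \<A>" "sum w (\<A> - J') \<le> \<nu>"
  show "\<kappa> / 2 * \<xi> * h0 ^ (r - 1) * w A \<le> card {x\<in>F.X0. F.hom x = A \<and> (\<forall>z. HE x z --> F.hom z \<in> J')}"
  proof -
   have "\<mu> * (w A * (h0 * N) ^ (r - 1)) * (real xx - real yy) \<le> card {x\<in>F.X0. F.hom x = A \<and> (\<forall>z. HE x z --> F.hom z \<in> J')}"
    using gap N0 by (intro F.swap_count A J') (auto simp: N_def)
   moreover have "\<mu> * (w A * (h0 * N) ^ (r - 1)) * (\<kappa> / 2 * l) \<le> \<mu> * (w A * (h0 * N) ^ (r - 1)) * (real xx - real yy)"
    using xy(1) mu0 wpos[OF A] gap N0 by (intro mult_left_mono mult_nonneg_nonneg) auto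
   moreover have e1: "\<mu> * (w A * (h0 * N) ^ (r - 1)) * (\<kappa> / 2 * l) = \<kappa> / 2 * (\<mu> * l * N ^ (r - 1)) * h0 ^ (r - 1) * w A"
    by (simp add: power_mult_distrib algebra_simps)
   moreover have e2: "\<mu> * l * N ^ (r - 1) = \<xi>"
   proof -
    have "N ^ r = N * N ^ (r - 1)" using r0 by (cases r) auto
    hence "N * (\<mu> * l * N ^ (r - 1)) = N * \<xi>" using mul by (simp add: algebra_simps)
    thus ?thesis using N0 by simp
   qed
   moreover have "\<kappa> / 2 * \<xi> * h0 ^ (r - 1) * w A = \<mu> * (w A * (h0 * N) ^ (r - 1)) * (\<kappa> / 2 * l)"
    unfolding e1 e2 ..
   ultimately show ?thesis by linarith
  qed
 qed
qed

section \<open>Random greedy embedding\<close>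

definition avg :: "'a set => ('a => real) => real" where
 "avg S F = (\<Sum>a\<in>S. F a) / real (card S)"

lemma avg_mono: "(\<And>a. a \<in> S ==> F a \<le> G a) ==> avg S F \<le> avg S G"
 unfolding avg_def by (intro divide_right_mono sum_mono) auto

lemma avg_const: "finite S ==> S \<noteq> {} ==> avg S (\<lambda>_. c) = c"
 by (simp add: avg_def)

lemma avg_add: "avg S (\<lambda>a. F a + G a) = avg S F + avg S G"
 by (simp add: avg_def sum.distrib add_divide_distrib)

lemma avg_cmult: "avg S (\<lambda>a. c * F a) = c * avg S F"
 by (simp add: avg_def sum_distrib_left[symmetric])

lemma avg_lower:
 assumes "finite S" "S \<noteq> {}" "Gd \<subseteq> S" "\<And>a. a \<in> S ==> 0 \<le> F a" "\<And>a. a \<in> Gd ==> q \<le> F a" "0 \<le> q"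
  "c * real (card S) \<le> real (card Gd)"
 shows "c * q \<le> avg S F"
proof -
 have pos: "0 < real (card S)" using assms(1,2) by (simp add: card_gt_0_iff)
 have "c * q * real (card S) = (c * real (card S)) * q" by simp
 also have "... \<le> real (card Gd) * q" using assms(6,7) by (intro mult_right_mono)
 also have "... = (\<Sum>a\<in>Gd. q)" by simp
 also have "... \<le> (\<Sum>a\<in>Gd. F a)" by (intro sum_mono assms)
 also have "... \<le> (\<Sum>a\<in>S. F a)" using assms by (intro sum_mono2) auto
 finally show ?thesis using pos by (simp add: avg_def pos_le_divide_eq)
qed

lemma avg_single:
 assumes "finite S" "\<And>a. a \<in> S ==> F a \<le> (if a = x then q else 0)" "K \<le> real (card S)" "0 < K" "0 \<le> q"
 shows "avg S F \<le> q / K"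
proof -
 have "(\<Sum>a\<in>S. F a) \<le> (\<Sum>a\<in>S. if a = x then q else 0)" by (intro sum_mono assms)
 also have "... \<le> q" using assms(1,5) by (simp add: sum.delta)
 finally have "avg S F \<le> q / real (card S)" unfolding avg_def by (intro divide_right_mono) auto
 also have "... \<le> q / K" using assms(3-5) by (intro divide_left_mono) auto
 finally show ?thesis .
qed

text \<open>Vertices below \<open>n2\<close> may be embedded in any order, the others in ascending
  order. \<open>early\<close> makes collisions among the former negligible, \<open>load\<close>
  keeps a proportion e1 of each cluster free for the latter, and \<open>bsmall\<close> makes the
  last b places negligible.\<close>

locale embedding = banded_graph n b \<Delta> r HE col
 for n b \<Delta> r HE col +
 fixes g :: "'b => 'b => bool" and f :: "nat => 'b set" and Y :: "nat set" and n2 :: nat and d \<delta> e1 :: real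
 assumes g_sym: "g x y ==> g y x"
  and fin_f: "u < n ==> finite (f u)" "u < n ==> f u \<noteq> {}"
  and disj: "u < n ==> v < n ==> f u = f v \<or> f u \<inter> f v = {}"
  and typical: "HE u v ==> typical_pair g d \<delta> (f u) (f v)"
  and d: "0 < d" "d \<le> 1" and e1: "0 < e1" "e1 \<le> 1"
  and load: "u < n ==> real (card {w. w < n \<and> w \<notin> Y \<and> f w = f u}) \<le> (1 - e1) * real (card (f u))"
  and early: "u < n ==> real (card {w. w < n2 + b \<and> w < n \<and> f w = f u}) \<le> d ^ (\<Delta> + 1) / 4 * real (card (f u))"
  and bsmall: "u < n ==> real b \<le> d ^ (\<Delta> + 1) * e1 / 4 * real (card (f u))"
  and dsmall: "real \<Delta> * \<delta> \<le> d ^ (\<Delta> + 1) * e1 / 8" "\<delta> \<le> d ^ (\<Delta> + 1) * e1"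
begin

text \<open>Vertices that, if embedded at all, precede every neighbour of \<open>z\<close>; their
  places are excluded from the candidates of \<open>z\<close>. All other occupied places are avoided
  only when \<open>z\<close> itself is embedded. So once a neighbour of \<open>z\<close> is
  embedded, the candidates change through neighbours of \<open>z\<close> alone.\<close>

definition far :: "nat => nat set" where
 "far z = (if z < n2 + b then {} else {w. w + b < z})"

definition cand :: "nat set => (nat => 'b) => nat => 'b set" where
 "cand D \<phi> z = {a \<in> f z. a \<notin> \<phi> ` (D \<inter> far z) \<and> (\<forall>w\<in>D. HE w z --> g a (\<phi> w))}"

definition rate :: "nat => real" where "rate z = (if z < n2 + b then 1 else e1)"

definition kdeg :: "nat set => nat => nat" where "kdeg D z = card {w\<in>D. HE w z}"

text \<open>The bound on candidates is required only where a neighbour is already embedded: from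
  then on each further neighbour costs a factor d. Before that it follows from \<open>load\<close>,
  see \<open>cand_lower\<close>.\<close>

definition valid :: "nat set => (nat => 'b) => bool" where
 "valid D \<phi> \<longleftrightarrow> D \<subseteq> {..<n} - Y \<and> inj_on \<phi> D \<and> (\<forall>u\<in>D. \<phi> u \<in> f u) \<and>
   (\<forall>u\<in>D. \<forall>v\<in>D. HE u v --> g (\<phi> u) (\<phi> v)) \<and>
   (\<forall>z. z < n --> z \<notin> D --> (\<exists>w\<in>D. HE w z) -->
    d ^ kdeg D z * rate z * real (card (f z)) \<le> real (card (cand D \<phi> z)))"

definition opts :: "nat set => (nat => 'b) => nat => 'b set" where
 "opts D \<phi> u = {a \<in> cand D \<phi> u. a \<notin> \<phi> ` D \<and> (\<forall>z. z \<notin> D --> HE u z -->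
   d * real (card (cand D \<phi> z)) \<le> real (card {c \<in> cand D \<phi> z. g a c}))}"

text \<open>Encodes the order of embedding: free below \<open>n2\<close>, ascending
  afterwards.\<close>

definition ok :: "nat set => nat => bool" where
 "ok D u \<longleftrightarrow> u < n \<and> u \<notin> Y \<and> u \<notin> D \<and> D \<subseteq> {..<max n2 u}"

lemma valid_empty: "valid {} \<phi>" by (simp add: valid_def)

lemma cand_sub: "cand D \<phi> z \<subseteq> f z" by (auto simp: cand_def)

lemma fin_cand: "z < n ==> finite (cand D \<phi> z)"
 using fin_f(1) cand_sub by (rule finite_subset[rotated])

lemma card_f_pos: "u < n ==> 0 < real (card (f u))"
 using fin_f by (simp add: card_gt_0_iff)

lemma rate_bounds: "e1 \<le> rate z" "rate z \<le> 1" "0 < rate z"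
 using e1 by (auto simp: rate_def)

lemma valid_finite: "valid D \<phi> ==> finite D"
 unfolding valid_def using finite_subset by blast

text \<open>Clusters coincide or are disjoint, so only vertices assigned to the cluster of
  \<open>u\<close> can occupy it.\<close>

lemma image_collision:
 assumes v: "valid D \<phi>" and u: "u < n" and S: "S \<subseteq> D"
 shows "card (\<phi> ` S \<inter> f u) \<le> card {w\<in>S. f w = f u}"
proof -
 have finS: "finite S" using valid_finite[OF v] S by (rule finite_subset[rotated])
 have "\<phi> ` S \<inter> f u \<subseteq> \<phi> ` {w\<in>S. f w = f u}"
 proof
  fix a assume "a \<in> \<phi> ` S \<inter> f u"
  then obtain w where w: "w \<in> S" "a = \<phi> w" "a \<in> f u" by auto
  have "a \<in> f w" "w < n" using w S v by (auto simp: valid_def)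
  hence "f w = f u" using disj[of w u] u w by auto
  thus "a \<in> \<phi> ` {w\<in>S. f w = f u}" using w by auto
 qed
 hence "card (\<phi> ` S \<inter> f u) \<le> card (\<phi> ` {w\<in>S. f w = f u})" using finS by (intro card_mono) auto
 also have "... \<le> card {w\<in>S. f w = f u}" using finS by (intro card_image_le) auto
 finally show ?thesis .
qed

lemma cand_lower:
 assumes v: "valid D \<phi>" and z: "z < n" "z \<notin> D"
 shows "d ^ kdeg D z * rate z * real (card (f z)) \<le> real (card (cand D \<phi> z))"
proof (cases "\<exists>w\<in>D. HE w z")
 case True thus ?thesis using v z by (auto simp: valid_def)
next
 case False
 hence "{w\<in>D. HE w z} = {}" by auto
 hence "kdeg D z = 0" by (simp only: kdeg_def card.empty)
 have c: "cand D \<phi> z = f z - \<phi> ` (D \<inter> far z) \<inter> f z" using False by (auto simp: cand_def)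
 have "rate z * real (card (f z)) \<le> real (card (cand D \<phi> z))"
 proof (cases "z < n2 + b")
  case True
  hence "cand D \<phi> z = f z" using c by (auto simp: far_def)
  thus ?thesis using True by (simp add: rate_def)
 next
  case F: False
  have "card (\<phi> ` (D \<inter> far z) \<inter> f z) \<le> card {w \<in> D \<inter> far z. f w = f z}"
   by (rule image_collision[OF v z(1)]) simp
  also have "... \<le> card {w. w < n \<and> w \<notin> Y \<and> f w = f z}" using v by (intro card_mono) (auto simp: valid_def)
  finally have "real (card (\<phi> ` (D \<inter> far z) \<inter> f z)) \<le> (1 - e1) * real (card (f z))" using load[OF z(1)] by linarith
  moreover have "card (cand D \<phi> z) = card (f z) - card (\<phi> ` (D \<inter> far z) \<inter> f z)"
   unfolding c using fin_f(1)[OF z(1)] by (intro card_Diff_subset) auto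
  moreover have "card (\<phi> ` (D \<inter> far z) \<inter> f z) \<le> card (f z)" using fin_f(1)[OF z(1)] by (intro card_mono) auto
  ultimately show ?thesis using F by (simp add: rate_def of_nat_diff algebra_simps)
 qed
 thus ?thesis using \<open>kdeg D z = 0\<close> by simp
qed

lemma kdeg_le: "valid D \<phi> ==> kdeg D z \<le> \<Delta>"
proof -
 have "kdeg D z \<le> card {w. HE z w}"
  unfolding kdeg_def using finite_nbhd HE_sym by (intro card_mono) auto
 thus ?thesis using degree_le[of z] by linarith
qed

lemma rate_pow: "valid D \<phi> ==> d ^ \<Delta> * rate z \<le> d ^ kdeg D z * rate z"
 using kdeg_le[of D \<phi> z] d rate_bounds(3)[of z] by (intro mult_right_mono power_decreasing) auto

lemma cand_lower':
 assumes "valid D \<phi>" "z < n" "z \<notin> D"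
 shows "d ^ \<Delta> * rate z * real (card (f z)) \<le> real (card (cand D \<phi> z))"
 using cand_lower[OF assms] mult_right_mono[OF rate_pow[OF assms(1), of z], of "real (card (f z))"] by linarith

lemma atypical_card:
 assumes "HE u z" "S \<subseteq> f z" "d ^ (\<Delta> + 1) * e1 * real (card (f z)) \<le> real (card S)"
 shows "real (card {a\<in>f u. real (card {c\<in>S. g a c}) < d * real (card S)}) \<le> \<delta> * real (card (f u))"
proof -
 have "\<delta> * real (card (f z)) \<le> real (card S)"
  using mult_right_mono[OF dsmall(2), of "real (card (f z))"] assms(3) by linarith
 thus ?thesis using typical[OF assms(1)] assms(2) unfolding typical_pair_def by blast
qed

lemma pow_bounds: "0 < d ^ (\<Delta> + 1)" "d ^ (\<Delta> + 1) \<le> 1" "d ^ (\<Delta> + 1) * e1 \<le> d ^ (\<Delta> + 1)"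
proof -
 show "0 < d ^ (\<Delta> + 1)" using d by (intro zero_less_power)
 show "d ^ (\<Delta> + 1) \<le> 1" using d by (intro power_le_one) auto
 show "d ^ (\<Delta> + 1) * e1 \<le> d ^ (\<Delta> + 1)" using d e1 by (intro mult_left_le) auto
qed

lemma pow_Suc_le: "d ^ (\<Delta> + 1) * x \<le> d ^ \<Delta> * x" if "0 \<le> x"
 using d that by (intro mult_right_mono power_decreasing) auto

lemma occupied_le:
 assumes v: "valid D \<phi>" and o: "ok D u"
 shows "real (card {w\<in>D. w \<notin> far u \<and> f w = f u}) \<le> d ^ (\<Delta> + 1) * rate u / 4 * real (card (f u))"
proof (cases "u < n2 + b")
 case True
 have "D \<subseteq> {..<n2 + b}" using o True by (auto simp: ok_def)
 hence "{w\<in>D. w \<notin> far u \<and> f w = f u} \<subseteq> {w. w < n2 + b \<and> w < n \<and> f w = f u}" using v by (auto simp: valid_def)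
 hence "card {w\<in>D. w \<notin> far u \<and> f w = f u} \<le> card {w. w < n2 + b \<and> w < n \<and> f w = f u}" by (intro card_mono) auto
 thus ?thesis using early[of u] o True by (simp add: ok_def rate_def)
next
 case False
 have "{w\<in>D. w \<notin> far u \<and> f w = f u} \<subseteq> {u - b..<u}" using o False by (auto simp: ok_def far_def)
 hence "card {w\<in>D. w \<notin> far u \<and> f w = f u} \<le> card {u - b..<u}" by (intro card_mono) auto
 hence "card {w\<in>D. w \<notin> far u \<and> f w = f u} \<le> b" by simp
 thus ?thesis using bsmall[of u] o False by (simp add: ok_def rate_def)
qed

text \<open>In units of d^(\<Delta>+1) rate u |f u|, at most 1/4 is lost to occupied places and 1/8
  to choices that are atypical for some neighbour not yet embedded. Stating this for subsets
  \<open>S\<close> allows the choice to be steered into \<open>S\<close>.\<close>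

lemma opts_inter:
 assumes v: "valid D \<phi>" and o: "ok D u" and S: "S \<subseteq> cand D \<phi> u"
 shows "real (card S) - 3 / 8 * d ^ (\<Delta> + 1) * rate u * real (card (f u)) \<le> real (card (S \<inter> opts D \<phi> u))"
proof -
 have u: "u < n" using o by (simp add: ok_def)
 define Z where "Z = {z. z \<notin> D \<and> HE u z}"
 have ZN: "Z \<subseteq> {z. HE u z}" by (auto simp: Z_def)
 have finZ: "finite Z" using finite_nbhd ZN by (rule finite_subset[rotated])
 have cZ: "card Z \<le> \<Delta>" using card_mono[OF finite_nbhd ZN] degree_le[of u] by linarith
 define bad where "bad z = {a\<in>f u. real (card {c\<in>cand D \<phi> z. g a c}) < d * real (card (cand D \<phi> z))}" for z
 have finbad: "finite (bad z)" for z using fin_f(1)[OF u] by (simp add: bad_def)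
 have cbad: "real (card (bad z)) \<le> \<delta> * real (card (f u))" if "z \<in> Z" for z
  unfolding bad_def
 proof (rule atypical_card)
  show H: "HE u z" using that by (simp add: Z_def)
  have zn: "z < n" using H HE_sym HE_less by blast
  have "d ^ (\<Delta> + 1) * e1 * real (card (f z)) \<le> d ^ \<Delta> * rate z * real (card (f z))"
  proof (rule mult_right_mono)
   have "d ^ (\<Delta> + 1) * e1 \<le> d ^ \<Delta> * e1" using e1 by (intro pow_Suc_le) simp
   also have "... \<le> d ^ \<Delta> * rate z" using d rate_bounds(1)[of z] by (intro mult_left_mono) auto
   finally show "d ^ (\<Delta> + 1) * e1 \<le> d ^ \<Delta> * rate z" .
  qed simp
  also have "... \<le> real (card (cand D \<phi> z))" using that zn by (intro cand_lower'[OF v]) (auto simp: Z_def)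
  finally show "d ^ (\<Delta> + 1) * e1 * real (card (f z)) \<le> real (card (cand D \<phi> z))" .
 qed (rule cand_sub)
 define O1 where "O1 = \<phi> ` {w\<in>D. w \<notin> far u} \<inter> f u"
 have finO: "finite O1" using fin_f(1)[OF u] by (simp add: O1_def)
 have cO: "real (card O1) \<le> d ^ (\<Delta> + 1) * rate u / 4 * real (card (f u))"
 proof -
  have "card O1 \<le> card {w\<in>{w\<in>D. w \<notin> far u}. f w = f u}" unfolding O1_def by (rule image_collision[OF v u]) auto
  also have "{w\<in>{w\<in>D. w \<notin> far u}. f w = f u} = {w\<in>D. w \<notin> far u \<and> f w = f u}" by auto
  finally show ?thesis using occupied_le[OF v o] by linarith
 qed
 have "S \<subseteq> (S \<inter> opts D \<phi> u) \<union> (O1 \<union> (\<Union>z\<in>Z. bad z))"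
 proof
  fix a assume a: "a \<in> S"
  hence ac: "a \<in> cand D \<phi> u" using S by auto
  hence af: "a \<in> f u" using cand_sub by blast
  show "a \<in> (S \<inter> opts D \<phi> u) \<union> (O1 \<union> (\<Union>z\<in>Z. bad z))"
  proof (cases "a \<in> O1 \<union> (\<Union>z\<in>Z. bad z)")
   case False
   have "a \<notin> \<phi> ` D"
   proof
    assume "a \<in> \<phi> ` D"
    then obtain w where w: "w \<in> D" "a = \<phi> w" by auto
    have "w \<notin> far u" using ac w by (auto simp: cand_def)
    thus False using False w af by (auto simp: O1_def)
   qed
   hence "a \<in> opts D \<phi> u" using ac False af by (auto simp: opts_def Z_def bad_def not_less)
   thus ?thesis using a by simp
  qed simp
 qed
 moreover have finS: "finite S" using S fin_cand[OF u] by (rule finite_subset)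
 ultimately have "card S \<le> card ((S \<inter> opts D \<phi> u) \<union> (O1 \<union> (\<Union>z\<in>Z. bad z)))"
  using finO finbad finZ by (intro card_mono) auto
 also have "... \<le> card (S \<inter> opts D \<phi> u) + (card O1 + card (\<Union>z\<in>Z. bad z))"
  by (meson card_Un_le add_left_mono order.trans)
 finally have 1: "real (card S) \<le> real (card (S \<inter> opts D \<phi> u)) + real (card O1) + real (card (\<Union>z\<in>Z. bad z))" by linarith
 have "card (\<Union>z\<in>Z. bad z) \<le> (\<Sum>z\<in>Z. card (bad z))" by (rule card_UN_le[OF finZ])
 hence "real (card (\<Union>z\<in>Z. bad z)) \<le> (\<Sum>z\<in>Z. real (card (bad z)))" by (metis of_nat_le_iff of_nat_sum)
 also have "... \<le> (\<Sum>z\<in>Z. \<delta> * real (card (f u)))" by (intro sum_mono cbad)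
 also have "... = real (card Z) * (\<delta> * real (card (f u)))" by simp
 also have "... \<le> d ^ (\<Delta> + 1) * rate u / 8 * real (card (f u))"
 proof (cases "Z = {}")
  case True
  thus ?thesis using d rate_bounds[of u] by simp
 next
  case False
  then obtain z where "z \<in> Z" by auto
  have "0 \<le> real (card (bad z))" by simp
  hence "0 \<le> \<delta> * real (card (f u))" using cbad[OF \<open>z \<in> Z\<close>] by linarith
  hence "real (card Z) * (\<delta> * real (card (f u))) \<le> real \<Delta> * (\<delta> * real (card (f u)))"
   using cZ by (intro mult_right_mono) auto
  also have "... = real \<Delta> * \<delta> * real (card (f u))" by simp
  also have "... \<le> d ^ (\<Delta> + 1) * e1 / 8 * real (card (f u))" using dsmall(1) by (intro mult_right_mono) auto
  also have "... \<le> d ^ (\<Delta> + 1) * rate u / 8 * real (card (f u))"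
   using d rate_bounds(1)[of u] by (intro mult_right_mono divide_right_mono mult_left_mono) auto
  finally show ?thesis .
 qed
 finally have 2: "real (card (\<Union>z\<in>Z. bad z)) \<le> d ^ (\<Delta> + 1) * rate u / 8 * real (card (f u))" .
 define t where "t = d ^ (\<Delta> + 1) * rate u * real (card (f u))"
 have e: "3 / 8 * d ^ (\<Delta> + 1) * rate u * real (card (f u)) = 3 / 8 * t"
  "d ^ (\<Delta> + 1) * rate u / 8 * real (card (f u)) = t / 8"
  "d ^ (\<Delta> + 1) * rate u / 4 * real (card (f u)) = t / 4" by (simp_all add: t_def)
 define p where "p = real (card (S \<inter> opts D \<phi> u))"
 define q where "q = real (card O1)"
 define q' where "q' = real (card (\<Union>z\<in>Z. bad z))"
 have "real (card S) \<le> p + q + q'" "q' \<le> t / 8" "q \<le> t / 4"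
  using 1 2 cO unfolding e p_def q_def q'_def by auto
 hence "real (card S) - 3 / 8 * t \<le> p" by linarith
 thus ?thesis unfolding e p_def .
qed

lemma opts_card:
 assumes v: "valid D \<phi>" and o: "ok D u"
 shows "d ^ (\<Delta> + 1) * e1 / 2 * real (card (f u)) \<le> real (card (opts D \<phi> u))" "opts D \<phi> u \<subseteq> f u"
  "finite (opts D \<phi> u)" "opts D \<phi> u \<noteq> {}"
proof -
 have u: "u < n" "u \<notin> D" using o by (auto simp: ok_def)
 show sub: "opts D \<phi> u \<subseteq> f u" using cand_sub by (auto simp: opts_def)
 thus fin: "finite (opts D \<phi> u)" using fin_f(1)[OF u(1)] finite_subset by blast
 have sub': "cand D \<phi> u \<inter> opts D \<phi> u = opts D \<phi> u" by (auto simp: opts_def)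
 define c where "c = real (card (f u))"
 have c0: "0 < c" using card_f_pos[OF u(1)] by (simp add: c_def)
 have p0: "0 < d ^ (\<Delta> + 1)" using d by simp
 have "d ^ \<Delta> * rate u * c - 3 / 8 * d ^ (\<Delta> + 1) * rate u * c \<le> real (card (opts D \<phi> u))"
  using opts_inter[OF v o order_refl] cand_lower'[OF v u] unfolding sub' c_def by linarith
 moreover have "d ^ (\<Delta> + 1) * (rate u * c) \<le> d ^ \<Delta> * (rate u * c)" using c0 rate_bounds(3)[of u] by (intro pow_Suc_le) simp
 moreover have "d ^ (\<Delta> + 1) * (e1 * c) \<le> d ^ (\<Delta> + 1) * (rate u * c)"
  using p0 c0 rate_bounds(1)[of u] by (intro mult_left_mono mult_right_mono) auto
 moreover have "0 < d ^ (\<Delta> + 1) * (e1 * c)" using p0 c0 e1 by simp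
 ultimately show lb: "d ^ (\<Delta> + 1) * e1 / 2 * real (card (f u)) \<le> real (card (opts D \<phi> u))"
  unfolding c_def[symmetric] by (simp add: algebra_simps)
 have "0 < d ^ (\<Delta> + 1) * e1 / 2 * c" using p0 c0 e1 by simp
 hence "0 < real (card (opts D \<phi> u))" using lb by (simp add: c_def)
 thus "opts D \<phi> u \<noteq> {}" by auto
qed

lemma cand_insert:
 assumes o: "ok D u" and z: "z \<noteq> u" and D: "z \<notin> D"
 shows "HE u z ==> cand (insert u D) (\<phi>(u := a)) z = {c \<in> cand D \<phi> z. g a c}"
  and "\<not> HE u z ==> \<exists>w\<in>D. HE w z ==> cand (insert u D) (\<phi>(u := a)) z = cand D \<phi> z"
proof -
 have uD: "u \<notin> D" using o by (simp add: ok_def)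
 have upd: "(\<phi>(u := a)) ` S = \<phi> ` S" if "S \<subseteq> D" for S using uD that by (auto simp: image_iff)
 have far: "(\<phi>(u := a)) ` (insert u D \<inter> far z) = \<phi> ` (D \<inter> far z)" if "u \<notin> far z"
 proof -
  have "insert u D \<inter> far z = D \<inter> far z" using that by auto
  thus ?thesis using upd[of "D \<inter> far z"] by simp
 qed
 have old: "(\<forall>w\<in>D. HE w z --> g x ((\<phi>(u := a)) w)) \<longleftrightarrow> (\<forall>w\<in>D. HE w z --> g x (\<phi> w))" for x
  using uD by auto
 show "cand (insert u D) (\<phi>(u := a)) z = {c \<in> cand D \<phi> z. g a c}" if H: "HE u z"
 proof -
  have "u \<notin> far z" using HE_band[OF H] by (simp add: far_def)
  have gs: "g a x \<longleftrightarrow> g x a" for x using g_sym by blast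
  have "(\<forall>w\<in>insert u D. HE w z --> g x ((\<phi>(u := a)) w)) \<longleftrightarrow> g a x \<and> (\<forall>w\<in>D. HE w z --> g x (\<phi> w))" for x
   using H old[of x] gs[of x] by simp
  thus ?thesis unfolding cand_def far[OF \<open>u \<notin> far z\<close>] by auto
 qed
 show "cand (insert u D) (\<phi>(u := a)) z = cand D \<phi> z" if H: "\<not> HE u z" and ex: "\<exists>w\<in>D. HE w z"
 proof -
  \<comment> \<open>If \<open>u\<close> were far from \<open>z\<close>, the embedded neighbour w
    \<ge> z - b would exceed \<open>u\<close> and be at least \<open>n2\<close>, against the
    ascending order.\<close>
  have "u \<notin> far z"
  proof
   assume "u \<in> far z"
   hence uz: "n2 + b \<le> z" "u + b < z" by (auto simp: far_def split: if_splits)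
   obtain w where w: "w \<in> D" "HE w z" using ex by blast
   have "z \<le> w + b" using HE_band[OF w(2)] .
   hence "n2 \<le> w" "u < w" using uz by linarith+
   moreover have "w < max n2 u" using o w(1) by (auto simp: ok_def)
   ultimately show False by simp
  qed
  thus ?thesis unfolding cand_def far[OF \<open>u \<notin> far z\<close>] using H old by auto
 qed
qed

lemma kdeg_insert:
 assumes "finite D" "u \<notin> D"
 shows "HE u z ==> kdeg (insert u D) z = Suc (kdeg D z)" "\<not> HE u z ==> kdeg (insert u D) z = kdeg D z"
proof -
 show "kdeg (insert u D) z = Suc (kdeg D z)" if "HE u z"
 proof -
  have "{w\<in>insert u D. HE w z} = insert u {w\<in>D. HE w z}" using that by auto
  thus ?thesis using assms by (simp add: kdeg_def)
 qed
 show "kdeg (insert u D) z = kdeg D z" if "\<not> HE u z"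
 proof -
  have "{w\<in>insert u D. HE w z} = {w\<in>D. HE w z}" using that by auto
  thus ?thesis by (simp add: kdeg_def)
 qed
qed

lemma valid_step:
 assumes v: "valid D \<phi>" and o: "ok D u" and a: "a \<in> opts D \<phi> u"
 shows "valid (insert u D) (\<phi>(u := a))"
proof -
 have u: "u < n" "u \<notin> Y" "u \<notin> D" using o by (auto simp: ok_def)
 have ac: "a \<in> f u" "\<And>w. w \<in> D ==> HE w u ==> g a (\<phi> w)" "a \<notin> \<phi> ` D"
  using a by (auto simp: opts_def cand_def)
 have finD: "finite D" by (rule valid_finite[OF v])
 have "d ^ kdeg (insert u D) z * rate z * real (card (f z)) \<le> real (card (cand (insert u D) (\<phi>(u := a)) z))"
  if z: "z < n" "z \<notin> insert u D" "\<exists>w\<in>insert u D. HE w z" for z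
 proof (cases "HE u z")
  case True
  have "d * real (card (cand D \<phi> z)) \<le> real (card {c \<in> cand D \<phi> z. g a c})" using a True z by (auto simp: opts_def)
  moreover have "d * (d ^ kdeg D z * rate z * real (card (f z))) \<le> d * real (card (cand D \<phi> z))"
   using cand_lower[OF v z(1)] z(2) d by (intro mult_left_mono) auto
  ultimately show ?thesis using True z kdeg_insert[OF finD u(3)] cand_insert(1)[OF o, of z] by (simp add: mult.assoc)
 next
  case False
  hence ex: "\<exists>w\<in>D. HE w z" using z by auto
  show ?thesis using False z kdeg_insert[OF finD u(3)] cand_insert(2)[OF o _ _ False ex] cand_lower[OF v z(1)] by simp
 qed
 moreover have "inj_on (\<phi>(u := a)) (insert u D)"
  using v ac(3) u(3) by (auto simp: valid_def inj_on_def image_iff)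
 moreover have "\<forall>x\<in>insert u D. \<forall>y\<in>insert u D. HE x y --> g ((\<phi>(u := a)) x) ((\<phi>(u := a)) y)"
 proof (intro ballI impI)
  fix x y assume xy: "x \<in> insert u D" "y \<in> insert u D" "HE x y"
  have yx: "HE y x" using HE_sym xy(3) .
  have ne: "x \<noteq> y" using xy(3) HE_irrefl by auto
  consider "x = u" "y \<in> D" | "y = u" "x \<in> D" | "x \<in> D" "y \<in> D" using xy ne by auto
  thus "g ((\<phi>(u := a)) x) ((\<phi>(u := a)) y)"
  proof cases
   case 1 thus ?thesis using ac(2)[of y] yx u(3) by auto
  next
   case 2 thus ?thesis using g_sym[OF ac(2)[of x]] xy(3) u(3) by auto
  next
   case 3
   hence "g (\<phi> x) (\<phi> y)" using v xy(3) unfolding valid_def by blast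
   thus ?thesis using 3 u(3) by auto
  qed
 qed
 moreover have "\<forall>x\<in>insert u D. (\<phi>(u := a)) x \<in> f x" using v ac(1) by (auto simp: valid_def)
 moreover have "insert u D \<subseteq> {..<n} - Y" using v u by (auto simp: valid_def)
 ultimately show ?thesis unfolding valid_def by blast
qed

text \<open>The conditional expectation of \<open>F\<close>, given the partial embedding
  \<open>\<phi>\<close> of \<open>D\<close>, when the listed vertices are embedded one by one at
  uniformly random options. Conditioning on the past is unfolding the recursion.\<close>

fun rgreedy :: "nat list => nat set => (nat => 'b) => ((nat => 'b) => real) => real" where
 "rgreedy [] D \<phi> F = F \<phi>"
| "rgreedy (u # us) D \<phi> F = avg (opts D \<phi> u) (\<lambda>a. rgreedy us (insert u D) (\<phi>(u := a)) F)"

fun okl :: "nat set => nat list => bool" where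
 "okl D [] = True"
| "okl D (u # us) \<longleftrightarrow> ok D u \<and> okl (insert u D) us"

lemma okl_append: "okl D (us @ vs) \<longleftrightarrow> okl D us \<and> okl (D \<union> set us) vs"
 by (induction us arbitrary: D) auto

lemma okl_disjoint: "okl D us ==> D \<inter> set us = {}"
 by (induction us arbitrary: D) (auto simp: ok_def)

lemma rgreedy_append:
 "rgreedy (us @ vs) D \<phi> F = rgreedy us D \<phi> (\<lambda>\<phi>'. rgreedy vs (D \<union> set us) \<phi>' F)"
 by (induction us arbitrary: D \<phi>) auto

lemma rgreedy_mono:
 assumes "valid D \<phi>" "okl D us"
  "\<And>\<phi>'. valid (D \<union> set us) \<phi>' ==> (\<forall>u\<in>D. \<phi>' u = \<phi> u) ==> F \<phi>' \<le> G \<phi>'"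
 shows "rgreedy us D \<phi> F \<le> rgreedy us D \<phi> G"
 using assms
proof (induction us arbitrary: D \<phi>)
 case (Cons u us)
 have o: "ok D u" "okl (insert u D) us" using Cons.prems(2) by auto
 have uD: "u \<notin> D" using o by (simp add: ok_def)
 show ?case unfolding rgreedy.simps
 proof (rule avg_mono)
  fix a assume "a \<in> opts D \<phi> u"
  note v = valid_step[OF Cons.prems(1) o(1) this]
  show "rgreedy us (insert u D) (\<phi>(u := a)) F \<le> rgreedy us (insert u D) (\<phi>(u := a)) G"
  proof (rule Cons.IH[OF v o(2)])
   fix \<phi>' assume "valid (insert u D \<union> set us) \<phi>'" "\<forall>x\<in>insert u D. \<phi>' x = (\<phi>(u := a)) x"
   thus "F \<phi>' \<le> G \<phi>'" using uD by (intro Cons.prems(3)) (auto split: if_splits)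
  qed
 qed
qed auto

lemma rgreedy_cong:
 assumes "valid D \<phi>" "okl D us"
  "\<And>\<phi>'. valid (D \<union> set us) \<phi>' ==> (\<forall>u\<in>D. \<phi>' u = \<phi> u) ==> F \<phi>' = G \<phi>'"
 shows "rgreedy us D \<phi> F = rgreedy us D \<phi> G"
 using rgreedy_mono[OF assms(1,2), of F G] rgreedy_mono[OF assms(1,2), of G F] assms(3) by force

lemma rgreedy_const:
 assumes "valid D \<phi>" "okl D us" shows "rgreedy us D \<phi> (\<lambda>_. c) = c"
 using assms
proof (induction us arbitrary: D \<phi>)
 case (Cons u us)
 have o: "ok D u" "okl (insert u D) us" using Cons.prems(2) by auto
 have "rgreedy (u # us) D \<phi> (\<lambda>_. c) = avg (opts D \<phi> u) (\<lambda>_. c)"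
  unfolding rgreedy.simps avg_def
  by (intro arg_cong2[of _ _ _ _ "(/)"] sum.cong refl Cons.IH[OF valid_step[OF Cons.prems(1) o(1)] o(2)])
 thus ?case using avg_const[OF opts_card(3,4)[OF Cons.prems(1) o(1)]] by simp
qed simp

lemma rgreedy_add: "rgreedy us D \<phi> (\<lambda>\<phi>'. F \<phi>' + G \<phi>') = rgreedy us D \<phi> F + rgreedy us D \<phi> G"
 by (induction us arbitrary: D \<phi>) (auto simp: avg_add)

lemma rgreedy_cmult: "rgreedy us D \<phi> (\<lambda>\<phi>'. c * F \<phi>') = c * rgreedy us D \<phi> F"
 by (induction us arbitrary: D \<phi>) (auto simp: avg_cmult)

lemma rgreedy_le:
 assumes "valid D \<phi>" "okl D us"
  "\<And>\<phi>'. valid (D \<union> set us) \<phi>' ==> (\<forall>u\<in>D. \<phi>' u = \<phi> u) ==> F \<phi>' \<le> c"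
 shows "rgreedy us D \<phi> F \<le> c"
 using rgreedy_mono[OF assms(1,2), of F "\<lambda>_. c"] rgreedy_const[OF assms(1,2), of c] assms(3) by force

lemma rgreedy_ge:
 assumes "valid D \<phi>" "okl D us"
  "\<And>\<phi>'. valid (D \<union> set us) \<phi>' ==> (\<forall>u\<in>D. \<phi>' u = \<phi> u) ==> c \<le> F \<phi>'"
 shows "c \<le> rgreedy us D \<phi> F"
 using rgreedy_mono[OF assms(1,2), of "\<lambda>_. c" F] rgreedy_const[OF assms(1,2), of c] assms(3) by force

text \<open>Whatever the past, a vertex of \<open>T\<close> meets its prescribed image with
  conditional probability at most 1/K.\<close>

lemma rgreedy_spread:
 assumes "valid D \<phi>" "okl D us" "T \<subseteq> set us" "0 < K"
  "\<And>D \<phi> u. valid D \<phi> ==> ok D u ==> K \<le> real (card (opts D \<phi> u))"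
 shows "rgreedy us D \<phi> (\<lambda>\<phi>'. of_bool (\<forall>z\<in>T. \<phi>' z = w z)) \<le> (1 / K) ^ card T"
 using assms(1-3)
proof (induction us arbitrary: D \<phi> T)
 case (Cons u us)
 have o: "ok D u" "okl (insert u D) us" using Cons.prems(2) by auto
 have uus: "u \<notin> set us" using okl_disjoint[OF o(2)] by auto
 note oc = opts_card[OF Cons.prems(1) o(1)]
 have finT: "finite T" using Cons.prems(3) finite_subset by blast
 show ?case
 proof (cases "u \<in> T")
  case False
  hence T: "T \<subseteq> set us" using Cons.prems(3) by auto
  have "rgreedy (u # us) D \<phi> (\<lambda>\<phi>'. of_bool (\<forall>z\<in>T. \<phi>' z = w z)) \<le> avg (opts D \<phi> u) (\<lambda>_. (1 / K) ^ card T)"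
   unfolding rgreedy.simps
   by (intro avg_mono Cons.IH[OF valid_step[OF Cons.prems(1) o(1)] o(2) T])
  thus ?thesis using avg_const[OF oc(3,4)] by simp
 next
  case True
  define T' where "T' = T - {u}"
  have T': "T' \<subseteq> set us" using Cons.prems(3) by (auto simp: T'_def)
  have cT: "card T = Suc (card T')" using True finT unfolding T'_def by (metis card_Suc_Diff1)
  have "rgreedy (u # us) D \<phi> (\<lambda>\<phi>'. of_bool (\<forall>z\<in>T. \<phi>' z = w z)) \<le> (1 / K) ^ card T' / K"
   unfolding rgreedy.simps
  proof (rule avg_single[OF oc(3) _ assms(5)[OF Cons.prems(1) o(1)] assms(4)])
   fix a assume a: "a \<in> opts D \<phi> u"
   note v = valid_step[OF Cons.prems(1) o(1) a]
   show "rgreedy us (insert u D) (\<phi>(u := a)) (\<lambda>\<phi>'. of_bool (\<forall>z\<in>T. \<phi>' z = w z))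
    \<le> (if a = w u then (1 / K) ^ card T' else 0)"
   proof (cases "a = w u")
    case True
    have "rgreedy us (insert u D) (\<phi>(u := a)) (\<lambda>\<phi>'. of_bool (\<forall>z\<in>T. \<phi>' z = w z))
      \<le> rgreedy us (insert u D) (\<phi>(u := a)) (\<lambda>\<phi>'. of_bool (\<forall>z\<in>T'. \<phi>' z = w z))"
     by (rule rgreedy_mono[OF v o(2)]) (auto simp: T'_def)
    thus ?thesis unfolding if_P[OF True] by (rule order_trans[OF _ Cons.IH[OF v o(2) T']])
   next
    case F: False
    have "rgreedy us (insert u D) (\<phi>(u := a)) (\<lambda>\<phi>'. of_bool (\<forall>z\<in>T. \<phi>' z = w z)) \<le> 0"
    proof (rule rgreedy_le[OF v o(2)])
     fix \<phi>' assume "\<forall>x\<in>insert u D. \<phi>' x = (\<phi>(u := a)) x"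
     hence "\<phi>' u = a" by simp
     hence "\<not> (\<forall>z\<in>T. \<phi>' z = w z)" using F True by auto
     thus "of_bool (\<forall>z\<in>T. \<phi>' z = w z) \<le> (0::real)" by simp
    qed
    thus ?thesis using F by simp
   qed
  qed (use assms(4) in simp)
  thus ?thesis using cT by (simp add: field_simps)
 qed
qed simp

definition common :: "(nat => 'b) => nat => 'b set" where
 "common \<phi> y = {a\<in>f y. \<forall>w. HE w y --> g a (\<phi> w)}"

text \<open>\<open>x\<close> can hand its place to \<open>y\<close> and move to \<open>v\<close>.
  The set \<open>common \<phi> y\<close> depends only on the images of the neighbours of
  \<open>y\<close>, the remaining conditions only on the star of \<open>x\<close>.\<close>

definition good :: "nat => 'b => (nat => 'b) => nat => bool" where
 "good y v \<phi> x \<longleftrightarrow> \<phi> x \<in> common \<phi> y \<and> (\<forall>z. HE x z --> g v (\<phi> z))"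

definition rich :: "'b => nat => bool" where
 "rich v z \<longleftrightarrow> d * real (card (f z)) \<le> real (card {c\<in>f z. g v c})"

text \<open>The invariant follows the candidates inside the neighbourhood of \<open>v\<close>; its
  exponent kdeg + 1 starts with one extra factor d for \<open>v\<close> itself. At each step at
  least a proportion d^(\<Delta>+1)/2 of the options lies next to \<open>v\<close> and preserves
  it.\<close>

lemma rgreedy_into_nbhd:
 assumes "valid D \<phi>" "okl D us" "set us \<subseteq> M" "M \<subseteq> {..<n2 + b} \<inter> {..<n}"
  "\<And>z. z \<in> M ==> z \<notin> D ==> d ^ (kdeg D z + 1) * real (card (f z)) \<le> real (card {c\<in>cand D \<phi> z. g v c})"
 shows "(d ^ (\<Delta> + 1) / 2) ^ length us \<le> rgreedy us D \<phi> (\<lambda>\<phi>'. of_bool (\<forall>z\<in>set us. g v (\<phi>' z)))"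
 using assms(1-3,5)
proof (induction us arbitrary: D \<phi>)
 case (Cons u us)
 have o: "ok D u" "okl (insert u D) us" using Cons.prems(2) by auto
 have uus: "u \<notin> set us" "u \<notin> D" "u < n" using okl_disjoint[OF o(2)] o(1) by (auto simp: ok_def)
 have uM: "u \<in> M" "set us \<subseteq> M" using Cons.prems(3) by auto
 note oc = opts_card[OF Cons.prems(1) o(1)]
 note finD = valid_finite[OF Cons.prems(1)]
 let ?p = "d ^ (\<Delta> + 1)"
 have p0: "0 < ?p" using d by simp
 have r1: "rate z = 1" if "z \<in> M" for z using that assms(4) by (auto simp: rate_def)
 define S where "S = {c\<in>cand D \<phi> u. g v c}"
 define Z where "Z = {z\<in>M. z \<notin> D \<and> HE u z}"
 have ZN: "Z \<subseteq> {z. HE u z}" by (auto simp: Z_def)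
 have finZ: "finite Z" using finite_nbhd ZN by (rule finite_subset[rotated])
 have cZ: "card Z \<le> \<Delta>" using card_mono[OF finite_nbhd ZN] degree_le[of u] by linarith
 define bad where "bad z = {a\<in>f u. real (card {c\<in>{c\<in>cand D \<phi> z. g v c}. g a c}) < d * real (card {c\<in>cand D \<phi> z. g v c})}" for z
 have finbad: "finite (bad z)" for z using fin_f(1)[OF uus(3)] by (simp add: bad_def)
 have pk: "?p * real (card (f z)) \<le> real (card {c\<in>cand D \<phi> z. g v c})" if "z \<in> M" "z \<notin> D" for z
 proof -
  have "?p * real (card (f z)) \<le> d ^ (kdeg D z + 1) * real (card (f z))"
   using kdeg_le[OF Cons.prems(1), of z] d by (intro mult_right_mono power_decreasing) auto
  thus ?thesis using Cons.prems(4)[OF that] by linarith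
 qed
 have cbad: "real (card (bad z)) \<le> \<delta> * real (card (f u))" if "z \<in> Z" for z
  unfolding bad_def
 proof (rule atypical_card)
  show "HE u z" using that by (simp add: Z_def)
  show "{c\<in>cand D \<phi> z. g v c} \<subseteq> f z" using cand_sub by blast
  have "?p * e1 * real (card (f z)) \<le> ?p * real (card (f z))" by (intro mult_right_mono pow_bounds) simp
  thus "?p * e1 * real (card (f z)) \<le> real (card {c\<in>cand D \<phi> z. g v c})" using pk[of z] that by (simp add: Z_def)
 qed
 have badU: "real (card (\<Union>z\<in>Z. bad z)) \<le> ?p / 8 * real (card (f u))"
 proof (cases "Z = {}")
  case True thus ?thesis using p0 by simp
 next
  case False
  then obtain z where z: "z \<in> Z" by auto
  have "0 \<le> real (card (bad z))" by simp
  hence nn: "0 \<le> \<delta> * real (card (f u))" using cbad[OF z] by linarith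
  have "card (\<Union>z\<in>Z. bad z) \<le> (\<Sum>z\<in>Z. card (bad z))" by (rule card_UN_le[OF finZ])
  hence "real (card (\<Union>z\<in>Z. bad z)) \<le> (\<Sum>z\<in>Z. real (card (bad z)))" by (metis of_nat_le_iff of_nat_sum)
  also have "... \<le> (\<Sum>z\<in>Z. \<delta> * real (card (f u)))" by (intro sum_mono cbad)
  also have "... = real (card Z) * (\<delta> * real (card (f u)))" by simp
  also have "... \<le> real \<Delta> * (\<delta> * real (card (f u)))" using cZ nn by (intro mult_right_mono) auto
  also have "... = real \<Delta> * \<delta> * real (card (f u))" by simp
  also have "... \<le> ?p * e1 / 8 * real (card (f u))" using dsmall(1) by (intro mult_right_mono) auto
  also have "... \<le> ?p / 8 * real (card (f u))" by (intro mult_right_mono divide_right_mono pow_bounds) auto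
  finally show ?thesis .
 qed
 define Gd where "Gd = (S \<inter> opts D \<phi> u) - (\<Union>z\<in>Z. bad z)"
 have Gd: "?p / 2 * real (card (f u)) \<le> real (card Gd)"
 proof -
  have "real (card S) - 3 / 8 * ?p * rate u * real (card (f u)) \<le> real (card (S \<inter> opts D \<phi> u))"
   by (rule opts_inter[OF Cons.prems(1) o(1)]) (auto simp: S_def)
  hence 1: "real (card S) - 3 / 8 * ?p * real (card (f u)) \<le> real (card (S \<inter> opts D \<phi> u))" using r1[OF uM(1)] by simp
  have 2: "?p * real (card (f u)) \<le> real (card S)" using pk[OF uM(1) uus(2)] by (simp add: S_def)
  have "card (S \<inter> opts D \<phi> u) - card (\<Union>z\<in>Z. bad z) \<le> card Gd"
   unfolding Gd_def using finZ finbad by (intro diff_card_le_card_Diff) auto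
  hence "real (card (S \<inter> opts D \<phi> u)) - real (card (\<Union>z\<in>Z. bad z)) \<le> real (card Gd)" by linarith
  thus ?thesis using 1 2 badU by (simp add: algebra_simps)
 qed
 have "(?p / 2) * (?p / 2) ^ length us \<le> avg (opts D \<phi> u) (\<lambda>a. rgreedy us (insert u D) (\<phi>(u := a)) (\<lambda>\<phi>'. of_bool (\<forall>z\<in>set (u # us). g v (\<phi>' z))))"
 proof (rule avg_lower[OF oc(3,4)])
  show "Gd \<subseteq> opts D \<phi> u" by (auto simp: Gd_def)
  show "0 \<le> rgreedy us (insert u D) (\<phi>(u := a)) (\<lambda>\<phi>'. of_bool (\<forall>z\<in>set (u # us). g v (\<phi>' z)))" if "a \<in> opts D \<phi> u" for a
   by (rule rgreedy_ge[OF valid_step[OF Cons.prems(1) o(1) that] o(2)]) simp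
  have "real (card (opts D \<phi> u)) \<le> real (card (f u))" using oc(2) fin_f(1)[OF uus(3)] by (simp add: card_mono)
  hence "?p / 2 * real (card (opts D \<phi> u)) \<le> ?p / 2 * real (card (f u))" using p0 by (intro mult_left_mono) auto
  thus "?p / 2 * real (card (opts D \<phi> u)) \<le> real (card Gd)" using Gd by linarith
  fix a assume a: "a \<in> Gd"
  hence ao: "a \<in> opts D \<phi> u" "g v a" by (auto simp: Gd_def S_def)
  note v' = valid_step[OF Cons.prems(1) o(1) ao(1)]
  have "(?p / 2) ^ length us \<le> rgreedy us (insert u D) (\<phi>(u := a)) (\<lambda>\<phi>'. of_bool (\<forall>z\<in>set us. g v (\<phi>' z)))"
  proof (rule Cons.IH[OF v' o(2) uM(2)])
   fix z assume z: "z \<in> M" "z \<notin> insert u D"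
   have zD: "z \<notin> D" "z \<noteq> u" using z by auto
   have IHz: "d ^ (kdeg D z + 1) * real (card (f z)) \<le> real (card {c\<in>cand D \<phi> z. g v c})"
    using Cons.prems(4) z zD by simp
   show "d ^ (kdeg (insert u D) z + 1) * real (card (f z)) \<le> real (card {c\<in>cand (insert u D) (\<phi>(u := a)) z. g v c})"
   proof (cases "HE u z")
    case True
    have "z \<in> Z" using True z by (simp add: Z_def)
    hence "a \<notin> bad z" using a by (auto simp: Gd_def)
    moreover have "a \<in> f u" using ao(1) oc(2) by blast
    ultimately have "d * real (card {c\<in>cand D \<phi> z. g v c}) \<le> real (card {c\<in>{c\<in>cand D \<phi> z. g v c}. g a c})"
     by (simp add: bad_def not_less)
    moreover have "d * (d ^ (kdeg D z + 1) * real (card (f z))) \<le> d * real (card {c\<in>cand D \<phi> z. g v c})"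
     using IHz d by (intro mult_left_mono) auto
    moreover have "{c\<in>{c\<in>cand D \<phi> z. g v c}. g a c} = {c\<in>cand (insert u D) (\<phi>(u := a)) z. g v c}"
     unfolding cand_insert(1)[OF o(1) zD(2,1) True] by auto
    ultimately show ?thesis using kdeg_insert(1)[OF finD uus(2) True] by (simp add: mult.assoc)
   next
    case False
    show ?thesis
    proof (cases "\<exists>w\<in>D. HE w z")
     case True
     thus ?thesis using IHz kdeg_insert(2)[OF finD uus(2) False] cand_insert(2)[OF o(1) zD(2,1) False True] by simp
    next
     case F: False
     have "far z = {}" using z(1) assms(4) by (auto simp: far_def)
     hence "cand (insert u D) (\<phi>(u := a)) z = f z" "cand D \<phi> z = f z" using F False by (auto simp: cand_def)
     thus ?thesis using IHz kdeg_insert(2)[OF finD uus(2) False] by simp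
    qed
   qed
  qed
  also have "... \<le> rgreedy us (insert u D) (\<phi>(u := a)) (\<lambda>\<phi>'. of_bool (\<forall>z\<in>set (u # us). g v (\<phi>' z)))"
   using ao(2) by (intro rgreedy_mono[OF v' o(2)]) auto
  finally show "(?p / 2) ^ length us \<le> rgreedy us (insert u D) (\<phi>(u := a)) (\<lambda>\<phi>'. of_bool (\<forall>z\<in>set (u # us). g v (\<phi>' z)))" .
 qed (use p0 in simp)
 thus ?case by simp
qed simp

definition star :: "nat => nat list" where "star x = x # sorted_list_of_set {z. HE x z}"

lemma set_star: "set (star x) = nb x"
 using finite_nbhd by (simp add: star_def nb_def)

text \<open>For the process \<open>y\<close> looks like a vertex whose neighbours are all embedded,
  so \<open>common \<phi> y\<close> is its candidate set and has proportion at least d^\<Delta>.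
  First \<open>x\<close> must fall into it, then the neighbours of \<open>x\<close> next to
  \<open>v\<close>. By \<open>fresh\<close> the star starts with full clusters as candidate
  sets.\<close>

lemma star_good:
 assumes v0: "valid D \<phi>" and ol: "okl D (star x)" and nbx: "nb x \<subseteq> {..<n2 + b} \<inter> {..<n}"
  and fresh: "\<And>z w. z \<in> nb x ==> w \<in> D ==> \<not> HE w z"
  and y: "y < n" "y \<in> Y" "y < n2 + b" "\<And>w. HE w y ==> w \<in> D" "f y = f x"
  and rch: "\<And>z. HE x z ==> rich v z"
 shows "(d ^ (\<Delta> + 1) / 2) ^ (\<Delta> + 1) \<le> rgreedy (star x) D \<phi> (\<lambda>\<phi>'. of_bool (good y v \<phi>' x))"
proof -
 let ?us = "sorted_list_of_set {z. HE x z}"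
 let ?p = "d ^ (\<Delta> + 1)"
 have p0: "0 < ?p" "?p \<le> 1" by (rule pow_bounds)+
 have o: "ok D x" "okl (insert x D) ?us" using ol by (auto simp: star_def)
 have xn: "x < n" "x \<notin> D" using o(1) by (auto simp: ok_def)
 have sus: "set ?us = {z. HE x z}" using finite_nbhd by simp
 note oc = opts_card[OF v0 o(1)]
 note finD = valid_finite[OF v0]
 have yD: "y \<notin> D" using y(2) v0 by (auto simp: valid_def)
 have k0: "kdeg D z = 0" "cand D \<phi> z = f z" if "z \<in> nb x" for z
 proof -
  have "{w\<in>D. HE w z} = {}" using fresh[OF that] by auto
  thus "kdeg D z = 0" by (simp only: kdeg_def card.empty)
  show "cand D \<phi> z = f z" using fresh[OF that] nbx that by (auto simp: cand_def far_def)
 qed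
 have candy: "cand D \<phi> y = common \<phi> y" using y(3,4) by (auto simp: cand_def common_def far_def)
 define S where "S = common \<phi> y"
 have cS: "d ^ \<Delta> * real (card (f x)) \<le> real (card S)"
  using cand_lower'[OF v0 y(1) yD] y(3,5) by (simp add: S_def candy rate_def)
 have SC: "S \<subseteq> cand D \<phi> x" using k0(2)[of x] y(5) by (auto simp: S_def common_def nb_def)
 define Z where "Z = {z. HE x z}"
 have cZ: "card Z \<le> \<Delta>" using degree_le[of x] by (simp add: Z_def)
 have finZ: "finite Z" using finite_nbhd by (simp add: Z_def)
 define bad where "bad z = {a\<in>f x. real (card {c\<in>{c\<in>f z. g v c}. g a c}) < d * real (card {c\<in>f z. g v c})}" for z
 have finbad: "finite (bad z)" for z using fin_f(1)[OF xn(1)] by (simp add: bad_def)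
 have cbad: "real (card (bad z)) \<le> \<delta> * real (card (f x))" if "z \<in> Z" for z
  unfolding bad_def
 proof (rule atypical_card)
  show "HE x z" using that by (simp add: Z_def)
  have "?p * e1 * real (card (f z)) \<le> d * real (card (f z))"
  proof (rule mult_right_mono)
   have "?p * e1 \<le> ?p" by (rule pow_bounds)
   also have "... \<le> d ^ 1" using d by (intro power_decreasing) auto
   finally show "?p * e1 \<le> d" by simp
  qed simp
  thus "?p * e1 * real (card (f z)) \<le> real (card {c\<in>f z. g v c})" using rch[of z] that by (simp add: rich_def Z_def)
 qed auto
 have badU: "real (card (\<Union>z\<in>Z. bad z)) \<le> ?p / 8 * real (card (f x))"
 proof (cases "Z = {}")
  case True thus ?thesis using p0 by simp
 next
  case False
  then obtain z where z: "z \<in> Z" by auto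
  have "0 \<le> real (card (bad z))" by simp
  hence nn: "0 \<le> \<delta> * real (card (f x))" using cbad[OF z] by linarith
  have "card (\<Union>z\<in>Z. bad z) \<le> (\<Sum>z\<in>Z. card (bad z))" by (rule card_UN_le[OF finZ])
  hence "real (card (\<Union>z\<in>Z. bad z)) \<le> (\<Sum>z\<in>Z. real (card (bad z)))" by (metis of_nat_le_iff of_nat_sum)
  also have "... \<le> (\<Sum>z\<in>Z. \<delta> * real (card (f x)))" by (intro sum_mono cbad)
  also have "... = real (card Z) * (\<delta> * real (card (f x)))" by simp
  also have "... \<le> real \<Delta> * (\<delta> * real (card (f x)))" using cZ nn by (intro mult_right_mono) auto
  also have "... = real \<Delta> * \<delta> * real (card (f x))" by simp
  also have "... \<le> ?p * e1 / 8 * real (card (f x))" using dsmall(1) by (intro mult_right_mono) auto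
  also have "... \<le> ?p / 8 * real (card (f x))" by (intro mult_right_mono divide_right_mono pow_bounds) auto
  finally show ?thesis .
 qed
 have rx: "rate x = 1" using nbx by (auto simp: rate_def nb_def)
 define Gd where "Gd = (S \<inter> opts D \<phi> x) - (\<Union>z\<in>Z. bad z)"
 have Gd: "?p / 2 * real (card (f x)) \<le> real (card Gd)"
 proof -
  have 1: "real (card S) - 3 / 8 * ?p * real (card (f x)) \<le> real (card (S \<inter> opts D \<phi> x))"
   using opts_inter[OF v0 o(1) SC] rx by simp
  have 2: "?p * real (card (f x)) \<le> d ^ \<Delta> * real (card (f x))" by (rule pow_Suc_le) simp
  have "card (S \<inter> opts D \<phi> x) - card (\<Union>z\<in>Z. bad z) \<le> card Gd"
   unfolding Gd_def using finZ finbad by (intro diff_card_le_card_Diff) auto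
  hence "real (card (S \<inter> opts D \<phi> x)) - real (card (\<Union>z\<in>Z. bad z)) \<le> real (card Gd)" by linarith
  thus ?thesis using 1 2 cS badU by (simp add: algebra_simps)
 qed
 have lenle: "length ?us \<le> \<Delta>" using cZ by (simp add: Z_def)
 have "(?p / 2) ^ (\<Delta> + 1) \<le> (?p / 2) ^ (length ?us + 1)" using p0 lenle by (intro power_decreasing) auto
 also have "... = (?p / 2) * (?p / 2) ^ length ?us" by simp
 also have "... \<le> avg (opts D \<phi> x) (\<lambda>a. rgreedy ?us (insert x D) (\<phi>(x := a)) (\<lambda>\<phi>'. of_bool (good y v \<phi>' x)))"
 proof (rule avg_lower[OF oc(3,4)])
  show "Gd \<subseteq> opts D \<phi> x" by (auto simp: Gd_def)
  show "0 \<le> rgreedy ?us (insert x D) (\<phi>(x := a)) (\<lambda>\<phi>'. of_bool (good y v \<phi>' x))" if "a \<in> opts D \<phi> x" for a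
   by (rule rgreedy_ge[OF valid_step[OF v0 o(1) that] o(2)]) simp
  have "real (card (opts D \<phi> x)) \<le> real (card (f x))" using oc(2) fin_f(1)[OF xn(1)] by (simp add: card_mono)
  hence "?p / 2 * real (card (opts D \<phi> x)) \<le> ?p / 2 * real (card (f x))" using p0 by (intro mult_left_mono) auto
  thus "?p / 2 * real (card (opts D \<phi> x)) \<le> real (card Gd)" using Gd by linarith
  fix a assume a: "a \<in> Gd"
  hence ao: "a \<in> opts D \<phi> x" "a \<in> common \<phi> y" by (auto simp: Gd_def S_def)
  note v' = valid_step[OF v0 o(1) ao(1)]
  have "(?p / 2) ^ length ?us \<le> rgreedy ?us (insert x D) (\<phi>(x := a)) (\<lambda>\<phi>'. of_bool (\<forall>z\<in>set ?us. g v (\<phi>' z)))"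
  proof (rule rgreedy_into_nbhd[OF v' o(2) order_refl])
   show "set ?us \<subseteq> {..<n2 + b} \<inter> {..<n}" using nbx sus by (auto simp: nb_def)
   fix z assume "z \<in> set ?us" "z \<notin> insert x D"
   hence z: "HE x z" "z \<noteq> x" "z \<notin> D" using sus by auto
   have znb: "z \<in> nb x" using z by (simp add: nb_def)
   have "a \<notin> bad z" using a z(1) by (auto simp: Gd_def Z_def)
   moreover have "a \<in> f x" using ao(1) oc(2) by blast
   ultimately have "d * real (card {c\<in>f z. g v c}) \<le> real (card {c\<in>{c\<in>f z. g v c}. g a c})" by (simp add: bad_def not_less)
   moreover have "{c\<in>cand (insert x D) (\<phi>(x := a)) z. g v c} = {c\<in>{c\<in>f z. g v c}. g a c}"
    unfolding cand_insert(1)[OF o(1) z(2,3,1)] k0(2)[OF znb] by auto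
   moreover have "kdeg (insert x D) z = 1" using kdeg_insert(1)[OF finD xn(2) z(1)] k0(1)[OF znb] by simp
   moreover have "d * (d * real (card (f z))) \<le> d * real (card {c\<in>f z. g v c})" using rch[OF z(1)] d unfolding rich_def by (intro mult_left_mono) auto
   ultimately show "d ^ (kdeg (insert x D) z + 1) * real (card (f z)) \<le> real (card {c\<in>cand (insert x D) (\<phi>(x := a)) z. g v c})"
    by (simp add: power2_eq_square mult.assoc)
  qed
  also have "... \<le> rgreedy ?us (insert x D) (\<phi>(x := a)) (\<lambda>\<phi>'. of_bool (good y v \<phi>' x))"
  proof (rule rgreedy_mono[OF v' o(2)])
   fix \<phi>' assume ag: "\<forall>u\<in>insert x D. \<phi>' u = (\<phi>(x := a)) u"
   have "\<phi>' x \<in> common \<phi>' y"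
   proof -
    have "\<phi>' w = \<phi> w" if "HE w y" for w using ag y(4)[OF that] xn(2) by auto
    thus ?thesis using ag ao(2) by (auto simp: common_def)
   qed
   thus "of_bool (\<forall>z\<in>set ?us. g v (\<phi>' z)) \<le> (of_bool (good y v \<phi>' x) :: real)" using sus by (auto simp: good_def)
  qed
  finally show "(?p / 2) ^ length ?us \<le> rgreedy ?us (insert x D) (\<phi>(x := a)) (\<lambda>\<phi>'. of_bool (good y v \<phi>' x))" .
 qed (use p0 in simp)
 finally show ?thesis by (simp add: star_def)
qed

text \<open>Exponential moment bound: given the past, every relevant star is good with
 probability bounded below, so few good stars are exponentially unlikely.\<close>

lemma stars_moment:
 assumes "valid D \<phi>" "okl D (concat (map star xs))" "\<And>x. x \<in> set xs ==> nb x \<subseteq> {..<n2 + b} \<inter> {..<n}"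
  "separated (set xs)" "distinct xs"
  "\<And>x z w. x \<in> set xs ==> z \<in> nb x ==> w \<in> D ==> \<not> HE w z"
  and y: "y < n" "y \<in> Y" "y < n2 + b" "\<And>w. HE w y ==> w \<in> D"
  and rel: "\<And>x. x \<in> L ==> f y = f x \<and> (\<forall>z. HE x z --> rich v z)"
 shows "rgreedy (concat (map star xs)) D \<phi> (\<lambda>\<phi>'. (1 / 2) ^ card {x\<in>L \<inter> set xs. good y v \<phi>' x})
   \<le> (1 - (d ^ (\<Delta> + 1) / 2) ^ (\<Delta> + 1) / 2) ^ card (L \<inter> set xs)"
 using assms(1-6) y(4)
proof (induction xs arbitrary: D \<phi>)
 case (Cons x xs)
 let ?c = "(d ^ (\<Delta> + 1) / 2) ^ (\<Delta> + 1)"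
 let ?rest = "concat (map star xs)"
 have c01: "0 < ?c" "?c \<le> 1" 
 proof -
  show "0 < ?c" using pow_bounds(1) by (intro zero_less_power) simp
  show "?c \<le> 1" using pow_bounds by (intro power_le_one) auto
 qed
 have ol: "okl D (star x)" "okl (D \<union> nb x) ?rest" using Cons.prems(2) by (auto simp: okl_append set_star)
 have xs: "x \<notin> set xs" using Cons.prems(5) by simp
 \<comment> \<open>Separation: the star just embedded has no edge to the remaining stars, so these
   stay fresh.\<close>
 have far_xs: "\<not> HE w z" if "x' \<in> set xs" "z \<in> nb x'" "w \<in> nb x" for x' z w
 proof
  assume "HE w z"
  hence "z \<in> nb w" by (simp add: nb_def)
  moreover have "x' \<in> nb z" using that(2) nb_sym by blast
  ultimately have "x' \<in> near x" using that(3) nearI by blast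
  moreover have "x \<noteq> x'" using xs that(1) by auto
  ultimately show False using Cons.prems(4) that(1) unfolding separated_def by auto
 qed
 \<comment> \<open>The moment factorises: after the star of \<open>x\<close> is embedded, its factor
   \<open>h\<close> no longer changes, since the star and the neighbours of \<open>y\<close> are
   fixed.\<close>
 define h where "h \<phi>' = (if x \<in> L \<and> good y v \<phi>' x then 1 / 2 else 1 :: real)" for \<phi>'
 define m where "m = card (L \<inter> set xs)"
 define q where "q = (1 - ?c / 2) ^ m"
 have q0: "0 \<le> q" using c01 by (simp add: q_def)
 have Fsplit: "(1 / 2) ^ card {x'\<in>L \<inter> set (x # xs). good y v \<phi>' x'} = h \<phi>' * (1 / 2 :: real) ^ card {x'\<in>L \<inter> set xs. good y v \<phi>' x'}" for \<phi>'
 proof (cases "x \<in> L \<and> good y v \<phi>' x")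
  case True
  hence "{x'\<in>L \<inter> set (x # xs). good y v \<phi>' x'} = insert x {x'\<in>L \<inter> set xs. good y v \<phi>' x'}" by auto
  thus ?thesis using True xs by (simp add: h_def)
 next
  case False
  hence "{x'\<in>L \<inter> set (x # xs). good y v \<phi>' x'} = {x'\<in>L \<inter> set xs. good y v \<phi>' x'}" by auto
  thus ?thesis using False by (simp add: h_def)
 qed
 have "rgreedy (concat (map star (x # xs))) D \<phi> (\<lambda>\<phi>'. (1 / 2) ^ card {x'\<in>L \<inter> set (x # xs). good y v \<phi>' x'})
   = rgreedy (star x) D \<phi> (\<lambda>\<phi>1. rgreedy ?rest (D \<union> nb x) \<phi>1 (\<lambda>\<phi>'. h \<phi>' * (1 / 2) ^ card {x'\<in>L \<inter> set xs. good y v \<phi>' x'}))"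
  unfolding Fsplit by (simp add: rgreedy_append set_star)
 also have "... \<le> rgreedy (star x) D \<phi> (\<lambda>\<phi>1. q * h \<phi>1)"
 proof (rule rgreedy_mono[OF Cons.prems(1) ol(1)])
  fix \<phi>1 assume "valid (D \<union> set (star x)) \<phi>1" "\<forall>u\<in>D. \<phi>1 u = \<phi> u"
  hence v1: "valid (D \<union> nb x) \<phi>1" by (simp add: set_star)
  have "rgreedy ?rest (D \<union> nb x) \<phi>1 (\<lambda>\<phi>'. h \<phi>' * (1 / 2) ^ card {x'\<in>L \<inter> set xs. good y v \<phi>' x'})
   = rgreedy ?rest (D \<union> nb x) \<phi>1 (\<lambda>\<phi>'. h \<phi>1 * (1 / 2) ^ card {x'\<in>L \<inter> set xs. good y v \<phi>' x'})"
  proof (rule rgreedy_cong[OF v1 ol(2)])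
   fix \<phi>' assume ag: "\<forall>u\<in>D \<union> nb x. \<phi>' u = \<phi>1 u"
   have "common \<phi>' y = common \<phi>1 y" using ag Cons.prems(7) by (auto simp: common_def)
   hence "good y v \<phi>' x = good y v \<phi>1 x" using ag by (auto simp: good_def nb_def)
   thus "h \<phi>' * (1 / 2) ^ card {x'\<in>L \<inter> set xs. good y v \<phi>' x'} = h \<phi>1 * (1 / 2) ^ card {x'\<in>L \<inter> set xs. good y v \<phi>' x'}"
    by (simp add: h_def)
  qed
  also have "... = h \<phi>1 * rgreedy ?rest (D \<union> nb x) \<phi>1 (\<lambda>\<phi>'. (1 / 2) ^ card {x'\<in>L \<inter> set xs. good y v \<phi>' x'})"
   by (rule rgreedy_cmult)
  also have "... \<le> h \<phi>1 * q"
  proof (rule mult_left_mono)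
   show "rgreedy ?rest (D \<union> nb x) \<phi>1 (\<lambda>\<phi>'. (1 / 2) ^ card {x'\<in>L \<inter> set xs. good y v \<phi>' x'}) \<le> q"
    unfolding q_def m_def
   proof (rule Cons.IH[OF v1 ol(2)])
    show "nb x' \<subseteq> {..<n2 + b} \<inter> {..<n}" if "x' \<in> set xs" for x' using Cons.prems(3)[of x'] that by simp
    show "separated (set xs)" using Cons.prems(4) separated_subset by auto
    show "distinct xs" using Cons.prems(5) by simp
    show "\<not> HE w z" if "x' \<in> set xs" "z \<in> nb x'" "w \<in> D \<union> nb x" for x' z w
     using that Cons.prems(6)[of x' z w] far_xs[of x' z w] by auto
    show "w \<in> D \<union> nb x" if "HE w y" for w using Cons.prems(7)[OF that] by simp
   qed
  qed (simp add: h_def)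
  finally show "rgreedy ?rest (D \<union> nb x) \<phi>1 (\<lambda>\<phi>'. h \<phi>' * (1 / 2) ^ card {x'\<in>L \<inter> set xs. good y v \<phi>' x'}) \<le> q * h \<phi>1"
   if "valid (D \<union> set (star x)) \<phi>1" by (simp add: mult.commute)
 qed
 also have "... = q * rgreedy (star x) D \<phi> h" by (rule rgreedy_cmult)
 also have "... \<le> (1 - ?c / 2) ^ card (L \<inter> set (x # xs))"
 proof (cases "x \<in> L")
  case True
  have "rgreedy (star x) D \<phi> h = rgreedy (star x) D \<phi> (\<lambda>\<phi>'. 1 + (- 1 / 2) * of_bool (good y v \<phi>' x))"
   using True by (intro arg_cong[where f="rgreedy (star x) D \<phi>"]) (auto simp: h_def fun_eq_iff)
  also have "... = 1 + (- 1 / 2) * rgreedy (star x) D \<phi> (\<lambda>\<phi>'. of_bool (good y v \<phi>' x))"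
   unfolding rgreedy_add rgreedy_cmult using rgreedy_const[OF Cons.prems(1) ol(1), of 1] by simp
  also have "... \<le> 1 - ?c / 2"
  proof -
   have "?c \<le> rgreedy (star x) D \<phi> (\<lambda>\<phi>'. of_bool (good y v \<phi>' x))"
   proof (rule star_good[OF Cons.prems(1) ol(1)])
    show "nb x \<subseteq> {..<n2 + b} \<inter> {..<n}" using Cons.prems(3) by simp
    show "\<not> HE w z" if "z \<in> nb x" "w \<in> D" for z w using Cons.prems(6)[of x z w] that by simp
    show "f y = f x" "\<And>z. HE x z ==> rich v z" using rel[OF True] by auto
   qed (use y Cons.prems(7) in auto)
   thus ?thesis by simp
  qed
  finally have "q * rgreedy (star x) D \<phi> h \<le> q * (1 - ?c / 2)" using q0 by (intro mult_left_mono)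
  moreover have "card (L \<inter> set (x # xs)) = Suc m"
  proof -
   have "L \<inter> set (x # xs) = insert x (L \<inter> set xs)" using True by auto
   thus ?thesis using xs by (simp add: m_def)
  qed
  ultimately show ?thesis by (simp add: q_def mult.commute)
 next
  case False
  have "rgreedy (star x) D \<phi> h \<le> 1" by (rule rgreedy_le[OF Cons.prems(1) ol(1)]) (simp add: h_def)
  hence "q * rgreedy (star x) D \<phi> h \<le> q" using q0 by (simp add: mult_left_le)
  moreover have "L \<inter> set (x # xs) = L \<inter> set xs" using False by auto
  ultimately show ?thesis by (simp add: q_def m_def)
 qed
 finally show ?case .
qed simp

end

section \<open>Random swaps\<close>

text \<open>\<open>\<sigma> y\<close> is the leftover vertex drawn for \<open>y\<close>, and \<open>\<eta> y\<close> is the vertex that gives up its place to \<open>y\<close> and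
 moves to \<open>\<sigma> y\<close>.\<close>

fun swp :: "(nat => 'b => nat set) => nat list => 'b set => nat set => (nat => 'b) => (nat => nat)
  => ((nat => 'b) => (nat => nat) => real) => real" where
 "swp G [] L U \<sigma> \<eta> F = F \<sigma> \<eta>"
| "swp G (y # ys) L U \<sigma> \<eta> F =
   avg L (\<lambda>v. avg (G y v - U) (\<lambda>x. swp G ys (L - {v}) (insert x U) (\<sigma>(y := v)) (\<eta>(y := x)) F))"

text \<open>Room in \<open>G y v\<close> is counted within one class of \<open>cls\<close>, the
  cluster: vertices already used and reserve vertices still to be served compete only inside it. The
  1 on the right cancels \<open>y\<close> itself, so at least K choices remain in every
  step.\<close>

definition swp_ok :: "(nat => 'b => nat set) => (nat => 'c) => real => nat list => 'b set => nat set => bool" where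
 "swp_ok G cls K ys L U \<longleftrightarrow> distinct ys \<and> finite L \<and> card L = length ys \<and> finite U \<and> 0 < K \<and>
   (\<forall>y\<in>set ys. \<forall>v\<in>L. finite (G y v) \<and> (\<forall>x\<in>G y v. cls x = cls y) \<and>
    K + real (card {u\<in>U. cls u = cls y}) + real (card {y'\<in>set ys. cls y' = cls y}) \<le> real (card (G y v)) + 1)"

lemma swp_ok_card:
 assumes "swp_ok G cls K (y # ys) L U" "v \<in> L"
 shows "K \<le> real (card (G y v - U))" "finite (G y v - U)" "G y v - U \<noteq> {}"
proof -
 have G: "finite (G y v)" "\<forall>x\<in>G y v. cls x = cls y"
  "K + real (card {u\<in>U. cls u = cls y}) + real (card {y'\<in>set (y # ys). cls y' = cls y}) \<le> real (card (G y v)) + 1"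
  and finU: "finite U" and K: "0 < K"
  using assms unfolding swp_ok_def by auto
 show fin: "finite (G y v - U)" using G(1) by simp
 have "card {y} \<le> card {y'\<in>set (y # ys). cls y' = cls y}" by (intro card_mono) auto
 hence 1: "1 \<le> real (card {y'\<in>set (y # ys). cls y' = cls y})" by simp
 have "card (G y v \<inter> U) \<le> card {u\<in>U. cls u = cls y}" using G(2) finU by (intro card_mono) auto
 moreover have "card (G y v) = card (G y v - U) + card (G y v \<inter> U)"
  using G(1) by (metis add.commute card_Int_Diff)
 ultimately show k: "K \<le> real (card (G y v - U))" using G(3) 1 by simp
 have "card (G y v - U) \<noteq> 0" using k K by linarith
 thus "G y v - U \<noteq> {}" by (metis card.empty)
qed

lemma swp_ok_step:
 assumes o: "swp_ok G cls K (y # ys) L U" and v: "v \<in> L" and x: "x \<in> G y v - U"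
 shows "swp_ok G cls K ys (L - {v}) (insert x U)"
proof -
 have cx: "cls x = cls y" using assms unfolding swp_ok_def by auto
 have finU: "finite U" and yys: "y \<notin> set ys" using o by (auto simp: swp_ok_def)
 have "K + real (card {u\<in>insert x U. cls u = cls y1}) + real (card {y'\<in>set ys. cls y' = cls y1}) \<le> real (card (G y1 v1)) + 1"
  if y1: "y1 \<in> set ys" "v1 \<in> L" for y1 v1
 proof -
  have old: "K + real (card {u\<in>U. cls u = cls y1}) + real (card {y'\<in>set (y # ys). cls y' = cls y1}) \<le> real (card (G y1 v1)) + 1"
   using o y1 unfolding swp_ok_def by auto
  show ?thesis
  proof (cases "cls y = cls y1")
   case True
   have "{u\<in>insert x U. cls u = cls y1} = insert x {u\<in>U. cls u = cls y1}" using cx True by auto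
   hence "card {u\<in>insert x U. cls u = cls y1} = Suc (card {u\<in>U. cls u = cls y1})" using x finU by simp
   moreover have "{y'\<in>set (y # ys). cls y' = cls y1} = insert y {y'\<in>set ys. cls y' = cls y1}" using True by auto
   hence "card {y'\<in>set (y # ys). cls y' = cls y1} = Suc (card {y'\<in>set ys. cls y' = cls y1})" using yys by simp
   ultimately show ?thesis using old by simp
  next
   case False
   have "{u\<in>insert x U. cls u = cls y1} = {u\<in>U. cls u = cls y1}" using cx False by auto
   moreover have "{y'\<in>set (y # ys). cls y' = cls y1} = {y'\<in>set ys. cls y' = cls y1}" using False by auto
   ultimately show ?thesis using old by simp
  qed
 qed
 moreover have "card (L - {v}) = length ys" using o v by (simp add: swp_ok_def)
 ultimately show ?thesis using o finU unfolding swp_ok_def by auto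
qed

lemma swp_ok_nonempty: "swp_ok G cls K (y # ys) L U ==> finite L \<and> L \<noteq> {}"
 by (auto simp: swp_ok_def)

definition swp_supp :: "(nat => 'b => nat set) => nat list => 'b set => nat set => (nat => 'b) => (nat => nat)
  => (nat => 'b) => (nat => nat) => bool" where
 "swp_supp G ys L U \<sigma> \<eta> \<sigma>' \<eta>' \<longleftrightarrow> (\<forall>u. u \<notin> set ys --> \<sigma>' u = \<sigma> u \<and> \<eta>' u = \<eta> u) \<and>
   bij_betw \<sigma>' (set ys) L \<and> inj_on \<eta>' (set ys) \<and> (\<forall>y\<in>set ys. \<eta>' y \<in> G y (\<sigma>' y)) \<and> \<eta>' ` set ys \<inter> U = {}"

lemma swp_supp_step:
 assumes s: "swp_supp G ys (L - {v}) (insert x U) (\<sigma>(y := v)) (\<eta>(y := x)) \<sigma>' \<eta>'"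
  and y: "y \<notin> set ys" and v: "v \<in> L" and x: "x \<in> G y v - U"
 shows "swp_supp G (y # ys) L U \<sigma> \<eta> \<sigma>' \<eta>'"
proof -
 have sy: "\<sigma>' y = v" "\<eta>' y = x" using s y by (auto simp: swp_supp_def)
 have "bij_betw \<sigma>' (insert y (set ys)) (insert v (L - {v}))"
  using s sy y by (subst insert_is_Un[of y], subst insert_is_Un[of v], intro bij_betw_combine)
   (auto simp: swp_supp_def bij_betw_def)
 hence "bij_betw \<sigma>' (set (y # ys)) L" using v by (simp add: insert_absorb)
 moreover have "inj_on \<eta>' (set (y # ys))" using s sy y by (auto simp: swp_supp_def inj_on_insert)
 ultimately show ?thesis using s sy x by (auto simp: swp_supp_def)
qed

lemma swp_mono:
 assumes "swp_ok G cls K ys L U" "\<And>\<sigma>' \<eta>'. swp_supp G ys L U \<sigma> \<eta> \<sigma>' \<eta>' ==> F \<sigma>' \<eta>' \<le> F' \<sigma>' \<eta>'"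
 shows "swp G ys L U \<sigma> \<eta> F \<le> swp G ys L U \<sigma> \<eta> F'"
 using assms
proof (induction ys arbitrary: L U \<sigma> \<eta>)
 case Nil
 have "swp_supp G [] L U \<sigma> \<eta> \<sigma> \<eta>" using Nil(1) by (auto simp: swp_supp_def swp_ok_def bij_betw_def)
 thus ?case using Nil(2) by simp
next
 case (Cons y ys)
 have y: "y \<notin> set ys" using Cons.prems(1) by (simp add: swp_ok_def)
 show ?case unfolding swp.simps
 proof (intro avg_mono)
  fix v x assume vx: "v \<in> L" "x \<in> G y v - U"
  show "swp G ys (L - {v}) (insert x U) (\<sigma>(y := v)) (\<eta>(y := x)) F \<le> swp G ys (L - {v}) (insert x U) (\<sigma>(y := v)) (\<eta>(y := x)) F'"
  proof (rule Cons.IH[OF swp_ok_step[OF Cons.prems(1) vx]])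
   fix \<sigma>' \<eta>' assume s: "swp_supp G ys (L - {v}) (insert x U) (\<sigma>(y := v)) (\<eta>(y := x)) \<sigma>' \<eta>'"
   show "F \<sigma>' \<eta>' \<le> F' \<sigma>' \<eta>'" by (rule Cons.prems(2)[OF swp_supp_step[OF s y vx]])
  qed
 qed
qed

lemma swp_const:
 assumes "swp_ok G cls K ys L U" shows "swp G ys L U \<sigma> \<eta> (\<lambda>_ _. c) = c"
 using assms
proof (induction ys arbitrary: L U \<sigma> \<eta>)
 case (Cons y ys)
 have "swp G (y # ys) L U \<sigma> \<eta> (\<lambda>_ _. c) = avg L (\<lambda>v. avg (G y v - U) (\<lambda>x. c))"
  unfolding swp.simps avg_def using Cons.IH[OF swp_ok_step[OF Cons.prems]]
  by (intro arg_cong2[of _ _ _ _ "(/)"] sum.cong refl) auto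
 also have "... = avg L (\<lambda>v. c)"
  unfolding avg_def[of L] using avg_const[OF swp_ok_card(2,3)[OF Cons.prems]]
  by (intro arg_cong2[of _ _ _ _ "(/)"] sum.cong refl) auto
 finally show ?case using avg_const swp_ok_nonempty[OF Cons.prems] by metis
qed simp

lemma swp_add: "swp G ys L U \<sigma> \<eta> (\<lambda>s e. F s e + F' s e) = swp G ys L U \<sigma> \<eta> F + swp G ys L U \<sigma> \<eta> F'"
 by (induction ys arbitrary: L U \<sigma> \<eta>) (auto simp: avg_add)

lemma swp_cmult: "swp G ys L U \<sigma> \<eta> (\<lambda>s e. c * F s e) = c * swp G ys L U \<sigma> \<eta> F"
 by (induction ys arbitrary: L U \<sigma> \<eta>) (auto simp: avg_cmult)

lemma avg_filter_empty: "(\<And>x. x \<in> A ==> \<not> Q x) ==> avg A (\<lambda>x. if Q x then F x else 0) = 0"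
 by (simp add: avg_def)

text \<open>The requirements satisfied by every step \<open>(y, v, x)\<close> when the final map agrees with \<open>w\<close> on \<open>S\<close>;
 \<open>Z\<close> is the set of points of \<open>S\<close> that have to be moved.\<close>

definition permitted :: "(nat => 'b) => (nat => 'b) => nat set => nat set => nat set => nat => 'b => nat => bool" where
 "permitted \<phi> w S SY Z y v x \<longleftrightarrow> (y \<in> SY --> \<phi> x = w y) \<and> (\<forall>z\<in>Z. w z = v --> x = z) \<and>
   (x \<in> Z --> v = w x) \<and> (y \<notin> SY --> \<phi> x \<notin> w ` SY)"

text \<open>\<open>P\<close> consists of the points of \<open>Z\<close> whose present place is
  prescribed for some y in \<open>SY\<close>. For such a z both draws of that y are forced, giving
  1/K and one factor of the factorial quotient. A point of Z - P may be moved by any y: whichever y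
  draws w z must then draw z, giving 1/K. Any other y in \<open>SY\<close> must draw the vertex on
  its prescribed place, again 1/K.\<close>

lemma swp_permitted:
 fixes \<phi> w :: "nat => 'b"
 assumes ok: "swp_ok G cls K ys L U"
  and GX: "\<And>y v. G y v \<subseteq> X0" and inj: "inj_on \<phi> (X0 \<union> Z)" and winj: "inj_on w SY" "inj_on w Z"
  and K1: "1 \<le> K"
  and P: "P = {z\<in>Z. \<exists>y\<in>SY \<inter> set ys. \<phi> z = w y}" and PL: "w ` P \<subseteq> L"
  and NP: "\<And>z. z \<in> Z ==> w z \<in> L ==> \<phi> z \<in> w ` SY ==> z \<in> P"
 shows "swp G ys L U \<sigma> \<eta> (\<lambda>\<sigma>' \<eta>'. of_bool (\<forall>y\<in>set ys. permitted \<phi> w S SY Z y (\<sigma>' y) (\<eta>' y)))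
   \<le> (1 / K) ^ (card (L \<inter> w ` (Z - P)) + card (SY \<inter> set ys)) * (fact (length ys - card P) / fact (length ys))"
 using ok P PL NP
proof (induction ys arbitrary: L U \<sigma> \<eta> P)
 case Nil
 have "L = {}" using Nil(1) by (auto simp: swp_ok_def)
 thus ?case using Nil(2,3) by simp
next
 case (Cons y ys)
 have y: "y \<notin> set ys" and finL: "finite L" and cL: "card L = Suc (length ys)" and K0: "0 < K"
  using Cons.prems(1) by (auto simp: swp_ok_def)
 let ?perm = "permitted \<phi> w S SY Z"
 define m where "m = length ys"
 define k where "k = card P"
 define N where "N = card (L \<inter> w ` (Z - P)) + card (SY \<inter> set (y # ys))"
 have PZ: "P \<subseteq> Z" using Cons.prems(2) by auto
 have winjP: "inj_on w P" using winj(2) PZ by (rule inj_on_subset)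
 have finP: "finite P" using Cons.prems(3) finL winjP by (meson finite_imageD finite_subset)
 have kcard: "card (w ` P) = k" using winjP by (simp add: card_image k_def)
 have km: "k \<le> Suc m" using card_mono[OF finL Cons.prems(3)] kcard cL by (simp add: m_def)
 define F where "F v x = swp G ys (L - {v}) (insert x U) (\<sigma>(y := v)) (\<eta>(y := x))
   (\<lambda>\<sigma>' \<eta>'. of_bool (\<forall>y\<in>set ys. ?perm y (\<sigma>' y) (\<eta>' y)))" for v x
 have inner: "swp G ys (L - {v}) (insert x U) (\<sigma>(y := v)) (\<eta>(y := x))
   (\<lambda>\<sigma>' \<eta>'. of_bool (\<forall>y'\<in>set (y # ys). ?perm y' (\<sigma>' y') (\<eta>' y'))) \<le> (if ?perm y v x then F v x else 0)"
  if "v \<in> L" "x \<in> G y v - U" for v x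
 proof -
  note o' = swp_ok_step[OF Cons.prems(1) that]
  have "swp G ys (L - {v}) (insert x U) (\<sigma>(y := v)) (\<eta>(y := x))
   (\<lambda>\<sigma>' \<eta>'. of_bool (\<forall>y'\<in>set (y # ys). ?perm y' (\<sigma>' y') (\<eta>' y')))
   \<le> swp G ys (L - {v}) (insert x U) (\<sigma>(y := v)) (\<eta>(y := x))
    (\<lambda>\<sigma>' \<eta>'. of_bool (?perm y v x) * of_bool (\<forall>y\<in>set ys. ?perm y (\<sigma>' y) (\<eta>' y)))"
  proof (rule swp_mono[OF o'])
   fix \<sigma>' \<eta>' assume "swp_supp G ys (L - {v}) (insert x U) (\<sigma>(y := v)) (\<eta>(y := x)) \<sigma>' \<eta>'"
   hence "\<sigma>' y = v" "\<eta>' y = x" using y by (auto simp: swp_supp_def)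
   thus "of_bool (\<forall>y'\<in>set (y # ys). ?perm y' (\<sigma>' y') (\<eta>' y')) \<le>
    (of_bool (?perm y v x) * of_bool (\<forall>y\<in>set ys. ?perm y (\<sigma>' y) (\<eta>' y)) :: real)" by auto
  qed
  thus ?thesis unfolding swp_cmult F_def by auto
 qed
 have xz: "x = z" if "x \<in> X0" "z \<in> Z" "\<phi> x = \<phi> z" for x z using inj that by (auto dest: inj_onD)
 have N1: "1 \<le> N" if "y \<in> SY"
 proof -
  have "card {y} \<le> card (SY \<inter> set (y # ys))" using that by (intro card_mono) auto
  thus ?thesis by (simp add: N_def)
 qed
 have SYc: "card (SY \<inter> set (y # ys)) = (if y \<in> SY then 1 else 0) + card (SY \<inter> set ys)"
 proof (cases "y \<in> SY")
  case True
  hence "SY \<inter> set (y # ys) = insert y (SY \<inter> set ys)" by auto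
  thus ?thesis using y True by simp
 next
  case False
  hence "SY \<inter> set (y # ys) = SY \<inter> set ys" by auto
  thus ?thesis using False by simp
 qed
 have step_avg: "swp G (y # ys) L U \<sigma> \<eta> (\<lambda>\<sigma>' \<eta>'. of_bool (\<forall>y'\<in>set (y # ys). ?perm y' (\<sigma>' y') (\<eta>' y')))
   \<le> avg L (\<lambda>v. avg (G y v - U) (\<lambda>x. if ?perm y v x then F v x else 0))"
  unfolding swp.simps by (intro avg_mono inner)
 show ?case
 proof (cases "y \<in> SY \<and> (\<exists>z\<in>P. \<phi> z = w y)")
  case True
  then obtain z where z: "z \<in> P" "\<phi> z = w y" "y \<in> SY" by blast
  have zZ: "z \<in> Z" using z PZ by auto
  define P' where "P' = P - {z}"
  have P'eq: "P' = {z\<in>Z. \<exists>y'\<in>SY \<inter> set ys. \<phi> z = w y'}"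
  proof -
   have A1: "z' \<noteq> z" if "y' \<in> SY \<inter> set ys" "\<phi> z' = w y'" for z' y'
   proof
    assume "z' = z"
    hence "w y' = w y" using that z by simp
    hence "y' = y" using winj(1) that z by (auto dest: inj_onD)
    thus False using that y by simp
   qed
   have A2: "\<exists>y'\<in>SY \<inter> set ys. \<phi> z' = w y'" if zz: "z' \<in> P" "z' \<noteq> z" for z'
   proof -
    obtain y' where y': "y' \<in> SY \<inter> set (y # ys)" "\<phi> z' = w y'" using Cons.prems(2) zz by auto
    have "y' \<noteq> y"
    proof
     assume "y' = y"
     hence "\<phi> z' = \<phi> z" using y' z by simp
     hence "z' = z" using inj zz(1) zZ PZ by (auto dest: inj_onD)
     thus False using zz by simp
    qed
    thus ?thesis using y' by auto
   qed
   show ?thesis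
   proof (intro set_eqI iffI)
    fix x assume "x \<in> P'"
    hence "x \<in> P" "x \<noteq> z" by (auto simp: P'_def)
    thus "x \<in> {z \<in> Z. \<exists>y'\<in>SY \<inter> set ys. \<phi> z = w y'}" using A2 PZ by blast
   next
    fix x assume "x \<in> {z \<in> Z. \<exists>y'\<in>SY \<inter> set ys. \<phi> z = w y'}"
    then obtain y' where y': "x \<in> Z" "y' \<in> SY \<inter> set ys" "\<phi> x = w y'" by blast
    have "x \<noteq> z" by (rule A1[OF y'(2,3)])
    moreover have "x \<in> P" unfolding Cons.prems(2) using y' by auto
    ultimately show "x \<in> P'" by (simp add: P'_def)
   qed
  qed
  have kP: "card P' = k - 1" "0 < k" using z finP by (auto simp: P'_def k_def card_gt_0_iff)
  \<comment> \<open>The prescribed place of y forces x = z, and z, which has to move, forces v = w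
    z.\<close>
  have only: "v = w z \<and> x = z" if "x \<in> G y v - U" "?perm y v x" for v x
  proof -
   have p1: "\<phi> x = \<phi> z" using that(2) z by (simp add: permitted_def)
   have p2: "x \<in> X0" using GX[of y v] that(1) by auto
   have p3: "x = z" by (rule xz[OF p2 zZ p1])
   have "x \<in> Z --> v = w x" using that(2) unfolding permitted_def by blast
   thus ?thesis using p3 zZ by simp
  qed
  have Fz: "F (w z) z \<le> (1 / K) ^ (N - 1) * (fact (m - (k - 1)) / fact m)" if v: "w z \<in> L" "z \<in> G y (w z) - U"
  proof -
   have sub: "(L - {w z}) \<inter> w ` (Z - P') = L \<inter> w ` (Z - P)"
   proof -
    have "w z' \<noteq> w z" if "z' \<in> Z - P" for z' using winj(2) zZ that z by (auto dest: inj_onD)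
    thus ?thesis unfolding P'_def using z zZ by auto
   qed
   have "F (w z) z \<le> (1 / K) ^ (card ((L - {w z}) \<inter> w ` (Z - P')) + card (SY \<inter> set ys)) * (fact (length ys - card P') / fact (length ys))"
    unfolding F_def
   proof (rule Cons.IH[OF swp_ok_step[OF Cons.prems(1) v] P'eq])
    show "w ` P' \<subseteq> L - {w z}" using Cons.prems(3) winjP z by (auto simp: P'_def dest: inj_onD)
    show "z' \<in> P'" if "z' \<in> Z" "w z' \<in> L - {w z}" "\<phi> z' \<in> w ` SY" for z'
     using Cons.prems(4)[of z'] that by (auto simp: P'_def)
   qed
   thus ?thesis unfolding sub kP m_def[symmetric] using z(3) SYc by (simp add: N_def)
  qed
  let ?q = "(1 / K) ^ N * (fact (m - (k - 1)) / fact m)"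
  have q0: "0 \<le> ?q" using K0 by simp
  have "avg L (\<lambda>v. avg (G y v - U) (\<lambda>x. if ?perm y v x then F v x else 0)) \<le> ?q / real (card L)"
  proof (rule avg_single[OF finL, where x = "w z"])
   fix v assume v: "v \<in> L"
   have "avg (G y v - U) (\<lambda>x. if ?perm y v x then F v x else 0) \<le> (if v = w z then (1 / K) ^ (N - 1) * (fact (m - (k - 1)) / fact m) else 0) / K"
   proof (rule avg_single[OF swp_ok_card(2)[OF Cons.prems(1) v] _ swp_ok_card(1)[OF Cons.prems(1) v] K0, where x = z])
    fix x assume x: "x \<in> G y v - U"
    show "(if ?perm y v x then F v x else 0) \<le> (if x = z then if v = w z then (1 / K) ^ (N - 1) * (fact (m - (k - 1)) / fact m) else 0 else 0)"
    proof (cases "?perm y v x")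
     case True
     have e: "v = w z" "x = z" using only[OF x True] by auto
     hence "F v x \<le> (1 / K) ^ (N - 1) * (fact (m - (k - 1)) / fact m)" using Fz v x by simp
     thus ?thesis using True e by simp
    qed (use K0 in simp)
   qed (use K0 in simp)
   also have "... = (if v = w z then ?q else 0)"
   proof -
    have "(1 / K) ^ N = (1 / K) ^ (N - 1) * (1 / K)" using N1[OF z(3)] by (metis Suc_diff_1 Suc_le_eq One_nat_def power_Suc2)
    thus ?thesis by simp
   qed
   finally show "avg (G y v - U) (\<lambda>x. if ?perm y v x then F v x else 0) \<le> (if v = w z then ?q else 0)" .
  qed (use q0 cL in auto)
  also have "?q / real (card L) = (1 / K) ^ N * (fact (length (y # ys) - k) / fact (length (y # ys)))"
  proof -
   have "m - (k - 1) = Suc m - k" using kP(2) by simp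
   thus ?thesis by (simp add: cL m_def field_simps)
  qed
  finally show ?thesis using step_avg unfolding N_def k_def by linarith
 next
  case F: False
  have Peq: "P = {z\<in>Z. \<exists>y'\<in>SY \<inter> set ys. \<phi> z = w y'}" using Cons.prems(2) F by auto
  let ?q = "(1 / K) ^ N * (fact (m - k) / fact m)"
  have q0: "0 \<le> ?q" using K0 by simp
  have each: "avg (G y v - U) (\<lambda>x. if ?perm y v x then F v x else 0) \<le> (if v \<in> w ` P then 0 else ?q)" if v: "v \<in> L" for v
  proof (cases "v \<in> w ` P")
   \<comment> \<open>The leftover vertex w z is reserved for the y that takes over the place of z,
     and the present y is a different one.\<close>
   case True
   then obtain z where z: "z \<in> P" "v = w z" by blast
   have "\<not> ?perm y v x" if "x \<in> G y v - U" for x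
   proof
    assume p: "?perm y v x"
    have "x = z" using p z PZ by (auto simp: permitted_def)
    moreover have "\<phi> z \<in> w ` SY" using z Peq by auto
    ultimately show False using p F z by (auto simp: permitted_def)
   qed
   hence "avg (G y v - U) (\<lambda>x. if ?perm y v x then F v x else 0) = 0" by (rule avg_filter_empty)
   thus ?thesis using True by simp
  next
   case vP: False
   define N' where "N' = card ((L - {v}) \<inter> w ` (Z - P)) + card (SY \<inter> set ys)"
   have Fx: "F v x \<le> (1 / K) ^ N' * (fact (m - k) / fact m)" if x: "x \<in> G y v - U" for x
    unfolding F_def N'_def m_def k_def
   proof (rule Cons.IH[OF swp_ok_step[OF Cons.prems(1) v x] Peq])
    show "w ` P \<subseteq> L - {v}" using Cons.prems(3) vP by auto
    show "z' \<in> P" if "z' \<in> Z" "w z' \<in> L - {v}" "\<phi> z' \<in> w ` SY" for z' using Cons.prems(4)[of z'] that by auto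
   qed
   have f0: "0 \<le> (1 / K) ^ N' * (fact (m - k) / fact m)" using K0 by simp
   have "avg (G y v - U) (\<lambda>x. if ?perm y v x then F v x else 0) \<le> ?q"
   proof (cases "y \<in> SY \<or> v \<in> w ` (Z - P)")
    case True
    obtain x0 where x0: "\<And>x. x \<in> G y v - U ==> ?perm y v x ==> x = x0"
    proof (cases "y \<in> SY")
     case True
     have "x = x'" if "x \<in> G y v - U" "?perm y v x" "x' \<in> G y v - U" "?perm y v x'" for x x'
     proof -
      have "\<phi> x = \<phi> x'" using that True by (simp add: permitted_def)
      moreover have "x \<in> X0" "x' \<in> X0" using that GX by blast+
      ultimately show ?thesis using inj by (auto dest: inj_onD)
     qed
     thus ?thesis using that by metis
    next
     case False
     then obtain z where z: "z \<in> Z" "v = w z" using True by auto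
     show ?thesis
     proof (rule that[of z])
      fix x assume "?perm y v x"
      hence "\<forall>z\<in>Z. w z = v --> x = z" unfolding permitted_def by blast
      thus "x = z" using z by simp
     qed
    qed
    have av: "avg (G y v - U) (\<lambda>x. if ?perm y v x then F v x else 0) \<le> (1 / K) ^ N' * (fact (m - k) / fact m) / K"
    proof (rule avg_single[OF swp_ok_card(2)[OF Cons.prems(1) v] _ swp_ok_card(1)[OF Cons.prems(1) v] K0 f0, where x = x0])
     fix x assume x: "x \<in> G y v - U"
     show "(if ?perm y v x then F v x else 0) \<le> (if x = x0 then (1 / K) ^ N' * (fact (m - k) / fact m) else 0)"
     proof (cases "?perm y v x")
      case True
      thus ?thesis using x0[OF x True] Fx[OF x] by simp
     qed (use f0 in simp)
    qed
    show ?thesis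
    proof (cases "y \<in> SY \<and> v \<in> w ` (Z - P)")
     \<comment> \<open>A z forced by \<open>v\<close> and by \<open>y\<close> at once would belong
       to P. Hence this combination has probability 0, and no step has to pay two factors
       1/K.\<close>
     case both: True
     have "\<not> ?perm y v x" if "x \<in> G y v - U" for x
     proof
      assume p: "?perm y v x"
      obtain z where z: "z \<in> Z - P" "v = w z" using both by auto
      have "x = z" using p z by (auto simp: permitted_def)
      hence "\<phi> z = w y" using p both by (auto simp: permitted_def)
      hence "z \<in> P" using Cons.prems(2) z both by auto
      thus False using z by simp
     qed
     hence "avg (G y v - U) (\<lambda>x. if ?perm y v x then F v x else 0) = 0" by (rule avg_filter_empty)
     thus ?thesis using q0 by simp
    next
     case one: False
     have "N = Suc N'"
     proof (cases "y \<in> SY")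
      case True
      hence "v \<notin> w ` (Z - P)" using one by simp
      hence "(L - {v}) \<inter> w ` (Z - P) = L \<inter> w ` (Z - P)" by auto
      thus ?thesis using True SYc by (simp add: N_def N'_def)
     next
      case False
      hence vw: "v \<in> w ` (Z - P)" using True by simp
      hence "L \<inter> w ` (Z - P) = insert v ((L - {v}) \<inter> w ` (Z - P))" using v by auto
      moreover have "v \<notin> (L - {v}) \<inter> w ` (Z - P)" "finite ((L - {v}) \<inter> w ` (Z - P))" using finL by auto
      ultimately have "card (L \<inter> w ` (Z - P)) = Suc (card ((L - {v}) \<inter> w ` (Z - P)))" by (metis card_insert_disjoint)
      thus ?thesis using False SYc by (simp add: N_def N'_def)
     qed
     thus ?thesis using av by (simp add: field_simps)
    qed
   next
    case False
    have "(L - {v}) \<inter> w ` (Z - P) = L \<inter> w ` (Z - P)" using False by auto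
    hence NN: "N' = N" using False SYc by (simp add: N_def N'_def)
    have "avg (G y v - U) (\<lambda>x. if ?perm y v x then F v x else 0) \<le> avg (G y v - U) (\<lambda>x. ?q)"
     using Fx q0 unfolding NN by (intro avg_mono) auto
    thus ?thesis using avg_const[OF swp_ok_card(2,3)[OF Cons.prems(1) v]] by simp
   qed
   thus ?thesis using vP by simp
  qed
  have "avg L (\<lambda>v. avg (G y v - U) (\<lambda>x. if ?perm y v x then F v x else 0)) \<le> avg L (\<lambda>v. if v \<in> w ` P then 0 else ?q)"
   by (intro avg_mono each)
  \<comment> \<open>Only m + 1 - k of the m + 1 leftover vertices are admissible, which carries the
    factorial quotient from m to m + 1.\<close>
  also have "... = real (Suc m - k) * ?q / real (Suc m)"
  proof -
   have "(\<Sum>v\<in>L. if v \<in> w ` P then 0 else ?q) = (\<Sum>v\<in>L - w ` P. ?q)"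
    using finL by (intro sum.mono_neutral_cong_right) auto
   also have "... = real (card (L - w ` P)) * ?q" by simp
   also have "card (L - w ` P) = Suc m - k" using Cons.prems(3) finL finP kcard cL by (subst card_Diff_subset) (auto simp: m_def)
   finally show ?thesis by (simp add: avg_def cL m_def)
  qed
  also have "... \<le> (1 / K) ^ N * (fact (length (y # ys) - k) / fact (length (y # ys)))"
  proof (cases "k \<le> m")
   case True
   have "fact (Suc m - k) = real (Suc m - k) * (fact (m - k) :: real)" using True by (simp add: Suc_diff_le)
   moreover have "fact (Suc m) = real (Suc m) * (fact m :: real)" by simp
   moreover have "a * (q * (c / e)) / s = q * ((a * c) / (s * e))" for a q c e s :: real by (simp add: ac_simps)
   ultimately have eq: "real (Suc m - k) * ?q / real (Suc m) = (1 / K) ^ N * (fact (Suc m - k) / fact (Suc m))" by simp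
   have len: "length (y # ys) = Suc m" by (simp add: m_def)
   show ?thesis unfolding len eq by (rule order_refl)
  next
   case False
   hence "Suc m - k = 0" using km by simp
   thus ?thesis using K0 by simp
  qed
  finally show ?thesis using step_avg unfolding N_def k_def by linarith
 qed
qed

text \<open>Passing from m to p = m - 1 costs (1 + 1/p)^k \<le> exp 1 \<le> 3, exactly the constant
  of the next factor.\<close>

lemma fact_quotient_le:
 assumes "k \<le> m" "0 < m"
 shows "fact (m - k) / fact m \<le> (3 / real m) ^ k"
 using assms
proof (induction k arbitrary: m)
 case (Suc k)
 show ?case
 proof (cases "k = 0")
  case True
  have "fact m = real m * (fact (m - 1) :: real)" using Suc.prems by (metis fact_reduce of_nat_fact of_nat_mult)
  thus ?thesis using True Suc.prems by (simp add: field_simps)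
 next
  case False
  define p where "p = m - 1"
  have m: "m = Suc p" "k \<le> p" "0 < p" using Suc.prems False by (auto simp: p_def)
  have "fact (m - Suc k) / fact m = (fact (p - k) / fact p) / (real m :: real)" by (simp add: m)
  also have "... \<le> (3 / real p) ^ k / real m" using Suc.IH[OF m(2,3)] by (intro divide_right_mono) auto
  also have "(3 / real p) ^ k = (3 / real m) ^ k * (1 + 1 / real p) ^ k"
  proof -
   have "1 + 1 / real p = real m / real p" using m by (simp add: add_divide_distrib)
   moreover have "real m \<noteq> 0" using m by simp
   hence "3 / real m * (real m / real p) = 3 / real p" by simp
   ultimately have "3 / real p = 3 / real m * (1 + 1 / real p)" by simp
   thus ?thesis by (simp add: power_mult_distrib[symmetric])
  qed
  also have "(3 / real m) ^ k * (1 + 1 / real p) ^ k / real m \<le> (3 / real m) ^ k * 3 / real m"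
  proof (intro divide_right_mono mult_left_mono)
   have "(1 + 1 / real p) ^ k \<le> (1 + 1 / real p) ^ p" using m by (intro power_increasing) auto
   also have "... \<le> exp (1 / real p) ^ p" by (intro power_mono) (auto intro: exp_ge_add_one_self)
   also have "... = exp 1" using m by (simp add: exp_of_nat_mult[symmetric])
   also have "... \<le> 3" using exp_le by simp
   finally show "(1 + 1 / real p) ^ k \<le> 3" .
  qed auto
  also have "... = (3 / real m) ^ Suc k" by simp
  finally show ?thesis .
 qed
qed simp

section \<open>Spread of random copies\<close>

definition pair_set :: "'a set set => bool" where
 "pair_set F \<longleftrightarrow> finite F \<and> (\<forall>e\<in>F. card e = 2)"

text \<open>Extensional functions, so that an embedding is determined by its values on the vertices
  of \<open>F\<close> and can be counted.\<close>

definition embs :: "nat => nat set set => 'b set set => ('b => nat) set" where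
 "embs n EH F = {\<tau> \<in> (\<Union>F) \<rightarrow>\<^sub>E {..<n}. inj_on \<tau> (\<Union>F) \<and> (\<forall>e\<in>F. \<tau> ` e \<in> EH)}"

lemma pair_set_finite: "pair_set F ==> finite (\<Union>F)"
 unfolding pair_set_def by (metis card.infinite finite_Union zero_neq_numeral)

lemma pair_set_subset: "pair_set F ==> F' \<subseteq> F ==> pair_set F'"
 unfolding pair_set_def using finite_subset by blast

lemma finite_embs: "pair_set F ==> finite (embs n EH F)"
 using finite_PiE[OF pair_set_finite, of F "\<lambda>_. {..<n}"] unfolding embs_def by simp

lemma pairE:
 assumes "card e = 2" "v \<in> e" obtains x where "e = {v, x}" "x \<noteq> v"
 using assms by (metis card_2_iff insert_iff insert_commute singletonD)

lemma card_Union_pairs: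
 assumes "pair_set F" shows "card (\<Union>F) \<le> 2 * card F"
proof -
 have "card (\<Union>F) \<le> (\<Sum>e\<in>F. card e)" using assms by (intro card_Union_le_sum_card)
 also have "... = 2 * card F" using assms by (simp add: pair_set_def)
 finally show ?thesis .
qed

lemma handshake:
 assumes "pair_set F" shows "(\<Sum>v\<in>\<Union>F. card {e\<in>F. v \<in> e}) = 2 * card F"
proof -
 have finF: "finite F" and finV: "finite (\<Union>F)" using assms pair_set_finite by (auto simp: pair_set_def)
 have "(\<Sum>v\<in>\<Union>F. card {e\<in>F. v \<in> e}) = (\<Sum>v\<in>\<Union>F. \<Sum>e\<in>F. of_bool (v \<in> e))"
  using finF by (intro sum.cong refl) (simp add: Int_def)
 also have "... = (\<Sum>e\<in>F. \<Sum>v\<in>\<Union>F. of_bool (v \<in> e))" by (rule sum.swap)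
 also have "... = (\<Sum>e\<in>F. 2)"
 proof (rule sum.cong, simp)
  fix e assume e: "e \<in> F"
  have "(\<Sum>v\<in>\<Union>F. of_bool (v \<in> e)) = card (\<Union>F \<inter> {v. v \<in> e})" using finV by simp
  also have "\<Union>F \<inter> {v. v \<in> e} = e" using e by auto
  finally show "(\<Sum>v\<in>\<Union>F. of_bool (v \<in> e)) = (2::nat)" using assms e by (simp add: pair_set_def)
 qed
 finally show ?thesis by simp
qed

locale host =
 fixes n \<Delta> :: nat and EH :: "nat set set"
 assumes finEH: "finite EH" and EH: "\<And>e. e \<in> EH ==> e \<subseteq> {..<n} \<and> card e = 2"
  and degEH: "\<And>u. card {e\<in>EH. u \<in> e} \<le> \<Delta>"
begin

lemma card_host_nbhd: "card {u. {p, u} \<in> EH} \<le> \<Delta>" "finite {u. {p, u} \<in> EH}"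
proof -
 have inj: "inj_on (\<lambda>u. {p, u}) {u. {p, u} \<in> EH}"
  using EH by (auto simp: inj_on_def doubleton_eq_iff)
 have "{u. {p, u} \<in> EH} \<subseteq> {..<n}" using EH by blast
 thus fin: "finite {u. {p, u} \<in> EH}" by (rule finite_subset) simp
 have "card {u. {p, u} \<in> EH} = card ((\<lambda>u. {p, u}) ` {u. {p, u} \<in> EH})" using inj by (simp add: card_image)
 also have "... \<le> card {e\<in>EH. p \<in> e}" using finEH by (intro card_mono) auto
 finally show "card {u. {p, u} \<in> EH} \<le> \<Delta>" using degEH[of p] by linarith
qed

definition reach :: "'b set set => 'b => 'b set" where
 "reach F a = {(x, y). {x, y} \<in> F}\<^sup>* `` {a}"

lemma reach_self: "a \<in> reach F a" by (simp add: reach_def)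

lemma reach_step: "x \<in> reach F a ==> {x, y} \<in> F ==> y \<in> reach F a"
 unfolding reach_def by (auto intro: rtrancl_into_rtrancl)

lemma reach_closed:
 assumes "a \<in> P" "\<And>x y. x \<in> P ==> {x, y} \<in> F ==> y \<in> P"
 shows "reach F a \<subseteq> P"
proof
 fix z assume "z \<in> reach F a"
 hence "(a, z) \<in> {(x, y). {x, y} \<in> F}\<^sup>*" by (simp add: reach_def)
 thus "z \<in> P" by (induction rule: rtrancl_induct) (use assms in auto)
qed

text \<open>Explore the vertices along edges from \<open>a\<close>: the first has n possible images,
  each further one at most \<Delta>, being adjacent to an explored vertex. The induction counts
  restrictions to the explored set.\<close>

lemma connected_embs:
 assumes F: "pair_set F" and a: "a \<in> \<Union>F" and conn: "\<Union>F \<subseteq> reach F a"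
 shows "card (embs n EH F) \<le> n * \<Delta> ^ (card (\<Union>F) - 1)"
proof -
 let ?V = "\<Union>F" and ?M = "embs n EH F"
 define rst where "rst P = (\<lambda>\<tau>. restrict \<tau> P) ` ?M" for P
 have finV: "finite ?V" using F by (rule pair_set_finite)
 have finM: "finite ?M" using F by (rule finite_embs)
 have finr: "finite (rst P)" for P using finM by (simp add: rst_def)
 have "k < card ?V ==> \<exists>P\<subseteq>?V. card P = Suc k \<and> a \<in> P \<and> card (rst P) \<le> n * \<Delta> ^ k" for k
 proof (induction k)
  case 0
  have "rst {a} \<subseteq> {a} \<rightarrow>\<^sub>E {..<n}"
   unfolding rst_def
  proof (rule image_subsetI)
   fix \<tau> assume "\<tau> \<in> ?M"
   hence "\<tau> \<in> ?V \<rightarrow>\<^sub>E {..<n}" by (simp add: embs_def)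
   hence "\<tau> a \<in> {..<n}" using a by (rule PiE_mem)
   thus "restrict \<tau> {a} \<in> {a} \<rightarrow>\<^sub>E {..<n}" by (simp add: restrict_PiE_iff)
  qed
  hence "card (rst {a}) \<le> card ({a} \<rightarrow>\<^sub>E {..<n})" by (intro card_mono finite_PiE) auto
  also have "... = n" by (simp add: card_PiE)
  finally show ?case using a by (intro exI[of _ "{a}"]) auto
 next
  case (Suc k)
  then obtain P where P: "P \<subseteq> ?V" "card P = Suc k" "a \<in> P" "card (rst P) \<le> n * \<Delta> ^ k" by auto
  have "\<exists>p x. p \<in> P \<and> {p, x} \<in> F \<and> x \<notin> P"
  proof (rule ccontr)
   assume "\<not> ?thesis"
   hence cl: "\<And>p x. p \<in> P ==> {p, x} \<in> F ==> x \<in> P" by blast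
   have "reach F a \<subseteq> P" by (rule reach_closed[OF P(3) cl])
   hence "?V = P" using conn P(1) by blast
   thus False using Suc.prems P(2) by simp
  qed
  then obtain p x where px: "p \<in> P" "{p, x} \<in> F" "x \<notin> P" by blast
  have "rst (insert x P) \<subseteq> (\<Union>\<rho>\<in>rst P. (\<lambda>u. \<rho>(x := u)) ` {u. {\<rho> p, u} \<in> EH})"
  proof
   fix \<sigma> assume "\<sigma> \<in> rst (insert x P)"
   then obtain \<tau> where t: "\<tau> \<in> ?M" "\<sigma> = restrict \<tau> (insert x P)" by (auto simp: rst_def)
   have "\<sigma> = (restrict \<tau> P)(x := \<tau> x)" using t(2) by (auto simp: fun_eq_iff restrict_def)
   moreover have "\<tau> ` {p, x} \<in> EH" using t(1) px(2) by (auto simp: embs_def)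
   hence "{restrict \<tau> P p, \<tau> x} \<in> EH" using px(1) by simp
   ultimately show "\<sigma> \<in> (\<Union>\<rho>\<in>rst P. (\<lambda>u. \<rho>(x := u)) ` {u. {\<rho> p, u} \<in> EH})"
    using t(1) unfolding rst_def by blast
  qed
  hence "card (rst (insert x P)) \<le> card (\<Union>\<rho>\<in>rst P. (\<lambda>u. \<rho>(x := u)) ` {u. {\<rho> p, u} \<in> EH})"
   using finr card_host_nbhd(2) by (intro card_mono) auto
  also have "... \<le> (\<Sum>\<rho>\<in>rst P. card ((\<lambda>u. \<rho>(x := u)) ` {u. {\<rho> p, u} \<in> EH}))" by (rule card_UN_le[OF finr])
  also have "... \<le> (\<Sum>\<rho>\<in>rst P. \<Delta>)"
   by (intro sum_mono order_trans[OF card_image_le[OF card_host_nbhd(2)] card_host_nbhd(1)])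
  also have "... = card (rst P) * \<Delta>" by simp
  also have "... \<le> n * \<Delta> ^ k * \<Delta>" using P(4) by (intro mult_right_mono) auto
  finally have "card (rst (insert x P)) \<le> n * \<Delta> ^ Suc k" by (simp add: ac_simps)
  moreover have "insert x P \<subseteq> ?V" using P(1) px(2) by auto
  moreover have "card (insert x P) = Suc (Suc k)" using P(1,2) px(3) finV finite_subset[of P ?V] by simp
  ultimately show ?case using P(3) by (intro exI[of _ "insert x P"]) auto
 qed
 moreover have V0: "0 < card ?V" using a finV by (auto simp: card_gt_0_iff)
 ultimately obtain P where P: "P \<subseteq> ?V" "card P = Suc (card ?V - 1)" "card (rst P) \<le> n * \<Delta> ^ (card ?V - 1)"
  by (metis diff_less zero_less_one)
 have "P = ?V" using P V0 finV by (intro card_subset_eq) auto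
 moreover have "rst ?V = ?M"
 proof -
  have "restrict \<tau> ?V = \<tau>" if "\<tau> \<in> ?M" for \<tau> using that PiE_restrict by (force simp: embs_def)
  thus ?thesis by (simp add: rst_def)
 qed
 ultimately show ?thesis using P(3) by simp
qed

text \<open>With v vertices, degrees are at most \<Delta>, via the embedding, and at most v - 1, so
  2|F| \<le> v min(\<Delta>, v-1). This is at most (\<Delta>+1)(v-1) whether or not v - 1 \<le>
  \<Delta>, with equality for the complete graph on \<Delta>+1 vertices.\<close>

lemma connected_edges:
 assumes F: "pair_set F" and a: "a \<in> \<Union>F" and ne: "embs n EH F \<noteq> {}"
 shows "2 * card F \<le> (\<Delta> + 1) * (card (\<Union>F) - 1)"
proof -
 let ?V = "\<Union>F"
 define q where "q = card ?V"
 have finF: "finite F" using F by (simp add: pair_set_def)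
 have finV: "finite ?V" using F by (rule pair_set_finite)
 have q0: "0 < q" using a finV by (auto simp: q_def card_gt_0_iff)
 obtain \<tau> where t: "inj_on \<tau> ?V" "\<And>e. e \<in> F ==> \<tau> ` e \<in> EH" using ne by (auto simp: embs_def)
 have d1: "card {e\<in>F. v \<in> e} \<le> \<Delta>" for v
 proof -
  have "inj_on ((`) \<tau>) {e\<in>F. v \<in> e}"
  proof (rule inj_onI)
   fix e e' assume "e \<in> {e\<in>F. v \<in> e}" "e' \<in> {e\<in>F. v \<in> e}" "\<tau> ` e = \<tau> ` e'"
   thus "e = e'" using inj_on_image_eq_iff[OF t(1), of e e'] by auto
  qed
  hence "card {e\<in>F. v \<in> e} = card ((`) \<tau> ` {e\<in>F. v \<in> e})" by (simp add: card_image)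
  also have "... \<le> card {e\<in>EH. \<tau> v \<in> e}" using finEH t(2) by (intro card_mono) auto
  finally show ?thesis using degEH[of "\<tau> v"] by linarith
 qed
 have d2: "card {e\<in>F. v \<in> e} \<le> q - 1" if v: "v \<in> ?V" for v
 proof -
  have "{e\<in>F. v \<in> e} \<subseteq> (\<lambda>x. {v, x}) ` (?V - {v})"
  proof
   fix e assume e: "e \<in> {e\<in>F. v \<in> e}"
   hence "card e = 2" "v \<in> e" using F by (auto simp: pair_set_def)
   then obtain x where "e = {v, x}" "x \<noteq> v" by (rule pairE)
   thus "e \<in> (\<lambda>x. {v, x}) ` (?V - {v})" using e by auto
  qed
  hence "card {e\<in>F. v \<in> e} \<le> card ((\<lambda>x. {v, x}) ` (?V - {v}))" using finV by (intro card_mono) auto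
  also have "... \<le> card (?V - {v})" using finV by (intro card_image_le) auto
  also have "... = q - 1" using v finV by (simp add: q_def)
  finally show ?thesis .
 qed
 have "2 * card F = (\<Sum>v\<in>?V. card {e\<in>F. v \<in> e})" using handshake[OF F] by simp
 also have "... \<le> (\<Sum>v\<in>?V. min \<Delta> (q - 1))" using d1 d2 by (intro sum_mono) auto
 also have "... = q * min \<Delta> (q - 1)" by (simp add: q_def)
 also have "... \<le> (\<Delta> + 1) * (q - 1)"
 proof (cases "q - 1 \<le> \<Delta>")
  case True
  hence "q * min \<Delta> (q - 1) = q * (q - 1)" by simp
  also have "... \<le> (\<Delta> + 1) * (q - 1)" using True by (intro mult_right_mono) auto
  finally show ?thesis .
 next
  case False
  then obtain k where k: "q = \<Delta> + 2 + k" by (metis Suc_diff_1 Suc_leI add_2_eq_Suc' le_Suc_ex not_less_eq_eq q0 add.assoc add_Suc_right)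
  show ?thesis unfolding k by (simp add: algebra_simps)
 qed
 finally show ?thesis by (simp add: q_def)
qed

text \<open>\<open>c\<close> is the number of components. The component of one vertex is split off,
  and an embedding is determined by its restrictions to the two parts.\<close>

lemma embs_count:
 assumes "pair_set F"
 shows "\<exists>c \<le> card (\<Union>F). card (embs n EH F) \<le> n ^ c * \<Delta> ^ (card (\<Union>F) - c) \<and>
   (embs n EH F \<noteq> {} --> 2 * card F \<le> (\<Delta> + 1) * (card (\<Union>F) - c))"
 using assms
proof (induction "card F" arbitrary: F rule: less_induct)
 case less
 let ?V = "\<Union>F"
 have finF: "finite F" using less.prems by (simp add: pair_set_def)
 have finV: "finite ?V" using less.prems by (rule pair_set_finite)
 show ?case
 proof (cases "F = {}")
  case True
  have "embs n EH F \<subseteq> {\<lambda>_. undefined}" using True by (auto simp: embs_def)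
  hence "card (embs n EH F) \<le> card {(\<lambda>_. undefined) :: 'a => nat}" by (intro card_mono) auto
  thus ?thesis using True by (intro exI[of _ 0]) auto
 next
  case False
  then obtain e0 where e0: "e0 \<in> F" by auto
  have "e0 \<noteq> {}" using less.prems e0 by (auto simp: pair_set_def)
  then obtain a where a: "a \<in> e0" by auto
  define Q where "Q = reach F a"
  define F1 where "F1 = {e\<in>F. e \<inter> Q \<noteq> {}}"
  define F2 where "F2 = F - F1"
  have sub: "e \<subseteq> Q" if eF1: "e \<in> F1" for e
  proof -
   obtain v where v: "v \<in> e" "v \<in> Q" using eF1 by (auto simp: F1_def)
   have eF: "e \<in> F" using eF1 by (simp add: F1_def)
   hence "card e = 2" using less.prems by (simp add: pair_set_def)
   then obtain x where "e = {v, x}" using v(1) by (rule pairE)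
   thus ?thesis using v(2) eF reach_step[of v F a x] by (auto simp: Q_def)
  qed
  have aQ: "a \<in> Q" by (simp add: Q_def reach_self)
  have e01: "e0 \<in> F1" using e0 a aQ by (auto simp: F1_def)
  have p1: "pair_set F1" "pair_set F2" 
   by (rule pair_set_subset[OF less.prems], auto simp: F1_def F2_def)+
  have a1: "a \<in> \<Union>F1" using e01 a by auto
  have U1: "\<Union>F1 \<subseteq> Q" using sub by blast
  have U2: "\<Union>F2 \<inter> Q = {}" by (auto simp: F2_def F1_def)
  have FU: "F = F1 \<union> F2" "F1 \<inter> F2 = {}" by (auto simp: F1_def F2_def)
  have VU: "?V = \<Union>F1 \<union> \<Union>F2" using FU by auto
  have Vdisj: "\<Union>F1 \<inter> \<Union>F2 = {}" using U1 U2 by blast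
  have conn: "\<Union>F1 \<subseteq> reach F1 a"
  proof -
   have "Q \<subseteq> reach F1 a"
    unfolding Q_def
   proof (rule reach_closed)
    show "a \<in> reach F1 a" by (rule reach_self)
    fix x y assume x: "x \<in> reach F1 a" and xy: "{x, y} \<in> F"
    have "reach F1 a \<subseteq> Q"
    proof (rule reach_closed[OF aQ])
     fix x y assume "x \<in> Q" "{x, y} \<in> F1"
     thus "y \<in> Q" using reach_step[of x F a y] by (simp add: F1_def Q_def)
    qed
    hence "{x, y} \<in> F1" using x xy by (auto simp: F1_def)
    thus "y \<in> reach F1 a" by (rule reach_step[OF x])
   qed
   thus ?thesis using U1 by blast
  qed
  have "card F2 < card F" using e01 finF FU by (intro psubset_card_mono) auto
  from less.hyps[OF this p1(2)] obtain c where c: "c \<le> card (\<Union>F2)"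
   "card (embs n EH F2) \<le> n ^ c * \<Delta> ^ (card (\<Union>F2) - c)"
   "embs n EH F2 \<noteq> {} --> 2 * card F2 \<le> (\<Delta> + 1) * (card (\<Union>F2) - c)" by blast
  have fin12: "finite (\<Union>F1)" "finite (\<Union>F2)" using p1 pair_set_finite by blast+
  define v1 v2 where "v1 = card (\<Union>F1)" and "v2 = card (\<Union>F2)"
  have cV: "card ?V = v1 + v2" unfolding VU v1_def v2_def using fin12 Vdisj by (rule card_Un_disjoint)
  have v1: "0 < v1" using a1 fin12 by (auto simp: v1_def card_gt_0_iff)
  let ?r = "\<lambda>\<tau>. (restrict \<tau> (\<Union>F1), restrict \<tau> (\<Union>F2))"
  have img: "?r ` embs n EH F \<subseteq> embs n EH F1 \<times> embs n EH F2"
  proof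
   fix z assume "z \<in> ?r ` embs n EH F"
   then obtain \<tau> where t: "\<tau> \<in> embs n EH F" "z = ?r \<tau>" by blast
   have r: "restrict \<tau> (\<Union>F') \<in> embs n EH F'" if "F' \<subseteq> F" for F'
   proof -
    have "\<Union>F' \<subseteq> ?V" using that by auto
    moreover have "restrict \<tau> (\<Union>F') ` e = \<tau> ` e" if "e \<in> F'" for e using that by (intro image_cong) auto
    ultimately show ?thesis using t(1) \<open>F' \<subseteq> F\<close> by (auto simp: embs_def inj_on_def PiE_iff) (meson subsetD)+
   qed
   show "z \<in> embs n EH F1 \<times> embs n EH F2" using t(2) r[of F1] r[of F2] FU(1) by auto
  qed
  have inj: "inj_on ?r (embs n EH F)"
  proof (rule inj_onI)
   fix \<tau> \<tau>' assume t: "\<tau> \<in> embs n EH F" "\<tau>' \<in> embs n EH F" "?r \<tau> = ?r \<tau>'"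
   show "\<tau> = \<tau>'"
   proof
    fix x
    have r1: "restrict \<tau> (\<Union>F1) x = restrict \<tau>' (\<Union>F1) x" and r2: "restrict \<tau> (\<Union>F2) x = restrict \<tau>' (\<Union>F2) x"
     using t(3) by simp_all
    show "\<tau> x = \<tau>' x"
    proof (cases "x \<in> ?V")
     case True
     thus ?thesis using r1 r2 unfolding VU by (auto simp: restrict_def split: if_splits)
    next
     case False
     thus ?thesis using t(1,2) PiE_arb[of \<tau> ?V "\<lambda>_. {..<n}" x] PiE_arb[of \<tau>' ?V "\<lambda>_. {..<n}" x] by (simp add: embs_def)
    qed
   qed
  qed
  have "card (embs n EH F) = card (?r ` embs n EH F)" using inj by (simp add: card_image)
  also have "... \<le> card (embs n EH F1 \<times> embs n EH F2)" by (intro card_mono finite_cartesian_product finite_embs p1 img)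
  also have "... = card (embs n EH F1) * card (embs n EH F2)" by (rule card_cartesian_product)
  also have "... \<le> (n * \<Delta> ^ (v1 - 1)) * (n ^ c * \<Delta> ^ (v2 - c))"
   unfolding v1_def v2_def by (intro mult_mono connected_embs[OF p1(1) a1 conn] c(2)) auto
  also have "... = n ^ (Suc c) * \<Delta> ^ ((v1 - 1) + (v2 - c))" by (simp add: power_add algebra_simps)
  also have "(v1 - 1) + (v2 - c) = card ?V - Suc c" using cV v1 c(1) by (simp add: v2_def)
  finally have A: "card (embs n EH F) \<le> n ^ Suc c * \<Delta> ^ (card ?V - Suc c)" .
  have B: "2 * card F \<le> (\<Delta> + 1) * (card ?V - Suc c)" if ne: "embs n EH F \<noteq> {}"
  proof -
   have ne12: "embs n EH F1 \<noteq> {}" "embs n EH F2 \<noteq> {}" using img ne by blast+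
   have "card F = card F1 + card F2" using FU finF by (metis card_Un_disjoint finite_Un)
   hence "2 * card F \<le> (\<Delta> + 1) * (v1 - 1) + (\<Delta> + 1) * (v2 - c)"
    using connected_edges[OF p1(1) a1 ne12(1)] c(3) ne12(2) by (simp add: v1_def v2_def)
   also have "... = (\<Delta> + 1) * ((v1 - 1) + (v2 - c))" by (simp only: distrib_left)
   also have "(v1 - 1) + (v2 - c) = card ?V - Suc c" using cV v1 c(1) by (simp add: v2_def)
   finally show ?thesis .
  qed
  show ?thesis using A B c(1) cV v1 by (intro exI[of _ "Suc c"]) (auto simp: v2_def)
 qed
qed

end

text \<open>A positive linear functional supported on \<open>Supp\<close> plays the role of a random map.\<close>

locale functional =
 fixes E :: "('f => real) => real" and Supp :: "'f => bool"
 assumes E_mono: "(\<And>\<psi>. Supp \<psi> ==> F \<psi> \<le> G \<psi>) ==> E F \<le> E G"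
  and E_add: "E (\<lambda>\<psi>. F \<psi> + G \<psi>) = E F + E G"
  and E_cmult: "E (\<lambda>\<psi>. c * F \<psi>) = c * E F"
begin

lemma E_zero: "E (\<lambda>_. 0) = 0"
 using E_cmult[of 0 "\<lambda>_. 0"] by simp

lemma E_sum: "finite I ==> E (\<lambda>\<psi>. \<Sum>i\<in>I. F i \<psi>) = (\<Sum>i\<in>I. E (F i))"
 by (induction I rule: finite_induct) (simp_all add: E_zero E_add)

end

text \<open>Union bound over the possible preimages of \<open>F\<close> in H, each of probability at
  most (K/n)^v. Since v \<le> 2|F|, the powers of \<Delta> and K are at most (\<Delta>K)^(2|F|), and
  \<open>embs_count\<close> turns n^(c-v) into the power of n claimed.\<close>

lemma (in functional) edge_spread:
 fixes conv :: "'f => nat => 'b"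
 assumes host: "host n \<Delta> EH" and inj: "\<And>\<psi>. Supp \<psi> ==> inj_on (conv \<psi>) {..<n}"
  and K: "1 \<le> K" and n: "1 \<le> n" and D: "1 \<le> \<Delta>"
  and spread: "\<And>S w. S \<subseteq> {..<n} ==> inj_on w S ==> E (\<lambda>\<psi>. of_bool (\<forall>z\<in>S. conv \<psi> z = w z)) \<le> (K / n) ^ card S"
  and F: "pair_set F"
 shows "E (\<lambda>\<psi>. of_bool (F \<subseteq> (\<lambda>e. conv \<psi> ` e) ` EH)) \<le> ((real \<Delta> * K)\<^sup>2 * n powr (- 2 / (real \<Delta> + 1))) ^ card F"
proof -
 interpret host n \<Delta> EH by fact
 let ?V = "\<Union>F" and ?M = "embs n EH F"
 define v where "v = card ?V"
 define f where "f = card F"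
 have finM: "finite ?M" using F by (rule finite_embs)
 have q0: "0 \<le> (real \<Delta> * K)\<^sup>2 * n powr (- 2 / (real \<Delta> + 1))" by simp
 have "E (\<lambda>\<psi>. of_bool (F \<subseteq> (\<lambda>e. conv \<psi> ` e) ` EH)) \<le> E (\<lambda>\<psi>. \<Sum>\<tau>\<in>?M. of_bool (\<forall>x\<in>?V. conv \<psi> (\<tau> x) = x))"
 proof (rule E_mono)
  fix \<psi> assume S: "Supp \<psi>"
  note inj\<psi> = inj[OF S]
  show "of_bool (F \<subseteq> (\<lambda>e. conv \<psi> ` e) ` EH) \<le> (\<Sum>\<tau>\<in>?M. of_bool (\<forall>x\<in>?V. conv \<psi> (\<tau> x) = x) :: real)"
  proof (cases "F \<subseteq> (\<lambda>e. conv \<psi> ` e) ` EH")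
   case True
   define \<tau> where "\<tau> = restrict (inv_into {..<n} (conv \<psi>)) ?V"
   have Vi: "?V \<subseteq> conv \<psi> ` {..<n}" using True EH by blast
   have ti: "conv \<psi> (\<tau> x) = x" "\<tau> x < n" if "x \<in> ?V" for x
   proof -
    have xi: "x \<in> conv \<psi> ` {..<n}" using Vi that by blast
    have "\<tau> x = inv_into {..<n} (conv \<psi>) x" using that by (simp add: \<tau>_def)
    thus "conv \<psi> (\<tau> x) = x" "\<tau> x < n" using f_inv_into_f[OF xi] inv_into_into[OF xi] by auto
   qed
   have "\<tau> \<in> ?M" unfolding embs_def
   proof (intro CollectI conjI ballI)
    show "\<tau> \<in> ?V \<rightarrow>\<^sub>E {..<n}" using ti(2) by (auto simp: \<tau>_def)
    show "inj_on \<tau> ?V" using ti(1) by (metis inj_onI)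
    fix e assume e: "e \<in> F"
    then obtain e' where e': "e' \<in> EH" "e = conv \<psi> ` e'" using True by blast
    have e'n: "e' \<subseteq> {..<n}" using EH[OF e'(1)] by simp
    have "\<tau> (conv \<psi> u) = u" if u: "u \<in> e'" for u
    proof -
     have "conv \<psi> u \<in> ?V" using e e' u by blast
     thus ?thesis using inv_into_f_f[OF inj\<psi>, of u] u e'n by (auto simp: \<tau>_def)
    qed
    hence "\<tau> ` e = e'" unfolding e'(2) image_image by simp
    thus "\<tau> ` e \<in> EH" using e' by simp
   qed
   hence "(\<Sum>\<tau>\<in>{\<tau>}. of_bool (\<forall>x\<in>?V. conv \<psi> (\<tau> x) = x) :: real) \<le> (\<Sum>\<tau>\<in>?M. of_bool (\<forall>x\<in>?V. conv \<psi> (\<tau> x) = x))"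
    using finM by (intro sum_mono2) auto
   thus ?thesis using ti(1) by simp
  qed (simp add: sum_nonneg)
 qed
 also have "... = (\<Sum>\<tau>\<in>?M. E (\<lambda>\<psi>. of_bool (\<forall>x\<in>?V. conv \<psi> (\<tau> x) = x)))" by (rule E_sum[OF finM])
 also have "... \<le> (\<Sum>\<tau>\<in>?M. (K / n) ^ v)"
 proof (rule sum_mono)
  fix \<tau> assume "\<tau> \<in> ?M"
  hence t: "inj_on \<tau> ?V" "\<tau> ` ?V \<subseteq> {..<n}" by (auto simp: embs_def)
  have "E (\<lambda>\<psi>. of_bool (\<forall>x\<in>?V. conv \<psi> (\<tau> x) = x)) = E (\<lambda>\<psi>. of_bool (\<forall>z\<in>\<tau> ` ?V. conv \<psi> z = inv_into ?V \<tau> z))"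
   using t(1) by (intro arg_cong[where f=E]) (simp add: inv_into_f_f)
  also have "... \<le> (K / n) ^ card (\<tau> ` ?V)" by (intro spread t(2) inj_on_inv_into) simp
  finally show "E (\<lambda>\<psi>. of_bool (\<forall>x\<in>?V. conv \<psi> (\<tau> x) = x)) \<le> (K / n) ^ v" using t(1) by (simp add: card_image v_def)
 qed
 also have "... = real (card ?M) * (K / n) ^ v" by simp
 also have "... \<le> ((real \<Delta> * K)\<^sup>2 * n powr (- 2 / (real \<Delta> + 1))) ^ f"
 proof (cases "?M = {}")
  case True thus ?thesis using q0 by simp
 next
  case False
  obtain c where c: "c \<le> v" "card ?M \<le> n ^ c * \<Delta> ^ (v - c)" "2 * f \<le> (\<Delta> + 1) * (v - c)"
   using embs_count[OF F] False unfolding v_def f_def by blast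
  have n0: "0 < real n" using n by simp
  have DK: "1 \<le> real \<Delta> * K" using D K mult_mono[of 1 "real \<Delta>" 1 K] by simp
  have "real (card ?M) \<le> real n ^ c * real \<Delta> ^ (v - c)" using c(2) by (metis of_nat_le_iff of_nat_mult of_nat_power)
  also have "... \<le> real n ^ c * real \<Delta> ^ v" using D by (intro mult_left_mono power_increasing) auto
  finally have "real (card ?M) * (K / n) ^ v \<le> real n ^ c * real \<Delta> ^ v * (K / n) ^ v" using K by (intro mult_right_mono) auto
  also have "... = (real \<Delta> * K) ^ v * (real n ^ c / real n ^ v)" by (simp add: power_mult_distrib power_divide)
  also have "real n ^ c / real n ^ v = n powr (- real (v - c))"
  proof -
   have "real n ^ v = real n ^ c * real n ^ (v - c)" using c(1) by (simp add: power_add[symmetric])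
   hence "real n ^ c / real n ^ v = 1 / real n ^ (v - c)" using n0 by simp
   thus ?thesis using n0 by (simp add: powr_minus powr_realpow divide_inverse)
  qed
  also have "(real \<Delta> * K) ^ v * n powr (- real (v - c)) \<le> (real \<Delta> * K) ^ (2 * f) * n powr (- 2 / (real \<Delta> + 1) * f)"
  proof (rule mult_mono)
   have "v \<le> 2 * f" using card_Union_pairs[OF F] by (simp add: v_def f_def)
   thus "(real \<Delta> * K) ^ v \<le> (real \<Delta> * K) ^ (2 * f)" using DK by (intro power_increasing) auto
   have "real (2 * f) \<le> real ((\<Delta> + 1) * (v - c))" using c(3) by (simp only: of_nat_le_iff)
   moreover have "real ((\<Delta> + 1) * (v - c)) = (real \<Delta> + 1) * real (v - c)" by (simp only: of_nat_mult of_nat_add of_nat_1)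
   ultimately have "2 * real f \<le> (real \<Delta> + 1) * real (v - c)" by simp
   hence "2 * real f / (real \<Delta> + 1) \<le> real (v - c)" by (simp add: divide_le_eq mult.commute)
   hence "- real (v - c) \<le> - 2 / (real \<Delta> + 1) * f" by simp
   thus "n powr (- real (v - c)) \<le> n powr (- 2 / (real \<Delta> + 1) * f)" using n by (intro powr_mono) auto
  qed (use DK in auto)
  also have "... = ((real \<Delta> * K)\<^sup>2 * n powr (- 2 / (real \<Delta> + 1))) ^ f"

  proof -
   have "(n powr a) ^ f = n powr (a * f)" for a :: real
    using n0 by (simp add: powr_realpow[symmetric] powr_powr)
   thus ?thesis by (simp only: power_mult_distrib power_mult[symmetric])
  qed
  finally show ?thesis .
 qed
 finally show ?thesis by (simp add: f_def)
qed

section \<open>Spanning embeddings\<close>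

text \<open>\<open>t y\<close> is the number of good vertices demanded for the reserve vertex
  \<open>y\<close>, and \<open>N y\<close> bounds from below the number of vertices that have a
  chance to become good. \<open>K1\<close> and \<open>K2\<close> bound the number of options in the
  greedy and in the swap phase.\<close>

locale spanning = embedding n b \<Delta> r HE col g f Y n2 d \<delta> e1
 for n b \<Delta> r HE col and g :: "'b => 'b => bool" and f Y n2 d \<delta> e1 +
 fixes V :: "'b set" and X0 :: "nat set" and n1 :: nat and K1 K2 :: real and t N :: "nat => nat"
 assumes V: "finite V" "card V = n" and fV: "u < n ==> f u \<subseteq> V"
  and n2: "n2 = n1 + b" and n1: "n1 \<le> n" and XY: "X0 \<union> Y \<subseteq> {..<n1}" "X0 \<inter> Y = {}"
  and sep: "separated (X0 \<union> Y)"
  and K1: "0 < K1" "\<And>u. u < n ==> K1 \<le> d ^ (\<Delta> + 1) * e1 / 2 * real (card (f u))"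
  and K2: "1 \<le> K2" "\<And>y. y \<in> Y ==> K2 + real (card {y'\<in>Y. f y' = f y}) \<le> real (t y) + 1"
  and N: "\<And>y v. y \<in> Y ==> v \<in> V ==> N y \<le> card {x\<in>X0. f x = f y \<and> (\<forall>z. HE x z --> rich v z)}"
begin

definition NY :: "nat list" where "NY = sorted_list_of_set (\<Union>y\<in>Y. {w. HE w y})"
definition stars :: "nat list" where "stars = concat (map star (sorted_list_of_set X0))"
definition rest :: "nat list" where "rest = sorted_list_of_set ({..<n} - Y - set NY - set stars)"

lemma finXY: "finite X0" "finite Y"
proof -
 have "X0 \<subseteq> {..<n1}" "Y \<subseteq> {..<n1}" using XY(1) by simp_all
 thus "finite X0" "finite Y" using finite_subset[OF _ finite_lessThan, of X0 n1] finite_subset[OF _ finite_lessThan, of Y n1] by simp_all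
qed

lemma finNY: "finite (\<Union>y\<in>Y. {w. HE w y})"
proof (rule finite_UN_I[OF finXY(2)])
 fix y
 have "{w. HE w y} \<subseteq> {v. HE y v}" by (rule Collect_mono) (rule impI, rule HE_sym)
 thus "finite {w. HE w y}" by (rule finite_subset[OF _ finite_nbhd])
qed

lemmas fin = finXY finNY

lemma set_NY: "set NY = (\<Union>y\<in>Y. {w. HE w y})" using fin by (simp add: NY_def)

lemma set_stars: "set stars = (\<Union>x\<in>X0. nb x)" using fin by (simp add: stars_def set_star)

lemma set_rest: "set rest = {..<n} - Y - set NY - set stars" by (simp add: rest_def)

lemma nb_bound: "x \<in> X0 \<union> Y ==> z \<in> nb x ==> z < n2 \<and> z < n"
proof -
 assume x: "x \<in> X0 \<union> Y" and z: "z \<in> nb x"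
 have xn: "x < n1" using x XY by auto
 have "z < n" using z xn n1 HE_sym HE_less by (auto simp: nb_def)
 moreover have "z \<le> x + b" using nb_band[OF z] .
 ultimately show ?thesis using xn n2 by simp
qed

text \<open>The use of radius 3: an edge between the closed neighbourhoods of two centres would give
  a path of at most three edges between the centres.\<close>

lemma no_path: "x \<in> X0 \<union> Y ==> y \<in> X0 \<union> Y ==> x \<noteq> y ==> p \<in> nb x ==> q \<in> nb y ==> q \<notin> nb p"
proof
 assume a: "x \<in> X0 \<union> Y" "y \<in> X0 \<union> Y" "x \<noteq> y" "p \<in> nb x" "q \<in> nb y" "q \<in> nb p"
 have "y \<in> nb q" using a(5) nb_sym by blast
 hence "y \<in> near x" using a(4,6) nearI by blast
 thus False using sep a(1-3) unfolding separated_def by blast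
qed

lemma nb_disj: "x \<in> X0 \<union> Y ==> y \<in> X0 \<union> Y ==> x \<noteq> y ==> nb x \<inter> nb y = {}"
proof (rule ccontr)
 assume a: "x \<in> X0 \<union> Y" "y \<in> X0 \<union> Y" "x \<noteq> y" "nb x \<inter> nb y \<noteq> {}"
 then obtain p where p: "p \<in> nb x" "p \<in> nb y" by blast
 have "p \<in> nb p" by (simp add: nb_def)
 thus False using no_path[OF a(1-3) p] by contradiction
qed

lemma nbhd_not_XY: "x \<in> X0 \<union> Y ==> HE x z ==> z \<notin> X0 \<union> Y"
proof
 assume a: "x \<in> X0 \<union> Y" "HE x z" "z \<in> X0 \<union> Y"
 have "x \<noteq> z" using a(2) HE_irrefl by blast
 hence "nb x \<inter> nb z = {}" using nb_disj a by blast
 thus False using a(2) by (auto simp: nb_def)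
qed

lemma okl_special:
 "distinct us ==> set us \<subseteq> {..<n2} \<inter> {..<n} - Y ==> D \<inter> set us = {} ==> D \<subseteq> {..<n2} ==> okl D us"
 by (induction us arbitrary: D) (auto simp: ok_def)

lemma okl_ascending:
 "sorted us ==> distinct us ==> set us \<subseteq> {..<n} - Y - D ==> (\<And>u. u \<in> set us ==> D \<subseteq> {..<max n2 u}) ==> okl D us"
proof (induction us arbitrary: D)
 case (Cons u us)
 have "ok D u" using Cons.prems(3,4) by (auto simp: ok_def)
 moreover have "okl (insert u D) us"
 proof (rule Cons.IH)
  show "sorted us" "distinct us" using Cons.prems by auto
  show "set us \<subseteq> {..<n} - Y - insert u D" using Cons.prems(2,3) by auto
  fix u' assume u': "u' \<in> set us"
  have "u < u'" using Cons.prems(1,2) u' by (metis distinct.simps(2) le_neq_implies_less sorted_simps(2))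
  moreover have "D \<subseteq> {..<max n2 u'}" using Cons.prems(4)[of u'] u' by simp
  ultimately show "insert u D \<subseteq> {..<max n2 u'}" by auto
 qed
 ultimately show ?case by simp
qed simp

lemma distinct_stars: "distinct stars"
 unfolding stars_def
proof (rule distinct_concat)
 have "inj_on star (set (sorted_list_of_set X0))" by (auto simp: star_def inj_on_def)
 thus "distinct (map star (sorted_list_of_set X0))" by (simp add: distinct_map)
next
 fix ys assume "ys \<in> set (map star (sorted_list_of_set X0))"
 then obtain x where x: "ys = star x" by auto
 have "x \<notin> {z. HE x z}" using HE_irrefl by simp
 thus "distinct ys" using x finite_nbhd by (simp add: star_def)
next
 fix ys zs assume "ys \<in> set (map star (sorted_list_of_set X0))" "zs \<in> set (map star (sorted_list_of_set X0))" "ys \<noteq> zs"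
 then obtain x x' where "ys = star x" "zs = star x'" "x \<in> X0" "x' \<in> X0" "x \<noteq> x'" using fin by auto
 thus "set ys \<inter> set zs = {}" using nb_disj[of x x'] by (simp add: set_star)
qed

lemma NY_stars: "set NY \<inter> set stars = {}"
proof -
 have "w \<notin> nb x" if "y \<in> Y" "HE w y" "x \<in> X0" for w x y
 proof -
  have "x \<noteq> y" using that XY(2) by auto
  hence "nb x \<inter> nb y = {}" using nb_disj that by blast
  moreover have "w \<in> nb y" using that HE_sym by (auto simp: nb_def)
  ultimately show ?thesis by blast
 qed
 thus ?thesis unfolding set_NY set_stars by blast
qed

lemma NY_sub: "set NY \<subseteq> {..<n2} \<inter> {..<n} - Y"
proof
 fix w assume "w \<in> set NY"
 then obtain y where y: "y \<in> Y" "HE w y" by (auto simp: set_NY)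
 have "w \<in> nb y" using y HE_sym by (auto simp: nb_def)
 moreover have "w \<notin> Y" using nbhd_not_XY[of y w] y HE_sym by blast
 ultimately show "w \<in> {..<n2} \<inter> {..<n} - Y" using nb_bound[of y w] y by auto
qed

lemma stars_sub: "set stars \<subseteq> {..<n2} \<inter> {..<n} - Y"
proof
 fix w assume "w \<in> set stars"
 then obtain x where x: "x \<in> X0" "w \<in> nb x" by (auto simp: set_stars)
 have "w \<notin> Y"
 proof
  assume w: "w \<in> Y"
  hence "w \<noteq> x" using x XY(2) by auto
  hence "HE x w" using x(2) by (simp add: nb_def)
  thus False using nbhd_not_XY[of x w] x w by blast
 qed
 thus "w \<in> {..<n2} \<inter> {..<n} - Y" using nb_bound[of x w] x by auto
qed

lemma okls: "okl {} NY" "okl (set NY) stars" "okl (set NY \<union> set stars) rest"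
proof -
 show "okl {} NY" using NY_sub by (intro okl_special) (auto simp: NY_def)
 show "okl (set NY) stars" using stars_sub distinct_stars NY_sub NY_stars by (intro okl_special) auto
 show "okl (set NY \<union> set stars) rest"
 proof (rule okl_ascending)
  show "sorted rest" "distinct rest" by (simp_all add: rest_def)
  show "set rest \<subseteq> {..<n} - Y - (set NY \<union> set stars)" unfolding set_rest by auto
  have "set NY \<union> set stars \<subseteq> {..<n2}" using NY_sub stars_sub by auto
  thus "set NY \<union> set stars \<subseteq> {..<max n2 u}" for u by auto
 qed
qed

text \<open>Neighbours of the reserve come first, so \<open>common \<phi> y\<close> is settled
  before the stars; the stars come one after the other, as \<open>stars_moment\<close> requires.
  Both groups lie below \<open>n2\<close>, where the order is free; the rest is ascending.\<close>

definition order :: "nat list" where "order = NY @ stars @ rest"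

lemma okl_order: "okl {} order"
 using okls by (simp add: order_def okl_append)

lemma set_order: "set order = {..<n} - Y"
 using NY_sub stars_sub unfolding order_def set_append set_rest by auto

definition Gd :: "(nat => 'b) => nat => 'b => nat set" where
 "Gd \<phi> y v = {x\<in>X0. f x = f y \<and> (\<forall>z. HE x z --> rich v z) \<and> good y v \<phi> x}"

definition succ :: "(nat => 'b) => bool" where
 "succ \<phi> \<longleftrightarrow> (\<forall>y\<in>Y. \<forall>v\<in>V. t y \<le> card (Gd \<phi> y v))"

definition ys :: "nat list" where "ys = sorted_list_of_set Y"

definition left :: "(nat => 'b) => 'b set" where "left \<phi> = V - \<phi> ` ({..<n} - Y)"

lemma set_ys: "set ys = Y" "distinct ys" "length ys = card Y"
 using fin by (simp_all add: ys_def)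

lemma image_V: "valid ({..<n} - Y) \<phi> ==> \<phi> ` ({..<n} - Y) \<subseteq> V"
 using fV by (fastforce simp: valid_def)

lemma card_left:
 assumes "valid ({..<n} - Y) \<phi>" shows "card (left \<phi>) = card Y"
proof -
 have inj: "inj_on \<phi> ({..<n} - Y)" using assms by (simp add: valid_def)
 have Yn: "Y \<subseteq> {..<n}" using XY n1 by auto
 have "card (left \<phi>) = n - card (\<phi> ` ({..<n} - Y))"
  unfolding left_def using image_V[OF assms] V by (subst card_Diff_subset) auto
 also have "... = n - (n - card Y)" using inj Yn fin by (simp add: card_image card_Diff_subset)
 also have "... = card Y" using card_mono[OF _ Yn] by simp
 finally show ?thesis .
qed

lemma swp_ok_start:
 assumes "valid ({..<n} - Y) \<phi>" "succ \<phi>"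
 shows "swp_ok (Gd \<phi>) f K2 ys (left \<phi>) {}"
 unfolding swp_ok_def
proof (intro conjI ballI)
 show "distinct ys" "card (left \<phi>) = length ys" using set_ys card_left[OF assms(1)] by auto
 show "finite (left \<phi>)" using V by (simp add: left_def)
 show "0 < K2" using K2 by simp
 fix y v assume yv: "y \<in> set ys" "v \<in> left \<phi>"
 show "finite (Gd \<phi> y v)" using fin by (simp add: Gd_def)
 show "f x = f y" if "x \<in> Gd \<phi> y v" for x using that by (simp add: Gd_def)
 have "t y \<le> card (Gd \<phi> y v)" using assms(2) yv set_ys by (auto simp: succ_def left_def)
 thus "K2 + real (card {u \<in> {}. f u = f y}) + real (card {y' \<in> set ys. f y' = f y}) \<le> real (card (Gd \<phi> y v)) + 1"
  using K2(2)[of y] yv set_ys by simp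
qed simp

text \<open>The process is cut off on the event \<open>succ\<close> without renormalisation. Its
  mass may be below 1, and \<open>total_mass\<close> bounds the loss.\<close>

definition EE :: "(((nat => 'b) \<times> (nat => 'b) \<times> (nat => nat)) => real) => real" where
 "EE F = rgreedy order {} (\<lambda>_. undefined) (\<lambda>\<phi>. of_bool (succ \<phi>) *
   swp (Gd \<phi>) ys (left \<phi>) {} (\<lambda>_. undefined) (\<lambda>_. 0) (\<lambda>\<sigma> \<eta>. F (\<phi>, \<sigma>, \<eta>)))"

definition Supp :: "((nat => 'b) \<times> (nat => 'b) \<times> (nat => nat)) => bool" where
 "Supp = (\<lambda>(\<phi>, \<sigma>, \<eta>). valid ({..<n} - Y) \<phi> \<and> succ \<phi> \<and>
   swp_supp (Gd \<phi>) ys (left \<phi>) {} (\<lambda>_. undefined) (\<lambda>_. 0) \<sigma> \<eta>)"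

definition conv :: "((nat => 'b) \<times> (nat => 'b) \<times> (nat => nat)) => nat => 'b" where
 "conv = (\<lambda>(\<phi>, \<sigma>, \<eta>) u. if u \<in> Y then \<phi> (\<eta> u) else if u \<in> \<eta> ` Y then \<sigma> (inv_into Y \<eta> u) else \<phi> u)"

lemma functional_EE: "functional EE Supp"
proof
 fix F G :: "((nat => 'b) \<times> (nat => 'b) \<times> (nat => nat)) => real" assume FG: "\<And>\<psi>. Supp \<psi> ==> F \<psi> \<le> G \<psi>"
 show "EE F \<le> EE G" unfolding EE_def
 proof (rule rgreedy_mono[OF valid_empty okl_order])
  fix \<phi> assume "valid ({} \<union> set order) \<phi>"
  hence v: "valid ({..<n} - Y) \<phi>" by (simp add: set_order)
  show "of_bool (succ \<phi>) * swp (Gd \<phi>) ys (left \<phi>) {} (\<lambda>_. undefined) (\<lambda>_. 0) (\<lambda>\<sigma> \<eta>. F (\<phi>, \<sigma>, \<eta>))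
   \<le> of_bool (succ \<phi>) * swp (Gd \<phi>) ys (left \<phi>) {} (\<lambda>_. undefined) (\<lambda>_. 0) (\<lambda>\<sigma> \<eta>. G (\<phi>, \<sigma>, \<eta>))"
  proof (cases "succ \<phi>")
   case True
   have "swp (Gd \<phi>) ys (left \<phi>) {} (\<lambda>_. undefined) (\<lambda>_. 0) (\<lambda>\<sigma> \<eta>. F (\<phi>, \<sigma>, \<eta>))
    \<le> swp (Gd \<phi>) ys (left \<phi>) {} (\<lambda>_. undefined) (\<lambda>_. 0) (\<lambda>\<sigma> \<eta>. G (\<phi>, \<sigma>, \<eta>))"
    by (rule swp_mono[OF swp_ok_start[OF v True]]) (rule FG, simp add: Supp_def v True)
   thus ?thesis using True by simp
  qed simp
 qed
next
 fix F G :: "((nat => 'b) \<times> (nat => 'b) \<times> (nat => nat)) => real" show "EE (\<lambda>\<psi>. F \<psi> + G \<psi>) = EE F + EE G"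
  unfolding EE_def swp_add distrib_left rgreedy_add ..
next
 fix c and F :: "((nat => 'b) \<times> (nat => 'b) \<times> (nat => nat)) => real" show "EE (\<lambda>\<psi>. c * F \<psi>) = c * EE F"
  unfolding EE_def swp_cmult rgreedy_cmult[symmetric] by (simp add: mult.left_commute)
qed

lemma supp_facts:
 assumes S: "Supp (\<phi>, \<sigma>, \<eta>)"
 shows "valid ({..<n} - Y) \<phi>" "succ \<phi>" "bij_betw \<sigma> Y (left \<phi>)" "inj_on \<eta> Y" "y \<in> Y ==> \<eta> y \<in> Gd \<phi> y (\<sigma> y)"
  "y \<in> Y ==> \<eta> y \<in> X0"
 using S set_ys by (auto simp: Supp_def swp_supp_def Gd_def)

lemma conv_simps:
 assumes S: "Supp (\<phi>, \<sigma>, \<eta>)"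
 shows "u \<in> Y ==> conv (\<phi>, \<sigma>, \<eta>) u = \<phi> (\<eta> u)"
  "y \<in> Y ==> conv (\<phi>, \<sigma>, \<eta>) (\<eta> y) = \<sigma> y"
  "u \<notin> Y ==> u \<notin> \<eta> ` Y ==> conv (\<phi>, \<sigma>, \<eta>) u = \<phi> u"
proof -
 note sf = supp_facts[OF S]
 show "u \<in> Y ==> conv (\<phi>, \<sigma>, \<eta>) u = \<phi> (\<eta> u)" by (simp add: conv_def)
 show "u \<notin> Y ==> u \<notin> \<eta> ` Y ==> conv (\<phi>, \<sigma>, \<eta>) u = \<phi> u" by (simp add: conv_def)
 assume y: "y \<in> Y"
 have "\<eta> y \<notin> Y" using sf(6)[OF y] XY(2) by blast
 thus "conv (\<phi>, \<sigma>, \<eta>) (\<eta> y) = \<sigma> y" using y sf(4) by (simp add: conv_def inv_into_f_f)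
qed

lemma X0_U: "x \<in> X0 ==> x \<in> {..<n} - Y"
 using XY n1 by auto

lemma conv_inj:
 assumes S: "Supp \<psi>" shows "inj_on (conv \<psi>) {..<n}" "conv \<psi> ` {..<n} \<subseteq> V"
proof -
 obtain \<phi> \<sigma> \<eta> where \<psi>: "\<psi> = (\<phi>, \<sigma>, \<eta>)" by (cases \<psi>)
 note S' = S[unfolded \<psi>]
 note sf = supp_facts[OF S'] and cs = conv_simps[OF S']
 let ?U = "{..<n} - Y"
 have inj\<phi>: "inj_on \<phi> ?U" using sf(1) by (simp add: valid_def)
 have \<sigma>L: "\<sigma> y \<in> left \<phi>" if "y \<in> Y" for y using sf(3) that by (auto simp: bij_betw_def)
 have \<sigma>n: "\<sigma> y \<noteq> \<phi> u" if "y \<in> Y" "u \<in> ?U" for y u using \<sigma>L[OF that(1)] that(2) by (auto simp: left_def)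
 have inj\<sigma>: "inj_on \<sigma> Y" using sf(3) by (simp add: bij_betw_def)
 have \<eta>U: "\<eta> y \<in> ?U" if "y \<in> Y" for y using X0_U sf(6)[OF that] by blast
 have cases: "(\<exists>y\<in>Y. u = y \<and> conv \<psi> u = \<phi> (\<eta> y)) \<or> (\<exists>y\<in>Y. u = \<eta> y \<and> conv \<psi> u = \<sigma> y) \<or>
   (u \<in> ?U \<and> u \<notin> \<eta> ` Y \<and> conv \<psi> u = \<phi> u)" if "u < n" for u
  using that cs unfolding \<psi> by blast
 show "inj_on (conv \<psi>) {..<n}"
 proof (rule inj_onI)
  fix u v assume uv: "u \<in> {..<n}" "v \<in> {..<n}" "conv \<psi> u = conv \<psi> v"
  have \<phi>\<phi>: "p = q" if "\<phi> p = \<phi> q" "p \<in> ?U" "q \<in> ?U" for p q using inj\<phi> that by (auto dest: inj_onD)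
  have \<eta>\<eta>: "p = q" if "\<eta> p = \<eta> q" "p \<in> Y" "q \<in> Y" for p q using sf(4) that by (auto dest: inj_onD)
  have \<sigma>\<sigma>: "p = q" if "\<sigma> p = \<sigma> q" "p \<in> Y" "q \<in> Y" for p q using inj\<sigma> that by (auto dest: inj_onD)
  from cases[of u] uv(1) consider (a) "u \<in> Y" "conv \<psi> u = \<phi> (\<eta> u)" | (b) y where "y \<in> Y" "u = \<eta> y" "conv \<psi> u = \<sigma> y"
   | (c) "u \<in> ?U" "u \<notin> \<eta> ` Y" "conv \<psi> u = \<phi> u" by auto
  note cu = this
  from cases[of v] uv(2) consider (a) "v \<in> Y" "conv \<psi> v = \<phi> (\<eta> v)" | (b) y where "y \<in> Y" "v = \<eta> y" "conv \<psi> v = \<sigma> y"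
   | (c) "v \<in> ?U" "v \<notin> \<eta> ` Y" "conv \<psi> v = \<phi> v" by auto
  note cv = this
  show "u = v"
  proof (cases rule: cu)
   case 1: a
   show ?thesis
   proof (cases rule: cv)
    case a
    have "\<eta> u = \<eta> v" using 1 a uv(3) by (intro \<phi>\<phi> \<eta>U) auto
    thus ?thesis using \<eta>\<eta> 1 a by blast
   next
    case b thus ?thesis using 1 uv(3) \<sigma>n[OF b(1) \<eta>U[OF 1(1)]] by simp
   next
    case c
    have "\<eta> u = v" using 1 c uv(3) by (intro \<phi>\<phi> \<eta>U) auto
    thus ?thesis using 1 c by blast
   qed
  next
   case 2: (b y)
   show ?thesis
   proof (cases rule: cv)
    case a thus ?thesis using 2 uv(3) \<sigma>n[OF 2(1) \<eta>U[OF a(1)]] by simp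
   next
    case (b y')
    hence "y = y'" using 2 uv(3) by (intro \<sigma>\<sigma>) auto
    thus ?thesis using 2 b by simp
   next
    case c thus ?thesis using 2 uv(3) \<sigma>n[OF 2(1) c(1)] by simp
   qed
  next
   case 3: c
   show ?thesis
   proof (cases rule: cv)
    case a
    have "u = \<eta> v" using 3 a uv(3) by (intro \<phi>\<phi> \<eta>U) auto
    thus ?thesis using 3 a by blast
   next
    case b thus ?thesis using 3 uv(3) \<sigma>n[OF b(1) 3(1)] by simp
   next
    case c thus ?thesis using 3 uv(3) by (intro \<phi>\<phi>) auto
   qed
  qed
 qed
 have "conv \<psi> u \<in> V" if "u < n" for u
  using cases[OF that] image_V[OF sf(1)] \<eta>U \<sigma>L by (auto simp: left_def)
 thus "conv \<psi> ` {..<n} \<subseteq> V" by auto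
qed

text \<open>No two vertices that take part in swaps are adjacent, so the neighbours of such a vertex
  keep their greedy images, and \<open>common\<close> or \<open>good\<close> provides the
  edges.\<close>

lemma conv_edge:
 assumes S: "Supp \<psi>" and H: "HE u w" shows "g (conv \<psi> u) (conv \<psi> w)"
proof -
 obtain \<phi> \<sigma> \<eta> where \<psi>: "\<psi> = (\<phi>, \<sigma>, \<eta>)" by (cases \<psi>)
 note S' = S[unfolded \<psi>]
 note sf = supp_facts[OF S'] and cs = conv_simps[OF S']
 have un: "u < n" "w < n" using H HE_sym HE_less by blast+
 have key: "g (conv \<psi> u) (conv \<psi> w)" if H': "HE u w" "u \<in> Y \<union> \<eta> ` Y" for u w
 proof -
  have uXY: "u \<in> X0 \<union> Y" using H'(2) sf(6) by auto
  have wXY: "w \<notin> X0 \<union> Y" by (rule nbhd_not_XY[OF uXY H'(1)])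
  hence "w \<notin> Y" "w \<notin> \<eta> ` Y" using sf(6) by auto
  hence cw: "conv \<psi> w = \<phi> w" using cs(3) \<psi> by simp
  show ?thesis
  proof (cases "u \<in> Y")
   case True
   have "\<phi> (\<eta> u) \<in> common \<phi> u" using sf(5)[OF True] by (simp add: Gd_def good_def)
   hence "g (\<phi> (\<eta> u)) (\<phi> w)" using H'(1) HE_sym by (auto simp: common_def)
   thus ?thesis using cw cs(1)[OF True] \<psi> by simp
  next
   case False
   then obtain y where y: "y \<in> Y" "u = \<eta> y" using H'(2) by blast
   have "good y (\<sigma> y) \<phi> u" using sf(5)[OF y(1)] y(2) by (simp add: Gd_def)
   hence "g (\<sigma> y) (\<phi> w)" using H'(1) by (simp add: good_def)
   thus ?thesis using cw cs(2)[OF y(1)] y(2) \<psi> by simp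
  qed
 qed
 consider "u \<in> Y \<union> \<eta> ` Y" | "w \<in> Y \<union> \<eta> ` Y" | "u \<notin> Y \<union> \<eta> ` Y" "w \<notin> Y \<union> \<eta> ` Y" by blast
 thus ?thesis
 proof cases
  case 1 thus ?thesis using key H by blast
 next
  case 2 thus ?thesis using key[OF HE_sym[OF H]] g_sym by blast
 next
  case 3
  have "g (\<phi> u) (\<phi> w)" using sf(1) H un 3 by (auto simp: valid_def)
  thus ?thesis using cs(3) 3 \<psi> by simp
 qed
qed

text \<open>Markov's inequality for 2 to the power of minus the number of good vertices. Goodness is
  decided by the neighbours of the reserve and the stars, so embedding the rest leaves it
  unchanged.\<close>

lemma fail_prob:
 assumes y: "y \<in> Y" and v: "v \<in> V"
 shows "rgreedy order {} (\<lambda>_. undefined) (\<lambda>\<phi>. of_bool (card (Gd \<phi> y v) < t y))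
   \<le> 2 ^ t y * (1 - (d ^ (\<Delta> + 1) / 2) ^ (\<Delta> + 1) / 2) ^ N y"
proof -
 let ?c = "(d ^ (\<Delta> + 1) / 2) ^ (\<Delta> + 1)"
 define L where "L = {x\<in>X0. f x = f y \<and> (\<forall>z. HE x z --> rich v z)}"
 have xs: "set (sorted_list_of_set X0) = X0" using fin by simp
 have LX: "L \<inter> set (sorted_list_of_set X0) = L" using xs by (auto simp: L_def)
 have Gd_L: "Gd \<phi> y v = {x\<in>L \<inter> set (sorted_list_of_set X0). good y v \<phi> x}" for \<phi>
  unfolding LX by (auto simp: Gd_def L_def)
 have c1: "0 < ?c" "?c \<le> 1"
 proof -
  show "0 < ?c" using pow_bounds(1) by (intro zero_less_power) simp
  show "?c \<le> 1" using pow_bounds by (intro power_le_one) auto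
 qed
 have yn: "y < n" "y < n2 + b" using y XY n1 n2 by auto
 have wy: "w \<in> set NY" if "HE w y" for w using that y by (auto simp: set_NY)
 have "rgreedy order {} (\<lambda>_. undefined) (\<lambda>\<phi>. of_bool (card (Gd \<phi> y v) < t y))
   \<le> rgreedy order {} (\<lambda>_. undefined) (\<lambda>\<phi>. 2 ^ t y * (1 / 2) ^ card (Gd \<phi> y v))"
 proof (rule rgreedy_mono[OF valid_empty okl_order])
  fix \<phi>
  show "of_bool (card (Gd \<phi> y v) < t y) \<le> (2 ^ t y * (1 / 2) ^ card (Gd \<phi> y v) :: real)"
  proof (cases "card (Gd \<phi> y v) < t y")
   case True
   have "(1::real) = 2 ^ t y * (1 / 2) ^ t y" by (simp add: power_mult_distrib[symmetric])
   also have "... \<le> 2 ^ t y * (1 / 2) ^ card (Gd \<phi> y v)" using True by (intro mult_left_mono power_decreasing) auto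
   finally show ?thesis using True by simp
  qed simp
 qed
 also have "... = 2 ^ t y * rgreedy order {} (\<lambda>_. undefined) (\<lambda>\<phi>. (1 / 2) ^ card (Gd \<phi> y v))" by (rule rgreedy_cmult)
 also have "rgreedy order {} (\<lambda>_. undefined) (\<lambda>\<phi>. (1 / 2) ^ card (Gd \<phi> y v)) \<le> (1 - ?c / 2) ^ N y"
  unfolding order_def rgreedy_append Un_empty_left
 proof (rule rgreedy_le[OF valid_empty okls(1)])
  fix \<phi>1 assume "valid ({} \<union> set NY) \<phi>1"
  hence v1: "valid (set NY) \<phi>1" by simp
  have "rgreedy stars (set NY) \<phi>1 (\<lambda>\<phi>2. rgreedy rest (set NY \<union> set stars) \<phi>2 (\<lambda>\<phi>. (1 / 2) ^ card (Gd \<phi> y v)))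
    = rgreedy stars (set NY) \<phi>1 (\<lambda>\<phi>2. (1 / 2) ^ card (Gd \<phi>2 y v))"
  proof (rule rgreedy_cong[OF v1 okls(2)])
   fix \<phi>2 assume v2: "valid (set NY \<union> set stars) \<phi>2"
   have "rgreedy rest (set NY \<union> set stars) \<phi>2 (\<lambda>\<phi>. (1 / 2) ^ card (Gd \<phi> y v))
     = rgreedy rest (set NY \<union> set stars) \<phi>2 (\<lambda>_. (1 / 2) ^ card (Gd \<phi>2 y v))"
   proof (rule rgreedy_cong[OF v2 okls(3)])
    fix \<phi> assume ag: "\<forall>u\<in>set NY \<union> set stars. \<phi> u = \<phi>2 u"
    have cm: "common \<phi> y = common \<phi>2 y" using ag wy by (auto simp: common_def)
    have "good y v \<phi> x = good y v \<phi>2 x" if "x \<in> X0" for x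
    proof -
     have "\<phi> z = \<phi>2 z" if "z \<in> nb x" for z using ag that \<open>x \<in> X0\<close> by (auto simp: set_stars)
     thus ?thesis using cm by (auto simp: good_def nb_def)
    qed
    hence "Gd \<phi> y v = Gd \<phi>2 y v" by (auto simp: Gd_def)
    thus "(1 / 2) ^ card (Gd \<phi> y v) = ((1 / 2) ^ card (Gd \<phi>2 y v) :: real)" by simp
   qed
   thus "rgreedy rest (set NY \<union> set stars) \<phi>2 (\<lambda>\<phi>. (1 / 2) ^ card (Gd \<phi> y v)) = (1 / 2) ^ card (Gd \<phi>2 y v)"
    using rgreedy_const[OF v2 okls(3)] by simp
  qed
  also have "... \<le> (1 - ?c / 2) ^ card (L \<inter> set (sorted_list_of_set X0))"
   unfolding stars_def Gd_L
  proof (rule stars_moment[OF v1])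
   show "okl (set NY) (concat (map star (sorted_list_of_set X0)))" using okls(2) by (simp add: stars_def)
   show "nb x \<subseteq> {..<n2 + b} \<inter> {..<n}" if "x \<in> set (sorted_list_of_set X0)" for x
    using nb_bound[of x] that xs by force
   show "separated (set (sorted_list_of_set X0))" using sep separated_subset xs by auto
   show "distinct (sorted_list_of_set X0)" by simp
   show "\<not> HE w z" if zx: "x \<in> set (sorted_list_of_set X0)" "z \<in> nb x" "w \<in> set NY" for x z w
   proof
    assume H: "HE w z"
    obtain y' where y': "y' \<in> Y" "HE w y'" using zx(3) by (auto simp: set_NY)
    have x: "x \<in> X0" using zx xs by simp
    have ne: "x \<noteq> y'" using x y' XY(2) by auto
    have "w \<in> nb y'" using y'(2) HE_sym by (auto simp: nb_def)
    hence "w \<notin> nb z" using no_path[of x y' z w] x y' ne zx(2) by blast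
    thus False using H HE_sym by (auto simp: nb_def)
   qed
   show "f y = f x \<and> (\<forall>z. HE x z --> rich v z)" if "x \<in> L" for x using that by (simp add: L_def)
  qed (use yn y wy in auto)
  also have "... \<le> (1 - ?c / 2) ^ N y"
   unfolding LX using N[OF y v] c1 by (intro power_decreasing) (auto simp: L_def)
  finally show "rgreedy stars (set NY) \<phi>1 (\<lambda>\<phi>2. rgreedy rest (set NY \<union> set stars) \<phi>2 (\<lambda>\<phi>. (1 / 2) ^ card (Gd \<phi> y v))) \<le> (1 - ?c / 2) ^ N y" .
 qed
 finally show ?thesis by simp
qed

text \<open>Union bound over all pairs of a reserve vertex and a vertex \<open>v\<close> of
  \<open>V\<close>; every \<open>v\<close> is included because the leftover vertices are not known
  in advance.\<close>

lemma total_mass: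
 assumes q: "\<And>y. y \<in> Y ==> 2 ^ t y * (1 - (d ^ (\<Delta> + 1) / 2) ^ (\<Delta> + 1) / 2) ^ N y \<le> q" and q0: "0 \<le> q"
 shows "1 - real n * real n * q \<le> EE (\<lambda>_. 1)"
proof -
 let ?rg = "rgreedy order {} (\<lambda>_. undefined)"
 define I where "I = Y \<times> V"
 have finI: "finite I" using fin V by (simp add: I_def)
 have Yn: "card Y \<le> n"
 proof -
  have "Y \<subseteq> {..<n}" using XY n1 by auto
  thus ?thesis using card_mono[of "{..<n}" Y] by simp
 qed
 have "?rg (\<lambda>\<phi>. 1 + (- 1) * (\<Sum>i\<in>I. of_bool (card (Gd \<phi> (fst i) (snd i)) < t (fst i)))) \<le> ?rg (\<lambda>\<phi>. of_bool (succ \<phi>))"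
 proof (rule rgreedy_mono[OF valid_empty okl_order])
  fix \<phi>
  show "1 + (- 1) * (\<Sum>i\<in>I. of_bool (card (Gd \<phi> (fst i) (snd i)) < t (fst i))) \<le> (of_bool (succ \<phi>) :: real)"
  proof (cases "succ \<phi>")
   case False
   then obtain y v where yv: "y \<in> Y" "v \<in> V" "card (Gd \<phi> y v) < t y" by (auto simp: succ_def not_le)
   have "(\<Sum>i\<in>{(y, v)}. of_bool (card (Gd \<phi> (fst i) (snd i)) < t (fst i)) :: real) \<le> (\<Sum>i\<in>I. of_bool (card (Gd \<phi> (fst i) (snd i)) < t (fst i)))"
    using yv finI by (intro sum_mono2) (auto simp: I_def)
   thus ?thesis using yv False by simp
  qed (simp add: sum_nonneg)
 qed
 moreover have "?rg (\<lambda>\<phi>. 1 + (- 1) * (\<Sum>i\<in>I. of_bool (card (Gd \<phi> (fst i) (snd i)) < t (fst i))))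
   = 1 - (\<Sum>i\<in>I. ?rg (\<lambda>\<phi>. of_bool (card (Gd \<phi> (fst i) (snd i)) < t (fst i))))"
 proof -
  have s: "?rg (\<lambda>\<phi>. \<Sum>i\<in>I'. F i \<phi>) = (\<Sum>i\<in>I'. ?rg (F i))" if "finite I'" for I' and F :: "nat \<times> 'b => (nat => 'b) => real"
   using that by (induction I' rule: finite_induct) (simp_all add: rgreedy_add rgreedy_const[OF valid_empty okl_order])
  show ?thesis unfolding rgreedy_add rgreedy_cmult s[OF finI] rgreedy_const[OF valid_empty okl_order] by simp
 qed
 moreover have "(\<Sum>i\<in>I. ?rg (\<lambda>\<phi>. of_bool (card (Gd \<phi> (fst i) (snd i)) < t (fst i)))) \<le> (\<Sum>i\<in>I. q)"
  using fail_prob q by (intro sum_mono) (fastforce simp: I_def)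
 moreover have "(\<Sum>i\<in>I. q) \<le> real n * real n * q"
 proof -
  have "card Y * n \<le> n * n" using Yn by (rule mult_right_mono) simp
  hence "real (card Y * n) * q \<le> real (n * n) * q" by (intro mult_right_mono[OF of_nat_mono q0])
  thus ?thesis using V by (simp add: I_def card_cartesian_product)
 qed
 moreover have "EE (\<lambda>_. 1) = ?rg (\<lambda>\<phi>. of_bool (succ \<phi>))"
  unfolding EE_def
 proof (rule rgreedy_cong[OF valid_empty okl_order])
  fix \<phi> assume "valid ({} \<union> set order) \<phi>"
  hence v: "valid ({..<n} - Y) \<phi>" by (simp add: set_order)
  show "of_bool (succ \<phi>) * swp (Gd \<phi>) ys (left \<phi>) {} (\<lambda>_. undefined) (\<lambda>_. 0) (\<lambda>\<sigma> \<eta>. 1) = of_bool (succ \<phi>)"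
   using swp_const[OF swp_ok_start[OF v]] by (cases "succ \<phi>") simp_all
 qed
 ultimately show ?thesis by linarith
qed

lemma conv_permitted:
 assumes S: "Supp (\<phi>, \<sigma>, \<eta>)" and T: "T \<subseteq> {..<n}" and eq: "\<And>z. z \<in> T ==> conv (\<phi>, \<sigma>, \<eta>) z = w z" and y: "y \<in> Y"
 shows "permitted \<phi> w T (T \<inter> Y) {z\<in>T - Y. \<phi> z \<noteq> w z} y (\<sigma> y) (\<eta> y)"
 unfolding permitted_def
proof (intro conjI impI ballI)
 note sf = supp_facts[OF S] and cs = conv_simps[OF S]
 have inj\<sigma>: "inj_on \<sigma> Y" using sf(3) by (simp add: bij_betw_def)
 show "\<phi> (\<eta> y) = w y" if "y \<in> T \<inter> Y" using eq[of y] cs(1)[of y] that by simp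
 show "\<eta> y = z" if z: "z \<in> {z\<in>T - Y. \<phi> z \<noteq> w z}" "w z = \<sigma> y" for z
 proof -
  have "z \<in> \<eta> ` Y"
  proof (rule ccontr)
   assume "z \<notin> \<eta> ` Y"
   thus False using z eq[of z] cs(3)[of z] by simp
  qed
  then obtain y' where y': "y' \<in> Y" "z = \<eta> y'" by blast
  have "\<sigma> y' = \<sigma> y" using eq[of z] z cs(2)[OF y'(1)] y'(2) by simp
  hence "y' = y" using inj\<sigma> y' y by (auto dest: inj_onD)
  thus ?thesis using y' by simp
 qed
 show "\<sigma> y = w (\<eta> y)" if "\<eta> y \<in> {z\<in>T - Y. \<phi> z \<noteq> w z}" using eq[of "\<eta> y"] cs(2)[OF y] that by simp
 show "\<phi> (\<eta> y) \<notin> w ` (T \<inter> Y)" if "y \<notin> T \<inter> Y"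
 proof
  assume "\<phi> (\<eta> y) \<in> w ` (T \<inter> Y)"
  then obtain y' where y': "y' \<in> T" "y' \<in> Y" "\<phi> (\<eta> y) = w y'" by blast
  have "conv (\<phi>, \<sigma>, \<eta>) y = conv (\<phi>, \<sigma>, \<eta>) y'" using y' eq[of y'] cs(1)[OF y] by simp
  moreover have "y < n" "y' < n" using y y' XY n1 by auto
  ultimately have "y = y'" using conv_inj(1)[OF S] by (auto dest: inj_onD)
  thus False using that y' by simp
 qed
qed

text \<open>If a displaced z has a target that is not left over, the event is impossible. Otherwise
  \<open>swp_permitted\<close> applies, and its factorial quotient gives 3/|Y| per point of P; so
  each displaced vertex and each reserve vertex of \<open>T\<close> pays one factor C.\<close>

lemma swap_spread:
 assumes v: "valid ({..<n} - Y) \<phi>" and s: "succ \<phi>" and T: "T \<subseteq> {..<n}" and w: "inj_on w T"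
  and C: "1 / K2 \<le> C" "3 / real (card Y) \<le> C"
 shows "swp (Gd \<phi>) ys (left \<phi>) {} (\<lambda>_. undefined) (\<lambda>_. 0) (\<lambda>\<sigma> \<eta>. of_bool (\<forall>z\<in>T. conv (\<phi>, \<sigma>, \<eta>) z = w z))
   \<le> C ^ (card {z\<in>T - Y. \<phi> z \<noteq> w z} + card (T \<inter> Y))"
proof -
 let ?sw = "swp (Gd \<phi>) ys (left \<phi>) {} (\<lambda>_. undefined) (\<lambda>_. 0)"
 define Z where "Z = {z\<in>T - Y. \<phi> z \<noteq> w z}"
 define SY where "SY = T \<inter> Y"
 define P where "P = {z\<in>Z. \<exists>y\<in>SY \<inter> set ys. \<phi> z = w y}"
 note ok = swp_ok_start[OF v s]
 have C0: "0 \<le> C" using C(1) K2 by (smt (verit) divide_nonneg_nonneg)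
 have finT: "finite T" using T finite_subset by blast
 have supp: "Supp (\<phi>, \<sigma>, \<eta>)" if "swp_supp (Gd \<phi>) ys (left \<phi>) {} (\<lambda>_. undefined) (\<lambda>_. 0) \<sigma> \<eta>" for \<sigma> \<eta>
  using that v s by (simp add: Supp_def)
 show ?thesis
 proof (cases "w ` Z \<subseteq> left \<phi>")
  case False
  have "?sw (\<lambda>\<sigma> \<eta>. of_bool (\<forall>z\<in>T. conv (\<phi>, \<sigma>, \<eta>) z = w z)) \<le> ?sw (\<lambda>\<sigma> \<eta>. 0)"
  proof (rule swp_mono[OF ok])
   fix \<sigma> \<eta> assume "swp_supp (Gd \<phi>) ys (left \<phi>) {} (\<lambda>_. undefined) (\<lambda>_. 0) \<sigma> \<eta>"
   note S = supp[OF this]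
   note sf = supp_facts[OF S] and cs = conv_simps[OF S]
   have "\<not> (\<forall>z\<in>T. conv (\<phi>, \<sigma>, \<eta>) z = w z)"
   proof
    assume eq: "\<forall>z\<in>T. conv (\<phi>, \<sigma>, \<eta>) z = w z"
    have "w z \<in> left \<phi>" if z: "z \<in> Z" for z
    proof -
     have zz: "z \<in> T" "z \<notin> Y" "\<phi> z \<noteq> w z" using z by (auto simp: Z_def)
     have "z \<in> \<eta> ` Y" using zz eq cs(3)[of z] by auto
     then obtain y' where y': "y' \<in> Y" "z = \<eta> y'" by blast
     have "w z = \<sigma> y'" using eq zz(1) cs(2)[OF y'(1)] y'(2) by simp
     thus ?thesis using sf(3) y'(1) by (auto simp: bij_betw_def)
    qed
    thus False using False by blast
   qed
   thus "of_bool (\<forall>z\<in>T. conv (\<phi>, \<sigma>, \<eta>) z = w z) \<le> (0::real)" by simp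
  qed
  thus ?thesis using swp_const[OF ok] C0 by (simp add: order_trans[OF _ zero_le_power])
 next
  case True
  have "?sw (\<lambda>\<sigma> \<eta>. of_bool (\<forall>z\<in>T. conv (\<phi>, \<sigma>, \<eta>) z = w z))
   \<le> ?sw (\<lambda>\<sigma> \<eta>. of_bool (\<forall>y\<in>set ys. permitted \<phi> w T SY Z y (\<sigma> y) (\<eta> y)))"
  proof (rule swp_mono[OF ok])
   fix \<sigma> \<eta> assume "swp_supp (Gd \<phi>) ys (left \<phi>) {} (\<lambda>_. undefined) (\<lambda>_. 0) \<sigma> \<eta>"
   note S = supp[OF this]
   show "of_bool (\<forall>z\<in>T. conv (\<phi>, \<sigma>, \<eta>) z = w z) \<le> (of_bool (\<forall>y\<in>set ys. permitted \<phi> w T SY Z y (\<sigma> y) (\<eta> y)) :: real)"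
    using conv_permitted[OF S T] unfolding set_ys SY_def Z_def by auto
  qed
  also have "... \<le> (1 / K2) ^ (card (left \<phi> \<inter> w ` (Z - P)) + card (SY \<inter> set ys)) * (fact (length ys - card P) / fact (length ys))"
  proof (rule swp_permitted[OF ok _ _ _ _ K2(1) P_def])
   show "Gd \<phi> y v \<subseteq> X0" for y v by (auto simp: Gd_def)
   have "X0 \<union> Z \<subseteq> {..<n} - Y" using X0_U T by (auto simp: Z_def)
   moreover have "inj_on \<phi> ({..<n} - Y)" using v by (simp add: valid_def)
   ultimately show "inj_on \<phi> (X0 \<union> Z)" by (rule inj_on_subset[rotated])
   show "inj_on w SY" "inj_on w Z" using w by (auto simp: SY_def Z_def intro: inj_on_subset)
   show "w ` P \<subseteq> left \<phi>" using True by (auto simp: P_def)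
   show "z \<in> P" if "z \<in> Z" "\<phi> z \<in> w ` SY" for z using that by (auto simp: P_def set_ys SY_def)
  qed
  also have "... \<le> C ^ (card Z + card SY)"
  proof -
   have PZ: "P \<subseteq> Z" by (auto simp: P_def)
   have finZ: "finite Z" using finT by (simp add: Z_def)
   have finP: "finite P" using PZ finZ by (rule finite_subset)
   have wZ: "inj_on w Z" using w by (auto simp: Z_def intro: inj_on_subset)
   have "left \<phi> \<inter> w ` (Z - P) = w ` (Z - P)" using True by auto
   hence c1: "card (left \<phi> \<inter> w ` (Z - P)) = card Z - card P"
    using inj_on_subset[OF wZ, of "Z - P"] PZ finP by (simp add: card_image card_Diff_subset)
   have c2: "SY \<inter> set ys = SY" by (auto simp: SY_def set_ys)
   have kZ: "card P \<le> card Z" using PZ finZ by (rule card_mono[rotated])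
   have finSY: "finite SY" using finT by (simp add: SY_def)
   have km: "card P \<le> card Y"
   proof -
    have "P \<subseteq> {..<n} - Y" using T by (auto simp: P_def Z_def)
    hence "inj_on \<phi> P" using v inj_on_subset by (auto simp: valid_def)
    hence "card P = card (\<phi> ` P)" by (simp add: card_image)
    also have "... \<le> card (w ` SY)" using finSY by (intro card_mono) (auto simp: P_def)
    also have "... \<le> card SY" using finSY by (rule card_image_le)
    also have "... \<le> card Y" using fin by (intro card_mono) (auto simp: SY_def)
    finally show ?thesis .
   qed
   have "fact (card Y - card P) / fact (card Y) \<le> C ^ card P"
   proof (cases "card Y = 0")
    case True
    thus ?thesis using km by simp
   next
    case False
    have "fact (card Y - card P) / fact (card Y) \<le> (3 / real (card Y)) ^ card P"
     using km False by (intro fact_quotient_le) auto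
    also have "... \<le> C ^ card P" using C(2) by (intro power_mono) auto
    finally show ?thesis .
   qed
   hence "(1 / K2) ^ (card Z - card P + card SY) * (fact (card Y - card P) / fact (card Y)) \<le> C ^ (card Z - card P + card SY) * C ^ card P"
    using C K2 C0 by (intro mult_mono power_mono) auto
   also have "... = C ^ (card Z + card SY)" using kZ by (simp add: power_add[symmetric])
   finally show ?thesis unfolding c1 c2 set_ys(3) .
  qed
  finally show ?thesis by (simp add: Z_def SY_def)
 qed
qed

text \<open>A vertex of \<open>T\<close> outside the reserve either keeps its greedy image, at cost
  1/K1, or is displaced, at cost C. Summing over the set S' of those that keep it costs at most
  2^|T|.\<close>

lemma EE_spread:
 assumes T: "T \<subseteq> {..<n}" and w: "inj_on w T" and C: "1 / K1 \<le> C" "1 / K2 \<le> C" "3 / real (card Y) \<le> C"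
 shows "EE (\<lambda>\<psi>. of_bool (\<forall>z\<in>T. conv \<psi> z = w z)) \<le> (2 * C) ^ card T"
proof -
 define S where "S = T - Y"
 define c where "c = card (T \<inter> Y)"
 have finT: "finite T" using T finite_subset by blast
 have finS: "finite S" using finT by (simp add: S_def)
 have C0: "0 \<le> C" using C(1) K1(1) by (smt (verit) divide_nonneg_nonneg)
 let ?rg = "rgreedy order {} (\<lambda>_. undefined)"
 have "EE (\<lambda>\<psi>. of_bool (\<forall>z\<in>T. conv \<psi> z = w z)) \<le> ?rg (\<lambda>\<phi>. \<Sum>S'\<in>Pow S. C ^ (card S - card S' + c) * of_bool (\<forall>z\<in>S'. \<phi> z = w z))"
  unfolding EE_def
 proof (rule rgreedy_mono[OF valid_empty okl_order])
  fix \<phi> assume "valid ({} \<union> set order) \<phi>"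
  hence v: "valid ({..<n} - Y) \<phi>" by (simp add: set_order)
  define A where "A = {z\<in>S. \<phi> z = w z}"
  have AS: "A \<subseteq> S" by (auto simp: A_def)
  have "{z\<in>T - Y. \<phi> z \<noteq> w z} = S - A" by (auto simp: S_def A_def)
  hence cA: "card {z\<in>T - Y. \<phi> z \<noteq> w z} = card S - card A" using AS finS by (simp add: card_Diff_subset finite_subset)
  have "of_bool (succ \<phi>) * swp (Gd \<phi>) ys (left \<phi>) {} (\<lambda>_. undefined) (\<lambda>_. 0) (\<lambda>\<sigma> \<eta>. of_bool (\<forall>z\<in>T. conv (\<phi>, \<sigma>, \<eta>) z = w z))
    \<le> C ^ (card S - card A + c)"
  proof (cases "succ \<phi>")
   case True
   show ?thesis using swap_spread[OF v True T w C(2,3)] True cA by (simp add: c_def)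
  qed (use C0 in simp)
  also have "... = (\<Sum>S'\<in>{A}. C ^ (card S - card S' + c) * of_bool (\<forall>z\<in>S'. \<phi> z = w z))" by (simp add: A_def)
  also have "... \<le> (\<Sum>S'\<in>Pow S. C ^ (card S - card S' + c) * of_bool (\<forall>z\<in>S'. \<phi> z = w z))"
   using AS finS C0 by (intro sum_mono2) auto
  finally show "of_bool (succ \<phi>) * swp (Gd \<phi>) ys (left \<phi>) {} (\<lambda>_. undefined) (\<lambda>_. 0) (\<lambda>\<sigma> \<eta>. of_bool (\<forall>z\<in>T. conv (\<phi>, \<sigma>, \<eta>) z = w z))
    \<le> (\<Sum>S'\<in>Pow S. C ^ (card S - card S' + c) * of_bool (\<forall>z\<in>S'. \<phi> z = w z))" .
 qed
 also have "... = (\<Sum>S'\<in>Pow S. C ^ (card S - card S' + c) * ?rg (\<lambda>\<phi>. of_bool (\<forall>z\<in>S'. \<phi> z = w z)))"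
 proof -
  have s: "?rg (\<lambda>\<phi>. \<Sum>i\<in>I'. F i \<phi>) = (\<Sum>i\<in>I'. ?rg (F i))" if "finite I'" for I' and F :: "nat set => (nat => 'b) => real"
   using that by (induction I' rule: finite_induct) (simp_all add: rgreedy_add rgreedy_const[OF valid_empty okl_order])
  have "finite (Pow S)" using finS by simp
  show ?thesis unfolding s[OF \<open>finite (Pow S)\<close>] rgreedy_cmult by (rule refl)
 qed
 also have "... \<le> (\<Sum>S'\<in>Pow S. C ^ (card S - card S' + c) * C ^ card S')"
 proof (intro sum_mono mult_left_mono)
  fix S' assume S': "S' \<in> Pow S"
  have "?rg (\<lambda>\<phi>. of_bool (\<forall>z\<in>S'. \<phi> z = w z)) \<le> (1 / K1) ^ card S'"
  proof (rule rgreedy_spread[OF valid_empty okl_order _ K1(1)])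
   show "S' \<subseteq> set order" using S' T unfolding set_order S_def by auto
   fix D \<phi> u assume "valid D \<phi>" "ok D u"
   thus "K1 \<le> real (card (opts D \<phi> u))" using opts_card(1)[of D \<phi> u] K1(2)[of u] by (auto simp: ok_def)
  qed
  also have "... \<le> C ^ card S'" using C(1) K1(1) by (intro power_mono) auto
  finally show "?rg (\<lambda>\<phi>. of_bool (\<forall>z\<in>S'. \<phi> z = w z)) \<le> C ^ card S'" .
 qed (use C0 in simp)
 also have "... = (\<Sum>S'\<in>Pow S. C ^ (card S + c))"
 proof (rule sum.cong, simp)
  fix S' assume "S' \<in> Pow S"
  hence "card S' \<le> card S" using finS by (simp add: card_mono)
  thus "C ^ (card S - card S' + c) * C ^ card S' = C ^ (card S + c)" by (simp add: power_add[symmetric])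
 qed
 also have "... = 2 ^ card S * C ^ card T"
 proof -
  have "card T = card S + c" unfolding S_def c_def using finT by (metis add.commute card_Int_Diff)
  thus ?thesis using finS by (simp add: card_Pow)
 qed
 also have "... \<le> 2 ^ card T * C ^ card T"
  using finT C0 by (intro mult_right_mono power_increasing card_mono) (auto simp: S_def)
 also have "... = (2 * C) ^ card T" by (simp add: power_mult_distrib)
 finally show ?thesis .
qed

end

type_synonym 'b outcome = "(nat => 'b) \<times> (nat => 'b) \<times> (nat => nat)"

text \<open>The outcome type is that of the swap construction, as a quantifier cannot range over
  types; the conditions mention outcomes only through \<open>conv\<close>.\<close>

definition spread_embedding :: "nat => (nat => nat => bool) => 'b set => ('b => 'b => bool) => real => real => bool" where
 "spread_embedding n HE V g K \<rho> \<longleftrightarrow> (\<exists>(E :: ('b outcome => real) => real) Supp conv. functional E Supp \<and>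
   (\<forall>\<psi>. Supp \<psi> --> inj_on (conv \<psi>) {..<n} \<and> conv \<psi> ` {..<n} \<subseteq> V \<and> (\<forall>u w. HE u w --> g (conv \<psi> u) (conv \<psi> w))) \<and>
   1 - \<rho> \<le> E (\<lambda>_. 1) \<and>
   (\<forall>S w. S \<subseteq> {..<n} --> inj_on w S --> E (\<lambda>\<psi>. of_bool (\<forall>z\<in>S. conv \<psi> z = w z)) \<le> (K / n) ^ card S))"

text \<open>The threshold costs 2 exp(cx/4), the moment bound gains exp(-cx/2); a threshold of a
  quarter of cx leaves half of the exponent.\<close>

lemma tail_bound:
 fixes c x :: real
 assumes c: "0 < c" "c \<le> 1" and x: "0 \<le> x"
 shows "2 ^ nat \<lceil>c / 4 * x\<rceil> * (1 - c / 2) ^ nat \<lceil>x\<rceil> \<le> 2 * exp (- (c / 4 * x))"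
proof -
 have ln2: "ln 2 \<le> (1::real)" using ln_2_less_1 by simp
 have "(2::real) ^ nat \<lceil>c / 4 * x\<rceil> = 2 powr real (nat \<lceil>c / 4 * x\<rceil>)" by (simp add: powr_realpow)
 also have "... \<le> 2 powr (c / 4 * x + 1)"
 proof (rule powr_mono)
  have "0 \<le> c / 4 * x" using c x by simp
  thus "real (nat \<lceil>c / 4 * x\<rceil>) \<le> c / 4 * x + 1" by linarith
 qed simp
 also have "... = 2 * exp (ln 2 * (c / 4 * x))" unfolding powr_add by (simp add: powr_def mult.commute)
 also have "... \<le> 2 * exp (1 * (c / 4 * x))" using ln2 c x by (intro mult_left_mono exp_le_cancel_iff[THEN iffD2] mult_right_mono) auto
 finally have 1: "(2::real) ^ nat \<lceil>c / 4 * x\<rceil> \<le> 2 * exp (c / 4 * x)" by simp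
 have "(1 - c / 2) ^ nat \<lceil>x\<rceil> \<le> exp (- (c / 2)) ^ nat \<lceil>x\<rceil>"
  using c exp_ge_add_one_self[of "- (c / 2)"] by (intro power_mono) auto
 also have "... = exp (- (c / 2) * real (nat \<lceil>x\<rceil>))" by (simp add: exp_of_nat_mult[symmetric] mult.commute)
 also have "... \<le> exp (- (c / 2) * x)"
 proof -
  have "x \<le> real (nat \<lceil>x\<rceil>)" by linarith
  thus ?thesis using c by simp
 qed
 finally have 2: "(1 - c / 2) ^ nat \<lceil>x\<rceil> \<le> exp (- (c / 2) * x)" .
 have "2 ^ nat \<lceil>c / 4 * x\<rceil> * (1 - c / 2) ^ nat \<lceil>x\<rceil> \<le> (2 * exp (c / 4 * x)) * exp (- (c / 2) * x)"
  using 1 2 c by (intro mult_mono) auto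
 also have "... = 2 * exp (- (c / 4 * x))" by (simp add: exp_add[symmetric] algebra_simps)
 finally show ?thesis .
qed

text \<open>Order of the constants: d and h0 from \<gamma>; then the size \<xi> of the initial part
  and the rate y of the reserve; then the slack e1 and the regularity parameters; only then the
  cluster size c0, the segment length \<eta>n and the bandwidth.\<close>

theorem dense_spread:
 fixes \<gamma> :: real and \<Delta> r :: nat
 assumes gam: "0 < \<gamma>" and Del: "1 \<le> \<Delta>" and r: "1 \<le> r"
 shows "\<exists>\<beta>>0. \<exists>K\<ge>1. \<exists>a>0. \<exists>n0::nat. \<forall>n\<ge>n0. \<forall>b HE col (V :: 'b set) g.
   banded_graph n b \<Delta> r HE col --> real b \<le> \<beta> * n --> finite V --> card V = n --> (\<forall>x y. g x y --> g y x) -->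
   (\<forall>v\<in>V. ((real r - 1) / real r + \<gamma>) * n \<le> card {u\<in>V. g v u}) -->
   spread_embedding n HE V g K (real n * real n * (2 * exp (- (a * n))))"
proof -
 define \<gamma>' where "\<gamma>' = min \<gamma> 1"
 have g0: "0 < \<gamma>'" "\<gamma>' \<le> 1" "\<gamma>' \<le> \<gamma>" using gam by (auto simp: \<gamma>'_def)
 have rr: "1 \<le> real r" using r by simp
 \<comment> \<open>With 2d = \<gamma>'/4, \<tau> \<le> \<gamma>'/8 and h0 = \<gamma>'/2 the
   inequality r\<nu> + h0 n \<le> (1-\<tau>)n holds; for r = 1 and \<tau> = \<gamma>'/8 it is an
   equality.\<close>
 define d where "d = \<gamma>' / 8"
 have d: "0 < d" "d \<le> 1" using g0 by (auto simp: d_def)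
 define p where "p = d ^ (\<Delta> + 1)"
 have p: "0 < p" "p \<le> 1" unfolding p_def using d by (simp_all del: power_Suc add: power_le_one)
 define h0 where "h0 = \<gamma>' / 2"
 have h0: "0 < h0" "h0 \<le> 1" using g0 by (auto simp: h0_def)
 define \<xi> where "\<xi> = min (min (h0 / 2) (1 / (8 * real r))) (p / (32 * real r))"
 have xi: "0 < \<xi>" "\<xi> \<le> h0 / 2" "\<xi> \<le> 1 / (8 * real r)" "\<xi> \<le> p / (32 * real r)" using h0 rr p by (auto simp: \<xi>_def)
 have xi': "8 * real r * \<xi> \<le> 1" "32 * real r * \<xi> \<le> p" using xi(3,4) rr by (auto simp: pos_le_divide_eq mult.commute)
 have xi8: "8 * \<xi> \<le> 1"
 proof -
  have "8 * \<xi> * 1 \<le> 8 * \<xi> * real r" using xi(1) rr by (intro mult_left_mono) auto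
  thus ?thesis using xi'(1) by (simp add: mult.commute mult.left_commute)
 qed
 define Q where "Q = 4 * real r * (real \<Delta> + 1) ^ 3"
 have Q: "0 < Q" using rr by (simp add: Q_def)
 define \<kappa> where "\<kappa> = 1 / Q"
 have kap: "0 < \<kappa>" "\<kappa> * Q = 1" using Q by (auto simp: \<kappa>_def)
 define c3 where "c3 = (p / 2) ^ (\<Delta> + 1)"
 have c3: "0 < c3" "c3 \<le> 1" unfolding c3_def using p by (simp_all del: power_Suc add: power_le_one)
 \<comment> \<open>\<open>structure_lemma\<close> provides s0 w A movable vertices for each cluster
   A.\<close>
 define s0 where "s0 = \<kappa> / 2 * \<xi> * h0 ^ (r - 1)"
 have s0: "0 < s0" using kap xi h0 by (simp add: s0_def)
 \<comment> \<open>Small enough that the reserve of a cluster uses at most half of the c3/4 s0 w A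
   good vertices demanded; the other half supplies K2.\<close>
 define y where "y = min (\<kappa> / 4) (c3 / 8 * s0 / (4 * real r * \<xi>))"
 have rx: "0 < 4 * real r * \<xi>" using rr xi by simp
 have y: "0 < y" "4 * y \<le> \<kappa>" "y \<le> c3 / 8 * s0 / (4 * real r * \<xi>)" using kap c3 s0 rx by (auto simp: y_def)
 have y': "4 * real r * y * \<xi> \<le> c3 / 8 * s0" using y(3) rx by (simp add: pos_le_divide_eq algebra_simps)
 define y1 where "y1 = y * \<xi> * h0 ^ r"
 have y1: "0 < y1" using y xi h0 by (simp add: y1_def)
 have y_le: "y \<le> 1"
 proof -
  have "1 \<le> Q" unfolding Q_def using rr by (intro mult_ge1_I one_le_power) auto
  hence "\<kappa> \<le> 1" by (simp add: \<kappa>_def)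
  thus ?thesis using y by simp
 qed
 have y1_le: "y1 \<le> 1"
 proof -
  have "\<xi> \<le> 1" using xi8 xi(1) by linarith
  hence "y * \<xi> \<le> 1" using y_le y xi by (intro mult_le_one) auto
  from mult_le_one[OF this, of "h0 ^ r"] show ?thesis unfolding y1_def using h0 by (simp add: power_le_one)
 qed
 define \<tau> where "\<tau> = min (\<gamma>' / 8) (y1 / 2)"
 have tau: "0 < \<tau>" "\<tau> \<le> \<gamma>' / 8" "2 * \<tau> \<le> y1" "4 * \<tau> \<le> 1" using g0 y1 by (auto simp: \<tau>_def)
 define e1 where "e1 = y1 / 16"
 have e1: "0 < e1" "e1 \<le> 1" using y1 y1_le by (auto simp: e1_def)
 define \<delta> where "\<delta> = p * e1 / (8 * real \<Delta>)"
 have pe: "0 < p * e1" using p e1 by simp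
 have del: "0 < \<delta>" "real \<Delta> * \<delta> \<le> p * e1 / 8" "\<delta> \<le> p * e1"
 proof -
  show "0 < \<delta>" using pe Del by (simp add: \<delta>_def)
  show "real \<Delta> * \<delta> \<le> p * e1 / 8" using Del by (simp add: \<delta>_def)
  have "\<delta> \<le> p * e1 / 1" unfolding \<delta>_def using pe Del by (intro divide_left_mono) auto
  thus "\<delta> \<le> p * e1" by simp
 qed
 obtain c1 :: real where c1: "0 < c1" and clus: "\<And>(V :: 'b set) g \<alpha>. finite V ==> V \<noteq> {} ==> (\<forall>u\<in>V. \<forall>v\<in>V. g u v = g v u) ==>
   (\<forall>v\<in>V. \<alpha> * real (card V) \<le> card {u\<in>V. g v u}) ==>
   (\<exists>\<A>. finite \<A> \<and> disjoint \<A> \<and> \<Union>\<A> \<subseteq> V \<and> (\<forall>A\<in>\<A>. c1 * card V \<le> card A) \<and>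
    (1 - \<tau>) * card V \<le> (\<Sum>A\<in>\<A>. real (card A)) \<and>
    (\<forall>A\<in>\<A>. (\<alpha> - 2 * d - \<tau>) * card V \<le>
      (\<Sum>B\<in>{B\<in>\<A>. typical_pair g d \<delta> A B \<and> typical_pair g d \<delta> B A}. real (card B))))"
  using cluster_lemma[OF d(1) tau(1) del(1), where 'b = 'b] by auto
 define c0 where "c0 = min c1 (1 / 2)"
 have c0: "0 < c0" "c0 < 1" "c0 \<le> c1" using c1 by (auto simp: c0_def)
 have ln0: "0 < ln (2 / c0)" using c0 by simp
 define \<eta> where "\<eta> = min (\<xi> * c0 * c0 ^ r) ((y1 / 8)\<^sup>2 * (c0 / 4) / ln (2 / c0))"
 have eta: "0 < \<eta>" "\<eta> \<le> \<xi> * c0 * c0 ^ r" "\<eta> \<le> (y1 / 8)\<^sup>2 * (c0 / 4) / ln (2 / c0)" using xi c0 y1 ln0 by (auto simp: \<eta>_def)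
 define D :: nat where "D = 2 ^ r - 1"
 \<comment> \<open>The three bounds make segments long enough for the walks, vertices in transit
   negligible against the slack, and the last b places negligible in a greedy step.\<close>
 define \<beta>' where "\<beta>' = min (min (\<eta> / (2 * (real D + 4) + 1)) (y1 / 16 * c0 / ((2 / \<eta> + 1) * (real D + 1)))) (p * e1 * c0 / 8)"
 have be: "0 < \<beta>'" "\<beta>' \<le> \<eta> / (2 * (real D + 4) + 1)" "\<beta>' \<le> y1 / 16 * c0 / ((2 / \<eta> + 1) * (real D + 1))" "\<beta>' \<le> p * e1 * c0 / 8"
 proof -
  have "0 < (2 / \<eta> + 1) * (real D + 1)" using eta by (intro mult_pos_pos add_nonneg_pos) auto
  thus "0 < \<beta>'" using eta y1 c0 pe by (simp add: \<beta>'_def)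
 qed (unfold \<beta>'_def, rule min.coboundedI1[OF min.cobounded1], rule min.coboundedI1[OF min.cobounded2], rule min.cobounded2)
 define C0 where "C0 = max (max (2 / (p * e1 * c0)) (8 / (c3 * s0 * c0))) (3 / e1)"
 have C0: "2 / (p * e1 * c0) \<le> C0" "8 / (c3 * s0 * c0) \<le> C0" "3 / e1 \<le> C0" by (auto simp: C0_def)
 have C01: "3 \<le> C0"
 proof -
  have "3 / 1 \<le> 3 / e1" using e1 by (intro divide_left_mono) auto
  thus ?thesis using C0(3) by simp
 qed
 define a where "a = c3 / 4 * (s0 * c0)"
 have a0: "0 < a" using c3 s0 c0 by (simp add: a_def)
 obtain n0 :: nat where n0: "2 / \<beta>' < n0" "2 / (y * \<eta>) < n0" "8 / (c3 * s0 * c0) < n0" "1 < real n0"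
 proof -
  obtain m :: nat where "max (max (2 / \<beta>') (2 / (y * \<eta>))) (max (8 / (c3 * s0 * c0)) 1) < m" using reals_Archimedean2 by blast
  thus ?thesis using that[of m] by simp
 qed
 have main: "spread_embedding n HE V g (2 * C0) (real n * real n * (2 * exp (- (a * n))))"
  if n: "n0 \<le> n" and bg: "banded_graph n b \<Delta> r HE col" and b: "real b \<le> \<beta>' / 2 * n" and V: "finite V" "card V = n"
   and gsym: "\<And>x y. g x y ==> g y x" and deg: "\<forall>v\<in>V. ((real r - 1) / real r + \<gamma>) * n \<le> card {u\<in>V. g v u}"
  for n b HE col and V :: "'b set" and g
 proof -
  interpret banded_graph n b \<Delta> r HE col by (rule bg)
  have nn: "2 / \<beta>' < n" "2 / (y * \<eta>) < n" "8 / (c3 * s0 * c0) < n" "1 < real n" using n0 n by linarith+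
  have n1': "0 < real n" using nn by simp
  have Vne: "V \<noteq> {}" using V n1' by auto
  define \<alpha> where "\<alpha> = (real r - 1) / real r + \<gamma>'"
  have deg': "\<forall>v\<in>V. \<alpha> * real (card V) \<le> card {u\<in>V. g v u}"
  proof
   fix v assume "v \<in> V"
   hence "((real r - 1) / real r + \<gamma>) * n \<le> card {u\<in>V. g v u}" using deg by blast
   moreover have "\<alpha> * n \<le> ((real r - 1) / real r + \<gamma>) * n" using g0 by (intro mult_right_mono) (auto simp: \<alpha>_def)
   ultimately show "\<alpha> * real (card V) \<le> card {u\<in>V. g v u}" using V by simp
  qed
  have al: "\<alpha> = 1 - 1 / real r + \<gamma>'" using rr by (simp add: \<alpha>_def diff_divide_distrib)
  have "\<alpha> \<le> 1"
  proof -
   obtain v where v: "v \<in> V" using Vne by auto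
   have "card {u\<in>V. g v u} \<le> n" using V card_mono[of V "{u\<in>V. g v u}"] by auto
   hence "\<alpha> * n \<le> 1 * real n" using deg' v V by force
   thus ?thesis using n1' by simp
  qed
  hence gr: "\<gamma>' \<le> 1 / real r" using al by simp
  have sym: "\<forall>u\<in>V. \<forall>v\<in>V. g u v = g v u" using gsym by blast
  obtain \<A> where A: "finite \<A>" "disjoint \<A>" "\<Union>\<A> \<subseteq> V" "\<And>A. A \<in> \<A> ==> c1 * n \<le> card A"
    "(1 - \<tau>) * n \<le> (\<Sum>A\<in>\<A>. real (card A))"
    "\<And>A. A \<in> \<A> ==> (\<alpha> - 2 * d - \<tau>) * n \<le>
      (\<Sum>B\<in>{B\<in>\<A>. typical_pair g d \<delta> A B \<and> typical_pair g d \<delta> B A}. real (card B))"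
   using clus[OF V(1) Vne sym deg'] V(2) by auto
  define w where "w A = real (card A)" for A :: "'b set"
  define R where "R A B \<longleftrightarrow> typical_pair g d \<delta> A B \<and> typical_pair g d \<delta> B A" for A B
  define \<nu> where "\<nu> = (1 - (\<alpha> - 2 * d - \<tau>)) * n"
  have finAA: "finite A" if "A \<in> \<A>" for A using that A(3) V(1) by (meson Union_upper finite_subset)
  have tot: "sum w \<A> \<le> n"
  proof -
   have "(\<Sum>A\<in>\<A>. card A) = card (\<Union>\<A>)" using finAA A(2) by (intro card_Union_disjoint[symmetric]) (auto simp: disjoint_def pairwise_def)
   also have "... \<le> n" using A(3) V card_mono by metis
   finally have "real (\<Sum>A\<in>\<A>. card A) \<le> real n" by (simp only: of_nat_le_iff)
   thus ?thesis by (simp add: w_def)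
  qed
  have nu0: "0 \<le> \<nu>"
  proof -
   have "0 \<le> 1 - (\<alpha> - 2 * d - \<tau>)" using al gr d tau by simp
   thus ?thesis by (simp add: \<nu>_def)
  qed
  have wg: "weighted_graph \<A> R w \<nu>"
  proof
   show "finite \<A>" by fact
   show "0 \<le> w A" for A by (simp add: w_def)
   show "R A B ==> R B A" for A B by (auto simp: R_def)
   show "0 \<le> \<nu>" by (rule nu0)
   fix A' assume A': "A' \<in> \<A>"
   have "sum w \<A> = sum w {B\<in>\<A>. R A' B} + sum w {B\<in>\<A>. \<not> R A' B}"
    using A(1) by (subst sum.union_disjoint[symmetric]) (auto intro: arg_cong[where f="sum w"])
   moreover have "(\<alpha> - 2 * d - \<tau>) * n \<le> sum w {B\<in>\<A>. R A' B}" using A(6)[OF A'] by (simp add: w_def R_def)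
   ultimately show "sum w {B\<in>\<A>. \<not> R A' B} \<le> \<nu>" using tot by (simp add: \<nu>_def algebra_simps)
  qed
  have gap: "real r * \<nu> + h0 * n \<le> sum w \<A>"
  proof -
   have "real r * \<nu> = (1 - real r * \<gamma>' + real r * (2 * d) + real r * \<tau>) * n"
    unfolding \<nu>_def al using rr by (simp add: algebra_simps)
   also have "... + h0 * n \<le> (1 - \<tau>) * n"
   proof -
    have r1: "\<tau> \<le> real r * \<tau>" "\<gamma>' \<le> real r * \<gamma>'" using rr tau g0 by auto
    have r2: "real r * \<tau> \<le> real r * (\<gamma>' / 8)" using tau rr by (intro mult_left_mono) auto
    have "1 - real r * \<gamma>' + real r * (2 * d) + real r * \<tau> + h0 \<le> 1 - \<tau>"
    proof -
     have "real r * (2 * d) = real r * \<gamma>' / 4" "real r * (\<gamma>' / 8) = real r * \<gamma>' / 8" by (simp_all add: d_def)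
     thus ?thesis using r1 r2 unfolding h0_def by linarith
    qed
    hence "(1 - real r * \<gamma>' + real r * (2 * d) + real r * \<tau> + h0) * n \<le> (1 - \<tau>) * n" by (intro mult_right_mono) auto
    thus ?thesis by (simp add: distrib_right)
   qed
   also have "... \<le> sum w \<A>" using A(5) by (simp add: w_def)
   finally show ?thesis .
  qed
  have cw: "c0 * n \<le> w A" if "A \<in> \<A>" for A
   using A(4)[OF that] mult_right_mono[OF c0(3), of "real n"] by (simp add: w_def)
  \<comment> \<open>The extra vertex per block is the reason why the bandwidth is granted only half
    of \<beta>' n.\<close>
  define B where "B = b + 1"
  have Bb: "real B \<le> \<beta>' * n"
  proof -
   have "1 \<le> \<beta>' / 2 * n" using nn(1) be(1) by (simp add: divide_less_eq mult.commute)
   thus ?thesis using b by (simp add: B_def)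
  qed
  have B0: "0 < real B" by (simp add: B_def)
  define s where "s = nat \<lfloor>\<eta> * n / B\<rfloor>"
  define l where "l = B * s"
  have Beta: "(2 * (real D + 4) + 1) * B \<le> \<eta> * n"
  proof -
   have "(2 * (real D + 4) + 1) * B \<le> (2 * (real D + 4) + 1) * (\<beta>' * n)" using Bb by (intro mult_left_mono) auto
   also have "... = ((2 * (real D + 4) + 1) * \<beta>') * n" by simp
   also have "... \<le> \<eta> * n" using be(2) by (intro mult_right_mono) (auto simp: pos_le_divide_eq mult.commute)
   finally show ?thesis .
  qed
  have sr: "real s \<le> \<eta> * n / B" "\<eta> * n / B - 1 \<le> real s"
  proof -
   have "0 \<le> \<eta> * n / B" using eta by simp
   thus "real s \<le> \<eta> * n / B" "\<eta> * n / B - 1 \<le> real s" unfolding s_def by linarith+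
  qed
  have l_hi: "real l \<le> \<eta> * n"
   using mult_left_mono[OF sr(1), of "real B"] B0 by (simp add: l_def)
  have l_lo: "\<eta> / 2 * n \<le> real l"
  proof -
   have "\<eta> * n - B \<le> real l" using mult_left_mono[OF sr(2), of "real B"] B0 by (simp add: l_def algebra_simps)
   moreover have "2 * real B \<le> (2 * (real D + 4) + 1) * B" using B0 by (intro mult_right_mono) auto
   ultimately have "\<eta> * n \<le> 2 * real l" using Beta by linarith
   thus ?thesis by simp
  qed
  have s_ge: "2 * (D + 4) \<le> s"
  proof -
   have "2 * (real D + 4) + 1 \<le> \<eta> * n / B" using Beta B0 by (simp add: pos_le_divide_eq)
   hence "real (2 * (D + 4)) \<le> real s" using sr(2) by simp
   thus ?thesis by (simp only: of_nat_le_iff)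
  qed
  have yl: "1 \<le> y * l"
  proof -
   have "2 < y * \<eta> * n" using nn(2) y eta by (simp add: divide_less_eq mult.commute)
   moreover have "y * (\<eta> / 2 * n) \<le> y * l" using l_lo y by (intro mult_left_mono) auto
   ultimately show ?thesis by simp
  qed
  have small: "(1 / c0) ^ r * l \<le> \<xi> * c0 * n"
  proof -
   have "(1 / c0) ^ r * l \<le> (1 / c0) ^ r * (\<xi> * c0 * c0 ^ r * n)"
   proof (rule mult_left_mono)
    have "\<eta> * n \<le> \<xi> * c0 * c0 ^ r * n" using eta(2) by (intro mult_right_mono) auto
    thus "real l \<le> \<xi> * c0 * c0 ^ r * n" using l_hi by linarith
   qed (use c0 in simp)
   also have "... = \<xi> * c0 * n" using c0 by (simp add: power_divide)
   finally show ?thesis .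
  qed
  have mw: "ln (2 / c0) * l \<le> (y1 / 8)\<^sup>2 * (c0 / 4) * n"
  proof -
   have "ln (2 / c0) * l \<le> ln (2 / c0) * (\<eta> * n)" using l_hi ln0 by (intro mult_left_mono) auto
   also have "... = (\<eta> * ln (2 / c0)) * n" by simp
   also have "... \<le> ((y1 / 8)\<^sup>2 * (c0 / 4)) * n" using eta(3) ln0 by (intro mult_right_mono) (auto simp: pos_le_divide_eq)
   finally show ?thesis by simp
  qed
  have l0: "0 < real l" using l_lo eta n1' by (smt (verit) mult_pos_pos half_gt_zero)
  have tr: "real ((n div l + 1) * (D * B) + b) \<le> y1 / 16 * c0 * n"
  proof -
   have "real (n div l) \<le> real n / real l" by (rule of_nat_div_le_of_nat)
   also have "... \<le> n / (\<eta> / 2 * n)" using l_lo eta n1' l0 by (intro divide_left_mono mult_pos_pos) auto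
   also have "... = 2 / \<eta>" using n1' by simp
   finally have q: "real (n div l) \<le> 2 / \<eta>" .
   have q0: "0 \<le> 2 / \<eta> + 1" using eta by simp
   have alg: "x * (real D * B) + x * B = x * (real D + 1) * real B" for x :: real by (simp add: algebra_simps)
   have "real ((n div l + 1) * (D * B) + b) = (real (n div l) + 1) * (real D * B) + b" by (simp add: distrib_right)
   also have "... \<le> (2 / \<eta> + 1) * (real D * B) + (2 / \<eta> + 1) * B"
   proof (intro add_mono mult_right_mono)
    have "1 * real B \<le> (2 / \<eta> + 1) * B" using eta B0 by (intro mult_right_mono) auto
    moreover have "real b \<le> real B" by (simp add: B_def)
    ultimately show "real b \<le> (2 / \<eta> + 1) * B" by linarith
   qed (use q in auto)
   also have "... = ((2 / \<eta> + 1) * (real D + 1)) * B" by (rule alg)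
   also have "... \<le> ((2 / \<eta> + 1) * (real D + 1)) * (\<beta>' * n)" using Bb q0 by (intro mult_left_mono) auto
   also have "... = ((2 / \<eta> + 1) * (real D + 1) * \<beta>') * n" by simp
   also have "... \<le> y1 / 16 * c0 * n"
   proof (rule mult_right_mono)
    have "0 < (2 / \<eta> + 1) * (real D + 1)" using eta by (intro mult_pos_pos add_nonneg_pos) auto
    hence "\<beta>' * ((2 / \<eta> + 1) * (real D + 1)) \<le> y1 / 16 * c0" using be(3) by (simp only: pos_le_divide_eq)
    thus "(2 / \<eta> + 1) * (real D + 1) * \<beta>' \<le> y1 / 16 * c0" by (simp only: mult.commute)
   qed simp
   finally show ?thesis .
  qed
  have Qk: "\<kappa> * (4 * real r * (real \<Delta> + 1) ^ 3) = 1" using kap(2) by (simp add: Q_def)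
  have xi2: "2 * \<xi> \<le> h0" "4 * real r * \<xi> \<le> 1" using xi xi' rx by auto
  have "\<exists>f X0 Y n1. (\<forall>u<n. f u \<in> \<A>) \<and> (\<forall>u v. HE u v --> R (f u) (f v)) \<and>
   X0 \<union> Y \<subseteq> {..<n1} \<and> X0 \<inter> Y = {} \<and> banded_graph.separated HE (X0 \<union> Y) \<and> n1 \<le> n \<and>
   (\<forall>A\<in>\<A>. card {u. u < n1 + b \<and> u < n \<and> f u = A} \<le> 4 * real r * \<xi> * w A) \<and>
   (\<forall>A\<in>\<A>. card {u\<in>Y. f u = A} \<le> 4 * real r * y * \<xi> * w A) \<and>
   (\<forall>A\<in>\<A>. \<forall>J'\<subseteq>\<A>. sum w (\<A> - J') \<le> \<nu> -->
    \<kappa> / 2 * \<xi> * h0 ^ (r - 1) * w A \<le> card {x\<in>X0. f x = A \<and> (\<forall>z. HE x z --> f z \<in> J')}) \<and>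
   (\<forall>A\<in>\<A>. card {u. u < n \<and> u \<notin> Y \<and> f u = A} \<le> (1 - y1 / 16) * w A)"
  proof (rule structure_lemma[OF wg bg _ _ tot _ gap h0 cw c0(1,2) B_def D_def l_def s_ge xi(1) xi2 xi8 Qk y(1,2) yl small y1_def tau(3,4) _ mw tr])
   show "0 < r" "0 < n" using r n1' by auto
   show "(1 - \<tau>) * n \<le> sum w \<A>" using A(5) by (simp add: w_def)
   show "0 \<le> \<tau>" using tau by simp
  qed
  then obtain f X0 Y n1 where F: "\<forall>u<n. f u \<in> \<A>" "\<forall>u v. HE u v --> R (f u) (f v)"
   and XY: "X0 \<union> Y \<subseteq> {..<n1}" "X0 \<inter> Y = {}" "separated (X0 \<union> Y)" "n1 \<le> n"
   and F': "\<forall>A\<in>\<A>. card {u. u < n1 + b \<and> u < n \<and> f u = A} \<le> 4 * real r * \<xi> * w A"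
    "\<forall>A\<in>\<A>. card {u\<in>Y. f u = A} \<le> 4 * real r * y * \<xi> * w A"
    "\<forall>A\<in>\<A>. \<forall>J'\<subseteq>\<A>. sum w (\<A> - J') \<le> \<nu> -->
     \<kappa> / 2 * \<xi> * h0 ^ (r - 1) * w A \<le> card {x\<in>X0. f x = A \<and> (\<forall>z. HE x z --> f z \<in> J')}"
    "\<forall>A\<in>\<A>. card {u. u < n \<and> u \<notin> Y \<and> f u = A} \<le> (1 - y1 / 16) * w A"
   by (elim exE conjE) (rule that)
  note f = F(1)[rule_format] and fR = F(2)[rule_format] and early = F'(1)[rule_format] and Yl = F'(2)[rule_format]
   and sw = F'(3)[rule_format, folded s0_def] and ld = F'(4)[rule_format, folded e1_def]
  have wpos: "0 < w A" if "A \<in> \<A>" for A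
  proof -
   have "0 < c0 * n" using c0 n1' by simp
   thus ?thesis using cw[OF that] by linarith
  qed
  \<comment> \<open>Of the \<alpha>n neighbours of v, at most dn lie in clusters where v is not rich
    and at most \<tau>n outside all clusters, so the poor clusters weigh at most \<nu>. This holds
    also for v outside the clusters.\<close>
  have Jv: "sum w (\<A> - {A\<in>\<A>. d * real (card A) \<le> card {x\<in>A. g v x}}) \<le> \<nu>" if v: "v \<in> V" for v
  proof -
   let ?J = "{A\<in>\<A>. d * real (card A) \<le> card {x\<in>A. g v x}}"
   define U where "U = \<Union>\<A>"
   have finU: "finite U" using A(3) V(1) unfolding U_def by (rule finite_subset)
   have cU: "card U = (\<Sum>A\<in>\<A>. card A)" unfolding U_def using finAA A(2) by (intro card_Union_disjoint) (auto simp: disjoint_def pairwise_def)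
   have cUr: "real (card U) = sum w \<A>" unfolding cU w_def by simp
   have "card {x\<in>V. g v x} \<le> card ({x\<in>U. g v x} \<union> (V - U))" using finU V by (intro card_mono) auto
   also have "... \<le> card {x\<in>U. g v x} + card (V - U)" by (rule card_Un_le)
   also have "card (V - U) = n - card U" using finU A(3) V by (simp add: card_Diff_subset U_def)
   finally have 1: "card {x\<in>V. g v x} \<le> card {x\<in>U. g v x} + (n - card U)" .
   have "card {x\<in>U. g v x} \<le> (\<Sum>A\<in>\<A>. card {x\<in>A. g v x})"
   proof -
    have "{x\<in>U. g v x} = (\<Union>A\<in>\<A>. {x\<in>A. g v x})" by (auto simp: U_def)
    thus ?thesis using card_UN_le[OF A(1), of "\<lambda>A. {x\<in>A. g v x}"] by simp
   qed
   hence "real (card {x\<in>U. g v x}) \<le> (\<Sum>A\<in>\<A>. real (card {x\<in>A. g v x}))" by (simp only: of_nat_le_iff of_nat_sum[symmetric])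
   also have "... \<le> (\<Sum>A\<in>\<A>. (if A \<in> ?J then w A else 0) + d * w A)"
   proof (rule sum_mono)
    fix A assume A': "A \<in> \<A>"
    have "card {x\<in>A. g v x} \<le> card A" using finAA[OF A'] by (intro card_mono) auto
    moreover have "0 \<le> d * w A" using d by (simp add: w_def)
    ultimately show "real (card {x\<in>A. g v x}) \<le> (if A \<in> ?J then w A else 0) + d * w A" using A' by (auto simp: w_def)
   qed
   also have "... = sum w ?J + d * sum w \<A>"
   proof -
    have "(\<Sum>A\<in>\<A>. if A \<in> ?J then w A else 0) = sum w (\<A> \<inter> ?J)" using A(1) by (simp add: sum.inter_restrict)
    also have "\<A> \<inter> ?J = ?J" by auto
    finally show ?thesis by (simp add: sum.distrib sum_distrib_left)
   qed
   also have "d * sum w \<A> \<le> d * n" using tot d by (intro mult_left_mono) auto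
   finally have 2: "real (card {x\<in>U. g v x}) \<le> sum w ?J + d * n" by simp
   have 3: "real (n - card U) \<le> \<tau> * n"
   proof -
    have "card U \<le> n" using cUr tot by linarith
    thus ?thesis using cUr A(5) by (simp add: of_nat_diff w_def algebra_simps)
   qed
   have "\<alpha> * n \<le> card {x\<in>V. g v x}" using deg' v V by simp
   hence "\<alpha> * n \<le> sum w ?J + d * n + \<tau> * n" using 1 2 3 by linarith
   moreover have "sum w \<A> = sum w ?J + sum w (\<A> - ?J)"
    using sum.subset_diff[of ?J \<A> w] A(1) by (simp add: add.commute)
   moreover have "0 \<le> d * n" using d by simp
   ultimately show ?thesis using tot by (simp add: \<nu>_def algebra_simps)
  qed
  define tt where "tt v = nat \<lceil>c3 / 4 * (s0 * w (f v))\<rceil>" for v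
  define NN where "NN v = nat \<lceil>s0 * w (f v)\<rceil>" for v
  define K1 where "K1 = p * e1 / 2 * (c0 * n)"
  define K2 where "K2 = c3 / 8 * s0 * (c0 * n)"
  have Yn: "Y \<subseteq> {..<n}" using XY by auto
  interpret E: embedding n b \<Delta> r HE col g f Y "n1 + b" d \<delta> e1
  proof
   show "g x y ==> g y x" for x y by (rule gsym)
   show "finite (f u)" if "u < n" for u using finAA f that by blast
   show "f u \<noteq> {}" if "u < n" for u using wpos[OF f[OF that]] by (auto simp: w_def)
   show "f u = f v \<or> f u \<inter> f v = {}" if "u < n" "v < n" for u v using A(2) f that unfolding disjoint_def by blast
   show "typical_pair g d \<delta> (f u) (f v)" if "HE u v" for u v using fR[OF that] by (simp add: R_def)
   show "0 < d" "d \<le> 1" "0 < e1" "e1 \<le> 1" by fact+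
   show "real (card {w. w < n \<and> w \<notin> Y \<and> f w = f u}) \<le> (1 - e1) * real (card (f u))" if "u < n" for u
    using ld[OF f[OF that]] by (simp add: w_def)
   show "real \<Delta> * \<delta> \<le> d ^ (\<Delta> + 1) * e1 / 8" "\<delta> \<le> d ^ (\<Delta> + 1) * e1" using del by (simp_all only: p_def)
   have bw: "real b \<le> p * e1 / 8 * w (f u)" if "u < n" for u
   proof -
    have "real b \<le> \<beta>' * n" using Bb by (simp add: B_def)
    also have "... \<le> (p * e1 * c0 / 8) * n" using be(4) by (intro mult_right_mono) auto
    also have "... = p * e1 / 8 * (c0 * n)" by simp
    also have "... \<le> p * e1 / 8 * w (f u)" using cw[OF f[OF that]] pe by (intro mult_left_mono) auto
    finally show ?thesis .
   qed
   show "real b \<le> d ^ (\<Delta> + 1) * e1 / 4 * real (card (f u))" if "u < n" for u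
   proof -
    have "p * e1 / 8 \<le> p * e1 / 4" using pe by linarith
    hence "p * e1 / 8 * w (f u) \<le> p * e1 / 4 * w (f u)" using wpos[OF f[OF that]] by (intro mult_right_mono) auto
    thus ?thesis using bw[OF that] by (simp only: p_def w_def)
   qed
   \<comment> \<open>Here n2 = n1 + b, so the early range ends at n1 + 2b;
     \<open>structure_lemma\<close> covers n1 + b, and the additional b vertices are absorbed by
     \<open>bw\<close>.\<close>
   show "real (card {w. w < n1 + b + b \<and> w < n \<and> f w = f u}) \<le> d ^ (\<Delta> + 1) / 4 * real (card (f u))" if "u < n" for u
   proof -
    have "{w. w < n1 + b + b \<and> w < n \<and> f w = f u} \<subseteq> {w. w < n1 + b \<and> w < n \<and> f w = f u} \<union> {n1 + b..<n1 + b + b}" by auto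
    hence "card {w. w < n1 + b + b \<and> w < n \<and> f w = f u} \<le> card ({w. w < n1 + b \<and> w < n \<and> f w = f u} \<union> {n1 + b..<n1 + b + b})"
     by (intro card_mono) auto
    also have "... \<le> card {w. w < n1 + b \<and> w < n \<and> f w = f u} + card {n1 + b..<n1 + b + b}" by (rule card_Un_le)
    finally have "real (card {w. w < n1 + b + b \<and> w < n \<and> f w = f u}) \<le> card {w. w < n1 + b \<and> w < n \<and> f w = f u} + real b" by simp
    also have "... \<le> 4 * real r * \<xi> * w (f u) + p * e1 / 8 * w (f u)" by (intro add_mono early f bw that)
    also have "... \<le> p / 8 * w (f u) + p / 8 * w (f u)"
    proof (intro add_mono mult_right_mono)
     show "4 * real r * \<xi> \<le> p / 8" using xi'(2) by simp
     show "p * e1 / 8 \<le> p / 8" using p e1 by (simp add: mult_left_le)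
    qed (use wpos[OF f[OF that]] in auto)
    also have "... = d ^ (\<Delta> + 1) / 4 * real (card (f u))" by (simp add: p_def w_def)
    finally show ?thesis .
   qed
  qed
  have ceq: "(d ^ (\<Delta> + 1) / 2) ^ (\<Delta> + 1) = c3" by (simp add: c3_def p_def)
  have K2n: "1 \<le> K2"
  proof -
   have "0 < c3 * s0 * c0" using c3 s0 c0 by simp
   hence "8 < c3 * s0 * c0 * n" using nn(3) by (simp add: divide_less_eq mult.commute)
   thus ?thesis by (simp add: K2_def)
  qed
  have K1p: "0 < K1" using pe c0 n1' by (simp add: K1_def)
  interpret S: spanning n b \<Delta> r HE col g f Y "n1 + b" d \<delta> e1 V X0 n1 K1 K2 tt NN
  proof
   show "finite V" "card V = n" by fact+
   show "f u \<subseteq> V" if "u < n" for u using A(3) f that by blast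
   show "n1 + b = n1 + b" by simp
   show "n1 \<le> n" "X0 \<union> Y \<subseteq> {..<n1}" "X0 \<inter> Y = {}" "separated (X0 \<union> Y)" by fact+
   show "0 < K1" "1 \<le> K2" by fact+
   show "K1 \<le> d ^ (\<Delta> + 1) * e1 / 2 * real (card (f u))" if "u < n" for u
   proof -
    have "K1 \<le> p * e1 / 2 * w (f u)" unfolding K1_def using cw[OF f[OF that]] pe by (intro mult_left_mono) auto
    thus ?thesis by (simp only: p_def w_def)
   qed
   show "K2 + real (card {y' \<in> Y. f y' = f v}) \<le> real (tt v) + 1" if v: "v \<in> Y" for v
   proof -
    have vA: "f v \<in> \<A>" using f Yn v by auto
    have "card {y' \<in> Y. f y' = f v} \<le> 4 * real r * y * \<xi> * w (f v)" by (rule Yl[OF vA])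
    also have "... \<le> c3 / 8 * s0 * w (f v)" using y' wpos[OF vA] by (intro mult_right_mono) auto
    finally have 1: "real (card {y' \<in> Y. f y' = f v}) \<le> c3 / 8 * s0 * w (f v)" .
    have 2: "K2 \<le> c3 / 8 * s0 * w (f v)" unfolding K2_def using cw[OF vA] c3 s0 by (intro mult_left_mono) auto
    have "c3 / 4 * (s0 * w (f v)) \<le> real (tt v)" unfolding tt_def by linarith
    moreover have "c3 / 4 * (s0 * w (f v)) = c3 / 8 * s0 * w (f v) + c3 / 8 * s0 * w (f v)" by simp
    ultimately show ?thesis using 1 2 by linarith
   qed
   show "NN y \<le> card {x \<in> X0. f x = f y \<and> (\<forall>z. HE x z --> E.rich v z)}" if yv: "y \<in> Y" "v \<in> V" for y v
   proof -
    let ?J = "{A\<in>\<A>. d * real (card A) \<le> card {x\<in>A. g v x}}"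
    have yA: "f y \<in> \<A>" using f Yn yv by auto
    have "s0 * w (f y) \<le> card {x\<in>X0. f x = f y \<and> (\<forall>z. HE x z --> f z \<in> ?J)}"
     by (rule sw[OF yA _ Jv[OF yv(2)]]) auto
    also have "{x\<in>X0. f x = f y \<and> (\<forall>z. HE x z --> f z \<in> ?J)} = {x \<in> X0. f x = f y \<and> (\<forall>z. HE x z --> E.rich v z)}"
    proof -
     have "f z \<in> ?J \<longleftrightarrow> E.rich v z" if "HE x z" for x z
      using f[of z] that HE_sym HE_less by (auto simp: E.rich_def)
     thus ?thesis by blast
    qed
    finally show ?thesis unfolding NN_def by linarith
   qed
  qed
  \<comment> \<open>The vertices outside the reserve fill at most the proportion 1 - e1 of clusters
    of total weight at most n, hence the reserve is linear.\<close>
  have Ycard: "e1 * n \<le> card Y"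
  proof -
   have "card ({..<n} - Y) = n - card Y" using Yn finite_subset[OF Yn] by (simp add: card_Diff_subset)
   moreover have "card Y \<le> n" using card_mono[OF _ Yn] by simp
   ultimately have 1: "real n - card Y = card ({..<n} - Y)" by (simp add: of_nat_diff)
   have fib: "(\<Sum>A\<in>\<A>. card {u\<in>{..<n} - Y. f u = A}) = card ({..<n} - Y)"
    by (rule sum_card_fibres) (auto simp: A(1) f)
   have "real (card ({..<n} - Y)) = (\<Sum>A\<in>\<A>. real (card {u\<in>{..<n} - Y. f u = A}))" by (simp only: of_nat_sum[symmetric] fib)
   also have "... \<le> (\<Sum>A\<in>\<A>. (1 - e1) * w A)"
   proof (rule sum_mono)
    fix A assume A': "A \<in> \<A>"
    have "{u\<in>{..<n} - Y. f u = A} = {u. u < n \<and> u \<notin> Y \<and> f u = A}" by auto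
    thus "real (card {u\<in>{..<n} - Y. f u = A}) \<le> (1 - e1) * w A" using ld[OF A'] by simp
   qed
   also have "... = (1 - e1) * sum w \<A>" by (simp add: sum_distrib_left)
   also have "... \<le> (1 - e1) * n" using tot e1 by (intro mult_left_mono) auto
   finally show ?thesis using 1 by (simp add: algebra_simps)
  qed
  have e1n: "0 < e1 * n" using e1 n1' by simp
  define C where "C = C0 / n"
  have C: "1 / K1 \<le> C" "1 / K2 \<le> C" "3 / real (card Y) \<le> C"
  proof -
   have "1 / K1 = 2 / (p * e1 * c0) / n" by (simp add: K1_def)
   also have "... \<le> C" unfolding C_def by (intro divide_right_mono C0) simp
   finally show "1 / K1 \<le> C" .
   have "1 / K2 = 8 / (c3 * s0 * c0) / n" by (simp add: K2_def)
   also have "... \<le> C" unfolding C_def by (intro divide_right_mono C0) simp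
   finally show "1 / K2 \<le> C" .
   have "3 / real (card Y) \<le> 3 / (e1 * n)" by (rule frac_le) (use Ycard e1n in auto)
   also have "... = 3 / e1 / n" by simp
   also have "... \<le> C" unfolding C_def by (intro divide_right_mono C0) simp
   finally show "3 / real (card Y) \<le> C" .
  qed
  show ?thesis
   unfolding spread_embedding_def
  proof (intro exI[of _ S.EE] exI[of _ S.Supp] exI[of _ S.conv] conjI allI impI)
   show "functional S.EE S.Supp" by (rule S.functional_EE)
   show "inj_on (S.conv \<psi>) {..<n}" "S.conv \<psi> ` {..<n} \<subseteq> V" if "S.Supp \<psi>" for \<psi> using S.conv_inj[OF that] by auto
   show "g (S.conv \<psi> u) (S.conv \<psi> w)" if "S.Supp \<psi>" "HE u w" for \<psi> u w by (rule S.conv_edge[OF that])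
   show "1 - real n * real n * (2 * exp (- (a * n))) \<le> S.EE (\<lambda>_. 1)"
   proof (rule S.total_mass)
    fix v assume v: "v \<in> Y"
    have vA: "f v \<in> \<A>" using f Yn v by auto
    have "2 ^ tt v * (1 - (d ^ (\<Delta> + 1) / 2) ^ (\<Delta> + 1) / 2) ^ NN v \<le> 2 * exp (- (c3 / 4 * (s0 * w (f v))))"
     unfolding ceq tt_def NN_def using wpos[OF vA] s0 by (intro tail_bound c3) auto
    also have "... \<le> 2 * exp (- (a * n))"
    proof -
     have "a * n = c3 / 4 * (s0 * (c0 * n))" by (simp add: a_def)
     also have "... \<le> c3 / 4 * (s0 * w (f v))" using cw[OF vA] c3 s0 by (intro mult_left_mono) auto
     finally show ?thesis by simp
    qed
    finally show "2 ^ tt v * (1 - (d ^ (\<Delta> + 1) / 2) ^ (\<Delta> + 1) / 2) ^ NN v \<le> 2 * exp (- (a * n))" .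
   qed simp
   fix T and w' :: "nat => 'b" assume T: "T \<subseteq> {..<n}" "inj_on w' T"
   have "S.EE (\<lambda>\<psi>. of_bool (\<forall>z\<in>T. S.conv \<psi> z = w' z)) \<le> (2 * C) ^ card T" by (rule S.EE_spread[OF T C])
   thus "S.EE (\<lambda>\<psi>. of_bool (\<forall>z\<in>T. S.conv \<psi> z = w' z)) \<le> (2 * C0 / n) ^ card T" by (simp add: C_def)
  qed
 qed
 show ?thesis
 proof (rule exI[of _ "\<beta>' / 2"], rule conjI[rotated], rule exI[of _ "2 * C0"], rule conjI[rotated],
   rule exI[of _ a], rule conjI[rotated], rule exI[of _ n0], intro allI impI)
  show "0 < \<beta>' / 2" "1 \<le> 2 * C0" "0 < a" using be C01 a0 by auto
  fix n b HE col and V :: "'b set" and g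
  assume "n0 \<le> n" "banded_graph n b \<Delta> r HE col" "real b \<le> \<beta>' / 2 * n" "finite V" "card V = n" "\<forall>x y. g x y --> g y x"
   "\<forall>v\<in>V. ((real r - 1) / real r + \<gamma>) * n \<le> card {u\<in>V. g v u}"
  thus "spread_embedding n HE V g (2 * C0) (real n * real n * (2 * exp (- (a * n))))" using main by blast
 qed
qed

section \<open>Random subgraphs\<close>

lemma pmf_Pi_bernoulli:
 assumes "finite E" "0 \<le> p" "p \<le> 1" "W \<subseteq> E"
 shows "pmf (Pi_pmf E False (\<lambda>_. bernoulli_pmf p)) (\<lambda>e. e \<in> W) = p ^ card W * (1 - p) ^ card (E - W)"
proof -
 have "pmf (Pi_pmf E False (\<lambda>_. bernoulli_pmf p)) (\<lambda>e. e \<in> W) = (\<Prod>e\<in>E. pmf (bernoulli_pmf p) (e \<in> W))"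
  using assms by (intro pmf_Pi') auto
 also have "... = (\<Prod>e\<in>W. pmf (bernoulli_pmf p) (e \<in> W)) * (\<Prod>e\<in>E - W. pmf (bernoulli_pmf p) (e \<in> W))"
  using prod.subset_diff[OF assms(4,1), of "\<lambda>e. pmf (bernoulli_pmf p) (e \<in> W)"] by (simp add: mult.commute)
 also have "(\<Prod>e\<in>W. pmf (bernoulli_pmf p) (e \<in> W)) = (\<Prod>e\<in>W. p)"
  using assms by (intro prod.cong) auto
 also have "(\<Prod>e\<in>E - W. pmf (bernoulli_pmf p) (e \<in> W)) = (\<Prod>e\<in>E - W. 1 - p)"
  using assms by (intro prod.cong) auto
 finally show ?thesis by simp
qed

lemma prob_random_subgraph:
 assumes fin: "finite (edges G)" and p: "0 \<le> p" "p \<le> 1"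
 shows "measure_pmf.prob (random_subgraph G p) {K. Q K}
  = bern p (edges G) (\<lambda>W. of_bool (Q \<lparr>verts = verts G, edges = W\<rparr>))"
proof -
 let ?M = "Pi_pmf (edges G) False (\<lambda>_. bernoulli_pmf p)"
 let ?Q = "\<lambda>W. Q \<lparr>verts = verts G, edges = W\<rparr>"
 let ?A = "(\<lambda>W e. e \<in> W) ` Pow (edges G)"
 have "measure_pmf.prob (random_subgraph G p) {K. Q K} = measure_pmf.prob ?M {\<omega>. ?Q {e \<in> edges G. \<omega> e}}"
  by (simp add: random_subgraph_def vimage_def)
 also have "... = measure_pmf.expectation ?M (indicator {\<omega>. ?Q {e \<in> edges G. \<omega> e}})"
  by simp
 also have "... = (\<Sum>\<omega>\<in>?A. indicator {\<omega>. ?Q {e \<in> edges G. \<omega> e}} \<omega> * pmf ?M \<omega>)"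
 proof (rule integral_measure_pmf_real)
  show "finite ?A" using fin by simp
  fix \<omega> assume "\<omega> \<in> set_pmf ?M"
  hence out: "\<And>e. e \<notin> edges G ==> \<not> \<omega> e" using set_Pi_pmf_subset[OF fin, of False "\<lambda>_. bernoulli_pmf p"] by auto
  have "\<omega> = (\<lambda>e. e \<in> {e\<in>edges G. \<omega> e})" using out by auto
  thus "\<omega> \<in> ?A" by blast
 qed
 also have "... = (\<Sum>W\<in>Pow (edges G). indicator {\<omega>. ?Q {e \<in> edges G. \<omega> e}} (\<lambda>e. e \<in> W) * pmf ?M (\<lambda>e. e \<in> W))"
  by (subst sum.reindex) (auto simp: inj_on_def fun_eq_iff)
 also have "... = bern p (edges G) (\<lambda>W. of_bool (?Q W))"
  unfolding bern_def
 proof (rule sum.cong)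
  fix W assume "W \<in> Pow (edges G)"
  hence W: "W \<subseteq> edges G" by simp
  have "{e \<in> edges G. e \<in> W} = W" using W by blast
  thus "indicator {\<omega>. ?Q {e \<in> edges G. \<omega> e}} (\<lambda>e. e \<in> W) * pmf ?M (\<lambda>e. e \<in> W)
    = p ^ card W * (1 - p) ^ card (edges G - W) * of_bool (?Q W)"
   by (simp add: pmf_Pi_bernoulli[OF fin p W] indicator_def)
 qed simp
 finally show ?thesis .
qed

text \<open>In round i one factor is at most 4*2^i/x and the other 2^i - 1 \<ge> i factors are at
  most 1/16, so the errors decay like 8^(-i). The constant 64 alone would leave a constant error in
  the lowest rounds; the terms x/2^i make it O(1/x) and add only 2x to the total density.\<close>

lemma round_errors:
 fixes x :: real
 assumes x: "0 < x"
 shows "(\<Sum>i<k. (4 / (64 + x / 2 ^ i)) ^ (2 ^ i)) \<le> 8 / x"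
proof -
 have t: "(4 / (64 + x / 2 ^ i)) ^ (2 ^ i) \<le> 4 / x * (1 / 8) ^ i" for i
 proof -
  let ?y = "4 / (64 + x / 2 ^ i)"
  have pos: "0 < x / 2 ^ i" using x by simp
  have "i < 2 ^ i" by simp
  hence e: "(2::nat) ^ i = Suc (2 ^ i - 1)" "i \<le> 2 ^ i - 1" by linarith+
  have y0: "0 \<le> ?y" using pos by simp
  have "?y \<le> 4 / 64" by (rule frac_le) (use pos in auto)
  hence y1: "?y \<le> 1 / 16" by simp
  have "?y \<le> 4 / (x / 2 ^ i)" using pos by (intro divide_left_mono mult_pos_pos) auto
  hence y2: "?y \<le> 4 / x * 2 ^ i" by simp
  have "?y ^ (2 ^ i - 1) \<le> (1 / 16) ^ (2 ^ i - 1)" using y0 y1 by (intro power_mono)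
  also have "... \<le> (1 / 16) ^ i" using e(2) by (intro power_decreasing) auto
  finally have "?y * ?y ^ (2 ^ i - 1) \<le> (4 / x * 2 ^ i) * (1 / 16) ^ i" using y0 y2 x by (intro mult_mono) auto
  moreover have "?y ^ (2 ^ i) = ?y * ?y ^ (2 ^ i - 1)" by (subst e(1)) (simp only: power_Suc)
  moreover have "(2::real) ^ i * (1 / 16) ^ i = (1 / 8) ^ i" by (simp add: power_mult_distrib[symmetric])
  ultimately show ?thesis by (simp add: mult.assoc)
 qed
 have geo: "(\<Sum>i<k. (1 / 8 :: real) ^ i) \<le> 2" for k
 proof -
  have "(\<Sum>i<k. (1 / 8 :: real) ^ i) = (1 - (1 / 8) ^ k) / (1 - 1 / 8)" by (subst sum_gp_strict) simp
  also have "... \<le> 1 / (1 - 1 / 8)" by (intro divide_right_mono) auto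
  finally show ?thesis by simp
 qed
 have "(\<Sum>i<k. (4 / (64 + x / 2 ^ i)) ^ (2 ^ i)) \<le> (\<Sum>i<k. 4 / x * (1 / 8) ^ i)" by (intro sum_mono t)
 also have "... = 4 / x * (\<Sum>i<k. (1 / 8) ^ i)" by (simp add: sum_distrib_left)
 also have "... \<le> 4 / x * 2" using geo x by (intro mult_left_mono) auto
 finally show ?thesis by simp
qed

lemma round_densities:
 fixes x :: real
 assumes x: "0 \<le> x"
 shows "(\<Sum>i<k. 64 + x / 2 ^ i) \<le> 64 * real k + 2 * x"
proof -
 have "(\<Sum>i<k. (1 / 2 :: real) ^ i) = (1 - (1 / 2) ^ k) / (1 - 1 / 2)" by (subst sum_gp_strict) simp
 also have "... \<le> 1 / (1 - 1 / 2)" by (intro divide_right_mono) auto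
 finally have "(\<Sum>i<k. (1 / 2 :: real) ^ i) \<le> 2" by simp
 hence "x * (\<Sum>i<k. (1 / 2) ^ i) \<le> x * 2" using x by (intro mult_left_mono) auto
 moreover have "(\<Sum>i<k. 64 + x / 2 ^ i) = 64 * real k + x * (\<Sum>i<k. (1 / 2) ^ i)"
  by (simp add: sum.distrib sum_distrib_left power_one_over)
 ultimately show ?thesis by simp
qed

text \<open>With s = 1 - 1/\<Delta>, the surplus power l^s is at most n^(s/(\<Delta>+1)), and
  s/(\<Delta>+1) is exactly 2/(\<Delta>+1) - 1/\<Delta>. For \<Delta> = 1 both sides agree.\<close>

lemma density_comparison:
 assumes D: "1 \<le> \<Delta>" and n: "1 \<le> n" and l0: "0 < l" and l: "l \<le> n powr (1 / (real \<Delta> + 1))"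
 shows "l * n powr (- 2 / (real \<Delta> + 1)) \<le> (l / n) powr (1 / real \<Delta>)"
proof -
 define s where "s = (real \<Delta> - 1) / real \<Delta>"
 have D0: "0 < real \<Delta>" using D by simp
 have s: "0 \<le> s" "1 / real \<Delta> + s = 1" using D by (auto simp: s_def field_simps)
 have "l = l powr (1 / real \<Delta> + s)" using s l0 by simp
 also have "... = l powr (1 / real \<Delta>) * l powr s" by (rule powr_add)
 also have "... \<le> l powr (1 / real \<Delta>) * (n powr (1 / (real \<Delta> + 1))) powr s"
  using l l0 s by (intro mult_left_mono powr_mono2) auto
 finally have "l * n powr (- 2 / (real \<Delta> + 1)) \<le> l powr (1 / real \<Delta>) * (n powr (1 / (real \<Delta> + 1))) powr s * n powr (- 2 / (real \<Delta> + 1))"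
  by (intro mult_right_mono) auto
 also have "... = l powr (1 / real \<Delta>) * n powr (1 / (real \<Delta> + 1) * s + - 2 / (real \<Delta> + 1))"
  by (simp only: powr_powr powr_add mult.assoc)
 also have "1 / (real \<Delta> + 1) * s + - 2 / (real \<Delta> + 1) = - (1 / real \<Delta>)"
  using D0 by (simp add: s_def divide_simps)
 also have "l powr (1 / real \<Delta>) * n powr (- (1 / real \<Delta>)) = (l / n) powr (1 / real \<Delta>)"
  using l0 n by (simp add: powr_divide powr_minus_divide)
 finally show ?thesis .
qed

lemma simple_graph_edge:
 assumes "simple_graph G" "{x, y} \<in> edges G"
 shows "x \<in> verts G" "y \<in> verts G" "x \<noteq> y"
proof -
 have e: "{x, y} \<subseteq> verts G" "card {x, y} = 2" using assms by (auto simp: simple_graph_def)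
 show "x \<in> verts G" "y \<in> verts G" using e(1) by auto
 show "x \<noteq> y" using e(2) by auto
qed

lemma simple_graph_edgeE:
 assumes "simple_graph G" "e \<in> edges G"
 obtains x y where "e = {x, y}"
 using assms by (auto simp: simple_graph_def card_2_iff)

lemma simple_graph_finite: "simple_graph G ==> finite (edges G)"
 by (rule finite_subset[of _ "Pow (verts G)"]) (auto simp: simple_graph_def)

lemma degree_eq:
 assumes G: "simple_graph G"
 shows "degree G v = card {y \<in> verts G. {v, y} \<in> edges G}"
proof -
 have "{e \<in> edges G. v \<in> e} = (\<lambda>y. {v, y}) ` {y \<in> verts G. {v, y} \<in> edges G}" (is "?A = ?B")
 proof
  show "?A \<subseteq> ?B"
  proof
   fix e assume e: "e \<in> ?A"
   then obtain x y where xy: "e = {x, y}" using simple_graph_edgeE[OF G] by blast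
   then obtain z where z: "e = {v, z}" using e by (cases "v = x") (auto simp: insert_commute)
   thus "e \<in> ?B" using e simple_graph_edge[OF G, of v z] by blast
  qed
 qed auto
 moreover have "inj_on (\<lambda>y. {v, y}) {y \<in> verts G. {v, y} \<in> edges G}" by (auto simp: inj_on_def doubleton_eq_iff)
 ultimately show ?thesis by (simp add: degree_def card_image)
qed

text \<open>Both minima are attained, as n itself is an admissible bandwidth and number of colours.
  Labels are shifted to start at 0 so that blocks and segments are given by division.\<close>

lemma banded_labelling:
 assumes H: "n_vertex_graph n H" and n: "1 \<le> n" and deg: "max_degree H \<le> \<Delta>"
 obtains l col HE where "bij_betw l (verts H) {..<n}" "\<forall>x y. {x, y} \<in> edges H --> HE (l x) (l y)"
  "banded_graph n (bandwidth H) \<Delta> (chromatic_number H) HE col"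
proof -
 have sg: "simple_graph H" and cH: "card (verts H) = n" using H by (auto simp: n_vertex_graph_def)
 have fin: "finite (verts H)" using sg by (simp add: simple_graph_def)
 define lab where "lab b l \<longleftrightarrow> bij_betw l (verts H) {1..card (verts H)} \<and>
   (\<forall>u v. {u, v} \<in> edges H --> \<bar>int (l u) - int (l v)\<bar> \<le> int b)" for b l
 have "\<exists>l. lab (bandwidth H) l"
 proof -
  obtain l where l: "bij_betw l (verts H) {1..card (verts H)}"
   using fin by (metis card_atLeastAtMost diff_Suc_1 finite_atLeastAtMost finite_same_card_bij)
  have "lab n l"
   unfolding lab_def
  proof (intro conjI allI impI l)
   fix u v assume "{u, v} \<in> edges H"
   hence "u \<in> verts H" "v \<in> verts H" using simple_graph_edge[OF sg] by blast+
   hence "l u \<in> {1..n}" "l v \<in> {1..n}" using bij_betwE[OF l] cH by auto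
   thus "\<bar>int (l u) - int (l v)\<bar> \<le> int n" by auto
  qed
  hence "\<exists>b l. lab b l" by blast
  thus ?thesis unfolding bandwidth_def lab_def by (rule LeastI_ex)
 qed
 then obtain l0 where l0: "bij_betw l0 (verts H) {1..card (verts H)}"
  "\<And>u v. {u, v} \<in> edges H ==> \<bar>int (l0 u) - int (l0 v)\<bar> \<le> int (bandwidth H)" by (auto simp: lab_def)
 have "\<exists>c. proper_colouring H (chromatic_number H) c"
 proof -
  obtain c where c: "bij_betw c (verts H) {0..<n}" using ex_bij_betw_finite_nat[OF fin] cH by blast
  have "proper_colouring H n c"
   unfolding proper_colouring_def
  proof (intro conjI allI impI)
   show "c ` verts H \<subseteq> {..<n}" using c by (simp add: bij_betw_def atLeast0LessThan)
   fix u v assume "{u, v} \<in> edges H"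
   thus "c u \<noteq> c v" using simple_graph_edge[OF sg, of u v] bij_betw_imp_inj_on[OF c] by (meson inj_onD)
  qed
  hence "\<exists>k c. proper_colouring H k c" by blast
  thus ?thesis unfolding chromatic_number_def by (rule LeastI_ex)
 qed
 then obtain c where c: "proper_colouring H (chromatic_number H) c" by blast
 define l where "l x = l0 x - 1" for x
 have l0r: "1 \<le> l0 x \<and> l0 x \<le> n" if "x \<in> verts H" for x using bij_betwE[OF l0(1)] that cH by auto
 have l: "bij_betw l (verts H) {..<n}"
 proof -
  have "bij_betw (\<lambda>i. i - 1) {1..n} {..<n}"
   by (rule bij_betw_byWitness[where f' = Suc]) auto
  from bij_betw_trans[OF l0(1)[unfolded cH] this] show ?thesis by (simp add: l_def[abs_def] comp_def)
 qed
 have linj: "x = y" if "x \<in> verts H" "y \<in> verts H" "l x = l y" for x y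
  using bij_betw_imp_inj_on[OF l] that by (meson inj_onD)
 define m where "m = inv_into (verts H) l"
 have m: "m u \<in> verts H" "l (m u) = u" if "u < n" for u
 proof -
  have "u \<in> l ` verts H" using l that by (simp add: bij_betw_def)
  thus "m u \<in> verts H" "l (m u) = u" unfolding m_def by (rule inv_into_into, rule f_inv_into_f)
 qed
 define HE where "HE u v \<longleftrightarrow> (\<exists>x y. {x, y} \<in> edges H \<and> u = l x \<and> v = l y)" for u v
 have "banded_graph n (bandwidth H) \<Delta> (chromatic_number H) HE (c \<circ> m)"
 proof
  show "HE v u" if "HE u v" for u v using that unfolding HE_def by (metis insert_commute)
  show "u < n" if "HE u v" for u v
  proof -
   obtain x y where "{x, y} \<in> edges H" "u = l x" using \<open>HE u v\<close> unfolding HE_def by blast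
   thus ?thesis using simple_graph_edge[OF sg] bij_betwE[OF l] by blast
  qed
  show "v \<le> u + bandwidth H" if "HE u v" for u v
  proof -
   obtain x y where xy: "{x, y} \<in> edges H" "u = l x" "v = l y" using \<open>HE u v\<close> unfolding HE_def by blast
   have "x \<in> verts H" "y \<in> verts H" using simple_graph_edge[OF sg xy(1)] by auto
   thus ?thesis using l0(2)[OF xy(1)] l0r[of x] l0r[of y] xy(2,3) by (simp add: l_def)
  qed
  show "(c \<circ> m) u < chromatic_number H" if "u < n" for u
   using c m(1)[OF that] by (auto simp: proper_colouring_def)
  show "(c \<circ> m) u \<noteq> (c \<circ> m) v" if "HE u v" for u v
  proof -
   obtain x y where xy: "{x, y} \<in> edges H" "u = l x" "v = l y" using \<open>HE u v\<close> unfolding HE_def by blast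
   have v: "x \<in> verts H" "y \<in> verts H" using simple_graph_edge[OF sg xy(1)] by auto
   have "u < n" "v < n" using v xy bij_betwE[OF l] by auto
   hence "m u = x" "m v = y" using m v xy(2,3) linj by blast+
   thus ?thesis using c xy(1) by (simp add: proper_colouring_def)
  qed
  show "card {v. HE u v} \<le> \<Delta>" for u
  proof (cases "u < n")
   case True
   let ?N = "{y \<in> verts H. {m u, y} \<in> edges H}"
   have "{v. HE u v} \<subseteq> l ` ?N"
   proof
    fix v assume "v \<in> {v. HE u v}"
    then obtain x y where xy: "{x, y} \<in> edges H" "u = l x" "v = l y" unfolding HE_def by blast
    have w: "x \<in> verts H" "y \<in> verts H" using simple_graph_edge[OF sg xy(1)] by auto
    have "m u = x" using linj[of "m u" x] m[OF True] w xy(2) by simp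
    thus "v \<in> l ` ?N" using xy w by blast
   qed
   hence "card {v. HE u v} \<le> card ?N" using fin by (intro surj_card_le) auto
   also have "... = degree H (m u)" by (simp add: degree_eq[OF sg])
   also have "... \<le> max_degree H" unfolding max_degree_def using fin m(1)[OF True] by (intro Max_ge) auto
   finally show ?thesis using deg by simp
  next
   case False
   hence "\<not> HE u v" for v
   proof -
    have "\<not> HE u v" if "\<not> u < n"
    proof
     assume "HE u v"
     then obtain x y where "{x, y} \<in> edges H" "u = l x" unfolding HE_def by blast
     thus False using simple_graph_edge[OF sg] bij_betwE[OF l] that by blast
    qed
    thus ?thesis using False by blast
   qed
   thus ?thesis by simp
  qed
 qed
 moreover have "\<forall>x y. {x, y} \<in> edges H --> HE (l x) (l y)" unfolding HE_def by blast
 ultimately show ?thesis by (intro that[OF l])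
qed

lemma min_degree_bound:
 assumes G: "n_vertex_graph n G" and v: "v \<in> verts G"
 shows "min_degree G \<le> card {u \<in> verts G. {v, u} \<in> edges G}"
proof -
 have sg: "simple_graph G" using G by (simp add: n_vertex_graph_def)
 hence "finite (verts G)" by (simp add: simple_graph_def)
 hence "min_degree G \<le> degree G v" unfolding min_degree_def using v by (intro Min_le) auto
 thus ?thesis by (simp add: degree_eq[OF sg])
qed

lemma subgraph_of_labelled:
 assumes H: "simple_graph H" and l: "bij_betw l (verts H) {..<n}" and HE: "\<And>x y. {x, y} \<in> edges H ==> HE (l x) (l y)"
  and f: "inj_on f {..<n}" "f ` {..<n} \<subseteq> verts G" "\<And>u w. HE u w ==> {f u, f w} \<in> edges G"
 shows "subgraph_of H G"
 unfolding subgraph_of_def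
proof (intro exI[of _ "f \<circ> l"] conjI ballI)
 show "inj_on (f \<circ> l) (verts H)" using l f(1) by (intro comp_inj_on) (auto simp: bij_betw_def)
 show "(f \<circ> l) ` verts H \<subseteq> verts G" using l f(2) by (auto simp: bij_betw_def image_comp[symmetric])
 fix e assume e: "e \<in> edges H"
 then obtain x y where xy: "e = {x, y}" using simple_graph_edgeE[OF H] by blast
 thus "(f \<circ> l) ` e \<in> edges G" using f(3)[OF HE[of x y]] e by simp
qed

section \<open>Conclusion\<close>

lemma spread_embedding_mono:
 assumes "spread_embedding n HE V g K \<rho>" "0 \<le> K" "K \<le> K'" "\<rho> \<le> \<rho>'"
 shows "spread_embedding n HE V g K' \<rho>'"
proof -
 obtain E :: "('a outcome => real) => real" and Supp conv where E: "functional E Supp"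
   "\<forall>\<psi>. Supp \<psi> --> inj_on (conv \<psi>) {..<n} \<and> conv \<psi> ` {..<n} \<subseteq> V \<and> (\<forall>u w. HE u w --> g (conv \<psi> u) (conv \<psi> w))"
   "1 - \<rho> \<le> E (\<lambda>_. 1)"
   "\<forall>S w. S \<subseteq> {..<n} --> inj_on w S --> E (\<lambda>\<psi>. of_bool (\<forall>z\<in>S. conv \<psi> z = w z)) \<le> (K / n) ^ card S"
  using assms(1) unfolding spread_embedding_def by (elim exE conjE) (rule that)
 have "1 - \<rho>' \<le> E (\<lambda>_. 1)" using E(3) assms(4) by simp
 moreover have "\<forall>S w. S \<subseteq> {..<n} --> inj_on w S --> E (\<lambda>\<psi>. of_bool (\<forall>z\<in>S. conv \<psi> z = w z)) \<le> (K' / n) ^ card S"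
 proof (intro allI impI)
  fix S and w :: "nat => 'a" assume S: "S \<subseteq> {..<n}" "inj_on w S"
  have "E (\<lambda>\<psi>. of_bool (\<forall>z\<in>S. conv \<psi> z = w z)) \<le> (K / n) ^ card S" using E(4) S by blast
  also have "... \<le> (K' / n) ^ card S" using assms(2,3) by (intro power_mono divide_right_mono) auto
  finally show "E (\<lambda>\<psi>. of_bool (\<forall>z\<in>S. conv \<psi> z = w z)) \<le> (K' / n) ^ card S" .
 qed
 ultimately show ?thesis unfolding spread_embedding_def using E(1,2) by blast
qed

text \<open>The constants must be fixed before the chromatic number is known; the induction on
  \<open>R\<close> takes the worst ones over all r up to \<open>R\<close>.\<close>

lemma dense_spread_uniform:
 fixes \<gamma> :: real and \<Delta> R :: nat
 assumes gam: "0 < \<gamma>" and Del: "1 \<le> \<Delta>"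
 shows "\<exists>\<beta> K a :: real. \<exists>n0 :: nat. 0 < \<beta> \<and> 1 \<le> K \<and> 0 < a \<and> (\<forall>r n b HE col (V :: 'b set) g.
   1 \<le> r --> r \<le> R --> n0 \<le> n -->
   banded_graph n b \<Delta> r HE col --> real b \<le> \<beta> * n --> finite V --> card V = n --> (\<forall>x y. g x y --> g y x) -->
   (\<forall>v\<in>V. ((real r - 1) / real r + \<gamma>) * n \<le> card {u\<in>V. g v u}) -->
   spread_embedding n HE V g K (real n * real n * (2 * exp (- (a * n)))))"
proof (induction R)
 case 0
 show ?case by (intro exI[of _ 1]) auto
next
 case (Suc R)
 obtain \<beta>1 K1 a1 :: real and n1 :: nat where 1: "0 < \<beta>1" "1 \<le> K1" "0 < a1" and R: "\<forall>r n b HE col (V :: 'b set) g.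
   1 \<le> r --> r \<le> R --> n1 \<le> n -->
   banded_graph n b \<Delta> r HE col --> real b \<le> \<beta>1 * n --> finite V --> card V = n --> (\<forall>x y. g x y --> g y x) -->
   (\<forall>v\<in>V. ((real r - 1) / real r + \<gamma>) * n \<le> card {u\<in>V. g v u}) -->
   spread_embedding n HE V g K1 (real n * real n * (2 * exp (- (a1 * n))))"
  using Suc.IH by (elim exE conjE) (rule that)
 have S: "1 \<le> Suc R" by simp
 obtain \<beta>2 K2 a2 :: real and n2 :: nat where 2: "0 < \<beta>2" "1 \<le> K2" "0 < a2" and S: "\<forall>n\<ge>n2. \<forall>b HE col (V :: 'b set) g.
   banded_graph n b \<Delta> (Suc R) HE col --> real b \<le> \<beta>2 * n --> finite V --> card V = n --> (\<forall>x y. g x y --> g y x) -->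
   (\<forall>v\<in>V. ((real (Suc R) - 1) / real (Suc R) + \<gamma>) * n \<le> card {u\<in>V. g v u}) -->
   spread_embedding n HE V g K2 (real n * real n * (2 * exp (- (a2 * n))))"
  using dense_spread[OF gam Del S, where 'b = 'b] by (elim exE conjE) (rule that)
 have step: "spread_embedding n HE V g (max K1 K2) (real n * real n * (2 * exp (- (min a1 a2 * n))))"
  if h: "1 \<le> r" "r \<le> Suc R" "max n1 n2 \<le> n" "banded_graph n b \<Delta> r HE col" "real b \<le> min \<beta>1 \<beta>2 * n" "finite V" "card V = n"
   "\<forall>x y. g x y --> g y x" "\<forall>v\<in>V. ((real r - 1) / real r + \<gamma>) * n \<le> card {u\<in>V. g v u}"
  for r n b HE col and V :: "'b set" and g
 proof -
  have b: "real b \<le> \<beta>1 * n" "real b \<le> \<beta>2 * n"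
   using h(5) mult_right_mono[of "min \<beta>1 \<beta>2" \<beta>1 "real n"] mult_right_mono[of "min \<beta>1 \<beta>2" \<beta>2 "real n"] by auto
  have err: "real n * real n * (2 * exp (- (a * n))) \<le> real n * real n * (2 * exp (- (min a1 a2 * n)))" if "min a1 a2 \<le> a" for a
   using mult_right_mono[OF that, of "real n"] by (intro mult_left_mono) auto
  show ?thesis
  proof (cases "r \<le> R")
   case True
   have "spread_embedding n HE V g K1 (real n * real n * (2 * exp (- (a1 * n))))"
    using h by (intro R[rule_format, OF h(1) True _ h(4) b(1) h(6,7)]) auto
   thus ?thesis by (rule spread_embedding_mono) (use 1 err[of a1] in auto)
  next
   case False
   hence r: "r = Suc R" using h(2) by simp
   have "spread_embedding n HE V g K2 (real n * real n * (2 * exp (- (a2 * n))))"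
    using h(3,8) h(9)[unfolded r] by (intro S[rule_format, OF _ h(4)[unfolded r] b(2) h(6,7)]) auto
   thus ?thesis by (rule spread_embedding_mono) (use 2 err[of a2] in auto)
  qed
 qed
 show ?case
 proof (rule exI[of _ "min \<beta>1 \<beta>2"], rule exI[of _ "max K1 K2"], rule exI[of _ "min a1 a2"], rule exI[of _ "max n1 n2"],
   intro conjI allI impI)
  show "0 < min \<beta>1 \<beta>2" "1 \<le> max K1 K2" "0 < min a1 a2" using 1 2 by auto
 qed (rule step)
qed

text \<open>\<open>park_pham\<close> for the edge sets of the copies of H. A cover has a member
  inside every copy, so the expected number of its members in the random copy is at least the mass 1
  - \<rho>; by spread it is at most the q-cost of the cover.\<close>

lemma embedding_probability:
 fixes K :: real and V :: "'b set"
 assumes se: "spread_embedding n HE V g K \<rho>" and bg: "banded_graph n b \<Delta> r HE col"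
  and K: "1 \<le> K" and n: "2 \<le> n" and D: "1 \<le> \<Delta>"
  and EG: "finite EG" "\<And>x y. x \<in> V ==> y \<in> V ==> g x y ==> {x, y} \<in> EG" "\<And>e. e \<in> EG ==> card e = 2"
  and p: "p \<le> 1" "322 * ((real \<Delta> * K)\<^sup>2 * n powr (- 2 / (real \<Delta> + 1))) * log 2 n \<le> p"
 shows "1 - \<rho> - 8 / log 2 n \<le> bern p EG (\<lambda>W. of_bool (\<exists>f. inj_on f {..<n} \<and> f ` {..<n} \<subseteq> V \<and> (\<forall>u w. HE u w --> {f u, f w} \<in> W)))"
proof -
 interpret banded_graph n b \<Delta> r HE col by fact
 define q where "q = (real \<Delta> * K)\<^sup>2 * n powr (- 2 / (real \<Delta> + 1))"
 define x where "x = log 2 n"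
 have q0: "0 < q" unfolding q_def using D K n by (intro mult_pos_pos) auto
 have x1: "1 \<le> x" unfolding x_def using n by simp
 obtain E :: "('b outcome => real) => real" and Supp conv where fE: "functional E Supp" and
   Sp: "\<forall>\<psi>. Supp \<psi> --> inj_on (conv \<psi>) {..<n} \<and> conv \<psi> ` {..<n} \<subseteq> V \<and> (\<forall>u w. HE u w --> g (conv \<psi> u) (conv \<psi> w))" and
   E1: "1 - \<rho> \<le> E (\<lambda>_. 1)" and
   spr: "\<forall>S w. S \<subseteq> {..<n} --> inj_on w S --> E (\<lambda>\<psi>. of_bool (\<forall>z\<in>S. conv \<psi> z = w z)) \<le> (K / n) ^ card S"
  using se unfolding spread_embedding_def by (elim exE conjE) (rule that)
 interpret functional E Supp by (rule fE)
 define EH where "EH = {{u, w} | u w. HE u w}"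
 define cp where "cp \<psi> = (\<lambda>e. conv \<psi> ` e) ` EH" for \<psi>
 have EHi: "EH \<subseteq> (\<lambda>(u, w). {u, w}) ` ({..<n} \<times> {..<n})"
 proof
  fix e assume "e \<in> EH"
  then obtain u w where e: "e = {u, w}" "HE u w" by (auto simp: EH_def)
  have "u < n" "w < n" using HE_less[OF e(2)] HE_less[OF HE_sym[OF e(2)]] by auto
  thus "e \<in> (\<lambda>(u, w). {u, w}) ` ({..<n} \<times> {..<n})" using e(1) by force
 qed
 have finEH: "finite EH" by (rule finite_subset[OF EHi]) simp
 have cEH: "card EH \<le> n * n"
 proof -
  have "card EH \<le> card ({..<n} \<times> {..<n})" by (rule surj_card_le[OF _ EHi]) simp
  thus ?thesis by simp
 qed
 have host: "host n \<Delta> EH"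
 proof
  show "finite EH" by fact
  fix e assume "e \<in> EH"
  then obtain u w where e: "e = {u, w}" "HE u w" by (auto simp: EH_def)
  have "u < n" "w < n" using HE_less[OF e(2)] HE_less[OF HE_sym[OF e(2)]] by auto
  moreover have "u \<noteq> w" using e(2) HE_irrefl by blast
  ultimately show "e \<subseteq> {..<n} \<and> card e = 2" using e(1) by simp
 next
  fix u
  have "{e \<in> EH. u \<in> e} \<subseteq> (\<lambda>w. {u, w}) ` {w. HE u w}"
  proof
   fix e assume "e \<in> {e \<in> EH. u \<in> e}"
   then obtain v w where e: "e = {v, w}" "HE v w" "u \<in> e" by (auto simp: EH_def)
   have "HE w v" using e(2) by (rule HE_sym)
   hence "\<exists>z. HE u z \<and> e = {u, z}" using e by (auto simp: insert_commute)
   thus "e \<in> (\<lambda>w. {u, w}) ` {w. HE u w}" by blast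
  qed
  hence "card {e \<in> EH. u \<in> e} \<le> card {w. HE u w}" using finite_nbhd by (intro surj_card_le)
  thus "card {e \<in> EH. u \<in> e} \<le> \<Delta>" using degree_le[of u] by linarith
 qed
 \<comment> \<open>A copy has at most n^2 = 2^(2x) edges; the additional 1 makes the bound
   strict.\<close>
 define k where "k = nat \<lceil>2 * x\<rceil> + 1"
 have nk: "n * n < 2 ^ k"
 proof -
  have "real (n * n) = 2 powr (2 * x)"
  proof -
   have "2 powr (x + x) = 2 powr x * 2 powr x" by (rule powr_add)
   also have "2 powr x = n" unfolding x_def using n by simp
   finally show ?thesis by simp
  qed
  also have "... \<le> 2 powr real (nat \<lceil>2 * x\<rceil>)" by (intro powr_mono) linarith+
  also have "... = 2 ^ nat \<lceil>2 * x\<rceil>" by (simp add: powr_realpow)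
  finally have "real (n * n) \<le> real (2 ^ nat \<lceil>2 * x\<rceil>)" by simp
  hence "n * n \<le> 2 ^ nat \<lceil>2 * x\<rceil>" by (simp only: of_nat_le_iff)
  also have "(2::nat) ^ nat \<lceil>2 * x\<rceil> < 2 ^ k" by (simp add: k_def)
  finally show ?thesis .
 qed
 define H where "H = cp ` {\<psi>. Supp \<psi>}"
 \<comment> \<open>These densities add up to at most q(64k + 2x), and k \<le> 4x, which the constant
   322 covers.\<close>
 define ps where "ps i = q * (64 + x / 2 ^ i)" for i :: nat
 have cpE: "cp \<psi> \<subseteq> EG" if "Supp \<psi>" for \<psi>
 proof
  fix e assume "e \<in> cp \<psi>"
  then obtain u w where e: "e = {conv \<psi> u, conv \<psi> w}" "HE u w" by (auto simp: cp_def EH_def)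
  have "u < n" "w < n" using HE_less[OF e(2)] HE_less[OF HE_sym[OF e(2)]] by auto
  moreover have im: "conv \<psi> ` {..<n} \<subseteq> V" "g (conv \<psi> u) (conv \<psi> w)" using Sp that e(2) by blast+
  ultimately have "conv \<psi> u \<in> V" "conv \<psi> w \<in> V" by auto
  thus "e \<in> EG" unfolding e(1) using im(2) by (rule EG(2))
 qed
 have pp: "1 - \<rho> - (\<Sum>i<k. (4 * q / ps i) ^ (2 ^ i)) \<le> bern p EG (\<lambda>W. of_bool (\<exists>S\<in>H. S \<subseteq> W))"
 proof (rule park_pham)
  show "finite EG" "0 < q" "p \<le> 1" by fact+
  show "q \<le> ps i" for i
  proof -
   have "0 \<le> x / 2 ^ i" using x1 by simp
   hence "q * 1 \<le> q * (64 + x / 2 ^ i)" using q0 by (intro mult_left_mono) linarith+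
   thus ?thesis by (simp add: ps_def)
  qed
  have "real k \<le> 4 * x" unfolding k_def using x1 by linarith
  moreover have "(\<Sum>i<k. 64 + x / 2 ^ i) \<le> 64 * real k + 2 * x" using x1 by (intro round_densities) simp
  ultimately have "(\<Sum>i<k. 64 + x / 2 ^ i) \<le> 322 * x" using x1 by linarith
  hence "q * (\<Sum>i<k. 64 + x / 2 ^ i) \<le> q * (322 * x)" using q0 by (intro mult_left_mono) auto
  thus "(\<Sum>i<k. ps i) \<le> p" using p(2) by (simp add: ps_def sum_distrib_left q_def x_def)
  show "H \<subseteq> Pow EG" using cpE by (auto simp: H_def)
  show "card S < 2 ^ k" if "S \<in> H" for S
  proof -
   have "card S \<le> card EH" using that finEH by (auto simp: H_def cp_def intro: card_image_le)
   thus ?thesis using cEH nk by linarith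
  qed
  fix \<G> assume G: "\<G> \<subseteq> Pow EG" "\<forall>S\<in>H. \<exists>T\<in>\<G>. T \<subseteq> S"
  have finG: "finite \<G>" using G(1) EG(1) by (meson finite_Pow_iff finite_subset)
  have "1 - \<rho> \<le> E (\<lambda>_. 1)" by fact
  also have "... \<le> E (\<lambda>\<psi>. \<Sum>T\<in>\<G>. of_bool (T \<subseteq> cp \<psi>))"
  proof (rule E_mono)
   fix \<psi> assume "Supp \<psi>"
   hence "cp \<psi> \<in> H" unfolding H_def by blast
   then obtain T where T: "T \<in> \<G>" "T \<subseteq> cp \<psi>" using G(2) by blast
   have "(of_bool (T \<subseteq> cp \<psi>) :: real) \<le> (\<Sum>T\<in>\<G>. of_bool (T \<subseteq> cp \<psi>))" by (rule member_le_sum) (use T finG in auto)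
   thus "1 \<le> (\<Sum>T\<in>\<G>. of_bool (T \<subseteq> cp \<psi>) :: real)" using T(2) by simp
  qed
  also have "... = (\<Sum>T\<in>\<G>. E (\<lambda>\<psi>. of_bool (T \<subseteq> cp \<psi>)))" by (rule E_sum[OF finG])
  also have "... \<le> (\<Sum>T\<in>\<G>. q ^ card T)"
  proof (rule sum_mono)
   fix T assume "T \<in> \<G>"
   hence T: "T \<subseteq> EG" using G(1) by blast
   have pT: "pair_set T" using T EG(1,3) finite_subset unfolding pair_set_def by blast
   show "E (\<lambda>\<psi>. of_bool (T \<subseteq> cp \<psi>)) \<le> q ^ card T"
    unfolding cp_def q_def
   proof (rule edge_spread[OF host _ K _ D _ pT])
    show "inj_on (conv \<psi>) {..<n}" if "Supp \<psi>" for \<psi> using Sp that by blast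
    show "1 \<le> n" using n by simp
    show "E (\<lambda>\<psi>. of_bool (\<forall>z\<in>S. conv \<psi> z = w z)) \<le> (K / n) ^ card S" if "S \<subseteq> {..<n}" "inj_on w S" for S w
     using spr that by blast
   qed
  qed
  finally show "1 - \<rho> \<le> (\<Sum>T\<in>\<G>. q ^ card T)" .
 qed
 have "(\<Sum>i<k. (4 * q / ps i) ^ (2 ^ i)) = (\<Sum>i<k. (4 / (64 + x / 2 ^ i)) ^ (2 ^ i))"
  using q0 by (simp add: ps_def)
 also have "... \<le> 8 / x" using x1 by (intro round_errors) simp
 finally have "1 - \<rho> - 8 / x \<le> bern p EG (\<lambda>W. of_bool (\<exists>S\<in>H. S \<subseteq> W))" using pp by linarith
 also have "... \<le> bern p EG (\<lambda>W. of_bool (\<exists>f. inj_on f {..<n} \<and> f ` {..<n} \<subseteq> V \<and> (\<forall>u w. HE u w --> {f u, f w} \<in> W)))"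
 proof (rule bern_mono)
  have "0 \<le> 322 * q * x" using q0 x1 by simp
  thus "0 \<le> p" using p(2) unfolding q_def x_def by linarith
  show "p \<le> 1" by fact
  fix W
  have "\<exists>f. inj_on f {..<n} \<and> f ` {..<n} \<subseteq> V \<and> (\<forall>u w. HE u w --> {f u, f w} \<in> W)" if S: "S \<in> H" "S \<subseteq> W" for S
  proof -
   obtain \<psi> where \<psi>: "Supp \<psi>" "S = cp \<psi>" using S(1) by (auto simp: H_def)
   have "{conv \<psi> u, conv \<psi> w} \<in> W" if "HE u w" for u w
   proof -
    have "{u, w} \<in> EH" using that by (auto simp: EH_def)
    hence "conv \<psi> ` {u, w} \<in> cp \<psi>" unfolding cp_def by (rule imageI)
    thus ?thesis using \<psi>(2) S(2) by auto
   qed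
   thus ?thesis using Sp \<psi>(1) by blast
  qed
  hence "(\<exists>S\<in>H. S \<subseteq> W) --> (\<exists>f. inj_on f {..<n} \<and> f ` {..<n} \<subseteq> V \<and> (\<forall>u w. HE u w --> {f u, f w} \<in> W))" by blast
  thus "(of_bool (\<exists>S\<in>H. S \<subseteq> W) :: real) \<le> of_bool (\<exists>f. inj_on f {..<n} \<and> f ` {..<n} \<subseteq> V \<and> (\<forall>u w. HE u w --> {f u, f w} \<in> W))"
   by auto
 qed
 finally show ?thesis by (simp add: x_def)
qed

lemma error_tendsto_0:
 fixes a :: real
 assumes a: "0 < a"
 shows "(\<lambda>n. real n * real n * (2 * exp (- (a * real n))) + 8 / log 2 (real n)) \<longlonglongrightarrow> 0"
proof -
 have "filterlim (\<lambda>n. a * real n) at_top sequentially"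
  using a by (intro filterlim_tendsto_pos_mult_at_top[OF tendsto_const]) (auto intro: filterlim_real_sequentially)
 from filterlim_compose[OF tendsto_power_div_exp_0[of 2] this]
 have "(\<lambda>n. 2 / a\<^sup>2 * ((a * real n) ^ 2 / exp (a * real n))) \<longlonglongrightarrow> 0" by (intro tendsto_mult_right_zero)
 moreover have "2 / a\<^sup>2 * ((a * real n) ^ 2 / exp (a * real n)) = real n * real n * (2 * exp (- (a * real n)))" for n
  using a by (simp add: power_mult_distrib exp_minus power2_eq_square field_simps)
 ultimately have 1: "(\<lambda>n. real n * real n * (2 * exp (- (a * real n)))) \<longlonglongrightarrow> 0" by simp
 have "filterlim (\<lambda>n. ln (real n)) at_infinity sequentially"
  by (intro filterlim_at_top_imp_at_infinity filterlim_compose[OF ln_at_top filterlim_real_sequentially])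
 hence "(\<lambda>n. 8 * ln 2 / ln (real n)) \<longlonglongrightarrow> 0" by (rule tendsto_divide_0[OF tendsto_const])
 hence "(\<lambda>n. 8 / log 2 (real n)) \<longlonglongrightarrow> 0" by (simp add: log_def)
 from tendsto_add[OF 1 this] show ?thesis by simp
qed

lemma log_le_powr_eventually:
 fixes s :: real
 assumes s: "0 < s"
 shows "\<forall>\<^sub>F n in sequentially. log 2 (real n) \<le> real n powr s"
proof -
 have "(\<lambda>n. ln (real n) / real n powr s) \<longlonglongrightarrow> 0" by (rule lim_ln_over_power[OF s])
 hence "\<forall>\<^sub>F n in sequentially. ln (real n) / real n powr s < ln 2" by (rule order_tendstoD) simp
 thus ?thesis using eventually_gt_at_top[of 0]
 proof eventually_elim
  case (elim n)
  have "0 < real n powr s" using elim(2) by simp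
  thus ?case using elim(1) by (simp add: log_def divide_less_eq divide_le_eq mult.commute)
 qed
qed

text \<open>A vertex has at most n neighbours, so (r-1)/r + \<gamma> \<le> 1. Only finitely many
  values of r can occur.\<close>

lemma chromatic_number_bound:
 fixes H :: "'a ugraph" and G :: "'b ugraph"
 assumes G: "n_vertex_graph n G" and n: "1 \<le> n" and r: "1 \<le> r" and gam: "0 < \<gamma>"
  and deg: "((real r - 1) / real r + \<gamma>) * n \<le> min_degree G"
 shows "r \<le> nat \<lceil>1 / \<gamma>\<rceil>"
proof -
 have fV: "finite (verts G)" "card (verts G) = n" using G by (auto simp: n_vertex_graph_def simple_graph_def)
 then obtain v where v: "v \<in> verts G" using n by fastforce
 have "card {u \<in> verts G. {v, u} \<in> edges G} \<le> n" using fV card_mono[of "verts G" "{u \<in> verts G. {v, u} \<in> edges G}"] by auto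
 hence "((real r - 1) / real r + \<gamma>) * n \<le> 1 * real n" using min_degree_bound[OF G v] deg by linarith
 hence "(real r - 1) / real r + \<gamma> \<le> 1" using n by simp
 hence "\<gamma> * real r \<le> 1" using r by (simp add: field_simps)
 hence "real r \<le> 1 / \<gamma>" using gam by (simp add: field_simps)
 thus ?thesis by linarith
qed

theorem theorem1p11:
  fixes \<gamma> :: real and \<Delta> :: nat
  assumes "\<gamma> > 0" and "\<Delta> \<ge> 1"
  shows "\<exists>\<beta>::real. \<beta> > 0 \<and> (\<exists>C::real.
    \<forall>(p :: nat \<Rightarrow> real) (H :: nat \<Rightarrow> 'a ugraph) (G :: nat \<Rightarrow> 'b ugraph).
      (\<forall>\<^sub>F n in sequentially.
          0 \<le> p n \<and> p n \<le> 1 \<and>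
          p n \<ge> C * (log 2 (real n) / real n) powr (1 / real \<Delta>) \<and>
          n_vertex_graph n (H n) \<and>
          max_degree (H n) \<le> \<Delta> \<and>
          real (bandwidth (H n)) \<le> \<beta> * real n \<and>
          n_vertex_graph n (G n) \<and>
          real (min_degree (G n)) \<ge>
            ((real (chromatic_number (H n)) - 1) / real (chromatic_number (H n)) + \<gamma>) * real n)
      \<longrightarrow>
      (\<lambda>n. measure_pmf.prob (random_subgraph (G n) (p n)) {K. subgraph_of (H n) K})
        \<longlonglongrightarrow> 1)"
proof -
 define R where "R = nat \<lceil>1 / \<gamma>\<rceil>"
 obtain \<beta> K a :: real and n0 :: nat where \<beta>: "0 < \<beta>" and K: "1 \<le> K" and a: "0 < a" and emb: "\<forall>r n b HE col (V :: 'b set) g.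
   1 \<le> r --> r \<le> R --> n0 \<le> n -->
   banded_graph n b \<Delta> r HE col --> real b \<le> \<beta> * n --> finite V --> card V = n --> (\<forall>x y. g x y --> g y x) -->
   (\<forall>v\<in>V. ((real r - 1) / real r + \<gamma>) * n \<le> card {u\<in>V. g v u}) -->
   spread_embedding n HE V g K (real n * real n * (2 * exp (- (a * n))))"
  using dense_spread_uniform[OF assms, of R, where 'b = 'b] by (elim exE conjE) (rule that)
 define C where "C = 322 * (real \<Delta> * K)\<^sup>2"
 \<comment> \<open>An error that depends on n but not on the graphs, so the statement about
   sequences follows by squeezing.\<close>
 define err where "err n = real n * real n * (2 * exp (- (a * real n))) + 8 / log 2 (real n)" for n
 have bound: "1 - err n \<le> measure_pmf.prob (random_subgraph G p) {K. subgraph_of H K}"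
  if p: "0 \<le> p" "p \<le> 1" "C * (log 2 (real n) / real n) powr (1 / real \<Delta>) \<le> p"
   and H: "n_vertex_graph n H" "max_degree H \<le> \<Delta>" "real (bandwidth H) \<le> \<beta> * real n"
   and G: "n_vertex_graph n G"
    "((real (chromatic_number H) - 1) / real (chromatic_number H) + \<gamma>) * real n \<le> real (min_degree G)"
   and n: "n0 \<le> n" "2 \<le> n" "log 2 (real n) \<le> real n powr (1 / (real \<Delta> + 1))"
  for n p and H :: "'a ugraph" and G :: "'b ugraph"
 proof -
  have n1: "1 \<le> n" using n by simp
  have sG: "simple_graph G" and sH: "simple_graph H" using G H by (auto simp: n_vertex_graph_def)
  have V: "finite (verts G)" "card (verts G) = n" using G by (auto simp: n_vertex_graph_def simple_graph_def)
  obtain l col HE where l: "bij_betw l (verts H) {..<n}" and HE: "\<forall>x y. {x, y} \<in> edges H --> HE (l x) (l y)"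
   and bg: "banded_graph n (bandwidth H) \<Delta> (chromatic_number H) HE col" by (rule banded_labelling[OF H(1) n1 H(2)])
  \<comment> \<open>As n is positive, vertex 0 exists and needs a colour.\<close>
  have r1: "1 \<le> chromatic_number H" using banded_graph.col_less[OF bg, of 0] n1 by linarith
  have rR: "chromatic_number H \<le> R" unfolding R_def by (rule chromatic_number_bound[OF G(1) n1 r1 assms(1) G(2)])
  have deg: "\<forall>v\<in>verts G. ((real (chromatic_number H) - 1) / real (chromatic_number H) + \<gamma>) * n \<le> card {u\<in>verts G. {v, u} \<in> edges G}"
   using min_degree_bound[OF G(1)] G(2) by (meson of_nat_mono order_trans)
  have "spread_embedding n HE (verts G) (\<lambda>x y. {x, y} \<in> edges G) K (real n * real n * (2 * exp (- (a * n))))"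
   using deg by (intro emb[rule_format, OF r1 rR n(1) bg H(3) V]) (auto simp: insert_commute)
  hence "1 - real n * real n * (2 * exp (- (a * n))) - 8 / log 2 n \<le> bern p (edges G)
    (\<lambda>W. of_bool (\<exists>f. inj_on f {..<n} \<and> f ` {..<n} \<subseteq> verts G \<and> (\<forall>u w. HE u w --> {f u, f w} \<in> W)))"
  proof (rule embedding_probability[OF _ bg K n(2) assms(2)])
   show "finite (edges G)" by (rule simple_graph_finite[OF sG])
   show "card e = 2" if "e \<in> edges G" for e using sG that by (simp add: simple_graph_def)
   show "p \<le> 1" by fact
   have "log 2 n * n powr (- 2 / (real \<Delta> + 1)) \<le> (log 2 n / n) powr (1 / real \<Delta>)"
    using n by (intro density_comparison assms) auto
   hence "C * (log 2 n * n powr (- 2 / (real \<Delta> + 1))) \<le> C * (log 2 n / n) powr (1 / real \<Delta>)"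
    by (intro mult_left_mono) (simp_all add: C_def)
   hence "C * (log 2 n * n powr (- 2 / (real \<Delta> + 1))) \<le> p" using p(3) by linarith
   thus "322 * ((real \<Delta> * K)\<^sup>2 * n powr (- 2 / (real \<Delta> + 1))) * log 2 n \<le> p" unfolding C_def by (simp only: mult_ac)
  qed
  also have "... \<le> bern p (edges G) (\<lambda>W. of_bool (subgraph_of H \<lparr>verts = verts G, edges = W\<rparr>))"
  proof (rule bern_mono[OF p(1,2)])
   fix W
   have "subgraph_of H \<lparr>verts = verts G, edges = W\<rparr>"
    if "inj_on f {..<n}" "f ` {..<n} \<subseteq> verts G" "\<forall>u w. HE u w --> {f u, f w} \<in> W" for f
    by (rule subgraph_of_labelled[where l = l and HE = HE and f = f, OF sH l HE[rule_format]]) (use that in auto)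
   thus "(of_bool (\<exists>f. inj_on f {..<n} \<and> f ` {..<n} \<subseteq> verts G \<and> (\<forall>u w. HE u w --> {f u, f w} \<in> W)) :: real)
     \<le> of_bool (subgraph_of H \<lparr>verts = verts G, edges = W\<rparr>)" by auto
  qed
  also have "... = measure_pmf.prob (random_subgraph G p) {K. subgraph_of H K}"
   by (rule prob_random_subgraph[OF simple_graph_finite[OF sG] p(1,2), symmetric])
  finally show ?thesis by (simp add: err_def)
 qed
 have lim: "(\<lambda>n. 1 - err n) \<longlonglongrightarrow> 1"
  using tendsto_diff[OF tendsto_const[of 1] error_tendsto_0[OF a]] by (simp add: err_def[abs_def])
 have ev: "\<forall>\<^sub>F n in sequentially. n0 \<le> n \<and> 2 \<le> n \<and> log 2 (real n) \<le> real n powr (1 / (real \<Delta> + 1))"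
  using eventually_ge_at_top[of n0] eventually_ge_at_top[of 2] log_le_powr_eventually[of "1 / (real \<Delta> + 1)"]
  by (intro eventually_conj) auto
 show ?thesis
 proof (rule exI[of _ \<beta>], rule conjI[OF \<beta>], rule exI[of _ C], intro allI impI)
  fix p :: "nat => real" and H :: "nat => 'a ugraph" and G :: "nat => 'b ugraph"
  assume A: "\<forall>\<^sub>F n in sequentially.
     0 \<le> p n \<and> p n \<le> 1 \<and>
     p n \<ge> C * (log 2 (real n) / real n) powr (1 / real \<Delta>) \<and>
     n_vertex_graph n (H n) \<and>
     max_degree (H n) \<le> \<Delta> \<and>
     real (bandwidth (H n)) \<le> \<beta> * real n \<and>
     n_vertex_graph n (G n) \<and>
     real (min_degree (G n)) \<ge>
      ((real (chromatic_number (H n)) - 1) / real (chromatic_number (H n)) + \<gamma>) * real n"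
  show "(\<lambda>n. measure_pmf.prob (random_subgraph (G n) (p n)) {K. subgraph_of (H n) K}) \<longlonglongrightarrow> 1"
  proof (rule tendsto_sandwich[OF _ _ lim tendsto_const])
   show "\<forall>\<^sub>F n in sequentially. 1 - err n \<le> measure_pmf.prob (random_subgraph (G n) (p n)) {K. subgraph_of (H n) K}"
    using A ev
   proof eventually_elim
    case (elim n)
    show ?case by (rule bound) (use elim in blast)+
   qed
  qed simp
 qed
qed

end
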